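(* Let $0<p<1$ and let $\mathcal Z$ be a sequence of distinct points of $\mathbb D$, separated in the pseudo-hyperbolic metric. The following are equivalent: (a) $\mathcal Z$ is an interpolating sequence for $A^p$; (b) for every $q\ge1$ there is a constant $C$ such that for every $f\in L^p_{q,\mathcal Z}$ the equation $(1-|z|^2)\frac{\partial u}{\partial\bar z}=f$ has a solution $u$ with $\|u\|_{p,\mathcal Z}\le C\|f\|_{p,q,\mathcal Z}$; (c) there exist $q\ge1$ and a constant $C$ such that for every $f\in L^p_{q,\mathcal Z}$ the equation $(1-|z|^2)\frac{\partial u}{\partial\bar z}=f$ has a solution $u$ with $\|u\|_{p,\mathcal Z}\le C\|f\|_{p,q,\mathcal Z}$.
   Context: $\mathbb D$ is the open unit disk, $dA$ area measure, $A^p$ the analytic functions with $\|f\|_p^p=\int_{\mathbb D}|f|^pdA<\infty$. $\psi(z,w)=\left|\frac{z-w}{1-\bar wz}\right|$, $D(z,r)=\{w:\psi(z,w)<r\}$; separated means $\inf\{\psi(a,b):a\ne b\in\mathcal Z\}>0$. $\ell^p(\mathcal Z)$ consists of $(c_a)$ with $\sum_{a\in\mathcal Z}|c_a|^p(1-|a|^2)^2<\infty$; $\mathcal Z$ is interpolating for $A^p$ if $f\mapsto(f(a))_{a\in\mathcal Z}$ maps $A^p$ onto $\ell^p(\mathcal Z)$. $k_{\mathcal Z}(z)=\frac{|z|^2}{2}\sum_{a\in\mathcal Z}\frac{(1-|a|^2)^2}{|1-\bar az|^2}$ and $\|u\|_{p,\mathcal Z}=\left(\int_{\mathbb D}|ue^{k_{\mathcal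 Z}}|^pdA\right)^{1/p}$. Fix $R\in(0,1)$ and let $D_z=D(z,R)$. For $|f|^q$ locally integrable, $m_q(f,z)=\left(\frac1{|D_z|}\int_{D_z}|f|^q\,dA\right)^{1/q}$ ($|D_z|$ = area). $L^p_{q,\mathcal Z}$ is the set of measurable $f$ with $\|f\|_{p,q,\mathcal Z}=\left(\int_{\mathbb D}m_q(fe^{k_{\mathcal Z}},z)^p\,dA(z)\right)^{1/p}<\infty$. $\frac{\partial}{\partial\bar z}=\frac12(\partial_x+i\partial_y)$; the equation holds in the distributional sense. *)

theory Defs
  imports "HOL-Analysis.Analysis"
begin

definition disc :: "complex set" where
  "disc = ball 0 1"

definition pshyp :: "complex \<Rightarrow> complex \<Rightarrow> real" where
  "pshyp z w = cmod ((z - w) / (1 - cnj w * z))"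

definition pdisc :: "complex \<Rightarrow> real \<Rightarrow> complex set" where
  "pdisc z r = {w \<in> disc. pshyp z w < r}"

definition separated :: "complex set \<Rightarrow> bool" where
  "separated Z \<longleftrightarrow> (\<exists>\<delta>>0. \<forall>a\<in>Z. \<forall>b\<in>Z. a \<noteq> b \<longrightarrow> \<delta> \<le> pshyp a b)"

definition epowr :: "ennreal \<Rightarrow> real \<Rightarrow> ennreal" where
  "epowr x r = (if x = \<infinity> then \<infinity> else ennreal (enn2real x powr r))"

definition Bergman :: "real \<Rightarrow> (complex \<Rightarrow> complex) set" where
  "Bergman p = {f. f holomorphic_on disc \<and>
      (\<integral>\<^sup>+ z\<in>disc. ennreal (cmod (f z) powr p) \<partial>lebesgue) < \<infinity>}"

definition lpZ :: "real \<Rightarrow> complex set \<Rightarrow> (complex \<Rightarrow> complex) set" where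
  "lpZ p Z = {c. (\<lambda>a. cmod (c a) powr p * (1 - (cmod a)\<^sup>2)\<^sup>2) summable_on Z}"

definition interpolating :: "real \<Rightarrow> complex set \<Rightarrow> bool" where
  "interpolating p Z \<longleftrightarrow>
     (\<forall>f\<in>Bergman p. f \<in> lpZ p Z) \<and>
     (\<forall>c\<in>lpZ p Z. \<exists>f\<in>Bergman p. \<forall>a\<in>Z. f a = c a)"

definition kZ :: "complex set \<Rightarrow> complex \<Rightarrow> real" where
  "kZ Z z = (cmod z)\<^sup>2 / 2 *
      (\<Sum>\<^sub>\<infinity> a\<in>Z. (1 - (cmod a)\<^sup>2)\<^sup>2 / (cmod (1 - cnj a * z))\<^sup>2)"

definition normZ :: "real \<Rightarrow> complex set \<Rightarrow> (complex \<Rightarrow> complex) \<Rightarrow> ennreal" where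
  "normZ p Z u = epowr (\<integral>\<^sup>+ z\<in>disc. ennreal ((cmod (u z) * exp (kZ Z z)) powr p) \<partial>lebesgue) (1/p)"

definition mq :: "real \<Rightarrow> real \<Rightarrow> (complex \<Rightarrow> complex) \<Rightarrow> complex \<Rightarrow> ennreal" where
  "mq R q g z = epowr (ennreal (1 / measure lebesgue (pdisc z R)) *
      (\<integral>\<^sup>+ w\<in>pdisc z R. ennreal (cmod (g w) powr q) \<partial>lebesgue)) (1/q)"

definition normpqZ :: "real \<Rightarrow> real \<Rightarrow> real \<Rightarrow> complex set \<Rightarrow> (complex \<Rightarrow> complex) \<Rightarrow> ennreal" where
  "normpqZ R p q Z f = epowr (\<integral>\<^sup>+ z\<in>disc.
      epowr (mq R q (\<lambda>w. f w * complex_of_real (exp (kZ Z w))) z) p \<partial>lebesgue) (1/p)"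

definition LpqZ :: "real \<Rightarrow> real \<Rightarrow> real \<Rightarrow> complex set \<Rightarrow> (complex \<Rightarrow> complex) set" where
  "LpqZ R p q Z = {f. set_borel_measurable lebesgue disc f \<and> normpqZ R p q Z f < \<infinity>}"

definition pd :: "complex \<Rightarrow> (complex \<Rightarrow> complex) \<Rightarrow> complex \<Rightarrow> complex" where
  "pd v \<phi> = (\<lambda>z. frechet_derivative \<phi> (at z) v)"

text \<open>C-infinity (as a function of two real variables): all iterated partial derivatives
  in the directions 1 (x) and i (y) exist and are (Frechet) differentiable.\<close>
definition smooth :: "(complex \<Rightarrow> complex) \<Rightarrow> bool" where
  "smooth \<phi> \<longleftrightarrow> (\<forall>ds. set ds \<subseteq> {1, \<i>} \<longrightarrow>
      (\<forall>z. foldr pd ds \<phi> differentiable (at z)))"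

definition test_fun :: "(complex \<Rightarrow> complex) \<Rightarrow> bool" where
  "test_fun \<phi> \<longleftrightarrow> smooth \<phi> \<and> compact (closure {z. \<phi> z \<noteq> 0}) \<and> closure {z. \<phi> z \<noteq> 0} \<subseteq> disc"

definition dbar :: "(complex \<Rightarrow> complex) \<Rightarrow> complex \<Rightarrow> complex" where
  "dbar \<phi> z = (pd 1 \<phi> z + \<i> * pd \<i> \<phi> z) / 2"

text \<open>u solves (1-|z|^2) du/d(conj z) = f in the sense of distributions on the disc:
  u is locally integrable on D and for all test functions phi,
  - int u dbar(phi) = int f/(1-|z|^2) phi.\<close>
definition dbar_solution :: "(complex \<Rightarrow> complex) \<Rightarrow> (complex \<Rightarrow> complex) \<Rightarrow> bool" where
  "dbar_solution f u \<longleftrightarrow>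
     (\<forall>K. compact K \<and> K \<subseteq> disc \<longrightarrow> set_integrable lebesgue K u) \<and>
     (\<forall>\<phi>. test_fun \<phi> \<longrightarrow>
        - (LINT z:disc|lebesgue. u z * dbar \<phi> z) =
          (LINT z:disc|lebesgue. f z / complex_of_real (1 - (cmod z)\<^sup>2) * \<phi> z))"

end

theory Submission
 imports Defs "HOL-Complex_Analysis.Complex_Analysis"
begin

text \<open>
Write k for the exponent in the weight and d for the distance to the unit circle. There is a holomorphic Psi
with zero set Z and modulus comparable to exp k off small discs around the points of Z.

If Z is interpolating, a Baire argument gives uniform bounds for the interpolation constants, and division by Psi
turns the interpolating functions into peak functions H at every point s of the disc: |H| exp k is at least 1 on a
disc of radius proportional to d(s), and the weighted p-integral of H is at most a constant times d(s)^2. Cut f into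
pieces supported in small discs around the points of a net, solve for each piece by H times a Cauchy transform of
the piece divided by H, and add up the solutions; as p < 1, the p-th powers of the norms are subadditive. Each piece
enters only through its weighted L1 norm, which is dominated by local L^q means, so every q >= 1 works.

Conversely let a be in Z and let v equal 1 / (z - a) away from a and 0 near a. Solving the equation with the same
dbar-derivative as v gives u with u - v holomorphic, by Weyl's lemma. So 1 / (z - a) + u - v has a simple pole at a,
and Psi (1 / (z - a) + u - v) / Psi'(a) takes the value 1 at a, vanishes on the rest of Z, and has p-integral at most a
constant times d(a)^2. Sums of such functions interpolate.
\<close>

text \<open>For p < 1 there is neither duality nor a triangle inequality for the norm, and an L^p
  bound does not give local integrability, so the outer exponent alone provides no Cauchy transform.
  The inner exponent q >= 1 supplies, at each net point s, a finite local weighted mass y(s), and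
  the norm of f dominates the sum of (y(s) / d(s)^2)^p d(s)^2. Hence every estimate is made for one
  point and normalised by d(s)^2, the order of the area of a hyperbolic disc. The function H does
  the work of a decaying kernel: |H| exp k >= 1 near s moves the weight into the L1 norm of the
  piece, and the weighted p-integral of H bounds the solution away from s.

  The exponent k comes from the zeros. A separated Z need not satisfy the Blaschke condition, so
  each factor (z - a) / (1 - conj(a) z) needs a zero-free exponential, and k is what these
  contribute to the logarithm of the modulus. To obtain a peak at a point s outside Z, a kernel
  equal to 1 at s is corrected on Z by the functions that interpolate there.\<close>

abbreviation nn_lborel :: "('a::euclidean_space => ennreal) => ennreal" (binder "NN " 10) where
 "nn_lborel f == nn_integral lborel f"

abbreviation nn_set :: "'a::euclidean_space set => ('a => ennreal) => ennreal" where
 "nn_set A f == nn_integral lborel (%x. f x * indicator A x)"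

section \<open>Kernel sums over separated sets\<close>

definition bd :: "complex => real" where
 "bd z = 1 - cmod z"

text \<open>Separation at the scale of the distance to the circle. It makes the balls of radius
  \<open>c / 2 * bd a\<close> disjoint, and it serves both Z and the nets along which f is
  cut.\<close>

definition esep :: "real => complex set => bool" where
 "esep c S \<longleftrightarrow> (\<forall>a\<in>S. \<forall>b\<in>S. a ~= b --> c * bd a <= cmod (a - b))"

lemma disc_iff: "z \<in> disc \<longleftrightarrow> cmod z < 1"
 by (simp add: disc_def)

lemma open_disc [simp, intro]: "open disc"
 by (simp add: disc_def)

lemma sets_disc [measurable, simp]: "disc \<in> sets borel"
 by (simp add: disc_def)

lemma bd_pos: "z \<in> disc ==> 0 < bd z"
 by (simp add: disc_iff bd_def)

lemma bd_le_1: "bd z <= 1"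
 by (simp add: bd_def)

lemma bd_diff: "\<bar>bd z - bd w\<bar> <= cmod (z - w)"
 using norm_triangle_ineq3[of w z] by (simp add: bd_def norm_minus_commute)

lemma bd_square_le: "z \<in> disc ==> bd z <= 1 - (cmod z)^2"
 using power_le_one[of "cmod z" 1]
 by (simp add: disc_iff bd_def power2_eq_square mult_left_le)

lemma square_le_bd: "1 - (cmod z)^2 <= 2 * bd z"
proof -
 have "2 * bd z - (1 - (cmod z)^2) = (1 - cmod z)^2"
  by (simp add: bd_def power2_eq_square algebra_simps)
 then show ?thesis
  by (metis diff_ge_0_iff_ge zero_le_power2)
qed

lemma ball_bd_subset_disc: "z \<in> disc ==> c <= 1 ==> ball z (c * bd z) \<subseteq> disc"
proof
 fix w assume "z \<in> disc" "c <= 1" "w \<in> ball z (c * bd z)"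
 then have "cmod (z - w) < c * bd z" "c * bd z <= bd z"
  using bd_pos[of z] by (auto simp: dist_norm mult_left_le_one_le)
 then have "cmod (z - w) < bd z" by linarith
 then show "w \<in> disc"
  using bd_diff[of z w] by (auto simp: disc_iff bd_def)
qed

lemma kern_sym: "cmod (1 - cnj a * z) = cmod (1 - cnj z * a)"
 by (metis complex_cnj_cnj complex_cnj_diff complex_cnj_mult complex_cnj_one complex_mod_cnj mult.commute)

lemma kern_ge_left: "z \<in> disc ==> bd a <= cmod (1 - cnj a * z)"
proof -
 assume "z \<in> disc"
 then have "cmod a * cmod z <= cmod a"
  by (simp add: disc_iff mult_left_le)
 then have "1 - cmod a <= 1 - cmod (cnj a * z)"
  by (simp add: norm_mult)
 also have "... <= cmod (1 - cnj a * z)"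
  by (metis norm_one norm_triangle_ineq2)
 finally show ?thesis by (simp add: bd_def)
qed

lemma kern_ge_right: "a \<in> disc ==> bd z <= cmod (1 - cnj a * z)"
 using kern_ge_left[of a z] by (simp add: kern_sym)

lemma kern_pos: "a \<in> disc ==> z \<in> disc ==> 0 < cmod (1 - cnj a * z)"
 using kern_ge_right[of a z] bd_pos[of z] by linarith

lemma kern_nz: "a \<in> disc ==> z \<in> disc ==> 1 - cnj a * z ~= 0"
 using kern_pos[of a z] by auto

lemma kern_le_2: "a \<in> disc ==> z \<in> disc ==> cmod (1 - cnj a * z) <= 2"
proof -
 assume "a \<in> disc" "z \<in> disc"
 then have "cmod a * cmod z <= 1"
  by (simp add: disc_iff mult_le_one)
 then show ?thesis
  using norm_triangle_ineq4[of 1 "cnj a * z"] by (simp add: norm_mult)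
qed

lemma kern_diff: "z \<in> disc ==> cmod (1 - cnj a * z) <= cmod (1 - cnj b * z) + cmod (a - b)"
proof -
 assume z: "z \<in> disc"
 have "1 - cnj a * z = (1 - cnj b * z) - cnj (a - b) * z"
  by (simp add: algebra_simps)
 then have "cmod (1 - cnj a * z) <= cmod (1 - cnj b * z) + cmod (cnj (a - b) * z)"
  using norm_triangle_ineq4 by metis
 moreover have "cmod (cnj (a - b) * z) <= cmod (a - b)"
  using z by (simp add: norm_mult disc_iff mult_left_le flip: complex_cnj_diff)
 ultimately show ?thesis by linarith
qed

lemma pshyp_identity:
 "(cmod (1 - cnj a * z))^2 - (cmod (z - a))^2 = (1 - (cmod a)^2) * (1 - (cmod z)^2)"
 unfolding cmod_power2 by (simp add: power2_eq_square algebra_simps)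

lemma emeasure_ball_complex: "0 <= r ==> emeasure lborel (ball (c::complex) r) = ennreal (pi * r^2)"
 by (simp add: emeasure_ball unit_ball_vol_2)

text \<open>Up to the factor |z| the kernel is the distance from w to the reflected point
  \<open>1 / cnj z\<close>. For |z| >= 1/2 the level set therefore lies in a ball of radius 2r; for
  |z| < 1/2 it is empty when r <= 1/2, and otherwise the area of the whole disc is already below the
  bound.\<close>

lemma kern_level_subset:
 assumes z: "z \<in> disc" and r: "0 < r"
 shows "emeasure lborel {w \<in> disc. cmod (1 - cnj w * z) < r} <= ennreal (4 * pi * r^2)"
proof (cases "cmod z \<ge> 1/2")
 case True
 have nz: "cnj z ~= 0" using True by auto
 have "{w \<in> disc. cmod (1 - cnj w * z) < r} \<subseteq> ball (1 / cnj z) (2 * r)"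
 proof
  fix w assume "w \<in> {w \<in> disc. cmod (1 - cnj w * z) < r}"
  then have w: "cmod (1 - cnj z * w) < r" by (simp add: kern_sym)
  have "cmod (1 - cnj z * w) = cmod (cnj z * (1 / cnj z - w))"
   using nz by (simp add: algebra_simps)
  also have "... = cmod z * cmod (1 / cnj z - w)"
   by (simp add: norm_mult)
  also have "... \<ge> 1/2 * cmod (1 / cnj z - w)"
   using True by (intro mult_right_mono) auto
  finally show "w \<in> ball (1 / cnj z) (2 * r)" using w by (simp add: dist_norm)
 qed
 then have "emeasure lborel {w \<in> disc. cmod (1 - cnj w * z) < r} <= emeasure lborel (ball (1 / cnj z) (2 * r))"
  by (intro emeasure_mono) auto
 also have "... = ennreal (4 * pi * r^2)"
  using r by (simp add: emeasure_ball_complex power_mult_distrib mult_ac)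
 finally show ?thesis .
next
 case False
 show ?thesis
 proof (cases "r <= 1/2")
  case True
  have "{w \<in> disc. cmod (1 - cnj w * z) < r} = {}"
  proof -
   have "\<not> cmod (1 - cnj w * z) < r" if "w \<in> disc" for w
    using kern_ge_right[OF that, of z] False True by (simp add: bd_def)
   then show ?thesis by auto
  qed
  then show ?thesis by (metis emeasure_empty zero_le)
 next
  case F2: False
  have "{w \<in> disc. cmod (1 - cnj w * z) < r} \<subseteq> ball 0 1"
   by (auto simp: disc_def)
  then have "emeasure lborel {w \<in> disc. cmod (1 - cnj w * z) < r} <= emeasure lborel (ball (0::complex) 1)"
   by (intro emeasure_mono) auto
  also have "... = ennreal (pi * 1^2)"
   by (subst emeasure_ball_complex) auto
  also have "... <= ennreal (4 * pi * r^2)"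
  proof (rule ennreal_leI)
   have "(1/2)^2 <= r^2" using F2 by (intro power_mono) auto
   then have "pi * 1 <= pi * (4 * r^2)" by (intro mult_left_mono) (auto simp: power2_eq_square)
   then show "pi * 1^2 <= 4 * pi * r^2" by (simp add: mult_ac)
  qed
  finally show ?thesis .
 qed
qed

text \<open>The least admissible k is the dyadic shell of x. This turns a decaying kernel into a sum
  of constants times indicators of sublevel sets, whose measures are easy to bound.\<close>

lemma powr_dyadic_bound:
 fixes x N d :: real
 assumes "d <= x" "0 < d" "0 < N"
 shows "\<exists>k::nat. x < 2 ^ Suc k * d \<and> x powr (-N) <= (2 ^ k * d) powr (-N)"
proof -
 define k where "k = (LEAST k. x < 2 ^ Suc k * d)"
 have "\<exists>n. x / d < 2 ^ n" by (rule real_arch_pow) simp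
 then obtain n where "x / d < 2 ^ n" by auto
 then have "x < 2 ^ n * d" using assms by (simp add: field_simps)
 also have "... <= 2 ^ Suc n * d" using assms by simp
 finally have ex: "x < 2 ^ Suc n * d" .
 have 1: "x < 2 ^ Suc k * d" unfolding k_def by (rule LeastI, rule ex)
 have 2: "2 ^ k * d <= x"
 proof (cases k)
  case 0 then show ?thesis using assms by simp
 next
  case (Suc j)
  then have "\<not> x < 2 ^ Suc j * d" unfolding k_def
   using not_less_Least[of j "%k. x < 2 ^ Suc k * d"] by (simp add: k_def)
  then show ?thesis by (simp add: Suc)
 qed
 have "x powr (-N) <= (2 ^ k * d) powr (-N)"
  using 2 assms by (intro powr_mono2') auto
 then show ?thesis using 1 by blast
qed

lemma ennreal_le_suminf: "f k <= suminf f" for f :: "nat => ennreal"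
 using sum_le_suminf[OF summableI, of "{k}" f] by simp

text \<open>The Forelli-Rudin estimate. The sublevel set of height \<open>2 ^ Suc k * bd z\<close>
  has area of order \<open>4 ^ k * (bd z)^2\<close>, so N > 2 makes the shells a geometric series
  with ratio \<open>2 powr (2 - N)\<close>.\<close>

lemma kern_integral:
 fixes N :: real
 assumes N: "2 < N"
 obtains C where "0 < C"
  "!!z. z \<in> disc ==> (nn_set disc (%w. ennreal (cmod (1 - cnj w * z) powr (-N))))
    <= ennreal (C * bd z powr (2 - N))"
proof -
 define q where "q = (2::real) powr (2 - N)"
 have q: "0 < q" "q < 1" using N by (auto simp: q_def powr_less_one)
 define C where "C = 16 * pi / (1 - q)"
 have C: "0 < C" using q by (simp add: C_def)
 show ?thesis
 proof (rule that[OF C])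
  fix z assume z: "z \<in> disc"
  define d where "d = bd z"
  have d: "0 < d" using z by (simp add: d_def bd_pos)
  have meas[measurable]: "{w \<in> disc. cmod (1 - cnj w * z) < r} \<in> sets borel" for r
  proof -
   have "{w \<in> disc. cmod (1 - cnj w * z) < r} = disc \<inter> {w. cmod (1 - cnj w * z) < r}" by auto
   also have "... \<in> sets borel"
    by (intro sets.Int borel_open open_Collect_less) (auto intro!: continuous_intros)
   finally show ?thesis .
  qed
  let ?A = "%k::nat. {w \<in> disc. cmod (1 - cnj w * z) < 2 ^ Suc k * d}"
  let ?c = "%k::nat. (2 ^ k * d) powr (-N)"
  have "(nn_set disc (%w. ennreal (cmod (1 - cnj w * z) powr (-N))))
    <= (NN w. (\<Sum>k. ennreal (?c k) * indicator (?A k) w))"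
  proof (rule nn_integral_mono)
   fix w :: complex
   show "ennreal (cmod (1 - cnj w * z) powr (-N)) * indicator disc w
     <= (\<Sum>k. ennreal (?c k) * indicator (?A k) w)"
   proof (cases "w \<in> disc")
    case True
    obtain k where k: "cmod (1 - cnj w * z) < 2 ^ Suc k * d"
      "cmod (1 - cnj w * z) powr (-N) <= ?c k"
     using powr_dyadic_bound[of d "cmod (1 - cnj w * z)" N] kern_ge_right[OF True, of z] d N
     by (auto simp: d_def)
    have "ennreal (cmod (1 - cnj w * z) powr (-N)) * indicator disc w <= ennreal (?c k) * indicator (?A k) w"
     using True k by (auto intro!: ennreal_leI)
    also have "... <= (\<Sum>k. ennreal (?c k) * indicator (?A k) w)"
     by (rule ennreal_le_suminf)
    finally show ?thesis .
   qed simp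
  qed
  also have "... = (\<Sum>k. NN w. ennreal (?c k) * indicator (?A k) w)"
   by (rule nn_integral_suminf) measurable
  also have "... = (\<Sum>k. ennreal (?c k) * emeasure lborel (?A k))"
   by (subst nn_integral_cmult_indicator) auto
  also have "... <= (\<Sum>k. ennreal (16 * pi * d powr (2 - N) * q ^ k))"
  proof (rule suminf_le[OF _ summableI summableI])
   fix k
   have "ennreal (?c k) * emeasure lborel (?A k) <= ennreal (?c k) * ennreal (4 * pi * (2 ^ Suc k * d)^2)"
    using z d by (intro mult_left_mono kern_level_subset) auto
   also have "... = ennreal (?c k * (4 * pi * (2 ^ Suc k * d)^2))"
    by (rule ennreal_mult[symmetric]) auto
   also have "?c k * (4 * pi * (2 ^ Suc k * d)^2) = 16 * pi * d powr (2 - N) * q ^ k"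
   proof -
    have "(2 ^ Suc k * d)^2 = 4 * (2 ^ k * d) powr 2"
     using d by (simp add: power_mult_distrib)
    moreover have "?c k * (2 ^ k * d) powr 2 = (2 ^ k * d) powr (2 - N)"
     by (simp flip: powr_add)
    moreover have "(2 ^ k * d) powr (2 - N) = q ^ k * d powr (2 - N)"
     using d by (simp add: powr_mult q_def powr_power flip: powr_realpow)
       (simp add: powr_powr mult.commute)
    ultimately show ?thesis by (simp add: algebra_simps)
   qed
   finally show "ennreal (?c k) * emeasure lborel (?A k) <= ennreal (16 * pi * d powr (2 - N) * q ^ k)" .
  qed
  also have "... = ennreal (16 * pi * d powr (2 - N) * (1 / (1 - q)))"
  proof (rule suminf_ennreal_eq)
   show "(%k. 16 * pi * d powr (2 - N) * q ^ k) sums (16 * pi * d powr (2 - N) * (1 / (1 - q)))"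
    using q by (intro sums_mult geometric_sums) auto
  qed (use q in auto)
  also have "... = ennreal (C * bd z powr (2 - N))"
   by (simp add: C_def d_def)
  finally show "(nn_set disc (%w. ennreal (cmod (1 - cnj w * z) powr (-N))))
    <= ennreal (C * bd z powr (2 - N))" .
 qed
qed

lemma esep_balls_disjoint:
 assumes "esep c S" "a \<in> S" "b \<in> S" "a ~= b"
 shows "ball a (c / 2 * bd a) \<inter> ball b (c / 2 * bd b) = {}"
proof -
 have "c * bd a <= cmod (a - b)" "c * bd b <= cmod (a - b)"
  using assms by (auto simp: esep_def norm_minus_commute)
 then have "False" if "w \<in> ball a (c / 2 * bd a)" "w \<in> ball b (c / 2 * bd b)" for w
  using that dist_triangle[of a b w] by (auto simp: dist_norm norm_minus_commute)
 then show ?thesis by auto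
qed

lemma esep_sum_integral_le:
 fixes g :: "complex => ennreal"
 assumes "esep c S" "S \<subseteq> disc" "c <= 1" "finite F" "F \<subseteq> S"
  and [measurable]: "g \<in> borel_measurable borel"
 shows "(\<Sum>a\<in>F. nn_set (ball a (c / 2 * bd a)) (%w. g w)) <= (nn_set disc (%w. g w))"
proof -
 have "(\<Sum>a\<in>F. nn_set (ball a (c / 2 * bd a)) (%w. g w))
   = (NN w. (\<Sum>a\<in>F. g w * indicator (ball a (c / 2 * bd a)) w))"
  by (rule nn_integral_sum[symmetric]) (auto intro!: borel_measurable_times_ennreal borel_measurable_indicator)
 also have "... <= (nn_set disc (%w. g w))"
 proof (rule nn_integral_mono)
  fix w :: complex
  show "(\<Sum>a\<in>F. g w * indicator (ball a (c / 2 * bd a)) w) <= g w * indicator disc w"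
  proof (cases "\<exists>a\<in>F. w \<in> ball a (c / 2 * bd a)")
   case True
   then obtain a where a: "a \<in> F" "w \<in> ball a (c / 2 * bd a)" by auto
   have "(\<Sum>b\<in>F. g w * indicator (ball b (c / 2 * bd b)) w)
     = (\<Sum>b\<in>F. if b = a then g w else 0)"
   proof (rule sum.cong[OF refl])
    fix b assume b: "b \<in> F"
    show "g w * indicator (ball b (c / 2 * bd b)) w = (if b = a then g w else 0)"
    proof (cases "b = a")
     case False
     then have "w \<notin> ball b (c / 2 * bd b)"
      using esep_balls_disjoint[OF assms(1), of a b] a b assms(5) by blast
     then show ?thesis using False by simp
    qed (use a in simp)
   qed
   also have "... = g w" using a assms by simp
   also have "w \<in> disc"
   proof -
    have "a \<in> disc" using a assms by auto
    from ball_bd_subset_disc[OF this, of "c/2"] a assms show ?thesis by auto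
   qed
   then have "g w = g w * indicator disc w" by simp
   finally show ?thesis by simp
  next
   case False
   then have "(\<Sum>a\<in>F. g w * indicator (ball a (c / 2 * bd a)) w) = 0"
    by (intro sum.neutral) auto
   then show ?thesis by simp
  qed
 qed
 finally show ?thesis .
qed

text \<open>Each term is compared with the average of the kernel over the ball of radius
  \<open>c / 2 * bd a\<close>; there \<open>cmod (1 - cnj w * z)\<close> is at most twice its value
  at a, and the balls are disjoint. C depends on N and c alone, so the bound is uniform over all
  separated sets.\<close>

lemma esep_kern_sum:
 fixes N c :: real
 assumes N: "2 < N" and c: "0 < c" "c <= 1"
 obtains C where "0 < C"
  "!!S F z. esep c S ==> S \<subseteq> disc ==> finite F ==> F \<subseteq> S ==> z \<in> disc ==>
   (\<Sum>a\<in>F. (bd a)^2 * cmod (1 - cnj a * z) powr (-N)) <= C * bd z powr (2 - N)"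
proof -
 obtain C0 where C0: "0 < C0" "!!z. z \<in> disc ==>
   (nn_set disc (%w. ennreal (cmod (1 - cnj w * z) powr (-N))))
    <= ennreal (C0 * bd z powr (2 - N))"
  using kern_integral[OF N] by blast
 \<comment> \<open>\<open>4 / (pi * c^2)\<close> is \<open>(bd a)^2\<close> over the area of the
   ball, and \<open>2 powr N\<close> pays for moving the kernel from a to w.\<close>
 define K where "K = 4 / (pi * c^2) * 2 powr N"
 have K: "0 < K" using c by (simp add: K_def)
 show ?thesis
 proof (rule that[of "K * C0"])
  show "0 < K * C0" using K C0 by simp
  fix S F z assume S: "esep c S" "S \<subseteq> disc" "finite F" "F \<subseteq> S" "z \<in> disc"
  let ?g = "%w. ennreal (K * cmod (1 - cnj w * z) powr (-N))"
  have [measurable]: "?g \<in> borel_measurable borel"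
  proof -
   have [measurable]: "(%w. cmod (1 - cnj w * z)) \<in> borel_measurable borel"
    by (intro borel_measurable_continuous_onI continuous_intros)
   show ?thesis by measurable
  qed
  have *: "ennreal ((bd a)^2 * cmod (1 - cnj a * z) powr (-N)) <= (nn_set (ball a (c / 2 * bd a)) (%w. ?g w))"
   if a: "a \<in> F" for a
  proof -
   have ad: "a \<in> disc" using a S by auto
   have "ennreal ((bd a)^2 * cmod (1 - cnj a * z) powr (-N))
     = (NN w. ennreal (4 / (pi * c^2) * cmod (1 - cnj a * z) powr (-N)) * indicator (ball a (c / 2 * bd a)) w)"
   proof -
    have "(NN w. ennreal (4 / (pi * c^2) * cmod (1 - cnj a * z) powr (-N)) * indicator (ball a (c / 2 * bd a)) w)
     = ennreal (4 / (pi * c^2) * cmod (1 - cnj a * z) powr (-N)) * ennreal (pi * (c / 2 * bd a)^2)"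
     using c bd_pos[OF ad] by (subst nn_integral_cmult_indicator) (auto simp: emeasure_ball_complex)
    also have "... = ennreal (4 / (pi * c^2) * cmod (1 - cnj a * z) powr (-N) * (pi * (c / 2 * bd a)^2))"
     by (rule ennreal_mult[symmetric]) auto
    also have "4 / (pi * c^2) * cmod (1 - cnj a * z) powr (-N) * (pi * (c / 2 * bd a)^2)
      = (bd a)^2 * cmod (1 - cnj a * z) powr (-N)"
     using c by (simp add: field_simps power2_eq_square)
    finally show ?thesis by simp
   qed
   also have "... <= (nn_set (ball a (c / 2 * bd a)) (%w. ?g w))"
   proof (rule nn_integral_mono)
    fix w :: complex
    show "ennreal (4 / (pi * c^2) * cmod (1 - cnj a * z) powr (-N)) * indicator (ball a (c / 2 * bd a)) w
     <= ?g w * indicator (ball a (c / 2 * bd a)) w"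
    proof (cases "w \<in> ball a (c / 2 * bd a)")
     case True
     then have wd: "w \<in> disc" using ball_bd_subset_disc[OF ad, of "c/2"] c by auto
     have "cmod (w - a) <= bd a"
     proof -
      have "c / 2 * bd a <= 1 * bd a" using c bd_pos[OF ad] by (intro mult_right_mono) auto
      then show ?thesis using True by (auto simp: dist_norm norm_minus_commute)
     qed
     then have "cmod (1 - cnj w * z) <= 2 * cmod (1 - cnj a * z)"
      using kern_diff[OF S(5), of w a] kern_ge_left[OF S(5), of a] by linarith
     then have "(2 * cmod (1 - cnj a * z)) powr (-N) <= cmod (1 - cnj w * z) powr (-N)"
      using kern_pos[OF wd S(5)] N by (intro powr_mono2') auto
     then have "2 powr (-N) * cmod (1 - cnj a * z) powr (-N) <= cmod (1 - cnj w * z) powr (-N)"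
      by (simp add: powr_mult)
     then have "cmod (1 - cnj a * z) powr (-N) <= 2 powr N * cmod (1 - cnj w * z) powr (-N)"
      using mult_left_mono[of _ _ "2 powr N"] by (fastforce simp: powr_minus_divide)
     then have "4 / (pi * c^2) * cmod (1 - cnj a * z) powr (-N) <= K * cmod (1 - cnj w * z) powr (-N)"
      unfolding K_def mult.assoc using c by (intro mult_left_mono) auto
     then show ?thesis using True by (auto intro!: ennreal_leI)
    qed simp
   qed
   finally show ?thesis .
  qed
  have "ennreal (\<Sum>a\<in>F. (bd a)^2 * cmod (1 - cnj a * z) powr (-N))
    = (\<Sum>a\<in>F. ennreal ((bd a)^2 * cmod (1 - cnj a * z) powr (-N)))"
   by (subst sum_ennreal) auto
  also have "... <= (\<Sum>a\<in>F. nn_set (ball a (c / 2 * bd a)) (%w. ?g w))"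
   by (intro sum_mono *)
  also have "... <= (nn_set disc (%w. ?g w))"
   using S c by (intro esep_sum_integral_le) auto
  also have "... = ennreal K * (nn_set disc (%w. ennreal (cmod (1 - cnj w * z) powr (-N))))"
  proof -
   have [measurable]: "(%w. cmod (1 - cnj w * z)) \<in> borel_measurable borel"
    by (intro borel_measurable_continuous_onI continuous_intros)
   have M: "(%w. ennreal (cmod (1 - cnj w * z) powr (-N)) * indicator disc w) \<in> borel_measurable lborel"
    by measurable
   show ?thesis
    using K by (subst nn_integral_cmult[OF M, symmetric]) (simp add: ennreal_mult mult.assoc)
  qed
  also have "... <= ennreal K * ennreal (C0 * bd z powr (2 - N))"
   by (intro mult_left_mono C0 S) auto
  also have "... = ennreal (K * C0 * bd z powr (2 - N))"
   using K C0 by (simp add: ennreal_mult mult_ac)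
  finally show "(\<Sum>a\<in>F. (bd a)^2 * cmod (1 - cnj a * z) powr (-N)) <= K * C0 * bd z powr (2 - N)"
   using K C0 by (subst (asm) ennreal_le_iff) auto
 qed
qed

lemma exp_ge_lower: "x < 1 ==> 0 <= x ==> exp (- x / (1 - x)) <= 1 - x" for x :: real
proof -
 assume x: "x < 1" "0 <= x"
 have "1 + x / (1 - x) <= exp (x / (1 - x))" by (rule exp_ge_add_one_self)
 then have "1 / (1 - x) <= exp (x / (1 - x))" using x by (simp add: field_simps)
 then have "1 / exp (x / (1 - x)) <= 1 - x"
  using x by (simp add: field_simps)
 then show ?thesis by (simp add: exp_minus field_simps flip: inverse_eq_divide)
qed

section \<open>A holomorphic function of modulus comparable to the weight\<close>

text \<open>One minus the squared pseudo-hyperbolic distance; see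
  \<open>pshyp_square\<close>.\<close>

definition tfac :: "complex => complex => real" where
 "tfac a z = (1 - (cmod a)^2) * (1 - (cmod z)^2) / (cmod (1 - cnj a * z))^2"

text \<open>A Blaschke factor times a zero-free exponential. Separation bounds the sum of
  \<open>(bd a)^2\<close> but not that of \<open>bd a\<close>, so the plain factors need not have a
  convergent product.\<close>

definition gfac :: "complex => complex => complex" where
 "gfac a z = (z - a) / (1 - cnj a * z) *
   exp ((1 - (cmod a)^2) / (1 - cnj a * z) - (1 - (cmod a)^2) / 2)"

definition Tfac :: "complex => complex => real" where
 "Tfac a z = pshyp z a * exp (tfac a z / 2)"

definition kterm :: "complex => complex => real" where
 "kterm a z = (1 - (cmod a)^2)^2 / (cmod (1 - cnj a * z))^2"

lemma kZ_kterm: "kZ Z z = (cmod z)^2 / 2 * (\<Sum>\<^sub>\<infinity>a\<in>Z. kterm a z)"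
 by (simp add: kZ_def kterm_def)

lemma kterm_nonneg: "0 <= kterm a z"
 by (simp add: kterm_def)

lemma pshyp_eq: "pshyp z a = cmod (z - a) / cmod (1 - cnj a * z)"
 by (simp add: pshyp_def norm_divide)

lemma pshyp_nonneg: "0 <= pshyp z a"
 by (simp add: pshyp_eq)

lemma pshyp_square: "a \<in> disc ==> z \<in> disc ==> (pshyp z a)^2 = 1 - tfac a z"
 using pshyp_identity[of a z] kern_pos[of a z]
 by (simp add: pshyp_eq tfac_def power_divide field_simps)

lemma tfac_pos: "a \<in> disc ==> z \<in> disc ==> 0 < tfac a z"
 using bd_square_le[of a] bd_square_le[of z] bd_pos[of a] bd_pos[of z] kern_pos[of a z]
 by (simp add: tfac_def)

lemma tfac_le_1: "a \<in> disc ==> z \<in> disc ==> tfac a z <= 1"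
 using pshyp_square[of a z] by (metis diff_ge_0_iff_ge zero_le_power2)

lemma pshyp_le_1: "a \<in> disc ==> z \<in> disc ==> pshyp z a <= 1"
proof (rule power2_le_imp_le)
 assume "a \<in> disc" "z \<in> disc"
 then show "(pshyp z a)^2 <= 1^2" using pshyp_square[of a z] tfac_pos[of a z] by simp
qed simp

lemma Tfac_square: "a \<in> disc ==> z \<in> disc ==> (Tfac a z)^2 = (1 - tfac a z) * exp (tfac a z)"
 by (simp add: Tfac_def power_mult_distrib pshyp_square flip: exp_double)

lemma Tfac_nonneg: "0 <= Tfac a z"
 by (simp add: Tfac_def pshyp_nonneg)

lemma Tfac_le_1: "a \<in> disc ==> z \<in> disc ==> Tfac a z <= 1"
proof (rule power2_le_imp_le)
 assume a: "a \<in> disc" "z \<in> disc"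
 have "1 + (- tfac a z) <= exp (- tfac a z)" by (rule exp_ge_add_one_self)
 then have "(1 - tfac a z) * exp (tfac a z) <= exp (- tfac a z) * exp (tfac a z)"
  by (intro mult_right_mono) auto
 then show "(Tfac a z)^2 <= 1^2" using a by (simp add: Tfac_square flip: exp_add)
qed simp

lemma Tfac_le_pshyp: "a \<in> disc ==> z \<in> disc ==> Tfac a z <= exp (1/2) * pshyp z a"
 using tfac_le_1[of a z] by (simp add: Tfac_def pshyp_nonneg mult.commute mult_left_mono)

lemma Tfac_ge_pshyp: "a \<in> disc ==> z \<in> disc ==> pshyp z a <= Tfac a z"
 using tfac_pos[of a z] mult_left_mono[of 1 "exp (tfac a z / 2)" "pshyp z a"]
 by (simp add: Tfac_def pshyp_nonneg)

text \<open>The square is \<open>(1 - t) * exp t >= 1 - t^2\<close>, and \<open>exp_ge_lower\<close>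
  bounds this below by \<open>exp (- t^2 / (1 - t^2))\<close>. Distance at least \<eta> gives
  \<open>t <= 1 - \<eta>^2\<close>, hence \<open>1 - t^2 >= \<eta>^2\<close>. Since only t^2 appears
  in the exponent, products over a separated set stay away from 0.\<close>

lemma Tfac_lower:
 assumes "a \<in> disc" "z \<in> disc" "0 < \<eta>" "\<eta> <= pshyp z a"
 shows "exp (- (tfac a z)\<^sup>2 / (2 * \<eta>^2)) <= Tfac a z"
proof (rule power2_le_imp_le)
 let ?t = "tfac a z"
 have t: "0 < ?t" "?t <= 1" using assms tfac_pos tfac_le_1 by auto
 have "\<eta>^2 <= (pshyp z a)^2" using assms by (intro power_mono) auto
 then have t2: "?t <= 1 - \<eta>\<^sup>2" using assms by (simp add: pshyp_square)
 have eta: "0 < \<eta>^2" using assms by simp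
 have tt: "?t^2 <= ?t" using t by (simp add: power2_eq_square mult_left_le)
 have "?t^2 < 1" using t2 eta tt by linarith
 then have "?t^2 / (1 - ?t\<^sup>2) <= ?t^2 / \<eta>^2"
  using t2 eta tt by (intro divide_left_mono mult_pos_pos) (linarith | simp)+
 then have "exp (- ?t\<^sup>2 / \<eta>^2) <= exp (- ?t\<^sup>2 / (1 - ?t\<^sup>2))"
  by simp
 also have "... <= 1 - ?t\<^sup>2"
  using \<open>?t^2 < 1\<close> by (intro exp_ge_lower) simp_all
 also have "... = (1 - ?t) * (1 + ?t)" by (simp add: power2_eq_square algebra_simps)
 also have "... <= (1 - ?t) * exp ?t" using t by (intro mult_left_mono exp_ge_add_one_self) auto
 also have "... = (Tfac a z)^2" using assms by (simp add: Tfac_square)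
 finally show "(exp (- ?t\<^sup>2 / (2 * \<eta>^2)))^2 <= (Tfac a z)^2"
  by (simp flip: exp_double)
qed (rule Tfac_nonneg)

text \<open>With s = (1 - |a|^2) / (1 - cnj a z) and t = tfac a z one has
|z|^2 |s|^2 / 2 = Re s - (1 - |a|^2) / 2 - t / 2. Hence a product of factors gfac has modulus exp(k) times
a product of factors Tfac, where Tfac^2 = (1 - t) exp t = 1 - O(t^2) and t^2 is summable over a separated set.\<close>
lemma norm_gfac:
 assumes "a \<in> disc" "z \<in> disc"
 shows "cmod (gfac a z) = exp ((cmod z)^2 / 2 * kterm a z) * Tfac a z"
proof -
 let ?D = "1 - cnj a * z"
 have D: "cmod ?D > 0" using assms kern_pos by auto
 define A x n where "A = 1 - (cmod a)^2" and "x = Re ?D" and "n = (cmod ?D)^2"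
 have n: "n > 0" using D by (simp add: n_def)
 have "Re (complex_of_real A / ?D) = A * x / n"
  by (simp add: Re_divide cmod_power2 x_def n_def)
 moreover have "2 * x = (cmod z)^2 * A + n + (1 - (cmod z)^2)"
  unfolding cmod_power2 x_def n_def A_def by (simp add: power2_eq_square algebra_simps)
 then have "x = ((cmod z)^2 * A + n + (1 - (cmod z)^2)) / 2"
  by (simp only: field_simps)
 moreover have "A * (((cmod z)^2 * A + n + (1 - (cmod z)^2)) / 2) / n
   = (cmod z)^2 / 2 * (A^2 / n) + A / 2 + (A * (1 - (cmod z)^2) / n) / 2"
  using n by (simp add: field_simps power2_eq_square)
 ultimately have *: "Re (complex_of_real (1 - (cmod a)^2) / ?D)
   = (cmod z)^2 / 2 * kterm a z + (1 - (cmod a)^2) / 2 + tfac a z / 2"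
  unfolding kterm_def tfac_def by (simp add: A_def n_def)
 have "cmod (gfac a z) = pshyp z a *
   exp (Re (complex_of_real (1 - (cmod a)^2) / ?D) - (1 - (cmod a)^2) / 2)"
  unfolding gfac_def pshyp_def norm_mult norm_exp_eq_Re by simp
 also have "... = pshyp z a * exp ((cmod z)^2 / 2 * kterm a z + tfac a z / 2)"
  by (subst *) simp
 finally show ?thesis by (simp add: Tfac_def exp_add)
qed

lemma holomorphic_gfac [holomorphic_intros]: "a \<in> disc ==> gfac a holomorphic_on disc"
 unfolding gfac_def using kern_nz by (intro holomorphic_intros) auto

text \<open>Pseudo-hyperbolic separation with its denominator cleared. \<open>dl <= 1\<close> keeps
  the balls of radius \<open>dl / 2 * bd a\<close> inside the disc.\<close>

locale separated_set =
 fixes Z :: "complex set" and dl :: real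
 assumes Z_disc: "Z \<subseteq> disc" and delta: "0 < dl" "dl <= 1"
  and sep: "!!a b. a \<in> Z ==> b \<in> Z ==> a ~= b ==> dl * cmod (1 - cnj b * a) <= cmod (a - b)"
begin

lemma esep_Z: "esep dl Z"
 unfolding esep_def
proof (intro ballI impI)
 fix a b assume ab: "a \<in> Z" "b \<in> Z" "a ~= b"
 have "dl * bd a <= dl * cmod (1 - cnj b * a)"
  using kern_ge_right[of b a] ab Z_disc delta by (intro mult_left_mono) auto
 then show "dl * bd a <= cmod (a - b)" using sep[OF ab] by linarith
qed

lemma in_disc: "a \<in> Z ==> a \<in> disc"
 using Z_disc by auto

text \<open>\<open>kterm\<close> carries the kernel to the power 2, the critical exponent, which
  \<open>esep_kern_sum\<close> does not reach; bounding one kernel factor by 2 raises the power to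
  3, at the price of \<open>1 / bd z\<close>. In the square of \<open>tfac\<close> the power is 4,
  and the factor \<open>(bd z)^2\<close> restores a bound free of z.\<close>

lemma finite_kterm_bound:
 "\<exists>C>0. \<forall>F z. finite F \<and> F \<subseteq> Z \<and> z \<in> disc -->
   (\<Sum>a\<in>F. (bd a)^2 / cmod (1 - cnj a * z) ^ 3) <= C / bd z \<and>
   (\<Sum>a\<in>F. kterm a z) <= C / bd z \<and> (\<Sum>a\<in>F. (tfac a z)\<^sup>2) <= C"
proof -
 have three: "(2::real) < 3" and four: "(2::real) < 4" by auto
 obtain C3 where C3: "0 < C3"
  "!!S F z. esep dl S ==> S \<subseteq> disc ==> finite F ==> F \<subseteq> S ==> z \<in> disc ==>
   (\<Sum>a\<in>F. (bd a)^2 * cmod (1 - cnj a * z) powr (-3)) <= C3 * bd z powr (2 - 3)"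
  by (rule esep_kern_sum[OF three delta]) (rule that)
 obtain C4 where C4: "0 < C4"
  "!!S F z. esep dl S ==> S \<subseteq> disc ==> finite F ==> F \<subseteq> S ==> z \<in> disc ==>
   (\<Sum>a\<in>F. (bd a)^2 * cmod (1 - cnj a * z) powr (-4)) <= C4 * bd z powr (2 - 4)"
  by (rule esep_kern_sum[OF four delta]) (rule that)
 have 3: "(\<Sum>a\<in>F. (bd a)^2 / cmod (1 - cnj a * z) ^ 3) <= C3 / bd z"
  if "finite F" "F \<subseteq> Z" "z \<in> disc" for F z
 proof -
  have "(\<Sum>a\<in>F. (bd a)^2 / cmod (1 - cnj a * z) ^ 3) = (\<Sum>a\<in>F. (bd a)^2 * cmod (1 - cnj a * z) powr (-3))"
  proof (rule sum.cong[OF refl])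
   fix a assume "a \<in> F"
   then have "0 < cmod (1 - cnj a * z)" using that in_disc kern_pos by blast
   then show "(bd a)^2 / cmod (1 - cnj a * z) ^ 3 = (bd a)^2 * cmod (1 - cnj a * z) powr (-3)"
    by (simp add: powr_minus divide_inverse)
  qed
  also have "... <= C3 / bd z" using C3(2)[OF esep_Z Z_disc that] bd_pos[OF that(3)] by (simp add: powr_minus divide_inverse)
  finally show ?thesis .
 qed
 show ?thesis
 proof (intro exI[of _ "8 * C3 + 16 * C4"] conjI allI impI; (elim conjE)?)
  fix F z assume F: "finite F" "F \<subseteq> Z" "z \<in> disc"
  have bz: "0 < bd z" using F bd_pos by auto
  note 31 = 3[OF F]
  have C38: "C3 / bd z <= (8 * C3 + 16 * C4) / bd z" "8 * (C3 / bd z) <= (8 * C3 + 16 * C4) / bd z"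
   using bz C3(1) C4(1) by (auto simp: divide_right_mono)
  show "(\<Sum>a\<in>F. (bd a)^2 / cmod (1 - cnj a * z) ^ 3) <= (8 * C3 + 16 * C4) / bd z"
   using 31 C38 by linarith
  have "(\<Sum>a\<in>F. kterm a z) <= (\<Sum>a\<in>F. 8 * ((bd a)^2 / cmod (1 - cnj a * z) ^ 3))"
  proof (rule sum_mono)
   fix a assume "a \<in> F"
   then have a: "a \<in> disc" using F in_disc by auto
   let ?h = "cmod (1 - cnj a * z)"
   have h: "0 < ?h" "?h <= 2" using a F kern_pos kern_le_2 by auto
   have "(1 - (cmod a)^2)^2 <= (2 * bd a)^2"
    using square_le_bd[of a] bd_square_le[OF a] bd_pos[OF a] by (intro power_mono) auto
   then have "kterm a z <= 4 * (bd a)^2 / ?h^2"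
    unfolding kterm_def by (intro divide_right_mono) (auto simp: power_mult_distrib)
   also have "... = 4 * (bd a)^2 * ?h / ?h ^ 3" using h by (simp add: power2_eq_square power3_eq_cube)
   also have "... <= 4 * (bd a)^2 * 2 / ?h ^ 3" using h by (intro divide_right_mono mult_left_mono) auto
   finally show "kterm a z <= 8 * ((bd a)^2 / ?h ^ 3)" by simp
  qed
  also have "... = 8 * (\<Sum>a\<in>F. (bd a)^2 / cmod (1 - cnj a * z) ^ 3)" by (simp add: sum_distrib_left)
  finally show "(\<Sum>a\<in>F. kterm a z) <= (8 * C3 + 16 * C4) / bd z" using 3[OF F] C38 by linarith
  have "(\<Sum>a\<in>F. (tfac a z)\<^sup>2) <= (\<Sum>a\<in>F. 16 * (bd z)^2 * ((bd a)^2 * cmod (1 - cnj a * z) powr (-4)))"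
  proof (rule sum_mono)
   fix a assume "a \<in> F"
   then have a: "a \<in> disc" using F in_disc by auto
   let ?h = "cmod (1 - cnj a * z)"
   have h: "0 < ?h" using a F kern_pos by auto
   have "(1 - (cmod a)^2) * (1 - (cmod z)^2) <= (2 * bd a) * (2 * bd z)"
    using square_le_bd[of a] bd_square_le[OF a] bd_pos[OF a] square_le_bd[of z] bd_square_le[OF F(3)] bd_pos[OF F(3)]
    by (intro mult_mono) auto
   then have "tfac a z <= (4 * bd a * bd z) / ?h^2"
    unfolding tfac_def by (intro divide_right_mono) auto
   then have "(tfac a z)\<^sup>2 <= ((4 * bd a * bd z) / ?h^2)^2"
    using tfac_pos[OF a F(3)] by (intro power_mono) auto
   also have "... = 16 * (bd z)^2 * ((bd a)^2 * ?h powr (-4))"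
    using h by (simp add: powr_minus divide_inverse power_mult_distrib power_inverse flip: power_mult)
   finally show "(tfac a z)\<^sup>2 <= 16 * (bd z)^2 * ((bd a)^2 * ?h powr (-4))" .
  qed
  also have "... = 16 * (bd z)^2 * (\<Sum>a\<in>F. (bd a)^2 * cmod (1 - cnj a * z) powr (-4))" by (simp add: sum_distrib_left)
  also have "... <= 16 * (bd z)^2 * (C4 * bd z powr (2 - 4))"
   using C4(2)[OF esep_Z Z_disc F] by (intro mult_left_mono) auto
  also have "... = 16 * C4" using bz by (simp add: powr_minus powr_numeral)
  finally show "(\<Sum>a\<in>F. (tfac a z)\<^sup>2) <= 8 * C3 + 16 * C4" using C3(1) by linarith
 qed (use C3(1) C4(1) in auto)
qed

lemma kterm_summable: "z \<in> disc ==> (%a. kterm a z) summable_on Z"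
proof -
 assume z: "z \<in> disc"
 obtain C where "!!F z. finite F ==> F \<subseteq> Z ==> z \<in> disc ==> (\<Sum>a\<in>F. kterm a z) <= C / bd z"
  using finite_kterm_bound by blast
 then show ?thesis
  using z by (intro nonneg_bdd_above_summable_on bdd_aboveI2[where M = "C / bd z"]) (auto simp: kterm_nonneg)
qed

lemma kterm_sum_le_infsum:
 "z \<in> disc ==> finite F ==> F \<subseteq> Z ==> (\<Sum>a\<in>F. kterm a z) <= (\<Sum>\<^sub>\<infinity>a\<in>Z. kterm a z)"
 by (rule finite_sum_le_infsum[OF kterm_summable]) (auto simp: kterm_nonneg)

lemma kZ_nonneg: "0 <= kZ Z z"
 unfolding kZ_kterm by (intro mult_nonneg_nonneg infsum_nonneg) (auto simp: kterm_nonneg)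

lemma kZ_finite_le: "z \<in> disc ==> finite F ==> F \<subseteq> Z ==> kZ F z <= kZ Z z"
 unfolding kZ_kterm using kterm_sum_le_infsum by (intro mult_left_mono) auto

lemma kZ_bound:
 obtains C where "0 < C" "!!z. z \<in> disc ==> kZ Z z <= C / bd z"
proof -
 obtain C where C: "0 < C" "!!F z. finite F ==> F \<subseteq> Z ==> z \<in> disc ==> (\<Sum>a\<in>F. kterm a z) <= C / bd z"
  using finite_kterm_bound by blast
 show ?thesis
 proof (rule that[OF C(1)])
  fix z assume z: "z \<in> disc"
  have "(\<Sum>\<^sub>\<infinity>a\<in>Z. kterm a z) <= C / bd z"
   by (rule infsum_le_finite_sums[OF kterm_summable[OF z]]) (use C z in auto)
  moreover have "(cmod z)^2 / 2 <= 1"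
   using z power_le_one[of "cmod z" 2] by (simp add: disc_iff)
  moreover have "0 <= (\<Sum>\<^sub>\<infinity>a\<in>Z. kterm a z)"
   by (intro infsum_nonneg) (auto simp: kterm_nonneg)
  ultimately show "kZ Z z <= C / bd z"
   unfolding kZ_kterm by (meson mult_left_le_one_le order_trans zero_le_power2 divide_nonneg_nonneg zero_le_numeral)
 qed
qed

text \<open>The factor |z|^2 stays with \<open>kterm\<close> because
  \<open>z / (1 - cnj a * z) - w / (1 - cnj a * w)\<close> equals
  \<open>(z - w) / ((1 - cnj a * z) * (1 - cnj a * w))\<close>, which leaves a cubic kernel. The
  closeness of w to z makes the two kernels comparable.\<close>

lemma kterm_diff:
 assumes "a \<in> disc" "z \<in> disc" "w \<in> disc" "cmod (z - w) <= bd z / 2"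
 shows "\<bar>(cmod z)^2 * kterm a z - (cmod w)^2 * kterm a w\<bar>
  <= 24 * cmod (z - w) * ((bd a)^2 / cmod (1 - cnj a * z) ^ 3)"
proof -
 let ?h = "cmod (1 - cnj a * z)" and ?k = "cmod (1 - cnj a * w)"
 have h: "0 < ?h" "0 < ?k" using assms kern_pos by auto
 have "?h <= ?k + cmod (z - w)"
  using kern_diff[OF assms(1), of z w] by (simp add: kern_sym)
 moreover have "bd z <= ?h" using assms kern_ge_right by auto
 ultimately have hk: "?h <= 2 * ?k" using assms(4) by linarith
 define x y where "x = cmod z / ?h" and "y = cmod w / ?k"
 have "\<bar>x - y\<bar> <= cmod (z / (1 - cnj a * z) - w / (1 - cnj a * w))"
  unfolding x_def y_def by (metis norm_divide norm_triangle_ineq3)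
 also have "z / (1 - cnj a * z) - w / (1 - cnj a * w) = (z - w) / ((1 - cnj a * z) * (1 - cnj a * w))"
  using h by (auto simp: field_simps)
 also have "cmod ... = cmod (z - w) / (?h * ?k)" by (simp add: norm_divide norm_mult)
 also have "... <= cmod (z - w) / (?h * (?h / 2))"
  using h hk by (intro divide_left_mono mult_left_mono mult_pos_pos) auto
 finally have xy: "\<bar>x - y\<bar> <= 2 * cmod (z - w) / ?h^2" by (simp add: power2_eq_square field_simps)
 have x1: "0 <= x" "x <= 1 / ?h" unfolding x_def using h assms by (auto simp: disc_iff divide_right_mono)
 have "y <= 1 / ?k" unfolding y_def using h assms by (auto simp: disc_iff divide_right_mono)
 also have "... <= 2 / ?h" using h hk by (simp add: field_simps)
 finally have y1: "0 <= y" "y <= 2 / ?h" by (auto simp: y_def)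
 have "\<bar>x^2 - y\<^sup>2\<bar> = \<bar>x - y\<bar> * (x + y)"
  using x1 y1 by (simp add: power2_eq_square square_diff_square_factored abs_mult mult.commute)
 also have "... <= (2 * cmod (z - w) / ?h^2) * (3 / ?h)"
  using xy x1 y1 by (intro mult_mono) auto
 also have "... = 6 * cmod (z - w) / ?h ^ 3" using h by (simp add: power2_eq_square power3_eq_cube)
 finally have d: "\<bar>x^2 - y\<^sup>2\<bar> <= 6 * cmod (z - w) / ?h ^ 3" .
 have b: "(1 - (cmod a)^2)^2 <= 4 * (bd a)^2"
  using square_le_bd[of a] bd_square_le[OF assms(1)] bd_pos[OF assms(1)]
   power_mono[of "1 - (cmod a)^2" "2 * bd a" 2] by (auto simp: power_mult_distrib)
 have "(cmod z)^2 * kterm a z - (cmod w)^2 * kterm a w = (1 - (cmod a)^2)^2 * (x^2 - y\<^sup>2)"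
  by (simp add: x_def y_def kterm_def power_divide algebra_simps)
 then have "\<bar>(cmod z)^2 * kterm a z - (cmod w)^2 * kterm a w\<bar> = (1 - (cmod a)^2)^2 * \<bar>x^2 - y\<^sup>2\<bar>"
  by (simp add: abs_mult)
 also have "... <= (4 * (bd a)^2) * (6 * cmod (z - w) / ?h ^ 3)"
  using b d by (intro mult_mono) auto
 finally show ?thesis by (simp add: mult_ac)
qed

text \<open>The weight \<open>exp (kZ Z z)\<close> is thus constant up to a bounded factor on discs
  of radius proportional to \<open>bd z\<close>, so it can be frozen in local estimates.\<close>

lemma kZ_lipschitz:
 obtains C where "0 < C"
  "!!z w. z \<in> disc ==> cmod (z - w) <= bd z / 2 ==> \<bar>kZ Z z - kZ Z w\<bar> <= C * cmod (z - w) / bd z"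
proof -
 obtain C where C: "0 < C"
  "!!F z. finite F ==> F \<subseteq> Z ==> z \<in> disc ==> (\<Sum>a\<in>F. (bd a)^2 / cmod (1 - cnj a * z) ^ 3) <= C / bd z"
  using finite_kterm_bound by blast
 show ?thesis
 proof (rule that[of "12 * C"])
  fix z w assume z: "z \<in> disc" and zw: "cmod (z - w) <= bd z / 2"
  have w: "w \<in> disc" using bd_diff[of z w] bd_pos[OF z] zw by (auto simp: disc_iff bd_def)
  let ?A = "%z a. (cmod z)^2 * kterm a z"
  have S: "(?A z) summable_on Z" "(?A w) summable_on Z"
   using kterm_summable z w by (auto intro: summable_on_cmult_right)
  have K: "kZ Z z = infsum (?A z) Z / 2" "kZ Z w = infsum (?A w) Z / 2"
   by (simp_all add: kZ_kterm infsum_cmult_right')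
  have F: "\<bar>sum (?A z) F - sum (?A w) F\<bar> <= 24 * C * cmod (z - w) / bd z" if "finite F" "F \<subseteq> Z" for F
  proof -
   have "\<bar>sum (?A z) F - sum (?A w) F\<bar> <= (\<Sum>a\<in>F. \<bar>?A z a - ?A w a\<bar>)"
    by (simp add: sum_abs flip: sum_subtractf)
   also have "... <= (\<Sum>a\<in>F. 24 * cmod (z - w) * ((bd a)^2 / cmod (1 - cnj a * z) ^ 3))"
    using that in_disc z w zw by (intro sum_mono kterm_diff) auto
   also have "... = 24 * cmod (z - w) * (\<Sum>a\<in>F. (bd a)^2 / cmod (1 - cnj a * z) ^ 3)"
    by (simp add: sum_distrib_left)
   also have "... <= 24 * cmod (z - w) * (C / bd z)"
    using C(2)[OF that z] by (intro mult_left_mono) auto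
   finally show ?thesis by (simp add: mult_ac)
  qed
  have "sum (?A z) F <= infsum (?A w) Z + 24 * C * cmod (z - w) / bd z" if "finite F" "F \<subseteq> Z" for F
   using F[OF that] finite_sum_le_infsum[OF S(2) that] by (fastforce simp: kterm_nonneg)
  then have 1: "infsum (?A z) Z <= infsum (?A w) Z + 24 * C * cmod (z - w) / bd z"
   by (intro infsum_le_finite_sums S) auto
  have "sum (?A w) F <= infsum (?A z) Z + 24 * C * cmod (z - w) / bd z" if "finite F" "F \<subseteq> Z" for F
   using F[OF that] finite_sum_le_infsum[OF S(1) that] by (fastforce simp: kterm_nonneg)
  then have 2: "infsum (?A w) Z <= infsum (?A z) Z + 24 * C * cmod (z - w) / bd z"
   by (intro infsum_le_finite_sums S) auto
  show "\<bar>kZ Z z - kZ Z w\<bar> <= 12 * C * cmod (z - w) / bd z"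
   unfolding K using 1 2 by (simp add: abs_le_iff)
 qed (use C(1) in auto)
qed

lemma continuous_kZ: "continuous_on disc (kZ Z)"
proof -
 obtain C where C: "0 < C"
  "!!z w. z \<in> disc ==> cmod (z - w) <= bd z / 2 ==> \<bar>kZ Z z - kZ Z w\<bar> <= C * cmod (z - w) / bd z"
  by (rule kZ_lipschitz) (rule that)
 have "continuous (at z) (kZ Z)" if z: "z \<in> disc" for z
 proof -
  have bz: "0 < bd z" using z bd_pos by auto
  have "((%w. C * cmod (z - w) / bd z) \<longlongrightarrow> C * cmod (z - z) / bd z) (at z)"
   by (intro tendsto_intros) (use bz in auto)
  then have lim: "((%w. C * cmod (z - w) / bd z) \<longlongrightarrow> 0) (at z)" by simp
  have ev: "\<forall>\<^sub>F w in at z. norm (kZ Z w - kZ Z z) <= C * cmod (z - w) / bd z"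
  proof -
   have "\<forall>\<^sub>F w in at z. dist w z < bd z / 2"
    unfolding eventually_at using bz by (intro exI[of _ "bd z / 2"]) auto
   then show ?thesis
   proof eventually_elim
    case (elim w)
    then show ?case using C(2)[OF z, of w] by (auto simp: dist_norm norm_minus_commute abs_minus_commute)
   qed
  qed
  show ?thesis unfolding continuous_at
   by (rule LIM_zero_cancel, rule Lim_null_comparison[OF ev lim])
 qed
 then show ?thesis by (simp add: continuous_at_imp_continuous_on)
qed

lemma countable_Z: "countable Z"
proof -
 have "inj_on (%a. ball a (dl / 2 * bd a)) Z"
 proof (rule inj_onI)
  fix a b assume ab: "a \<in> Z" "b \<in> Z" "ball a (dl / 2 * bd a) = ball b (dl / 2 * bd b)"
  have "a \<in> ball a (dl / 2 * bd a)" using delta bd_pos[OF in_disc[OF ab(1)]] by auto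
  then show "a = b" using esep_balls_disjoint[OF esep_Z ab(1,2)] ab(3) by blast
 qed
 moreover have "countable ((%a. ball a (dl / 2 * bd a)) ` Z)"
 proof (rule countable_disjoint_open_subsets)
  show "disjoint ((%a. ball a (dl / 2 * bd a)) ` Z)"
   using esep_balls_disjoint[OF esep_Z] by (force simp: disjoint_def)
 qed auto
 ultimately show ?thesis by (rule countable_image_inj_on[rotated])
qed

text \<open>Montel's theorem and Fatou's lemma work with sequences, whereas infinite sums over Z are
  limits along finite subsets; this sequence of finite sets links the two.\<close>

lemma exhaustion:
 obtains F :: "nat => complex set" where "!!n. finite (F n)" "!!n. F n \<subseteq> Z"
  "filterlim F (finite_subsets_at_top Z) sequentially"
proof (cases "Z = {}")
 case True
 show ?thesis by (rule that[of "%_. {}"]) (auto simp: True filterlim_finite_subsets_at_top)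
next
 case False
 define F where "F n = from_nat_into Z ` {..<n}" for n
 have F: "finite (F n)" "F n \<subseteq> Z" for n
  using from_nat_into[OF False] by (auto simp: F_def)
 have "filterlim F (finite_subsets_at_top Z) sequentially"
  unfolding filterlim_finite_subsets_at_top
 proof (intro allI impI)
  fix X assume X: "finite X \<and> X \<subseteq> Z"
  have "\<forall>x\<in>X. \<exists>n. from_nat_into Z n = x"
   using X countable_Z by (meson from_nat_into_surj subsetD)
  then obtain g where g: "!!x. x \<in> X ==> from_nat_into Z (g x) = x" by metis
  have "finite (g ` X)" using X by auto
  then obtain N where N: "!!x. x \<in> X ==> g x < N"
   by (metis finite_nat_set_iff_bounded imageI)
  have "\<forall>\<^sub>F n in sequentially. N <= n" by (rule eventually_ge_at_top)
  then show "\<forall>\<^sub>F n in sequentially. finite (F n) \<and> X \<subseteq> F n \<and> F n \<subseteq> Z"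
  proof eventually_elim
   case (elim n)
   have "X \<subseteq> F n"
   proof
    fix x assume x: "x \<in> X"
    show "x \<in> F n" unfolding F_def using g[OF x] N[OF x] elim
     by (metis imageI lessThan_iff order_less_le_trans)
   qed
   then show ?case using F by auto
  qed
 qed
 then show ?thesis using that F by blast
qed

text \<open>Outside the ball, \<open>cmod (1 - cnj b * z)\<close> is at most
  \<open>2 * bd b + cmod (z - b)\<close>, hence at most \<open>4 / dl + 1 <= 5 / dl\<close> times
  \<open>cmod (z - b)\<close>.\<close>

lemma pshyp_lower:
 assumes "z \<in> disc" "b \<in> Z" "dl / 2 * bd b <= cmod (z - b)"
 shows "dl / 5 <= pshyp z b"
proof -
 have b: "b \<in> disc" using assms in_disc by auto
 have "1 - cnj b * z = (1 - cnj b * b) + cnj b * (b - z)" by (simp add: algebra_simps)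
 then have "cmod (1 - cnj b * z) <= cmod (1 - cnj b * b) + cmod (cnj b * (b - z))"
  by (metis norm_triangle_ineq)
 also have "1 - cnj b * b = of_real (1 - (cmod b)^2)"
  unfolding of_real_diff of_real_1 complex_norm_square by (simp add: mult.commute)
 also have "cmod (of_real (1 - (cmod b)^2)) <= 2 * bd b"
  using square_le_bd[of b] bd_square_le[OF b] bd_pos[OF b] by (simp del: of_real_diff)
 also have "cmod (cnj b * (b - z)) <= cmod (z - b)"
  using b by (simp add: norm_mult disc_iff norm_minus_commute mult_left_le_one_le)
 also have "2 * bd b <= 4 / dl * cmod (z - b)"
  using assms(3) delta by (simp add: field_simps)
 finally have "cmod (1 - cnj b * z) <= (4 / dl + 1) * cmod (z - b)" by (simp add: algebra_simps)
 also have "... <= 5 / dl * cmod (z - b)" using delta by (intro mult_right_mono) (auto simp: field_simps)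
 finally have "dl / 5 * cmod (1 - cnj b * z) <= cmod (z - b)" using delta by (simp add: field_simps)
 then show ?thesis using kern_pos[OF b assms(1)] by (simp add: pshyp_eq field_simps)
qed

lemma near_far:
 assumes "z \<in> disc" "a \<in> Z" "b \<in> Z" "a ~= b" "cmod (z - a) < dl / 2 * bd a"
 shows "dl / 2 * bd b <= cmod (z - b)"
proof -
 have "z \<in> ball a (dl / 2 * bd a)" using assms(5) by (simp add: dist_norm norm_minus_commute)
 then have "z \<notin> ball b (dl / 2 * bd b)" using esep_balls_disjoint[OF esep_Z assms(2-4)] by blast
 then show ?thesis by (simp add: dist_norm norm_minus_commute)
qed

lemma Tfac_prod_lower:
 obtains c where "0 < c" "c <= 1"
  "!!F z. finite F ==> F \<subseteq> Z ==> z \<in> disc ==> (!!a. a \<in> F ==> dl / 5 <= pshyp z a) ==> c <= (\<Prod>a\<in>F. Tfac a z)"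
proof -
 obtain C where C: "0 < C"
  "!!F z. finite F ==> F \<subseteq> Z ==> z \<in> disc ==> (\<Sum>a\<in>F. (tfac a z)\<^sup>2) <= C"
  using finite_kterm_bound by blast
 show ?thesis
 proof (rule that[of "exp (- C / (2 * (dl / 5)^2))"])
  show "exp (- C / (2 * (dl / 5)^2)) <= 1" using C by simp
  fix F z assume F: "finite F" "F \<subseteq> Z" "z \<in> disc" "!!a. a \<in> F ==> dl / 5 <= pshyp z a"
  have "- C / (2 * (dl / 5)^2) <= - (\<Sum>a\<in>F. (tfac a z)\<^sup>2) / (2 * (dl / 5)^2)"
   using C(2)[OF F(1-3)] by (intro divide_right_mono) auto
  also have "... = (\<Sum>a\<in>F. - (tfac a z)\<^sup>2 / (2 * (dl / 5)^2))"
   by (simp add: sum_negf sum_divide_distrib)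
  finally have "exp (- C / (2 * (dl / 5)^2)) <= exp (\<Sum>a\<in>F. - (tfac a z)\<^sup>2 / (2 * (dl / 5)^2))"
   by simp
  also have "... = (\<Prod>a\<in>F. exp (- (tfac a z)\<^sup>2 / (2 * (dl / 5)^2)))"
   by (rule exp_sum[OF F(1)])
  also have "... <= (\<Prod>a\<in>F. Tfac a z)"
   using F in_disc delta by (intro prod_mono conjI Tfac_lower) auto
  finally show "exp (- C / (2 * (dl / 5)^2)) <= (\<Prod>a\<in>F. Tfac a z)" .
 qed simp
qed

lemma norm_prod_gfac:
 assumes "finite F" "F \<subseteq> Z" "z \<in> disc"
 shows "cmod (\<Prod>a\<in>F. gfac a z) = exp (kZ F z) * (\<Prod>a\<in>F. Tfac a z)"
proof -
 have "cmod (\<Prod>a\<in>F. gfac a z) = (\<Prod>a\<in>F. exp ((cmod z)^2 / 2 * kterm a z) * Tfac a z)"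
  unfolding prod_norm[symmetric] using assms in_disc by (intro prod.cong norm_gfac) auto
 also have "... = exp (kZ F z) * (\<Prod>a\<in>F. Tfac a z)"
  using assms by (simp add: prod.distrib kZ_kterm sum_distrib_left exp_sum)
 finally show ?thesis .
qed

text \<open>The finite products have modulus \<open>exp (kZ F z)\<close> times factors between 0 and
  1, so they are locally bounded and Montel's theorem gives a limit. The upper and lower bounds hold
  for all finite products with the same constants, and they pass to the limit because
  \<open>kZ (F n) z\<close> tends to \<open>kZ Z z\<close>. Close to a only the factor of a can be
  small.\<close>

lemma Psi_exists:
 obtains \<Psi> c where "\<Psi> holomorphic_on disc" "0 < c" "c <= 1"
  "!!z. z \<in> disc ==> cmod (\<Psi> z) <= exp (kZ Z z)"
  "!!z a. z \<in> disc ==> a \<in> Z ==> cmod (\<Psi> z) <= exp (1/2) * pshyp z a * exp (kZ Z z)"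
  "!!z. z \<in> disc ==> (!!a. a \<in> Z ==> dl / 2 * bd a <= cmod (z - a)) ==> c * exp (kZ Z z) <= cmod (\<Psi> z)"
  "!!z a. z \<in> disc ==> a \<in> Z ==> cmod (z - a) < dl / 2 * bd a ==> c * pshyp z a * exp (kZ Z z) <= cmod (\<Psi> z)"
proof -
 obtain F :: "nat => complex set" where F: "!!n. finite (F n)" "!!n. F n \<subseteq> Z"
  "filterlim F (finite_subsets_at_top Z) sequentially" by (rule exhaustion) (rule that)
 obtain c where c: "0 < c" "c <= 1"
  "!!F z. finite F ==> F \<subseteq> Z ==> z \<in> disc ==> (!!a. a \<in> F ==> dl / 5 <= pshyp z a) ==> c <= (\<Prod>a\<in>F. Tfac a z)"
  by (rule Tfac_prod_lower) (rule that, blast+)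
 obtain C where C: "0 < C" "!!z. z \<in> disc ==> kZ Z z <= C / bd z"
  by (rule kZ_bound) (rule that)
 define P where "P n z = (\<Prod>a\<in>F n. gfac a z)" for n z
 have T01: "0 <= (\<Prod>a\<in>G. Tfac a z)" "(\<Prod>a\<in>G. Tfac a z) <= 1" if "G \<subseteq> Z" "z \<in> disc" for G z
  using that in_disc by (auto intro!: prod_nonneg prod_le_1 simp: Tfac_nonneg Tfac_le_1)
 have nP: "cmod (P n z) = exp (kZ (F n) z) * (\<Prod>a\<in>F n. Tfac a z)" if "z \<in> disc" for n z
  unfolding P_def using F that by (intro norm_prod_gfac) auto
 have nP1: "cmod (P n z) <= exp (kZ Z z)" if z: "z \<in> disc" for n z
 proof -
  have "cmod (P n z) <= exp (kZ (F n) z) * 1"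
   unfolding nP[OF z] using T01[OF F(2) z] by (intro mult_left_mono) auto
  also have "... <= exp (kZ Z z)" using kZ_finite_le[OF z F(1,2)] by simp
  finally show ?thesis .
 qed
 have hol: "P n holomorphic_on disc" for n
  unfolding P_def using F in_disc by (intro holomorphic_intros) auto
 have bdd: "\<exists>B. \<forall>h\<in>range P. \<forall>z\<in>K. cmod (h z) <= B" if K: "compact K" "K \<subseteq> disc" for K
 proof (cases "K = {}")
  case False
  have "continuous_on K bd" unfolding bd_def by (intro continuous_intros)
  then obtain m where m: "m \<in> K" "!!z. z \<in> K ==> bd m <= bd z"
   using continuous_attains_inf[OF K(1) False] by blast
  have "cmod (P n z) <= exp (C / bd m)" if z: "z \<in> K" for n z
  proof -
   have "C / bd z <= C / bd m"
    using m z K bd_pos C by (intro divide_left_mono mult_pos_pos) auto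
   then have "kZ Z z <= C / bd m" using C(2)[of z] z K by force
   then show ?thesis using nP1[of z n] z K by (meson exp_le_cancel_iff order_trans subsetD)
  qed
  then show ?thesis by auto
 qed auto
 obtain \<Psi> r where \<Psi>: "\<Psi> holomorphic_on disc" "strict_mono (r :: nat => nat)"
   "!!x. x \<in> disc ==> ((%n. P (r n) x) \<longlongrightarrow> \<Psi> x) sequentially"
 proof (rule Montel[OF open_disc, of "range P" P])
  show "h holomorphic_on disc" if "h \<in> range P" for h using hol that by auto
  show "\<exists>B. \<forall>h\<in>range P. \<forall>z\<in>K. cmod (h z) <= B" if "compact K" "K \<subseteq> disc" for K
   using bdd[OF that] .
  fix g :: "complex => complex" and r :: "nat => nat"
  assume "g holomorphic_on disc" "strict_mono r" "!!x. x \<in> disc ==> (%n. P (r n) x) \<longlonglongrightarrow> g x"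
  then show thesis by (rule that)
 qed simp
 have lim: "(%n. cmod (P (r n) z)) \<longlonglongrightarrow> cmod (\<Psi> z)" if "z \<in> disc" for z
  using \<Psi>(3)[OF that] by (rule tendsto_norm)
 have limk: "(%n. kZ (F (r n)) z) \<longlonglongrightarrow> kZ Z z" if z: "z \<in> disc" for z
 proof -
  have "((%a. kterm a z) has_sum (\<Sum>\<^sub>\<infinity>a\<in>Z. kterm a z)) Z"
   using kterm_summable[OF z] by (rule has_sum_infsum)
  then have "(sum (%a. kterm a z) \<longlongrightarrow> (\<Sum>\<^sub>\<infinity>a\<in>Z. kterm a z)) (finite_subsets_at_top Z)"
   by (simp add: has_sum_def)
  from filterlim_compose[OF this F(3)] have "(%n. sum (%a. kterm a z) (F n)) \<longlonglongrightarrow> (\<Sum>\<^sub>\<infinity>a\<in>Z. kterm a z)" .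
  then have "(%n. (cmod z)^2 / 2 * sum (%a. kterm a z) (F n)) \<longlonglongrightarrow> kZ Z z"
   unfolding kZ_kterm by (intro tendsto_intros)
  then have "(%n. kZ (F n) z) \<longlonglongrightarrow> kZ Z z" using F by (simp add: kZ_kterm)
  from LIMSEQ_subseq_LIMSEQ[OF this \<Psi>(2)] show ?thesis by (simp add: o_def)
 qed
 have limc: "(%n. d * exp (kZ (F (r n)) z)) \<longlonglongrightarrow> d * exp (kZ Z z)" if "z \<in> disc" for z d
  using limk[OF that] by (intro tendsto_intros)
 show ?thesis
 proof (rule that[OF \<Psi>(1) c(1,2)])
  show "cmod (\<Psi> z) <= exp (kZ Z z)" if z: "z \<in> disc" for z
   using lim[OF z] by (rule LIMSEQ_le_const2) (use nP1[OF z] in auto)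
 next
  fix z a assume z: "z \<in> disc" and a: "a \<in> Z"
  have "eventually (%n. finite (F n) \<and> {a} \<subseteq> F n \<and> F n \<subseteq> Z) sequentially"
   using F(3) a unfolding filterlim_finite_subsets_at_top by blast
  then have "eventually (%n. a \<in> F n) sequentially" by eventually_elim auto
  then have "eventually (%n. a \<in> F (r n)) sequentially"
   by (rule eventually_subseq[OF \<Psi>(2)])
  then have "eventually (%n. cmod (P (r n) z) <= exp (1/2) * pshyp z a * exp (kZ Z z)) sequentially"
  proof eventually_elim
   case (elim n)
   have "(\<Prod>b\<in>F (r n). Tfac b z) = Tfac a z * (\<Prod>b\<in>F (r n) - {a}. Tfac b z)"
    using elim F(1) by (simp add: prod.remove)
   also have "... <= Tfac a z * 1"
    using T01[of "F (r n) - {a}" z] F(2) z by (intro mult_left_mono Tfac_nonneg) auto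
   also have "... <= exp (1/2) * pshyp z a"
    using Tfac_le_pshyp[OF in_disc[OF a] z] by simp
   finally have "cmod (P (r n) z) <= exp (kZ (F (r n)) z) * (exp (1/2) * pshyp z a)"
    unfolding nP[OF z] by (intro mult_left_mono) auto
   also have "... <= exp (kZ Z z) * (exp (1/2) * pshyp z a)"
    using kZ_finite_le[OF z F(1,2)] by (intro mult_right_mono) (auto simp: pshyp_nonneg)
   finally show ?case by (simp add: mult_ac)
  qed
  then show "cmod (\<Psi> z) <= exp (1/2) * pshyp z a * exp (kZ Z z)"
   by (rule tendsto_upperbound[OF lim[OF z]]) auto
 next
  fix z assume z: "z \<in> disc" and far: "!!a. a \<in> Z ==> dl / 2 * bd a <= cmod (z - a)"
  have "c * exp (kZ (F (r n)) z) <= cmod (P (r n) z)" for n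
   unfolding nP[OF z] mult.commute[of c]
  proof (intro mult_left_mono c(3) F z)
   show "dl / 5 <= pshyp z a" if "a \<in> F (r n)" for a
    using that F(2) pshyp_lower[OF z _ far] by blast
  qed simp
  then show "c * exp (kZ Z z) <= cmod (\<Psi> z)"
   by (intro LIMSEQ_le[OF limc[OF z] lim[OF z]]) auto
 next
  fix z a assume z: "z \<in> disc" and a: "a \<in> Z" and near: "cmod (z - a) < dl / 2 * bd a"
  have ad: "a \<in> disc" using a in_disc by auto
  have "c * pshyp z a * exp (kZ (F (r n)) z) <= cmod (P (r n) z)" for n
  proof -
   have 1: "c <= (\<Prod>b\<in>F (r n) - {a}. Tfac b z)"
   proof (intro c(3) z)
    show "dl / 5 <= pshyp z b" if b: "b \<in> F (r n) - {a}" for b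
    proof (rule pshyp_lower[OF z])
     show bZ: "b \<in> Z" using b F(2) by blast
     show "dl / 2 * bd b <= cmod (z - b)" using near_far[OF z a bZ _ near] b by blast
    qed
   qed (use F in auto)
   \<comment> \<open>While a is not yet in the finite set, the product is at least c, and
     \<open>pshyp z a <= 1\<close> makes the claim weaker than that.\<close>
   have "pshyp z a * c <= (\<Prod>b\<in>F (r n). Tfac b z)"
   proof (cases "a \<in> F (r n)")
    case True
    then have "(\<Prod>b\<in>F (r n). Tfac b z) = Tfac a z * (\<Prod>b\<in>F (r n) - {a}. Tfac b z)"
     using F(1) by (simp add: prod.remove)
    moreover have "pshyp z a * c <= Tfac a z * (\<Prod>b\<in>F (r n) - {a}. Tfac b z)"
     using 1 c(1) Tfac_ge_pshyp[OF ad z] by (intro mult_mono) (simp_all add: Tfac_nonneg)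
    ultimately show ?thesis by simp
   next
    case False
    then have "F (r n) - {a} = F (r n)" by auto
    then have "c <= (\<Prod>b\<in>F (r n). Tfac b z)" using 1 by simp
    moreover have "pshyp z a * c <= c" using pshyp_le_1[OF ad z] c by (simp add: pshyp_nonneg mult_left_le_one_le)
    ultimately show ?thesis by linarith
   qed
   then have "exp (kZ (F (r n)) z) * (pshyp z a * c) <= exp (kZ (F (r n)) z) * (\<Prod>b\<in>F (r n). Tfac b z)"
    by (intro mult_left_mono) auto
   then show ?thesis unfolding nP[OF z] by (simp add: mult_ac)
  qed
  then show "c * pshyp z a * exp (kZ Z z) <= cmod (\<Psi> z)"
   by (intro LIMSEQ_le[OF limc[OF z] lim[OF z]]) auto
 qed
qed

end

section \<open>Smooth functions of two real variables\<close>

definition C1 :: "(complex => complex) => bool" where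
 "C1 \<phi> \<longleftrightarrow> (\<forall>z. \<phi> differentiable (at z)) \<and> continuous_on UNIV (pd 1 \<phi>) \<and> continuous_on UNIV (pd \<i> \<phi>)"

text \<open>Real differentiability with a and b the partial derivatives in x and y. Carrying these
  values explicitly turns each rule of calculus into algebra.\<close>

definition hasAB :: "(complex => complex) => complex => complex => complex => bool" where
 "hasAB \<phi> a b z \<longleftrightarrow> (\<phi> has_derivative (%v. of_real (Re v) * a + of_real (Im v) * b)) (at z)"

lemma pd_eq: "(\<phi> has_derivative \<phi>') (at z) ==> pd v \<phi> z = \<phi>' v"
 unfolding pd_def using frechet_derivative_at by metis

lemma hasAB_pd:
 assumes "hasAB \<phi> a b z" shows "pd 1 \<phi> z = a" "pd \<i> \<phi> z = b" "\<phi> differentiable (at z)"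
 using assms pd_eq[of \<phi> _ z] unfolding hasAB_def by (auto simp: differentiable_def)

lemma hasAB_dbar: "hasAB \<phi> a b z ==> dbar \<phi> z = (a + \<i> * b) / 2"
 by (simp add: dbar_def hasAB_pd)

lemma has_derivative_hasAB:
 assumes "(\<phi> has_derivative \<phi>') (at z)" shows "hasAB \<phi> (\<phi>' 1) (\<phi>' \<i>) z"
proof -
 interpret linear \<phi>' using assms by (rule has_derivative_linear)
 have "\<phi>' v = of_real (Re v) * \<phi>' 1 + of_real (Im v) * \<phi>' \<i>" for v
 proof -
  have "v = Re v *\<^sub>R 1 + Im v *\<^sub>R \<i>" by (simp add: complex_eq_iff)
  then have "\<phi>' v = Re v *\<^sub>R \<phi>' 1 + Im v *\<^sub>R \<phi>' \<i>" by (metis add scale)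
  then show ?thesis by (simp add: scaleR_conv_of_real)
 qed
 then have "\<phi>' = (%v. of_real (Re v) * \<phi>' 1 + of_real (Im v) * \<phi>' \<i>)" by (rule ext)
 then show ?thesis using assms unfolding hasAB_def by metis
qed

lemma differentiable_hasAB: "\<phi> differentiable (at z) ==> hasAB \<phi> (pd 1 \<phi> z) (pd \<i> \<phi> z) z"
proof -
 assume "\<phi> differentiable (at z)"
 then obtain \<phi>' where d: "(\<phi> has_derivative \<phi>') (at z)" by (auto simp: differentiable_def)
 show ?thesis using has_derivative_hasAB[OF d] unfolding pd_eq[OF d] .
qed

lemma C1_hasAB: "C1 \<phi> ==> hasAB \<phi> (pd 1 \<phi> z) (pd \<i> \<phi> z) z"
 by (simp add: C1_def differentiable_hasAB)

lemma C1I: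
 assumes "!!z. hasAB \<phi> (a z) (b z) z" "continuous_on UNIV a" "continuous_on UNIV b"
 shows "C1 \<phi>"
proof -
 have "pd 1 \<phi> = a" "pd \<i> \<phi> = b" using hasAB_pd[OF assms(1)] by auto
 then show ?thesis using assms hasAB_pd(3)[OF assms(1)] by (simp add: C1_def)
qed

lemma hasAB_const: "hasAB (%_. c) 0 0 z"
 by (simp add: hasAB_def)

lemma hasAB_add: "hasAB f a b z ==> hasAB g c d z ==> hasAB (%z. f z + g z) (a + c) (b + d) z"
 unfolding hasAB_def by (drule (1) has_derivative_add) (simp add: algebra_simps)

lemma hasAB_mult: "hasAB f a b z ==> hasAB g c d z ==>
  hasAB (%z. f z * g z) (a * g z + f z * c) (b * g z + f z * d) z"
 unfolding hasAB_def by (drule (1) has_derivative_mult) (simp add: algebra_simps)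

lemma hasAB_inverse: "hasAB f a b z ==> f z ~= 0 ==>
  hasAB (%z. inverse (f z)) (- (inverse (f z) * a * inverse (f z))) (- (inverse (f z) * b * inverse (f z))) z"
proof -
 assume f: "hasAB f a b z" "f z ~= 0"
 show ?thesis
  using has_derivative_compose[OF f(1)[unfolded hasAB_def] has_derivative_inverse'[OF f(2)]] unfolding hasAB_def
  by (rule has_derivative_eq_rhs) (intro ext, algebra)
qed

lemma hasAB_Re: "hasAB f a b z ==> hasAB (%z. of_real (Re (f z))) (of_real (Re a)) (of_real (Re b)) z"
 unfolding hasAB_def
 by (drule has_derivative_Re, drule has_derivative_of_real) (simp add: algebra_simps)

lemma hasAB_field: "(f has_field_derivative d) (at z) ==> hasAB f d (\<i> * d) z"
 unfolding hasAB_def has_field_derivative_def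
 by (rule has_derivative_eq_rhs, assumption) (auto simp: fun_eq_iff complex_eq_iff)

lemma hasAB_transform: "hasAB f a b z ==> open U ==> z \<in> U ==> (!!w. w \<in> U ==> f w = g w) ==> hasAB g a b z"
 unfolding hasAB_def by (rule has_derivative_transform_within_open)

lemma dbar_mult: "f differentiable (at z) ==> g differentiable (at z) ==>
  dbar (%z. f z * g z) z = dbar f z * g z + f z * dbar g z"
proof -
 assume "f differentiable (at z)" "g differentiable (at z)"
 from hasAB_dbar[OF hasAB_mult[OF this[THEN differentiable_hasAB]]] show ?thesis
  by (simp add: dbar_def[of f] dbar_def[of g] add_divide_distrib algebra_simps)
qed

lemma differentiable_continuous_on:
 fixes f :: "complex => complex"
 assumes "!!z. f differentiable (at z)"
 shows "continuous_on S f"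
 by (rule continuous_at_imp_continuous_on) (intro ballI differentiable_imp_continuous_within assms)

lemma C1_continuous: "C1 f ==> continuous_on S f"
 by (rule differentiable_continuous_on) (simp add: C1_def)

lemma C1_pd_continuous: "C1 f ==> continuous_on S (pd 1 f)" "C1 f ==> continuous_on S (pd \<i> f)"
 unfolding C1_def using continuous_on_subset[OF _ subset_UNIV] by blast+

lemma C1_add: "C1 f ==> C1 g ==> C1 (%z. f z + g z)"
 by (rule C1I[OF hasAB_add[OF C1_hasAB C1_hasAB]]) (assumption | rule continuous_on_add C1_pd_continuous)+

lemma C1_mult: "C1 f ==> C1 g ==> C1 (%z. f z * g z)"
 by (rule C1I[OF hasAB_mult[OF C1_hasAB C1_hasAB]]) (assumption | rule continuous_on_add continuous_on_mult C1_pd_continuous C1_continuous)+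

lemma C1_dbar_continuous: "C1 f ==> continuous_on S (dbar f)"
 unfolding dbar_def by (intro continuous_intros C1_pd_continuous) auto

lemma C1_const: "C1 (%_. c)"
 by (rule C1I[OF hasAB_const]) auto

text \<open>Off K the product vanishes together with both partial derivatives, whatever f is there,
  and the open sets U and - K cover the plane. On U the derivative d of f drops out of
  \<open>dbar\<close>, since its x- and y-derivatives are d and i d.\<close>

lemma C1_mult_holomorphic:
 assumes "C1 \<phi>" "open U" "f holomorphic_on U" "closed K" "K \<subseteq> U" "!!z. z \<notin> K ==> \<phi> z = 0"
 shows "C1 (%z. \<phi> z * f z)" "dbar (%z. \<phi> z * f z) z = dbar \<phi> z * f z"
proof -
 let ?g = "%z. \<phi> z * f z"
 define a where "a z = pd 1 \<phi> z * f z + \<phi> z * deriv f z" for z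
 define b where "b z = pd \<i> \<phi> z * f z + \<phi> z * (\<i> * deriv f z)" for z
 have in1: "hasAB ?g (a z) (b z) z" if "z \<in> U" for z
 proof -
  have "(f has_field_derivative deriv f z) (at z)"
   using assms(2,3) that holomorphic_derivI by blast
  from hasAB_mult[OF C1_hasAB[OF assms(1)] hasAB_field[OF this]] show ?thesis
   by (simp add: a_def b_def)
 qed
 have zero: "hasAB \<phi> 0 0 z" if "z \<notin> K" for z
  using hasAB_transform[OF hasAB_const[of 0], of "- K" z \<phi>] that assms(4,6) by auto
 have pd0: "pd 1 \<phi> z = 0" "pd \<i> \<phi> z = 0" if "z \<notin> K" for z
  using hasAB_pd[OF zero[OF that]] by auto
 have ab0: "a z = 0" "b z = 0" if "z \<notin> K" for z using pd0 assms(6) that by (auto simp: a_def b_def)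
 have out: "hasAB ?g (a z) (b z) z" if "z \<notin> K" for z
  using hasAB_transform[OF hasAB_const[of 0], of "- K" z ?g] that assms(4,6) by (auto simp: ab0)
 have all: "hasAB ?g (a z) (b z) z" for z using in1 out assms(5) by blast
 have opK: "open (- K)" using assms(4) by auto
 have df: "continuous_on U (deriv f)" "continuous_on U f"
  using assms(2,3) holomorphic_deriv holomorphic_on_imp_continuous_on by blast+
 have c1: "continuous_on U (pd 1 \<phi>)" "continuous_on U (pd \<i> \<phi>)" "continuous_on U \<phi>"
  using C1_pd_continuous[OF assms(1)] C1_continuous[OF assms(1)] by blast+
 have cU: "continuous_on U a" "continuous_on U b"
  unfolding a_def b_def by (intro continuous_intros c1 df)+
 have "continuous_on (- K) a"
  by (rule continuous_on_eq[OF continuous_on_const[of _ 0]]) (simp add: ab0)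
 from continuous_on_open_Un[OF assms(2) opK cU(1) this] have 1: "continuous_on (U \<union> - K) a" .
 have "continuous_on (- K) b"
  by (rule continuous_on_eq[OF continuous_on_const[of _ 0]]) (simp add: ab0)
 from continuous_on_open_Un[OF assms(2) opK cU(2) this] have 2: "continuous_on (U \<union> - K) b" .
 note 1 2
 moreover have "U \<union> - K = UNIV" using assms(5) by auto
 ultimately show "C1 ?g" using C1I[OF all] by metis
 show "dbar ?g z = dbar \<phi> z * f z"
  by (simp add: hasAB_dbar[OF all] a_def b_def dbar_def field_simps)
qed

section \<open>Area measure as a product, and the vanishing integral of a dbar-derivative\<close>

lemma measurable_Complex [measurable]: "(%(x, y). Complex x y) \<in> borel_measurable (lborel \<Otimes>\<^sub>M lborel)"
proof -
 have "(%p. Complex (fst p) (snd p)) \<in> borel_measurable borel"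
  unfolding Complex_eq by (intro borel_measurable_continuous_onI continuous_intros)
 then show ?thesis unfolding lborel_prod by (simp add: case_prod_beta')
qed

text \<open>Both measures agree on boxes. This opens the way to Fubini in the real coordinates x and
  y.\<close>

lemma lborel_complex: "(lborel :: complex measure) = distr (lborel \<Otimes>\<^sub>M lborel) borel (%(x, y). Complex x y)"
proof (rule lborel_eqI)
 fix l u :: complex assume lu: "!!b. b \<in> Basis ==> l \<bullet> b <= u \<bullet> b"
 have le: "Re l <= Re u" "Im l <= Im u" using lu[of 1] lu[of \<i>] by (auto simp: Basis_complex_def)
 have "emeasure (distr (lborel \<Otimes>\<^sub>M lborel) borel (%(x, y). Complex x y)) (box l u)
   = emeasure (lborel \<Otimes>\<^sub>M lborel) ((%(x, y). Complex x y) -` box l u \<inter> space (lborel \<Otimes>\<^sub>M lborel))"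
  by (rule emeasure_distr) auto
 also have "(%(x, y). Complex x y) -` box l u \<inter> space (lborel \<Otimes>\<^sub>M lborel) = box (Re l) (Re u) \<times> box (Im l) (Im u)"
  by (auto simp: box_def Basis_complex_def space_pair_measure)
 also have "emeasure (lborel \<Otimes>\<^sub>M lborel) ... = emeasure lborel (box (Re l) (Re u)) * emeasure lborel (box (Im l) (Im u))"
  by (rule lborel.emeasure_pair_measure_Times) auto
 also have "... = ennreal (\<Prod>b\<in>Basis. (u - l) \<bullet> b)"
  using le by (simp add: Basis_complex_def ennreal_mult' prod.insert_if)
 finally show "emeasure (distr (lborel \<Otimes>\<^sub>M lborel) borel (%(x, y). Complex x y)) (box l u)
   = ennreal (\<Prod>b\<in>Basis. (u - l) \<bullet> b)" .
qed simp

lemma integrable_compact_support: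
 fixes f :: "complex => complex"
 assumes "continuous_on UNIV f" "!!z. B < cmod z ==> f z = 0"
 shows "integrable lborel f"
proof -
 have "integrable lborel (%x. indicator (cball 0 B) x *\<^sub>R f x)"
  using assms by (intro borel_integrable_compact) (auto intro: continuous_on_subset)
 also have "(%x. indicator (cball 0 B) x *\<^sub>R f x) = f"
  using assms(2) by (auto simp: fun_eq_iff indicator_def not_le)
 finally show ?thesis .
qed

lemma integral_line_zero:
 fixes g g' :: "real => complex"
 assumes d: "!!x. (g has_vector_derivative g' x) (at x)" and c: "continuous_on UNIV g'"
  and z: "!!x. B < \<bar>x\<bar> ==> g x = 0" "!!x. B < \<bar>x\<bar> ==> g' x = 0"
 shows "integral\<^sup>L lborel g' = 0"
proof -
 define b where "b = \<bar>B\<bar> + 1"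
 have "has_bochner_integral lborel (%x. indicator {-b..b} x *\<^sub>R g' x) (g b - g (-b))"
  using d c by (intro has_bochner_integral_FTC_Icc)
    (auto simp: b_def intro: has_vector_derivative_at_within continuous_on_subset)
 moreover have "(%x. indicator {-b..b} x *\<^sub>R g' x) = g'"
  using z(2) by (auto simp: fun_eq_iff indicator_def b_def)
 moreover have "g b = 0" "g (-b) = 0" using z(1) by (auto simp: b_def)
 ultimately show ?thesis using has_bochner_integral_integral_eq by fastforce
qed

text \<open>By the fundamental theorem of calculus and the bounded support, the x-derivative
  integrates to 0 along every horizontal line and the y-derivative along every vertical one; Fubini
  does the rest.\<close>

lemma integral_dbar_zero:
 assumes "C1 \<phi>" "!!z. B < cmod z ==> \<phi> z = 0"
 shows "integral\<^sup>L lborel (dbar \<phi>) = 0"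
proof -
 have zero: "hasAB \<phi> 0 0 z" if "B < cmod z" for z
 proof (rule hasAB_transform[OF hasAB_const[of 0], of "{z. B < cmod z}"])
  show "open {z. B < cmod z}" by (intro open_Collect_less continuous_intros)
 qed (use that assms in auto)
 have pd0: "pd 1 \<phi> z = 0" "pd \<i> \<phi> z = 0" if "B < cmod z" for z
  using hasAB_pd[OF zero[OF that]] by auto
 have c: "continuous_on UNIV (pd 1 \<phi>)" "continuous_on UNIV (pd \<i> \<phi>)" using assms by (auto simp: C1_def)
 have int: "integrable lborel (pd 1 \<phi>)" "integrable lborel (pd \<i> \<phi>)"
  using c pd0 by (auto intro: integrable_compact_support)
 have der: "(\<phi> has_derivative (%v. of_real (Re v) * pd 1 \<phi> z + of_real (Im v) * pd \<i> \<phi> z)) (at z)" for z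
  using C1_hasAB[OF assms(1)] by (simp add: hasAB_def)
 have dx: "((%x. \<phi> (Complex x y)) has_vector_derivative pd 1 \<phi> (Complex x y)) (at x)" for x y
 proof -
  have "((%x. Complex x y) has_derivative (%h. of_real h)) (at x)"
   unfolding Complex_eq by (auto intro!: derivative_eq_intros)
  from has_derivative_compose[OF this der] show ?thesis
   by (simp add: has_vector_derivative_def scaleR_conv_of_real)
 qed
 have dy: "((%y. \<phi> (Complex x y)) has_vector_derivative pd \<i> \<phi> (Complex x y)) (at y)" for x y
 proof -
  have "((%y. Complex x y) has_derivative (%h. \<i> * of_real h)) (at y)"
   unfolding Complex_eq by (auto intro!: derivative_eq_intros)
  from has_derivative_compose[OF this der] show ?thesis
   by (simp add: has_vector_derivative_def scaleR_conv_of_real)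
 qed
 have cc: "continuous_on UNIV (%x. f (Complex x y))" "continuous_on UNIV (%y. f (Complex x y))"
  if "continuous_on UNIV f" for f :: "complex => complex" and x y
  by (rule continuous_on_compose2[OF that]; auto simp: Complex_eq intro!: continuous_intros)+
 have bb: "B < cmod (Complex x y)" if "B < \<bar>x\<bar> \<or> B < \<bar>y\<bar>" for x y
  using that abs_Re_le_cmod[of "Complex x y"] abs_Im_le_cmod[of "Complex x y"] by auto
 have Ix: "integral\<^sup>L lborel (%x. pd 1 \<phi> (Complex x y)) = 0" for y
  by (rule integral_line_zero[OF dx cc(1)[OF c(1)], of B]) (use assms(2) pd0 bb in auto)
 have Iy: "integral\<^sup>L lborel (%y. pd \<i> \<phi> (Complex x y)) = 0" for x
  by (rule integral_line_zero[OF dy cc(2)[OF c(2)], of B]) (use assms(2) pd0 bb in auto)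
 have trans: "integrable (lborel \<Otimes>\<^sub>M lborel) (%(x, y). f (Complex x y))"
   "integral\<^sup>L lborel f = integral\<^sup>L (lborel \<Otimes>\<^sub>M lborel) (%(x, y). f (Complex x y))"
   if "integrable lborel f" for f :: "complex => complex"
 proof -
  have fm: "f \<in> borel_measurable borel" using that by auto
  show "integrable (lborel \<Otimes>\<^sub>M lborel) (%(x, y). f (Complex x y))"
   using that fm by (subst (asm) lborel_complex) (simp add: integrable_distr_eq case_prod_beta')
  show "integral\<^sup>L lborel f = integral\<^sup>L (lborel \<Otimes>\<^sub>M lborel) (%(x, y). f (Complex x y))"
   using fm by (subst lborel_complex) (simp add: integral_distr case_prod_beta')
 qed
 have I1: "integral\<^sup>L lborel (pd 1 \<phi>) = 0"
  using lborel_pair.integral_snd[OF trans(1)[OF int(1)]] by (simp add: trans(2)[OF int(1)] Ix)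
 have I2: "integral\<^sup>L lborel (pd \<i> \<phi>) = 0"
  using lborel_pair.integral_fst'[OF trans(1)[OF int(2)]] by (simp add: trans(2)[OF int(2)] Iy)
 show ?thesis unfolding dbar_def using int I1 I2 by simp
qed

section \<open>Smooth cutoff functions\<close>

definition flat :: "nat => real => real" where
 "flat n x = (if 0 < x then exp (- 1 / x) / x ^ n else 0)"

lemma flat_nonneg: "0 <= flat n x"
 by (simp add: flat_def)

lemma flat_pos: "0 < x ==> 0 < flat n x"
 by (simp add: flat_def)

lemma flat_zero: "x <= 0 ==> flat n x = 0"
 by (simp add: flat_def)

lemma flat_tendsto_0: "(flat n \<longlongrightarrow> 0) (at 0)"
proof -
 have "((%y::real. y ^ n / exp y) \<longlongrightarrow> 0) at_top" by (rule tendsto_power_div_exp_0)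
 from filterlim_compose[OF this filterlim_inverse_at_top_right]
 have "((%x::real. inverse x ^ n / exp (inverse x)) \<longlongrightarrow> 0) (at_right 0)" .
 moreover have "\<forall>\<^sub>F x in at_right 0. inverse x ^ n / exp (inverse x) = flat n x"
  unfolding eventually_at_right_field by (intro exI[of _ 1]) (auto simp: flat_def exp_minus power_inverse divide_inverse)
 ultimately have "(flat n \<longlongrightarrow> 0) (at_right 0)" using tendsto_cong by fast
 moreover have "(flat n \<longlongrightarrow> 0) (at_left 0)"
 proof (rule tendsto_eventually)
  show "\<forall>\<^sub>F x in at_left 0. flat n x = 0"
   unfolding eventually_at_left_field by (intro exI[of _ "-1"]) (auto simp: flat_def)
 qed
 ultimately show ?thesis by (simp add: filterlim_split_at)
qed

lemma flat_deriv: "(flat n has_real_derivative (flat (n + 2) x - real n * flat (n + 1) x)) (at x)"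
proof -
 consider "x < 0" | "x = 0" | "0 < x" by linarith
 then show ?thesis
 proof cases
  case 1
  have "((%_. 0) has_real_derivative 0) (at x)" by simp
  then have "(flat n has_real_derivative 0) (at x)"
   by (rule has_field_derivative_transform_within_open[of _ _ _ "{..<0}"]) (use 1 in \<open>auto simp: flat_def\<close>)
  then show ?thesis using 1 by (simp add: flat_def)
 next
  case 2
  \<comment> \<open>The difference quotient of \<open>flat n\<close> at 0 is
    \<open>flat (Suc n)\<close>, which tends to 0.\<close>
  have "((%h. flat n h / h) \<longlongrightarrow> 0) (at 0)"
  proof (rule Lim_transform_eventually[OF flat_tendsto_0[of "Suc n"]])
   show "\<forall>\<^sub>F x in at 0. flat (Suc n) x = flat n x / x"
    by (rule always_eventually) (auto simp: flat_def)
  qed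
  then show ?thesis using 2 by (simp add: DERIV_def flat_def)
 next
  case 3
  have "((%x. exp (- inverse x) * inverse x ^ n) has_real_derivative
    exp (- inverse x) * (inverse x * inverse x) * inverse x ^ n +
    exp (- inverse x) * (real n * inverse x ^ (n - 1) * - (inverse x * inverse x))) (at x)"
   using 3 by (auto intro!: derivative_eq_intros simp: power2_eq_square)
  moreover have "exp (- inverse x) * (inverse x * inverse x) * inverse x ^ n +
    exp (- inverse x) * (real n * inverse x ^ (n - 1) * - (inverse x * inverse x)) = flat (n + 2) x - real n * flat (n + 1) x"
   using 3 by (cases n) (simp_all add: flat_def divide_inverse power_inverse algebra_simps)
  ultimately have "((%x. exp (- inverse x) * inverse x ^ n) has_real_derivative (flat (n + 2) x - real n * flat (n + 1) x)) (at x)"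
   by simp
  then show ?thesis
   by (rule has_field_derivative_transform_within_open[of _ _ _ "{0<..}"]) (use 3 in \<open>auto simp: flat_def divide_inverse power_inverse\<close>)
 qed
qed

text \<open>This class is closed under both partial derivatives, which gives smoothness by induction;
that is why flat carries the parameter n.\<close>
inductive smooth_gen :: "(complex => complex) => bool" where
 const: "smooth_gen (%_. c)"
| Re: "smooth_gen (%z. of_real (Re z))"
| Im: "smooth_gen (%z. of_real (Im z))"
| add: "smooth_gen f ==> smooth_gen g ==> smooth_gen (%z. f z + g z)"
| mult: "smooth_gen f ==> smooth_gen g ==> smooth_gen (%z. f z * g z)"
| inverse: "smooth_gen f ==> (!!z. f z ~= 0) ==> smooth_gen (%z. inverse (f z))"
| Re_comp: "smooth_gen f ==> smooth_gen (%z. of_real (Re (f z)))"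
| flat: "smooth_gen f ==> smooth_gen (%z. of_real (flat n (Re (f z))))"

lemma smooth_gen_hasAB:
 assumes "smooth_gen f"
 shows "\<exists>a b. smooth_gen a \<and> smooth_gen b \<and> (\<forall>z. hasAB f (a z) (b z) z)"
 using assms
proof induction
 case (const c)
 show ?case using smooth_gen.const[of 0] hasAB_const by (intro exI[of _ "%_. 0"]) auto
next
 case Re
 have "hasAB (%z. of_real (Re z)) 1 0 z" for z
  unfolding hasAB_def by (auto intro!: derivative_eq_intros)
 then show ?case using smooth_gen.const by (intro exI[of _ "%_. 1"] exI[of _ "%_. 0"]) auto
next
 case Im
 have "hasAB (%z. of_real (Im z)) 0 1 z" for z
  unfolding hasAB_def by (auto intro!: derivative_eq_intros)
 then show ?case using smooth_gen.const by (intro exI[of _ "%_. 1"] exI[of _ "%_. 0"]) auto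
next
 case (add f g)
 then obtain a b c d where "smooth_gen a" "smooth_gen b" "smooth_gen c" "smooth_gen d"
  "!!z. hasAB f (a z) (b z) z" "!!z. hasAB g (c z) (d z) z" by metis
 then show ?case
  by (intro exI[of _ "%z. a z + c z"] exI[of _ "%z. b z + d z"]) (auto intro: smooth_gen.add hasAB_add)
next
 case (mult f g)
 then obtain a b c d where *: "smooth_gen a" "smooth_gen b" "smooth_gen c" "smooth_gen d"
  "!!z. hasAB f (a z) (b z) z" "!!z. hasAB g (c z) (d z) z" by metis
 show ?case
  by (intro exI[of _ "%z. a z * g z + f z * c z"] exI[of _ "%z. b z * g z + f z * d z"])
    (use mult * in \<open>auto intro!: smooth_gen.add smooth_gen.mult intro: hasAB_mult\<close>)
next
 case (inverse f)
 then obtain a b where *: "smooth_gen a" "smooth_gen b" "!!z. hasAB f (a z) (b z) z" by metis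
 have i: "smooth_gen (%z. inverse (f z))" by (rule smooth_gen.inverse) (use inverse in auto)
 have n: "smooth_gen (%z. - g z)" if "smooth_gen g" for g
  using smooth_gen.mult[OF smooth_gen.const[of "-1"] that] by simp
 have "smooth_gen (%z. - (inverse (f z) * a z * inverse (f z)))" "smooth_gen (%z. - (inverse (f z) * b z * inverse (f z)))"
  by (intro n smooth_gen.mult i *)+
 moreover have "hasAB (%z. inverse (f z)) (- (inverse (f z) * a z * inverse (f z))) (- (inverse (f z) * b z * inverse (f z))) z" for z
  using * inverse by (intro hasAB_inverse) auto
 ultimately show ?case by blast
next
 case (Re_comp f)
 then obtain a b where *: "smooth_gen a" "smooth_gen b" "!!z. hasAB f (a z) (b z) z" by metis
 show ?case
  by (rule exI[of _ "%z. of_real (Re (a z))"], rule exI[of _ "%z. of_real (Re (b z))"])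
    (use * in \<open>auto intro: smooth_gen.Re_comp hasAB_Re\<close>)
next
 case (flat f n)
 then obtain a b where *: "smooth_gen a" "smooth_gen b" "!!z. hasAB f (a z) (b z) z" by metis
 define h where "h z = of_real (flat (n + 2) (Re (f z))) + (- of_nat n) * complex_of_real (flat (n + 1) (Re (f z)))" for z
 have h: "smooth_gen h"
  unfolding h_def using flat by (intro smooth_gen.add smooth_gen.mult smooth_gen.flat smooth_gen.const)
 have "hasAB (%z. of_real (flat n (Re (f z)))) (h z * of_real (Re (a z))) (h z * of_real (Re (b z))) z" for z
 proof -
  have "((%z. Re (f z)) has_derivative (%v. Re (of_real (Re v) * a z + of_real (Im v) * b z))) (at z)"
   using *(3)[of z] unfolding hasAB_def by (rule has_derivative_Re)
  from has_derivative_compose[OF this flat_deriv[THEN has_field_derivative_imp_has_derivative], THEN has_derivative_of_real]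
  show ?thesis unfolding hasAB_def h_def
   by (rule has_derivative_eq_rhs) (auto simp: fun_eq_iff algebra_simps)
 qed
 then show ?case
  by (intro exI[of _ "%z. h z * of_real (Re (a z))"] exI[of _ "%z. h z * of_real (Re (b z))"])
   (auto intro!: smooth_gen.mult smooth_gen.Re_comp h *)
qed

lemma smooth_gen_pd:
 assumes "smooth_gen f" shows "f differentiable (at z)" "smooth_gen (pd 1 f)" "smooth_gen (pd \<i> f)"
proof -
 obtain a b where *: "smooth_gen a" "smooth_gen b" "!!z. hasAB f (a z) (b z) z"
  using smooth_gen_hasAB[OF assms] by metis
 have "pd 1 f = a" "pd \<i> f = b" using hasAB_pd[OF *(3)] by auto
 then show "f differentiable (at z)" "smooth_gen (pd 1 f)" "smooth_gen (pd \<i> f)"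
  using * hasAB_pd(3)[OF *(3)] by auto
qed

lemma smooth_gen_C1: "smooth_gen f ==> C1 f"
 unfolding C1_def by (intro conjI allI differentiable_continuous_on smooth_gen_pd)

lemma smooth_gen_smooth: "smooth_gen f ==> smooth f"
proof -
 assume f: "smooth_gen f"
 have "smooth_gen (foldr pd ds f)" if "set ds \<subseteq> {1, \<i>}" for ds
  using that by (induction ds) (auto simp: f smooth_gen_pd)
 then show ?thesis unfolding smooth_def using smooth_gen_pd by blast
qed

lemma smooth_C1: "smooth \<phi> ==> C1 \<phi>"
proof -
 assume s: "smooth \<phi>"
 have "\<phi> differentiable at z" "pd 1 \<phi> differentiable at z" "pd \<i> \<phi> differentiable at z" for z
  using s[unfolded smooth_def, rule_format, of "[]" z] s[unfolded smooth_def, rule_format, of "[1]" z]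
   s[unfolded smooth_def, rule_format, of "[\<i>]" z] by auto
 then show ?thesis unfolding C1_def by (intro conjI allI differentiable_continuous_on)
qed

text \<open>The usual quotient f(s^2 - x) / (f(s^2 - x) + f(x - r^2)) with f = \<open>flat 0\<close>
  and x = |z|^2; the square keeps it smooth at the origin.\<close>

definition cutoff :: "real => real => complex => complex" where
 "cutoff r s z = of_real (flat 0 (s^2 - (cmod z)^2)) *
   inverse (of_real (flat 0 (s^2 - (cmod z)^2)) + of_real (flat 0 ((cmod z)^2 - r\<^sup>2)))"

lemma cutoff_denominator: "0 < r ==> r < s ==> 0 < flat 0 (s^2 - x) + flat 0 (x - r\<^sup>2)"
proof -
 assume "0 < r" "r < s"
 then have "r^2 < s^2" by (simp add: power_strict_mono)
 then have "0 < s^2 - x \<or> 0 < x - r\<^sup>2" by linarith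
 then show ?thesis using flat_pos flat_nonneg by (metis add_nonneg_pos add_pos_nonneg)
qed

lemma smooth_gen_cutoff: "0 < r ==> r < s ==> smooth_gen (cutoff r s)"
proof -
 assume rs: "0 < r" "r < s"
 have sq: "smooth_gen (%z. of_real a + of_real b * (of_real (Re z) * of_real (Re z) + of_real (Im z) * of_real (Im z)))" for a b
  by (intro smooth_gen.intros)
 have e: "Re (of_real a + of_real b * (of_real (Re z) * of_real (Re z) + of_real (Im z) * of_real (Im z))) = a + b * (cmod z)^2" for a b z
  unfolding cmod_power2 by (simp add: power2_eq_square)
 have 1: "smooth_gen (%z. of_real (flat 0 (s^2 - (cmod z)^2)))"
  using smooth_gen.flat[OF sq[of "s^2" "-1"], of 0] unfolding e by simp
 have 2: "smooth_gen (%z. of_real (flat 0 ((cmod z)^2 - r\<^sup>2)))"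
  using smooth_gen.flat[OF sq[of "- r\<^sup>2" "1"], of 0] unfolding e by simp
 have 3: "of_real (flat 0 (s^2 - (cmod z)^2)) + of_real (flat 0 ((cmod z)^2 - r\<^sup>2)) ~= (0::complex)" for z
  using cutoff_denominator[OF rs, of "(cmod z)^2"] by (metis less_irrefl of_real_add of_real_eq_0_iff)
 show ?thesis unfolding cutoff_def
  by (intro smooth_gen.mult smooth_gen.inverse smooth_gen.add 1 2 3)
qed

lemma cutoff_eq_1: "0 < r ==> r < s ==> cmod z <= r ==> cutoff r s z = 1"
proof -
 assume rs: "0 < r" "r < s" "cmod z <= r"
 then have "(cmod z)^2 <= r^2" by (simp add: power_mono)
 then have "flat 0 ((cmod z)^2 - r\<^sup>2) = 0" by (simp add: flat_zero)
 then show ?thesis using cutoff_denominator[OF rs(1,2), of "(cmod z)^2"] by (simp add: cutoff_def)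
qed

lemma cutoff_eq_0: "0 < r ==> r < s ==> s <= cmod z ==> cutoff r s z = 0"
proof -
 assume rs: "0 < r" "r < s" "s <= cmod z"
 then have "s^2 <= (cmod z)^2" by (simp add: power_mono)
 then show ?thesis by (simp add: cutoff_def flat_zero)
qed

lemma cutoff_bounds: "cmod (cutoff r s z) <= 1" "cmod (1 - cutoff r s z) <= 1" if "0 < r" "r < s"
proof -
 let ?a = "flat 0 (s^2 - (cmod z)^2)" and ?b = "flat 0 ((cmod z)^2 - r\<^sup>2)"
 have p: "0 <= ?a" "0 <= ?b" "0 < ?a + ?b" using flat_nonneg cutoff_denominator[OF that] by auto
 define q where "q = ?a / (?a + ?b)"
 have e: "cutoff r s z = of_real q" "1 - cutoff r s z = of_real (1 - q)"
  by (simp_all add: cutoff_def divide_inverse q_def)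
 have "0 <= q" "q <= 1" using p by (auto simp: q_def)
 then show "cmod (cutoff r s z) <= 1" unfolding e(1) norm_of_real by auto
 show "cmod (1 - cutoff r s z) <= 1"
  unfolding e(2) norm_of_real using \<open>0 <= q\<close> \<open>q <= 1\<close> by auto
qed

section \<open>The Cauchy-Pompeiu formula\<close>

text \<open>On the shell at distance about r / 2^k from w the integrand is of order 2^k / r and the
  area of order r^2 / 4^k, so the shells form a geometric series.\<close>

lemma sing_integral:
 fixes w :: complex
 assumes r: "0 < r"
 shows "(nn_set (ball w r) (%z. ennreal (1 / cmod (z - w)))) <= ennreal (16 * pi * r)"
proof -
 let ?c = "%k::nat. 2 ^ Suc k / r" and ?A = "%k::nat. ball w (2 * r / 2 ^ k)"
 have "(nn_set (ball w r) (%z. ennreal (1 / cmod (z - w))))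
   <= (NN z. (\<Sum>k. ennreal (?c k) * indicator (?A k) z))"
 proof (rule nn_integral_mono)
  fix z :: complex
  show "ennreal (1 / cmod (z - w)) * indicator (ball w r) z <= (\<Sum>k. ennreal (?c k) * indicator (?A k) z)"
  proof (cases "z \<in> ball w r \<and> z ~= w")
   case True
   define x where "x = cmod (z - w)"
   have x: "0 < x" "x < r" using True by (auto simp: x_def dist_norm norm_minus_commute)
   obtain k where k: "r / x < 2 ^ Suc k * 1" "(r / x) powr (-1) <= (2 ^ k * 1) powr (-1)"
    using powr_dyadic_bound[of 1 "r / x" 1] x r by auto
   have "x / r <= 1 / 2 ^ k" using k(2) x r by (simp add: powr_minus divide_inverse mult.commute)
   then have "x <= r / 2 ^ k" using r by (simp add: field_simps)
   also have "... < 2 * r / 2 ^ k" using r by (simp add: divide_strict_right_mono)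
   finally have "z \<in> ?A k" by (simp add: x_def dist_norm norm_minus_commute)
   moreover have "1 / x <= ?c k" using k(1) x r by (simp add: field_simps)
   ultimately have "ennreal (1 / cmod (z - w)) * indicator (ball w r) z <= ennreal (?c k) * indicator (?A k) z"
    using True by (simp add: x_def ennreal_leI)
   also have "... <= (\<Sum>k. ennreal (?c k) * indicator (?A k) z)"
    by (rule ennreal_le_suminf)
   finally show ?thesis .
  qed (auto simp: indicator_def)
 qed
 also have "... = (\<Sum>k. NN z. ennreal (?c k) * indicator (?A k) z)"
  by (rule nn_integral_suminf) (auto intro!: borel_measurable_times_ennreal borel_measurable_indicator)
 also have "... = (\<Sum>k. ennreal (?c k) * emeasure lborel (?A k))"
  by (subst nn_integral_cmult_indicator) auto
 also have "... = (\<Sum>k. ennreal (8 * pi * r * (1 / 2) ^ k))"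
 proof (rule suminf_cong)
  fix k
  have "ennreal (?c k) * emeasure lborel (?A k) = ennreal (?c k * (pi * (2 * r / 2 ^ k)^2))"
  proof -
   have "emeasure lborel (?A k) = ennreal (pi * (2 * r / 2 ^ k)^2)"
    using r by (intro emeasure_ball_complex) simp
   then show ?thesis using r by (simp only:) (rule ennreal_mult[symmetric], auto)
  qed
  also have "?c k * (pi * (2 * r / 2 ^ k)^2) = 8 * pi * r * (1 / 2) ^ k"
   using r by (simp add: power2_eq_square power_divide field_simps)
  finally show "ennreal (?c k) * emeasure lborel (?A k) = ennreal (8 * pi * r * (1 / 2) ^ k)" .
 qed
 also have "... = ennreal (8 * pi * r * (1 / (1 - 1 / 2)))"
  using r by (intro suminf_ennreal_eq sums_mult geometric_sums) auto
 finally show ?thesis by (simp add: mult_ac)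
qed

text \<open>The number pi, kept as a symbol: it is the total mass of the bump into which
  \<open>dbar\<close> turns the regularised Cauchy kernel, and it normalises every Cauchy transform
  below.\<close>

definition kap :: real where
 "kap = integral\<^sup>L lborel (%z::complex. 1 / (1 + (cmod z)^2)^2)"

lemma integrable_kap: "integrable lborel (%z::complex. 1 / (1 + (cmod z)^2)^2)"
proof (rule integrableI_nonneg)
 let ?c = "%k::nat. 4 * (1 / (2 ^ k) ^ 4)" and ?A = "%k::nat. ball (0::complex) (2 ^ Suc k)"
 have "(NN z. ennreal (1 / (1 + (cmod z)^2)^2))
   <= (NN z. (\<Sum>k. ennreal (?c k) * indicator (?A k) z))"
 proof (rule nn_integral_mono)
  fix z :: complex
  define x where "x = cmod z"
  have x: "0 <= x" by (simp add: x_def)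
  obtain k where k: "1 + x < 2 ^ Suc k * 1" "(1 + x) powr (-4) <= (2 ^ k * 1) powr (-4)"
   using powr_dyadic_bound[of 1 "1 + x" 4] x by auto
  have k2: "(1 + x) powr (-4) <= 1 / (2 ^ k) ^ 4"
   using k(2) by (simp add: powr_minus divide_inverse)
  have "0 <= (1 - x)^2" by simp
  then have "(1 + x)^2 <= 2 * (1 + x^2)" by (simp add: power2_eq_square algebra_simps)
  then have "((1 + x)^2)^2 <= (2 * (1 + x^2))^2" by (intro power_mono) auto
  moreover have "((1 + x)^2)^2 = (1 + x) ^ 4" by (simp flip: power_mult)
  moreover have "(2 * (1 + x^2))^2 = 4 * (1 + x^2)^2" unfolding power_mult_distrib by simp
  ultimately have "(1 + x) ^ 4 <= 4 * (1 + x^2)^2" by linarith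
  moreover have "0 < (1 + x) ^ 4" using x by (intro zero_less_power) linarith
  ultimately have "1 / (4 * (1 + x^2)^2) <= 1 / (1 + x) ^ 4" by (intro frac_le) auto
  also have "... = (1 + x) powr (-4)" using x by (simp add: powr_minus divide_inverse)
  finally have "1 / (4 * (1 + x^2)^2) <= 1 / (2 ^ k) ^ 4" using k2 by simp
  moreover have "1 / (1 + x^2)^2 = 4 * (1 / (4 * (1 + x^2)^2))" by simp
  ultimately have "1 / (1 + x^2)^2 <= ?c k" by linarith
  then have "ennreal (1 / (1 + (cmod z)^2)^2) <= ennreal (?c k) * indicator (?A k) z"
   using k(1) by (auto simp: x_def dist_norm intro!: ennreal_leI)
  also have "... <= (\<Sum>k. ennreal (?c k) * indicator (?A k) z)"
   by (rule ennreal_le_suminf)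
  finally show "ennreal (1 / (1 + (cmod z)^2)^2) <= (\<Sum>k. ennreal (?c k) * indicator (?A k) z)" .
 qed
 also have "... = (\<Sum>k. NN z. ennreal (?c k) * indicator (?A k) z)"
  by (rule nn_integral_suminf) (intro borel_measurable_times_ennreal borel_measurable_indicator borel_measurable_const, simp)
 also have "... = (\<Sum>k. ennreal (?c k) * emeasure lborel (?A k))"
  by (subst nn_integral_cmult_indicator) auto
 also have "... = (\<Sum>k. ennreal (16 * pi * (1 / 4) ^ k))"
 proof (rule suminf_cong)
  fix k
  have "ennreal (?c k) * emeasure lborel (?A k) = ennreal (?c k * (pi * (2 ^ Suc k)^2))"
  proof -
   have "emeasure lborel (?A k) = ennreal (pi * (2 ^ Suc k)^2)"
    by (intro emeasure_ball_complex) simp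
   then show ?thesis by (simp only:) (rule ennreal_mult[symmetric], auto)
  qed
  also have "?c k * (pi * (2 ^ Suc k)^2) = 16 * pi * (1 / 4) ^ k"
  proof -
   have "(4::real) ^ k = (2 ^ k)^2" by (simp add: power2_eq_square flip: power_mult_distrib)
   then show ?thesis by (simp add: power_divide power2_eq_square power4_eq_xxxx)
  qed
  finally show "ennreal (?c k) * emeasure lborel (?A k) = ennreal (16 * pi * (1 / 4) ^ k)" .
 qed
 also have "... = ennreal (16 * pi * (1 / (1 - 1 / 4)))"
  by (intro suminf_ennreal_eq sums_mult geometric_sums) auto
 also have "... < \<infinity>" by simp
 finally show "(NN z. ennreal (1 / (1 + (cmod z)^2)^2)) < \<infinity>" .
qed (auto intro!: borel_measurable_divide)

lemma kap_pos: "0 < kap"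
proof -
 have "0 < pi / 4" by simp
 also have "pi / 4 = integral\<^sup>L lborel (%z::complex. indicator (ball 0 1) z *\<^sub>R (1/4 :: real))"
  by (simp add: measure_def emeasure_ball_complex)
 also have "... <= kap"
  unfolding kap_def
 proof (rule integral_mono[OF _ integrable_kap])
  show "integrable lborel (%z::complex. indicator (ball 0 1) z *\<^sub>R (1/4 :: real))"
   by (intro integrable_scaleR_left integrable_real_indicator) (auto simp: emeasure_ball_complex)
  fix z :: complex
  show "indicator (ball 0 1) z *\<^sub>R (1/4 :: real) <= 1 / (1 + (cmod z)^2)^2"
  proof (cases "z \<in> ball 0 1")
   case True
   then have "(cmod z)^2 <= 1" by (simp add: power_le_one)
   then have "(1 + (cmod z)^2)^2 <= 2^2" by (intro power_mono) auto
   moreover have "0 < 1 + (cmod z)^2" by (simp add: add_pos_nonneg)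
   ultimately show ?thesis using True by (simp add: field_simps)
  qed simp
 qed
 finally show ?thesis .
qed

lemma lborel_integral_complex_affine:
 fixes g :: "complex => complex"
 assumes e: "0 < e" and [measurable]: "g \<in> borel_measurable borel"
 shows "integral\<^sup>L lborel g = e^2 *\<^sub>R integral\<^sup>L lborel (%t. g (w + e *\<^sub>R t))"
proof -
 have [measurable]: "(%t::complex. w + e *\<^sub>R t) \<in> borel_measurable borel" by measurable
 have "integral\<^sup>L lborel g = integral\<^sup>L (density (distr lborel borel (%t::complex. w + e *\<^sub>R t)) (%_. ennreal (\<bar>e\<bar> ^ DIM(complex)))) g"
  using lborel_affine[of e w] e by simp
 also have "... = integral\<^sup>L (distr lborel borel (%t::complex. w + e *\<^sub>R t)) (%x. e^2 *\<^sub>R g x)"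
  using e by (subst integral_density) auto
 also have "... = integral\<^sup>L lborel (%t. e^2 *\<^sub>R g (w + e *\<^sub>R t))"
  by (subst integral_distr) auto
 finally show ?thesis by simp
qed

text \<open>The Cauchy kernel 1 / (z - w), written as conjugate over squared modulus, with e^2 added
  to the denominator. It tends to the kernel as e tends to 0, is dominated by it in modulus, and is
  smooth.\<close>

definition Kreg :: "real => complex => complex => complex" where
 "Kreg e w z = cnj (z - w) * inverse ((z - w) * cnj (z - w) + of_real (e^2))"

lemma Kreg_denominator: "(z - w) * cnj (z - w) + of_real (e^2) = of_real ((cmod (z - w))^2 + e^2)"
 by (simp only: of_real_add complex_norm_square)

lemma Kreg_denominator_nz: "0 < e ==> (z - w) * cnj (z - w) + of_real (e^2) ~= 0"
 unfolding Kreg_denominator of_real_eq_0_iff by (metis add_nonneg_pos less_irrefl zero_le_power2 zero_less_power)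

lemma smooth_gen_Kreg: "0 < e ==> smooth_gen (Kreg e w)"
proof -
 assume e: "0 < e"
 have 1: "smooth_gen (%z. z - w)"
 proof -
  have "smooth_gen (%z. (of_real (Re z) + \<i> * of_real (Im z)) + (- w))" by (intro smooth_gen.intros)
  then show ?thesis by (simp flip: complex_eq)
 qed
 have 2: "smooth_gen (%z. cnj (z - w))"
 proof -
  have "smooth_gen (%z. (of_real (Re z) + (- \<i>) * of_real (Im z)) + (- cnj w))" by (intro smooth_gen.intros)
  moreover have "(%z. (of_real (Re z) + (- \<i>) * of_real (Im z)) + (- cnj w)) = (%z. cnj (z - w))"
   by (auto simp: fun_eq_iff complex_eq_iff)
  ultimately show ?thesis by simp
 qed
 show ?thesis unfolding Kreg_def
  by (intro smooth_gen.mult 2 smooth_gen.inverse smooth_gen.add 1 smooth_gen.const Kreg_denominator_nz e)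
qed

text \<open>An approximate identity: with z = w + e t this is 1 / (1 + |t|^2)^2 up to the Jacobian
  e^2, so its mass is \<open>kap\<close> for every e and concentrates at w.\<close>

lemma dbar_Kreg: "0 < e ==> dbar (Kreg e w) z = of_real (e^2 / ((cmod (z - w))^2 + e^2)^2)"
proof -
 assume e: "0 < e"
 have 1: "hasAB (%z. z - w) 1 \<i> z"
 proof -
  have "((%z. z - w) has_field_derivative 1) (at z)" by (auto intro!: derivative_eq_intros)
  from hasAB_field[OF this] show ?thesis by simp
 qed
 have 2: "hasAB (%z. cnj (z - w)) 1 (- \<i>) z"
  unfolding hasAB_def
  by (rule has_derivative_eq_rhs, rule has_derivative_cnj, rule derivative_intros, rule has_derivative_ident, rule has_derivative_const)
    (auto simp: complex_eq_iff fun_eq_iff)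
 let ?u = "z - w" let ?D = "?u * cnj ?u + of_real (e^2)"
 have D: "?D ~= 0" using Kreg_denominator_nz[OF e] .
 have 3: "hasAB (%z. (z - w) * cnj (z - w) + of_real (e^2)) (1 * cnj ?u + ?u * 1 + 0) (\<i> * cnj ?u + ?u * (- \<i>) + 0) z"
  by (rule hasAB_add[OF hasAB_mult[OF 1 2] hasAB_const])
 have alg: "((1 * i + c * - (i * (1 * c + u * 1 + 0) * i)) + \<i> * (- \<i> * i + c * - (i * (\<i> * c + u * - \<i> + 0) * i))) / 2
  = i - c * u * (i * i)" for i c u :: complex by (simp add: field_simps)
 from hasAB_dbar[OF hasAB_mult[OF 2 hasAB_inverse[OF 3 D]]]
 have "dbar (Kreg e w) z = inverse ?D - cnj ?u * ?u * (inverse ?D * inverse ?D)"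
  unfolding alg by (simp only: Kreg_def[abs_def])
 also have "... = of_real (e^2) / ?D^2"
 proof -
  have "inverse D - c * u * (inverse D * inverse D) = d / D^2" if "D ~= 0" "d = D - u * c" for D c u d :: complex
   using that by (simp add: field_simps power2_eq_square)
  from this[OF D] show ?thesis by simp
 qed
 finally show ?thesis unfolding Kreg_denominator by simp
qed

lemma norm_Kreg_le: "cmod (Kreg e w z) <= 1 / cmod (z - w)"
proof (cases "z = w")
 case False
 then have p: "0 < cmod (z - w)" by simp
 have "cmod (Kreg e w z) = cmod (z - w) / ((cmod (z - w))^2 + e^2)"
  unfolding Kreg_def Kreg_denominator norm_mult norm_inverse complex_mod_cnj norm_of_real
  by (simp add: divide_inverse)
 also have "... <= cmod (z - w) / (cmod (z - w))^2"
  using p by (intro divide_left_mono) (auto intro!: mult_pos_pos add_pos_nonneg)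
 also have "... = 1 / cmod (z - w)" using p by (simp add: power2_eq_square)
 finally show ?thesis .
qed (simp add: Kreg_def)

lemma Kreg_tendsto: "(%n. Kreg (1 / real (Suc n)) w z) \<longlonglongrightarrow> 1 / (z - w)"
proof (cases "z = w")
 case True
 then show ?thesis by (simp add: Kreg_def)
next
 case False
 then have nz: "(z - w) * cnj (z - w) + of_real (0^2) ~= 0" by simp
 have "(%n. 1 / real (Suc n)) \<longlonglongrightarrow> 0" using LIMSEQ_inverse_real_of_nat by (simp add: divide_inverse)
 then have "(%n. Kreg (1 / real (Suc n)) w z) \<longlonglongrightarrow> cnj (z - w) * inverse ((z - w) * cnj (z - w) + of_real (0^2))"
  unfolding Kreg_def by (intro tendsto_intros nz)
 moreover have "cnj u * inverse (u * cnj u + of_real (0^2)) = 1 / u" if "u ~= 0" for u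
  using that by (simp add: divide_inverse)
 ultimately show ?thesis using False by (metis right_minus_eq)
qed

lemma continuous_Kreg: "0 < e ==> continuous_on S (Kreg e w)"
 using smooth_gen_C1[OF smooth_gen_Kreg] C1_continuous by blast

lemma integrable_div_sing:
 fixes g :: "complex => complex"
 assumes [measurable]: "g \<in> borel_measurable borel" and M: "!!z. cmod (g z) <= M" and B: "!!z. B < cmod z ==> g z = 0"
 shows "integrable lborel (%z. g z / (z - w))"
proof (rule integrableI_bounded)
 define r where "r = \<bar>B\<bar> + cmod w + 1"
 have r: "0 < r" using norm_ge_zero[of w] abs_ge_zero[of B] unfolding r_def by linarith
 have M0: "0 <= M" using M[of 0] norm_ge_zero order_trans by blast
 have "(NN z. ennreal (cmod (g z / (z - w)))) <= (NN z. ennreal M * (ennreal (1 / cmod (z - w)) * indicator (ball w r) z))"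
 proof (rule nn_integral_mono)
  fix z :: complex
  show "ennreal (cmod (g z / (z - w))) <= ennreal M * (ennreal (1 / cmod (z - w)) * indicator (ball w r) z)"
  proof (cases "z \<in> ball w r")
   case True
   have "cmod (g z / (z - w)) <= M * (1 / cmod (z - w))"
    using M[of z] by (simp add: norm_divide divide_right_mono)
   then show ?thesis using True M0 by (simp add: ennreal_mult[symmetric] ennreal_leI)
  next
   case False
   then have "B < cmod z" using norm_triangle_ineq4[of z w] by (auto simp: r_def dist_norm norm_minus_commute)
   then show ?thesis by (simp add: B)
  qed
 qed
 also have "... = ennreal M * (nn_set (ball w r) (%z. ennreal (1 / cmod (z - w))))"
  by (rule nn_integral_cmult) (auto intro!: borel_measurable_times_ennreal borel_measurable_indicator)
 also have "... <= ennreal M * ennreal (16 * pi * r)"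
  by (intro mult_left_mono sing_integral r) auto
 also have "... < \<infinity>" by (simp add: ennreal_mult_less_top)
 finally show "(NN z. ennreal (cmod (g z / (z - w)))) < \<infinity>" .
qed measurable

lemma compact_support_bounded:
 fixes g :: "complex => complex"
 assumes "continuous_on UNIV g" "!!z. B < cmod z ==> g z = 0"
 obtains M where "0 < M" "!!z. cmod (g z) <= M"
proof -
 have "compact (g ` cball 0 B)" using assms(1) by (intro compact_continuous_image) (auto intro: continuous_on_subset)
 then have "bounded (g ` cball 0 B)" by (rule compact_imp_bounded)
 then obtain M where "\<forall>x\<in>g ` cball 0 B. cmod x <= M" unfolding bounded_iff by blast
 then have M: "!!z. z \<in> cball 0 B ==> cmod (g z) <= M" by blast
 have "cmod (g z) <= \<bar>M\<bar> + 1" for z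
 proof (cases "B < cmod z")
  case False then show ?thesis using M[of z] by auto
 qed (simp add: assms(2))
 then show ?thesis by (intro that[of "\<bar>M\<bar> + 1"]) auto
qed

lemma dbar_support: "C1 \<phi> ==> (!!z. B < cmod z ==> \<phi> z = 0) ==> B < cmod z ==> dbar \<phi> z = 0"
proof -
 assume a: "C1 \<phi>" "!!z. B < cmod z ==> \<phi> z = 0" "B < cmod z"
 have "hasAB \<phi> 0 0 z"
 proof (rule hasAB_transform[OF hasAB_const[of 0], of "{z. B < cmod z}"])
  show "open {z. B < cmod z}" by (intro open_Collect_less continuous_intros)
 qed (use a in auto)
 then show ?thesis by (simp add: hasAB_dbar)
qed

text \<open>The integral of \<open>dbar\<close> of the product of \<phi> and \<open>Kreg\<close> is
  0. As e tends to 0, the part with \<open>dbar \<phi>\<close> converges by the domination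
  \<open>norm_Kreg_le\<close>, and the part with \<open>dbar\<close> of the kernel becomes
  \<open>kap * \<phi> w\<close> after rescaling around w.\<close>

theorem Cauchy_Pompeiu:
 assumes "C1 \<phi>" and B: "!!z. B < cmod z ==> \<phi> z = 0"
 shows "integrable lborel (%z. dbar \<phi> z / (z - w))"
  and "integral\<^sup>L lborel (%z. dbar \<phi> z / (z - w)) = - of_real kap * \<phi> w"
proof -
 have c: "continuous_on UNIV \<phi>" "continuous_on UNIV (dbar \<phi>)"
  using assms C1_continuous C1_dbar_continuous by blast+
 have [measurable]: "\<phi> \<in> borel_measurable borel" "dbar \<phi> \<in> borel_measurable borel"
  using c by (auto intro: borel_measurable_continuous_onI)
 have B': "!!z. B < cmod z ==> dbar \<phi> z = 0" using dbar_support[OF assms] by blast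
 obtain M where M: "0 < M" "!!z. cmod (dbar \<phi> z) <= M" using compact_support_bounded[OF c(2) B'] by blast
 obtain M' where M': "0 < M'" "!!z. cmod (\<phi> z) <= M'" using compact_support_bounded[OF c(1) B] by blast
 show int: "integrable lborel (%z. dbar \<phi> z / (z - w))"
  by (rule integrable_div_sing[OF _ M(2) B']) auto
 let ?e = "%n. 1 / real (Suc n)"
 have e: "0 < ?e n" for n by simp
 have Km [measurable]: "Kreg (?e n) w \<in> borel_measurable borel" for n
  by (intro borel_measurable_continuous_onI continuous_Kreg e)
 have L1: "(%n. integral\<^sup>L lborel (%z. dbar \<phi> z * Kreg (?e n) w z)) \<longlonglongrightarrow> integral\<^sup>L lborel (%z. dbar \<phi> z / (z - w))"
 proof (rule integral_dominated_convergence[where w = "%z. cmod (dbar \<phi> z / (z - w))"])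
  show "AE z in lborel. (%n. dbar \<phi> z * Kreg (?e n) w z) \<longlonglongrightarrow> dbar \<phi> z / (z - w)"
   using tendsto_mult[OF tendsto_const Kreg_tendsto] by (simp add: divide_inverse)
  show "AE z in lborel. cmod (dbar \<phi> z * Kreg (?e n) w z) <= cmod (dbar \<phi> z / (z - w))" for n
   using norm_Kreg_le[of "?e n" w] by (auto simp: norm_mult norm_divide intro!: AE_I2 mult_left_mono
    order_trans[OF mult_left_mono[OF norm_Kreg_le norm_ge_zero]])
  show "(%z. dbar \<phi> z * Kreg (?e n) w z) \<in> borel_measurable lborel" for n
   using Km[of n] by (simp del: of_nat_Suc)
  show "(%z. dbar \<phi> z / (z - w)) \<in> borel_measurable lborel" using int by (rule borel_measurable_integrable)
 qed (use int in auto)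
 have eq: "integral\<^sup>L lborel (%z. dbar \<phi> z * Kreg (?e n) w z) = - integral\<^sup>L lborel (%t. \<phi> (w + ?e n *\<^sub>R t) * of_real (1 / (1 + (cmod t)^2)^2))" for n
 proof -
  let ?K = "Kreg (?e n) w"
  have C: "C1 ?K" by (intro smooth_gen_C1 smooth_gen_Kreg e)
  have C2: "C1 (%z. \<phi> z * ?K z)" by (intro C1_mult assms C)
  have d: "dbar (%z. \<phi> z * ?K z) z = dbar \<phi> z * ?K z + \<phi> z * dbar ?K z" for z
   using assms(1) C by (intro dbar_mult) (auto simp: C1_def)
  have "0 = integral\<^sup>L lborel (dbar (%z. \<phi> z * ?K z))"
   using integral_dbar_zero[OF C2, of B] B by simp
  also have "dbar (%z. \<phi> z * ?K z) = (%z. dbar \<phi> z * ?K z + \<phi> z * dbar ?K z)" using d by (rule ext)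
  also have "integral\<^sup>L lborel ... = integral\<^sup>L lborel (%z. dbar \<phi> z * ?K z) + integral\<^sup>L lborel (%z. \<phi> z * dbar ?K z)"
  proof (rule Bochner_Integration.integral_add)
   show "integrable lborel (%z. dbar \<phi> z * ?K z)"
    using B' by (intro integrable_compact_support[of _ B] continuous_on_mult c continuous_Kreg e) auto
   show "integrable lborel (%z. \<phi> z * dbar ?K z)"
    using B by (intro integrable_compact_support[of _ B] continuous_on_mult c C1_dbar_continuous C) auto
  qed
  also have "integral\<^sup>L lborel (%z. \<phi> z * dbar ?K z) = (?e n)^2 *\<^sub>R integral\<^sup>L lborel (%t. \<phi> (w + ?e n *\<^sub>R t) * dbar ?K (w + ?e n *\<^sub>R t))"
   by (rule lborel_integral_complex_affine[OF e]) (intro borel_measurable_continuous_onI continuous_on_mult c C1_dbar_continuous C)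
  also have "... = integral\<^sup>L lborel (%t. (?e n)^2 *\<^sub>R (\<phi> (w + ?e n *\<^sub>R t) * dbar ?K (w + ?e n *\<^sub>R t)))"
   by simp
  also have "(%t. (?e n)^2 *\<^sub>R (\<phi> (w + ?e n *\<^sub>R t) * dbar ?K (w + ?e n *\<^sub>R t))) = (%t. \<phi> (w + ?e n *\<^sub>R t) * of_real (1 / (1 + (cmod t)^2)^2))"
  proof
   fix t
   have "dbar ?K (w + ?e n *\<^sub>R t) = of_real ((?e n)^2 / ((?e n)^2 * (1 + (cmod t)^2))^2)"
    unfolding dbar_Kreg[OF e] by (simp add: power_mult_distrib power_divide algebra_simps add_divide_distrib)
   then have "(?e n)^2 *\<^sub>R dbar ?K (w + ?e n *\<^sub>R t) = of_real ((?e n)^2 * ((?e n)^2 / ((?e n)^2 * (1 + (cmod t)^2))^2))"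
    by (simp add: scaleR_conv_of_real)
   also have "(?e n)^2 * ((?e n)^2 / ((?e n)^2 * (1 + (cmod t)^2))^2) = 1 / (1 + (cmod t)^2)^2"
   proof -
    have aux: "a * (a / (a * b)^2) = 1 / b^2" if "a ~= 0" for a b :: real
     using that by (simp add: power2_eq_square)
    show ?thesis by (rule aux) simp
   qed
   finally show "(?e n)^2 *\<^sub>R (\<phi> (w + ?e n *\<^sub>R t) * dbar ?K (w + ?e n *\<^sub>R t)) = \<phi> (w + ?e n *\<^sub>R t) * of_real (1 / (1 + (cmod t)^2)^2)"
    by (metis mult_scaleR_right)
  qed
  finally show ?thesis by (simp add: eq_neg_iff_add_eq_0)
 qed
 have L2: "(%n. integral\<^sup>L lborel (%t. \<phi> (w + ?e n *\<^sub>R t) * of_real (1 / (1 + (cmod t)^2)^2)))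
   \<longlonglongrightarrow> integral\<^sup>L lborel (%t::complex. \<phi> w * of_real (1 / (1 + (cmod t)^2)^2))"
 proof (rule integral_dominated_convergence[where w = "%t. M' * (1 / (1 + (cmod t)^2)^2)"])
  show "integrable lborel (%t::complex. M' * (1 / (1 + (cmod t)^2)^2))"
   by (intro integrable_mult_right integrable_kap)
  have "(%n. \<phi> (w + ?e n *\<^sub>R t)) \<longlonglongrightarrow> \<phi> (w + 0 *\<^sub>R t)" for t
  proof -
   have "(%n. w + ?e n *\<^sub>R t) \<longlonglongrightarrow> w + 0 *\<^sub>R t"
    using LIMSEQ_inverse_real_of_nat by (intro tendsto_intros) (simp add: divide_inverse)
   then show ?thesis using c(1) continuous_on_tendsto_compose by (metis UNIV_I eventually_sequentiallyI)
  qed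
  then show "AE t in lborel. (%n. \<phi> (w + ?e n *\<^sub>R t) * of_real (1 / (1 + (cmod t)^2)^2)) \<longlonglongrightarrow> \<phi> w * of_real (1 / (1 + (cmod t)^2)^2)"
   by (intro AE_I2 tendsto_mult tendsto_const) simp
  show "AE t in lborel. cmod (\<phi> (w + ?e n *\<^sub>R t) * of_real (1 / (1 + (cmod t)^2)^2)) <= M' * (1 / (1 + (cmod t)^2)^2)" for n
   unfolding norm_mult norm_of_real using M'(2) less_imp_le[OF M'(1)] by (intro AE_I2 mult_mono) auto
 qed (measurable)
 have "integral\<^sup>L lborel (%t::complex. \<phi> w * of_real (1 / (1 + (cmod t)^2)^2)) = \<phi> w * of_real kap"
  unfolding kap_def by (simp del: of_real_divide)
 then have "(%n. integral\<^sup>L lborel (%z. dbar \<phi> z * Kreg (?e n) w z)) \<longlonglongrightarrow> - (\<phi> w * of_real kap)"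
  unfolding eq using L2 by (intro tendsto_minus) simp
 from LIMSEQ_unique[OF L1 this]
 show "integral\<^sup>L lborel (%z. dbar \<phi> z / (z - w)) = - of_real kap * \<phi> w" by (simp add: mult.commute)
qed

section \<open>Integral estimates for holomorphic functions\<close>

lemma C1_scale:
 assumes "C1 \<phi>" "0 < r"
 shows "C1 (%z. \<phi> ((z - w) / of_real r))" "dbar (%z. \<phi> ((z - w) / of_real r)) z = dbar \<phi> ((z - w) / of_real r) / of_real r"
proof -
 have h: "hasAB (%z. \<phi> ((z - w) / of_real r)) (pd 1 \<phi> ((z - w) / of_real r) / of_real r) (pd \<i> \<phi> ((z - w) / of_real r) / of_real r) z" for z
 proof -
  have "((%z. (z - w) / of_real r) has_derivative (%h. h / of_real r)) (at z)"
   using assms(2) by (auto intro!: derivative_eq_intros)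
  from has_derivative_compose[OF this C1_hasAB[OF assms(1), unfolded hasAB_def]]
  show ?thesis unfolding hasAB_def
   by (rule has_derivative_eq_rhs) (simp add: fun_eq_iff)
 qed
 have c: "continuous_on UNIV (%z. f ((z - w) / of_real r) / of_real r)" if "continuous_on UNIV f" for f :: "complex => complex"
  using assms(2) by (intro continuous_intros continuous_on_compose2[OF that]) auto
 show "C1 (%z. \<phi> ((z - w) / of_real r))"
  by (rule C1I[OF h]) (intro c C1_pd_continuous assms)+
 show "dbar (%z. \<phi> ((z - w) / of_real r)) z = dbar \<phi> ((z - w) / of_real r) / of_real r"
  unfolding hasAB_dbar[OF h] by (simp add: dbar_def add_divide_distrib mult.commute)
qed

lemma nn_meas:
 fixes f :: "complex => complex"
 assumes "continuous_on A f" "A \<in> sets borel" "0 < p"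
 shows "(%z. ennreal (cmod (f z) powr p) * indicator A z) \<in> borel_measurable borel"
proof -
 have [measurable]: "(%z. indicator A z *\<^sub>R f z) \<in> borel_measurable borel"
  by (rule borel_measurable_continuous_on_indicator[OF assms(2,1)])
 have "(%z. ennreal (cmod (indicator A z *\<^sub>R f z) powr p)) \<in> borel_measurable borel"
  by measurable
 also have "(%z. ennreal (cmod (indicator A z *\<^sub>R f z) powr p)) = (%z. ennreal (cmod (f z) powr p) * indicator A z)"
  using assms(3) by (auto simp: fun_eq_iff indicator_def)
 finally show ?thesis .
qed

lemma nn_meas1:
 fixes f :: "complex => complex"
 assumes "continuous_on A f" "A \<in> sets borel"
 shows "(%z. ennreal (cmod (f z)) * indicator A z) \<in> borel_measurable borel"
 using nn_meas[OF assms, of 1] by simp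

text \<open>The fixed profile of all rescaled cutoffs. \<open>dbar chi\<close> lives on the annulus
  between 1/3 and 2/3, away from a pole at the centre.\<close>

definition chi :: "complex => complex" where
 "chi = cutoff (1/3) (2/3)"

lemma C1_chi: "C1 chi"
 unfolding chi_def by (intro smooth_gen_C1 smooth_gen_cutoff) auto

lemma chi_1: "cmod z <= 1/3 ==> chi z = 1"
 unfolding chi_def by (rule cutoff_eq_1) auto

lemma chi_0: "2/3 <= cmod z ==> chi z = 0"
 unfolding chi_def by (rule cutoff_eq_0) auto

lemma dbar_chi_zero: "cmod z < 1/3 \<or> 2/3 < cmod z ==> dbar chi z = 0"
proof (elim disjE)
 assume z: "cmod z < 1/3"
 have "hasAB chi 0 0 z"
 proof (rule hasAB_transform[OF hasAB_const[of 1], of "{z. cmod z < 1/3}"])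
  show "open {z. cmod z < 1/3}" by (intro open_Collect_less continuous_intros)
 qed (use z chi_1 in auto)
 then show ?thesis by (simp add: hasAB_dbar)
next
 assume "2/3 < cmod z"
 then show ?thesis using dbar_support[OF C1_chi, of "2/3" z] chi_0 by auto
qed

lemma dbar_chi_bound: "\<exists>M>0. \<forall>z. cmod (dbar chi z) <= M"
proof -
 have "continuous_on UNIV (dbar chi)" by (rule C1_dbar_continuous[OF C1_chi])
 then show ?thesis using compact_support_bounded[of "dbar chi" "2/3"] dbar_chi_zero by metis
qed

text \<open>Apply \<open>Cauchy_Pompeiu\<close> to f times a cutoff X at w. Since f is holomorphic,
  only \<open>dbar X\<close> survives; it is at most M / r and lives at distance at least r / 3 from
  w, whence the factor 3 M / r^2.\<close>

lemma mean_bound: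
 "\<exists>C>0. \<forall>f w r. 0 < r \<and> f holomorphic_on ball w r -->
   ennreal (cmod (f w)) <= ennreal (C / r^2) * (nn_set (ball w r) (%z. ennreal (cmod (f z))))"
proof -
 obtain M where M: "0 < M" "!!z. cmod (dbar chi z) <= M" using dbar_chi_bound by auto
 show ?thesis
 proof (intro exI[of _ "3 * M / kap"] conjI allI impI; (elim conjE)?)
  show "0 < 3 * M / kap" using M kap_pos by simp
  fix f :: "complex => complex" and w :: complex and r :: real
  assume r: "0 < r" and hol: "f holomorphic_on ball w r"
  define X where "X z = chi ((z - w) / of_real r)" for z
  have XC: "C1 X" "!!z. dbar X z = dbar chi ((z - w) / of_real r) / of_real r"
   unfolding X_def using C1_scale[OF C1_chi r] by auto
  have nr: "cmod ((z - w) / of_real r) = cmod (z - w) / r" for z using r by (simp add: norm_divide)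
  have X0: "X z = 0" if "z \<notin> cball w (2/3 * r)" for z
   unfolding X_def using that r by (intro chi_0) (simp add: nr dist_norm norm_minus_commute field_simps)
  let ?\<phi> = "%z. X z * f z"
  have sub: "cball w (2/3 * r) \<subseteq> ball w r" using r by auto
  have phi: "C1 ?\<phi>" "!!z. dbar ?\<phi> z = dbar X z * f z"
   using C1_mult_holomorphic[OF XC(1) open_ball hol closed_cball sub X0] by auto
  have supp: "?\<phi> z = 0" if "cmod w + r < cmod z" for z
  proof -
   have "r < dist w z" using that norm_triangle_ineq2[of z w] by (simp add: dist_norm norm_minus_commute)
   then have "z \<notin> cball w (2/3 * r)" using r by auto
   then show ?thesis using X0 by simp
  qed
  have fm: "(%z. ennreal (cmod (f z)) * indicator (ball w r) z) \<in> borel_measurable lborel"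
   using nn_meas1[OF holomorphic_on_imp_continuous_on[OF hol]] by simp
  have "X w = 1" by (simp add: X_def chi_1)
  then have "kap * cmod (f w) = cmod (integral\<^sup>L lborel (%z. dbar ?\<phi> z / (z - w)))"
   using Cauchy_Pompeiu(2)[OF phi(1) supp, where w = w] kap_pos by (simp add: norm_mult)
  also have "ennreal ... <= (NN z. ennreal (cmod (dbar ?\<phi> z / (z - w))))"
   by (rule integral_norm_bound_ennreal[OF Cauchy_Pompeiu(1)[OF phi(1) supp]])
  also have "... <= (NN z. ennreal (3 * M / r^2) * (ennreal (cmod (f z)) * indicator (ball w r) z))"
  proof (rule nn_integral_mono)
   fix z :: complex
   show "ennreal (cmod (dbar ?\<phi> z / (z - w))) <= ennreal (3 * M / r^2) * (ennreal (cmod (f z)) * indicator (ball w r) z)"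
   proof (cases "cmod (z - w) / r < 1/3 \<or> 2/3 < cmod (z - w) / r")
    case True
    then have "dbar X z = 0" unfolding XC(2) using dbar_chi_zero[of "(z - w) / of_real r"] by (simp only: nr) simp
    then show ?thesis by (simp add: phi(2))
   next
    case False
    then have d: "r / 3 <= cmod (z - w)" "cmod (z - w) <= 2/3 * r" using r by (auto simp: field_simps)
    then have zin: "z \<in> ball w r" using r by (simp add: dist_norm norm_minus_commute)
    have "cmod (dbar ?\<phi> z / (z - w)) = cmod (dbar chi ((z - w) / of_real r)) / r * cmod (f z) / cmod (z - w)"
     using r by (simp add: phi(2) XC(2) norm_mult norm_divide)
    also have "... <= M / r * cmod (f z) / (r / 3)"
     using d r M by (intro frac_le mult_right_mono divide_right_mono mult_nonneg_nonneg) auto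
    also have "... = 3 * M / r^2 * cmod (f z)" by (simp add: power2_eq_square)
    finally show ?thesis using zin M r by (simp add: ennreal_mult[symmetric] ennreal_leI)
   qed
  qed
  also have "... = ennreal (3 * M / r^2) * (nn_set (ball w r) (%z. ennreal (cmod (f z))))"
   by (rule nn_integral_cmult[OF fm])
  finally have *: "ennreal (kap * cmod (f w)) <= ennreal (3 * M / r^2) * (nn_set (ball w r) (%z. ennreal (cmod (f z))))" .
  have "ennreal (cmod (f w)) = ennreal (1 / kap) * ennreal (kap * cmod (f w))"
   using kap_pos by (simp add: ennreal_mult[symmetric])
  also have "... <= ennreal (1 / kap) * (ennreal (3 * M / r^2) * (nn_set (ball w r) (%z. ennreal (cmod (f z)))))"
   using * by (intro mult_left_mono) auto
  also have "... = ennreal (3 * M / kap / r^2) * (nn_set (ball w r) (%z. ennreal (cmod (f z))))"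
   using kap_pos M r by (simp add: ennreal_mult[symmetric] mult.assoc[symmetric])
  finally show "ennreal (cmod (f w)) <= ennreal (3 * M / kap / r^2) * (nn_set (ball w r) (%z. ennreal (cmod (f z))))" .
 qed
qed

text \<open>The sub-mean value property of |f|^p for small p. The function h, which is |f| weighted
  by a power of the distance to the boundary of a smaller ball, attains its maximum S at some z0;
  near z0 then |f| <= m, with m comparable to |f(z0)|. There |f| <= m^(1-p) |f|^p, so
  \<open>mean_bound\<close> at z0 bounds S^p.\<close>

lemma powr_mean_bound:
 assumes p: "0 < p" "p <= 1"
 shows "\<exists>C>0. \<forall>f w r. 0 < r \<and> f holomorphic_on ball w r -->
   ennreal (cmod (f w) powr p) <= ennreal (C / r^2) * (nn_set (ball w r) (%z. ennreal (cmod (f z) powr p)))"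
proof -
 obtain C1 where C1: "0 < C1" "!!f w r. 0 < r ==> f holomorphic_on ball w r ==>
   ennreal (cmod (f w)) <= ennreal (C1 / r^2) * (nn_set (ball w r) (%z. ennreal (cmod (f z))))"
  using mean_bound by blast
 \<comment> \<open>With q p = 2 the p-th power of the weight scales like an area, so the powers of
   the distance d cancel below.\<close>
 define q where "q = 2 / p"
 have q: "0 < q" "q * p = 2" using p by (auto simp: q_def)
 define C where "C = 16 * C1 * 2 powr (q - 2)"
 have C: "0 < C" using C1 by (simp add: C_def)
 show ?thesis
 proof (intro exI[of _ C] conjI allI impI C; (elim conjE)?)
  fix f :: "complex => complex" and w :: complex and r :: real
  assume r: "0 < r" and hol: "f holomorphic_on ball w r"
  let ?I = "nn_set (ball w r) (%z. ennreal (cmod (f z) powr p))"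
  show "ennreal (cmod (f w) powr p) <= ennreal (C / r^2) * ?I"
  proof (cases "?I = \<infinity>")
   case True
   then show ?thesis using C r by (simp add: ennreal_mult_top)
  next
   case False
   then obtain I where I: "?I = ennreal I" "0 <= I" by (cases ?I) auto
   define rh where "rh = r / 2"
   have rho: "0 < rh" using r by (simp add: rh_def)
   have sub: "cball w rh \<subseteq> ball w r" using r by (auto simp: rh_def)
   have cf: "continuous_on (ball w r) f" using hol by (rule holomorphic_on_imp_continuous_on)
   define h where "h z = (rh - cmod (z - w)) powr q * cmod (f z)" for z
   have "continuous_on (cball w rh) h" unfolding h_def
    using q continuous_on_subset[OF cf sub]
    by (intro continuous_on_mult continuous_on_powr' continuous_intros) (auto simp: dist_norm norm_minus_commute)
   then obtain z0 where z0: "z0 \<in> cball w rh" "!!z. z \<in> cball w rh ==> h z <= h z0"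
    using continuous_attains_sup[OF compact_cball, of w rh h] rho by auto
   define S where "S = h z0"
   have hw: "rh powr q * cmod (f w) <= S" using z0(2)[of w] rho by (simp add: S_def h_def)
   have goal: "cmod (f w) powr p <= C / r^2 * I"
   proof (cases "S = 0")
    case True
    then have "f w = 0" using hw rho by (simp add: mult_le_0_iff)
    then show ?thesis using p C I r by simp
   next
    case nz: False
    have S0: "0 < S" using nz by (simp add: S_def h_def less_le)
    define d where "d = rh - cmod (z0 - w)"
    have d: "0 < d"
    proof -
     have "0 <= d" using z0(1) by (simp add: d_def dist_norm norm_minus_commute)
     moreover have "d ~= 0" using nz by (auto simp: S_def h_def d_def)
     ultimately show ?thesis by simp
    qed
    have fz0: "cmod (f z0) = S * d powr (-q)"
     using d by (simp add: S_def h_def d_def powr_minus)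
    have near: "z \<in> cball w rh" "d / 2 <= rh - cmod (z - w)" if "z \<in> ball z0 (d/2)" for z
    proof -
     have "cmod (z - w) <= cmod (z - z0) + cmod (z0 - w)" using norm_triangle_ineq[of "z - z0" "z0 - w"] by simp
     moreover have "cmod (z - z0) < d / 2" using that by (simp add: dist_norm norm_minus_commute)
     ultimately show "d / 2 <= rh - cmod (z - w)" by (simp add: d_def)
     then show "z \<in> cball w rh" using d by (simp add: dist_norm norm_minus_commute)
    qed
    define m where "m = S * (d / 2) powr (-q)"
    have m: "0 < m" using S0 d by (simp add: m_def)
    have fb: "cmod (f z) <= m" if "z \<in> ball z0 (d/2)" for z
    proof -
     have "(d / 2) powr q * cmod (f z) <= h z"
      unfolding h_def using near[OF that] d q by (intro mult_right_mono powr_mono2) auto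
     also have "... <= S" using z0(2) near[OF that] by (simp add: S_def)
     finally show ?thesis using d by (simp add: m_def powr_minus field_simps)
    qed
    have sub2: "ball z0 (d/2) \<subseteq> ball w r" using near(1) sub by blast
    have "ennreal (cmod (f z0)) <= ennreal (C1 / (d/2)^2) * (nn_set (ball z0 (d/2)) (%z. ennreal (cmod (f z))))"
     using d holomorphic_on_subset[OF hol sub2] by (intro C1) auto
    also have "(nn_set (ball z0 (d/2)) (%z. ennreal (cmod (f z))))
      <= (NN z. ennreal (m powr (1 - p)) * (ennreal (cmod (f z) powr p) * indicator (ball w r) z))"
    proof (rule nn_integral_mono)
     fix z :: complex
     show "ennreal (cmod (f z)) * indicator (ball z0 (d/2)) z <= ennreal (m powr (1 - p)) * (ennreal (cmod (f z) powr p) * indicator (ball w r) z)"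
     proof (cases "z \<in> ball z0 (d/2)")
      case True
      have "cmod (f z) = cmod (f z) powr (1 - p) * cmod (f z) powr p"
       by (cases "f z = 0") (simp_all flip: powr_add)
      also have "... <= m powr (1 - p) * cmod (f z) powr p"
       using fb[OF True] p by (intro mult_right_mono powr_mono2) auto
      finally show ?thesis using True sub2 by (auto simp: ennreal_mult[symmetric] ennreal_leI)
     qed simp
    qed
    also have "... = ennreal (m powr (1 - p)) * ?I"
     using nn_meas[OF cf _ p(1)] by (intro nn_integral_cmult) auto
    also have "... = ennreal (m powr (1 - p) * I)" using I by (simp add: ennreal_mult)
    also have "ennreal (C1 / (d/2)^2) * ennreal (m powr (1 - p) * I) = ennreal (C1 / (d/2)^2 * (m powr (1 - p) * I))"
     using C1(1) I by (intro ennreal_mult[symmetric]) auto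
    finally have "ennreal (cmod (f z0)) <= ennreal (C1 / (d/2)^2 * (m powr (1 - p) * I))"
     by (simp add: mult_left_mono)
    then have 1: "S * d powr (-q) <= C1 / (d/2)^2 * (m powr (1 - p) * I)"
     unfolding fz0 using C1 I by (subst (asm) ennreal_le_iff) auto
    have "C1 / (d/2)^2 * (m powr (1 - p) * I) = 4 * C1 * 2 powr (q - 2) * S powr (1 - p) * I * d powr (-q)"
    proof -
     have "m powr (1 - p) = S powr (1 - p) * ((d / 2) powr (-q)) powr (1 - p)"
      unfolding m_def using S0 by (simp add: powr_mult)
     also have "((d / 2) powr (-q)) powr (1 - p) = (d / 2) powr (2 - q)"
      using q by (simp add: powr_powr algebra_simps)
     also have "... = (d / 2) powr 2 * (d / 2) powr (- q)" by (simp add: flip: powr_add)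
     also have "(d / 2) powr (- q) = d powr (-q) * 2 powr q"
      using d by (simp add: powr_divide powr_minus field_simps)
     also have "(d / 2) powr 2 = (d/2)^2" using d by simp
     also have "2 powr q = 4 * 2 powr (q - 2)" by (simp add: powr_diff)
     finally have "m powr (1 - p) = S powr (1 - p) * ((d/2)^2 * (d powr (-q) * (4 * 2 powr (q - 2))))" .
     then show ?thesis using d by (simp add: field_simps)
    qed
    with 1 have "S <= 4 * C1 * 2 powr (q - 2) * S powr (1 - p) * I"
     using d by simp
    then have "S powr (1 - p) * S powr p <= S powr (1 - p) * (4 * C1 * 2 powr (q - 2) * I)"
     using S0 by (simp add: mult_ac flip: powr_add)
    then have Sp: "S powr p <= 4 * C1 * 2 powr (q - 2) * I" using S0 by simp
    have "(rh powr q * cmod (f w)) powr p <= S powr p"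
     using hw p rho by (intro powr_mono2) auto
    moreover have "(rh powr q * cmod (f w)) powr p = rh^2 * cmod (f w) powr p"
     using rho q by (simp add: powr_mult powr_powr)
    ultimately have "rh^2 * cmod (f w) powr p <= 4 * C1 * 2 powr (q - 2) * I" using Sp by linarith
    then show ?thesis using r by (simp add: rh_def C_def field_simps power2_eq_square)
   qed
   show ?thesis unfolding I(1) using goal C I by (simp add: ennreal_mult[symmetric] ennreal_leI)
  qed
 qed
qed

lemma powr_mean_bound2:
 assumes p: "0 < p" "p <= 1"
 shows "\<exists>C>0. \<forall>f w r z. 0 < r \<and> f holomorphic_on ball w r \<and> z \<in> ball w (r/2) -->
   ennreal (cmod (f z) powr p) <= ennreal (C / r^2) * (nn_set (ball w r) (%z. ennreal (cmod (f z) powr p)))"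
proof -
 obtain C where C: "0 < C" "!!f w r. 0 < r ==> f holomorphic_on ball w r ==>
   ennreal (cmod (f w) powr p) <= ennreal (C / r^2) * (nn_set (ball w r) (%z. ennreal (cmod (f z) powr p)))"
  using powr_mean_bound[OF p] by blast
 show ?thesis
 proof (intro exI[of _ "4 * C"] conjI allI impI; (elim conjE)?)
  show "0 < 4 * C" using C by simp
  fix f w r z assume r: "0 < r" and hol: "f holomorphic_on ball w r" and z: "z \<in> ball w (r/2)"
  have sub: "ball z (r/2) \<subseteq> ball w r"
  proof
   fix x assume "x \<in> ball z (r/2)"
   then show "x \<in> ball w r" using z dist_triangle[of w x z] by auto
  qed
  have "ennreal (cmod (f z) powr p) <= ennreal (C / (r/2)^2) * (nn_set (ball z (r/2)) (%z. ennreal (cmod (f z) powr p)))"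
   using r holomorphic_on_subset[OF hol sub] by (intro C) auto
  also have "... <= ennreal (C / (r/2)^2) * (nn_set (ball w r) (%z. ennreal (cmod (f z) powr p)))"
   using sub by (intro mult_left_mono nn_integral_mono) (auto simp: indicator_def)
  also have "C / (r/2)^2 = 4 * C / r^2" by (simp add: power2_eq_square)
  finally show "ennreal (cmod (f z) powr p) <= ennreal (4 * C / r^2) * (nn_set (ball w r) (%z. ennreal (cmod (f z) powr p)))" .
 qed
qed

lemma holomorphic_lipschitz:
 assumes hol: "f holomorphic_on ball w r" and r: "0 < r" and M: "!!x. x \<in> ball w r ==> cmod (f x) <= M"
  and z: "z \<in> ball w (r/2)"
 shows "cmod (f z - f w) <= 4 * M / r * cmod (z - w)"
proof (rule field_differentiable_bound[of "ball w (r/2)" f "deriv f"])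
 fix x assume x: "x \<in> ball w (r/2)"
 then have xb: "x \<in> ball w r" using r by auto
 then show "(f has_field_derivative deriv f x) (at x within ball w (r/2))"
  using hol holomorphic_derivI[OF hol open_ball] has_field_derivative_at_within by blast
 have sub: "cball x (r/4) \<subseteq> ball w r"
 proof
  fix y assume "y \<in> cball x (r/4)"
  then show "y \<in> ball w r" using x r dist_triangle[of w y x] by auto
 qed
 have "norm ((deriv ^^ 1) f x) <= fact 1 * M / (r/4) ^ 1"
 proof (rule Cauchy_inequality)
  show "f holomorphic_on ball x (r/4)" using hol sub ball_subset_cball holomorphic_on_subset by blast
  show "continuous_on (cball x (r/4)) f" using hol sub continuous_on_subset holomorphic_on_imp_continuous_on by blast
  show "0 < r/4" using r by simp
  show "cmod (f y) <= M" if "cmod (x - y) = r/4" for y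
   using that sub by (intro M) (auto simp: subset_iff dist_norm)
 qed
 then show "cmod (deriv f x) <= 4 * M / r" using r by (simp add: mult.commute)
qed (use z r in auto)

lemma add_powr_le:
 fixes x y :: real
 assumes "0 <= x" "0 <= y" "0 < p" "p <= 1"
 shows "(x + y) powr p <= x powr p + y powr p"
proof (cases "x + y = 0")
 case False
 then have s: "0 < x + y" using assms by auto
 have *: "t <= t powr p" if "0 <= t" "t <= 1" for t
 proof (cases "t = 0")
  case False
  then show ?thesis using that assms powr_mono'[of p 1 t] by simp
 qed simp
 have "1 = x / (x + y) + y / (x + y)" using s by (simp add: add_divide_distrib[symmetric])
 also have "... <= (x / (x + y)) powr p + (y / (x + y)) powr p"
  using assms s by (intro add_mono *) auto
 also have "... = (x powr p + y powr p) / (x + y) powr p"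
  using assms s by (simp add: powr_divide add_divide_distrib)
 finally show ?thesis using s by (simp add: field_simps)
qed (use assms in auto)

lemma sum_powr_le:
 fixes x :: "'a => real"
 assumes "finite F" "!!a. a \<in> F ==> 0 <= x a" "0 < p" "p <= 1"
 shows "(\<Sum>a\<in>F. x a) powr p <= (\<Sum>a\<in>F. x a powr p)"
 using assms(1,2)
proof (induction F rule: finite_induct)
 case (insert a F)
 have "(x a + sum x F) powr p <= x a powr p + sum x F powr p"
  using insert assms(3,4) by (intro add_powr_le sum_nonneg) auto
 then show ?case using insert by force
qed simp

section \<open>The p-integral as a subadditive functional\<close>

definition Bint :: "real => (complex => complex) => ennreal" where
 "Bint p f = (nn_set disc (%z. ennreal (cmod (f z) powr p)))"

lemma Bergman_iff: "f \<in> Bergman p \<longleftrightarrow> f holomorphic_on disc \<and> Bint p f < \<infinity>"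
 by (simp add: Bergman_def Bint_def nn_integral_completion)

lemma Bint_cmult:
 assumes "continuous_on disc f" "0 < p"
 shows "Bint p (%z. c * f z) = ennreal (cmod c powr p) * Bint p f"
proof -
 have "Bint p (%z. c * f z) = (NN z. ennreal (cmod c powr p) * (ennreal (cmod (f z) powr p) * indicator disc z))"
  unfolding Bint_def by (intro nn_integral_cong) (simp add: norm_mult powr_mult ennreal_mult mult.assoc)
 also have "... = ennreal (cmod c powr p) * Bint p f"
  unfolding Bint_def using nn_meas[OF assms(1) sets_disc assms(2)] by (intro nn_integral_cmult) simp
 finally show ?thesis .
qed

lemma Bint_sum:
 assumes "finite F" "!!a. a \<in> F ==> continuous_on disc (g a)" "0 < p" "p <= 1"
 shows "Bint p (%z. \<Sum>a\<in>F. g a z) <= (\<Sum>a\<in>F. Bint p (g a))"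
proof -
 have "Bint p (%z. \<Sum>a\<in>F. g a z) <= (NN z. (\<Sum>a\<in>F. ennreal (cmod (g a z) powr p) * indicator disc z))"
  unfolding Bint_def
 proof (rule nn_integral_mono)
  fix z :: complex
  have "cmod (\<Sum>a\<in>F. g a z) powr p <= (\<Sum>a\<in>F. cmod (g a z)) powr p"
   using assms by (intro powr_mono2 norm_sum) auto
  also have "... <= (\<Sum>a\<in>F. cmod (g a z) powr p)" using assms by (intro sum_powr_le) auto
  finally have "ennreal (cmod (\<Sum>a\<in>F. g a z) powr p) <= (\<Sum>a\<in>F. ennreal (cmod (g a z) powr p))"
   by (subst sum_ennreal) (auto intro: ennreal_leI)
  then show "ennreal (cmod (\<Sum>a\<in>F. g a z) powr p) * indicator disc z <= (\<Sum>a\<in>F. ennreal (cmod (g a z) powr p) * indicator disc z)"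
   by (simp add: mult_right_mono flip: sum_distrib_right)
 qed
 also have "... = (\<Sum>a\<in>F. Bint p (g a))"
  unfolding Bint_def using nn_meas[OF assms(2) sets_disc assms(3)] by (intro nn_integral_sum) simp
 finally show ?thesis .
qed

lemma Bint_add:
 assumes "continuous_on disc f" "continuous_on disc g" "0 < p" "p <= 1"
 shows "Bint p (%z. f z + g z) <= Bint p f + Bint p g"
 using Bint_sum[of "{False, True}" "%b. if b then g else f" p] assms by simp

lemma Bint_Fatou:
 assumes c: "!!n::nat. continuous_on disc (h n)" and l: "!!z. z \<in> disc ==> (%n. h n z) \<longlonglongrightarrow> f z"
  and B: "!!n. Bint p (h n) <= B" and p: "0 < p"
 shows "Bint p f <= B"
proof -
 have "Bint p f = (NN z. liminf (%n. ennreal (cmod (h n z) powr p) * indicator disc z))"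
  unfolding Bint_def
 proof (rule nn_integral_cong)
  fix z :: complex
  have "(%n. ennreal (cmod (h n z) powr p) * indicator disc z) \<longlonglongrightarrow> ennreal (cmod (f z) powr p) * indicator disc z"
  proof (cases "z \<in> disc")
   case True
   have "(%n. cmod (h n z) powr p) \<longlonglongrightarrow> cmod (f z) powr p"
    using l[OF True] p by (intro tendsto_powr' tendsto_norm tendsto_const) auto
   then show ?thesis using True by (simp add: tendsto_ennrealI)
  qed simp
  then show "ennreal (cmod (f z) powr p) * indicator disc z = liminf (%n. ennreal (cmod (h n z) powr p) * indicator disc z)"
   by (intro lim_imp_Liminf[symmetric]) auto
 qed
 also have "... <= liminf (%n. Bint p (h n))"
  unfolding Bint_def using nn_meas[OF c sets_disc p] by (intro nn_integral_liminf) simp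
 also have "... <= liminf (%n::nat. B)" using B by (intro Liminf_mono) simp
 also have "... = B" by (rule Liminf_const) simp
 finally show ?thesis .
qed

lemma Bint_point:
 assumes p: "0 < p" "p <= 1"
 shows "\<exists>C>0. \<forall>f z. f holomorphic_on disc \<and> z \<in> disc -->
   ennreal (cmod (f z) powr p) <= ennreal (C / (bd z)^2) * Bint p f"
proof -
 obtain C where C: "0 < C" "!!f w r. 0 < r ==> f holomorphic_on ball w r ==>
   ennreal (cmod (f w) powr p) <= ennreal (C / r^2) * (nn_set (ball w r) (%z. ennreal (cmod (f z) powr p)))"
  using powr_mean_bound[OF p] by blast
 show ?thesis
 proof (intro exI[of _ C] conjI allI impI C; (elim conjE)?)
  fix f z assume f: "f holomorphic_on disc" and z: "z \<in> disc"
  have sub: "ball z (bd z) \<subseteq> disc" using ball_bd_subset_disc[OF z, of 1] by simp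
  have "ennreal (cmod (f z) powr p) <= ennreal (C / (bd z)^2) * (nn_set (ball z (bd z)) (%z. ennreal (cmod (f z) powr p)))"
   using bd_pos[OF z] holomorphic_on_subset[OF f sub] by (intro C) auto
  also have "... <= ennreal (C / (bd z)^2) * Bint p f"
   unfolding Bint_def using sub by (intro mult_left_mono nn_integral_mono) (auto simp: indicator_def)
  finally show "ennreal (cmod (f z) powr p) <= ennreal (C / (bd z)^2) * Bint p f" .
 qed
qed

text \<open>Replaces the Baire category argument behind the open mapping theorem: a 0-1 sequence prescribes
on which points of Z the data are kept.\<close>
lemma cantor_Baire:
 fixes E :: "nat => (nat => bool) set"
 assumes cover: "!!x. \<exists>N. x \<in> E N"
  and closed: "!!N x y. (!!n::nat. x n \<in> E N) ==> (!!n i. i < n ==> x n i = y i) ==> y \<in> E N"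
 shows "\<exists>N n x. \<forall>y. (\<forall>i<n. y i = x i) --> y \<in> E N"
proof (rule ccontr)
 assume no: "\<not> ?thesis"
 define P where "P N n x p \<longleftrightarrow> n < fst p \<and> (\<forall>i<n. snd p i = x i) \<and> (\<forall>z. (\<forall>i<fst p. z i = snd p i) --> z \<notin> E N)"
  for N n x and p :: "nat \<times> (nat => bool)"
 have step: "\<exists>p. P N n x p" for N n x
 proof -
  obtain y where y: "\<forall>i<n. y i = x i" "y \<notin> E N" using no by blast
  define Q where "Q n' \<longleftrightarrow> (\<forall>z. (\<forall>i<n'. z i = y i) --> z \<notin> E N)" for n' :: nat
  \<comment> \<open>Closedness: if every prefix of y had an extension in \<open>E N\<close>, then y
    itself would belong to it. \<open>Suc\<close> makes the new prefix strictly longer than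
    n.\<close>
  have "\<exists>m. Q (n + Suc m)"
  proof (rule ccontr)
   assume "\<not> (\<exists>m. Q (n + Suc m))"
   then have "\<forall>m. \<exists>z. (\<forall>i<n + Suc m. z i = y i) \<and> z \<in> E N"
    unfolding Q_def not_ex not_all not_imp not_not .
   from choice[OF this] obtain z where z: "\<forall>m. (\<forall>i<n + Suc m. z m i = y i) \<and> z m \<in> E N" ..
   have "y \<in> E N" by (rule closed[of z]) (use z in auto)
   then show False using y by simp
  qed
  then obtain m where "Q (n + Suc m)" ..
  then have "P N n x (n + Suc m, y)" using y unfolding P_def Q_def by simp
  then show ?thesis ..
 qed
 define f where "f N n x = fst (SOME p. P N n x p)" for N n x
 define g where "g N n x = snd (SOME p. P N n x p)" for N n x
 have Pfg: "P N n x (f N n x, g N n x)" for N n x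
  using someI_ex[OF step, of N n x] by (simp add: f_def g_def)
 have fg: "n < f N n x" "i < n ==> g N n x i = x i" "(!!i. i < f N n x ==> z i = g N n x i) ==> z \<notin> E N" for N n x i z
  using Pfg[of N n x] unfolding P_def by simp_all
 \<comment> \<open>\<open>S k\<close> is a length with a prefix; step k extends the prefix so that
   every continuation avoids \<open>E k\<close>.\<close>
 define S where "S = rec_nat (0::nat, %_::nat. False) (%k s. (f k (fst s) (snd s), g k (fst s) (snd s)))"
 have S: "S (Suc k) = (f k (fst (S k)) (snd (S k)), g k (fst (S k)) (snd (S k)))" for k
  by (simp add: S_def)
 have lt: "fst (S k) < fst (S (Suc k))" for k using S[of k] fg(1) by simp
 have ge: "k <= fst (S k)" for k
 proof (induction k)
  case (Suc k) then show ?case using lt[of k] by linarith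
 qed simp
 have mono: "fst (S k) <= fst (S (k + j))" for k j
 proof (induction j)
  case (Suc j) then show ?case using lt[of "k + j"] by simp
 qed simp
 have coh: "snd (S (k + j)) i = snd (S k) i" if "i < fst (S k)" for k j i
 proof (induction j)
  case (Suc j)
  have "i < fst (S (k + j))" using that mono[of k j] by simp
  then show ?case using Suc S[of "k + j"] fg(2) by simp
 qed simp
 \<comment> \<open>\<open>S (Suc i)\<close> has length greater than i, so its entry i is
   final.\<close>
 define x where "x i = snd (S (Suc i)) i" for i
 have xS: "x i = snd (S (Suc N)) i" if "i < fst (S (Suc N))" for i N
 proof -
  have "i < fst (S (Suc i))" using ge[of "Suc i"] by simp
  then show ?thesis unfolding x_def using coh[of i "Suc i" N] coh[OF that, of i] by (simp add: add.commute)
 qed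
 have "x \<notin> E N" for N
  by (rule fg(3)[where n = "fst (S N)" and x = "snd (S N)"]) (use S[of N] xS[of _ N] in simp)
 then show False using cover[of x] by simp
qed

context separated_set
begin

text \<open>Point evaluation bounds |g a z| by a multiple of x(a)^(1/p), and x(a) <= B turns this
  into a multiple of x(a) because 1/p >= 1. So summable p-integrals force absolute, locally uniform
  convergence, and Fatou's lemma keeps the bound B.\<close>

lemma Bergman_series:
 assumes p: "0 < p" "p <= 1" and B: "0 <= B"
  and hol: "!!a. a \<in> Z ==> g a holomorphic_on disc"
  and bnd: "!!F. finite F ==> F \<subseteq> Z ==> (\<Sum>a\<in>F. Bint p (g a)) <= ennreal B"
 shows "\<exists>h. h holomorphic_on disc \<and> Bint p h <= ennreal B \<and> (\<forall>z\<in>disc. ((%a. g a z) has_sum h z) Z)"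
proof -
 obtain C where C: "0 < C" "!!f z. f holomorphic_on disc ==> z \<in> disc ==>
   ennreal (cmod (f z) powr p) <= ennreal (C / (bd z)^2) * Bint p f"
  using Bint_point[OF p] by blast
 define x where "x a = enn2real (Bint p (g a))" for a
 have Bx: "Bint p (g a) = ennreal (x a)" if "a \<in> Z" for a
 proof -
  have "Bint p (g a) <= ennreal B" using bnd[of "{a}"] that by simp
  then have "Bint p (g a) < top" using ennreal_less_top le_less_trans by blast
  then show ?thesis by (simp add: x_def)
 qed
 have x0: "0 <= x a" for a by (simp add: x_def)
 have xF: "(\<Sum>a\<in>F. x a) <= B" if "finite F" "F \<subseteq> Z" for F
 proof -
  have "(\<Sum>a\<in>F. Bint p (g a)) = (\<Sum>a\<in>F. ennreal (x a))" using that by (intro sum.cong Bx) auto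
  also have "... = ennreal (\<Sum>a\<in>F. x a)" using x0 by (simp add: sum_ennreal)
  finally have "ennreal (\<Sum>a\<in>F. x a) <= ennreal B" using bnd[OF that] by simp
  then show ?thesis using B by simp
 qed
 have xB: "x a <= B" if "a \<in> Z" for a using xF[of "{a}"] that by simp
 have xs: "x summable_on Z"
  using xF x0 by (intro nonneg_bdd_above_summable_on bdd_aboveI2[where M = B]) auto
 have pt: "cmod (g a z) <= (C / (bd z)^2) powr (1/p) * (B powr (1/p - 1) * x a)" if a: "a \<in> Z" and z: "z \<in> disc" for a z
 proof -
  have "ennreal (cmod (g a z) powr p) <= ennreal (C / (bd z)^2 * x a)"
  proof -
   have "ennreal (C / (bd z)^2) * ennreal (x a) = ennreal (C / (bd z)^2 * x a)"
    using C(1) x0 by (intro ennreal_mult[symmetric]) auto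
   then show ?thesis using C(2)[OF hol[OF a] z] by (simp add: Bx[OF a])
  qed
  then have "cmod (g a z) powr p <= C / (bd z)^2 * x a"
   using C(1) x0[of a] by (subst (asm) ennreal_le_iff) auto
  then have "(cmod (g a z) powr p) powr (1/p) <= (C / (bd z)^2 * x a) powr (1/p)"
   using p by (intro powr_mono2) auto
  moreover have "(cmod (g a z) powr p) powr (1/p) = cmod (g a z)"
   using p by (simp add: powr_powr)
  moreover have "(C / (bd z)^2 * x a) powr (1/p) = (C / (bd z)^2) powr (1/p) * x a powr (1/p)"
   by (rule powr_mult)
  ultimately have "cmod (g a z) <= (C / (bd z)^2) powr (1/p) * x a powr (1/p)" by (simp only:)
  also have "x a powr (1/p) <= B powr (1/p - 1) * x a"
  proof (cases "x a = 0")
   case False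
   then have xp: "0 < x a" using x0[of a] by simp
   have "x a powr (1/p) = x a powr (1/p - 1) * x a powr 1" using powr_add[of "x a" "1/p - 1" 1] by simp
   also have "... <= B powr (1/p - 1) * x a"
    using xp xB[OF a] p by (intro mult_mono powr_mono2) auto
   finally show ?thesis .
  qed simp
  finally show ?thesis by (simp add: mult_left_mono)
 qed
 have ul: "uniform_limit K (%X y. \<Sum>a\<in>X. g a y) (%y. \<Sum>\<^sub>\<infinity>a\<in>Z. g a y) (finite_subsets_at_top Z)"
  if K: "K \<subseteq> disc" and m: "0 < m" "!!z. z \<in> K ==> m <= bd z" for K m
 proof (rule Weierstrass_m_test_general)
  show "(%a. (C / m^2) powr (1/p) * (B powr (1/p - 1) * x a)) summable_on Z"
   by (intro summable_on_cmult_right xs)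
  fix a y assume a: "a \<in> Z" and y: "y \<in> K"
  have "cmod (g a y) <= (C / (bd y)^2) powr (1/p) * (B powr (1/p - 1) * x a)" using pt a y K by auto
  also have "... <= (C / m^2) powr (1/p) * (B powr (1/p - 1) * x a)"
  proof (intro mult_right_mono powr_mono2)
   have "m^2 <= (bd y)^2" using m y by (intro power_mono) auto
   then show "C / (bd y)^2 <= C / m^2" using C(1) m by (intro frac_le) auto
  qed (use p x0 C in auto)
  finally show "cmod (g a y) <= (C / m^2) powr (1/p) * (B powr (1/p - 1) * x a)" .
 qed
 obtain F :: "nat => complex set" where F: "!!n. finite (F n)" "!!n. F n \<subseteq> Z"
  "filterlim F (finite_subsets_at_top Z) sequentially" by (rule exhaustion) (rule that)
 define h where "h y = (\<Sum>\<^sub>\<infinity>a\<in>Z. g a y)" for y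
 have hS: "(%a. g a z) summable_on Z" if z: "z \<in> disc" for z
 proof (rule abs_summable_summable, rule summable_on_comparison_test[OF _ pt[OF _ z]])
  show "(%a. (C / (bd z)^2) powr (1/p) * (B powr (1/p - 1) * x a)) summable_on Z"
   by (intro summable_on_cmult_right xs)
 qed auto
 have hsum: "((%a. g a z) has_sum h z) Z" if z: "z \<in> disc" for z
  using hS[OF z] unfolding h_def by (rule has_sum_infsum)
 have holF: "(%y. \<Sum>a\<in>F n. g a y) holomorphic_on disc" for n
  using F hol by (intro holomorphic_intros) auto
 have "h holomorphic_on disc"
 proof (rule holomorphic_uniform_sequence[OF open_disc holF])
  fix z assume z: "z \<in> disc"
  define d where "d = bd z / 2"
  have d: "0 < d" using bd_pos[OF z] by (simp add: d_def)
  have b: "d <= bd y" if "y \<in> cball z d" for y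
   using bd_diff[of z y] that by (auto simp: d_def dist_norm)
  have sub: "cball z d \<subseteq> disc"
  proof
   fix y assume "y \<in> cball z d"
   then show "y \<in> disc" using b[of y] d by (auto simp: disc_iff bd_def)
  qed
  have "uniform_limit (cball z d) (%n y. \<Sum>a\<in>F n. g a y) h sequentially"
   using filterlim_compose[OF ul[OF sub d b] F(3)] by (simp add: h_def[abs_def])
  then show "\<exists>d>0. cball z d \<subseteq> disc \<and> uniform_limit (cball z d) (%n y. \<Sum>a\<in>F n. g a y) h sequentially"
   using d sub by blast
 qed
 moreover have "Bint p h <= ennreal B"
 proof (rule Bint_Fatou[OF _ _ _ p(1)])
  show "continuous_on disc (%y. \<Sum>a\<in>F n. g a y)" for n
   using holF by (rule holomorphic_on_imp_continuous_on)
  show "(%n. \<Sum>a\<in>F n. g a z) \<longlonglongrightarrow> h z" if "z \<in> disc" for z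
   using filterlim_compose[OF hsum[OF that, unfolded has_sum_def] F(3)] .
  show "Bint p (%y. \<Sum>a\<in>F n. g a y) <= ennreal B" for n
  proof -
   have "Bint p (%y. \<Sum>a\<in>F n. g a y) <= (\<Sum>a\<in>F n. Bint p (g a))"
    using F(1) F(2)[of n] hol holomorphic_on_imp_continuous_on p by (intro Bint_sum) blast+
   then show ?thesis using bnd[OF F(1,2), of n] by (rule order_trans)
  qed
 qed
 ultimately show ?thesis using hsum by blast
qed

end

context separated_set
begin

section \<open>Uniform interpolation\<close>

text \<open>B bounds the p-th power of the norm, so these costs add under differences and scale by
  |s|^p.\<close>

definition interp :: "real => real => (complex => complex) => bool" where
 "interp p B c \<longleftrightarrow> (\<exists>f. f holomorphic_on disc \<and> Bint p f <= ennreal B \<and> (\<forall>b\<in>Z. f b = c b))"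

lemma interp_cong: "interp p B c ==> (!!b. b \<in> Z ==> c b = d b) ==> interp p B d"
 unfolding interp_def by metis

lemma interp_mono: "interp p B c ==> B <= B' ==> interp p B' c"
 unfolding interp_def by (meson ennreal_leI order_trans)

lemma interp_scale:
 assumes "0 < p" "interp p B c" "0 <= B"
 shows "interp p (cmod s powr p * B) (%b. s * c b)"
proof -
 obtain f where f: "f holomorphic_on disc" "Bint p f <= ennreal B" "!!b. b \<in> Z ==> f b = c b"
  using assms(2) unfolding interp_def by blast
 have "Bint p (%z. s * f z) = ennreal (cmod s powr p) * Bint p f"
  using f(1) assms(1) holomorphic_on_imp_continuous_on by (intro Bint_cmult) auto
 also have "... <= ennreal (cmod s powr p) * ennreal B" using f(2) by (intro mult_left_mono) auto
 also have "... = ennreal (cmod s powr p * B)" using assms(3) by (intro ennreal_mult[symmetric]) auto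
 finally show ?thesis unfolding interp_def using f by (intro exI[of _ "%z. s * f z"]) (auto intro!: holomorphic_intros)
qed

lemma interp_diff:
 assumes p: "0 < p" "p <= 1" and "interp p B c" "interp p B' c'" "0 <= B" "0 <= B'"
 shows "interp p (B + B') (%b. c b - c' b)"
proof -
 obtain f where f: "f holomorphic_on disc" "Bint p f <= ennreal B" "!!b. b \<in> Z ==> f b = c b"
  using assms(3) unfolding interp_def by blast
 obtain g where g: "g holomorphic_on disc" "Bint p g <= ennreal B'" "!!b. b \<in> Z ==> g b = c' b"
  using assms(4) unfolding interp_def by blast
 have cf: "continuous_on disc f" "continuous_on disc g" using f g holomorphic_on_imp_continuous_on by auto
 have "Bint p (%z. f z + (-1) * g z) <= Bint p f + Bint p (%z. (-1) * g z)"
  using cf p by (intro Bint_add continuous_intros) auto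
 also have "Bint p (%z. (-1) * g z) = Bint p g" using Bint_cmult[OF cf(2) p(1), of "-1"] by simp
 also have "Bint p f + Bint p g <= ennreal B + ennreal B'" by (intro add_mono f g)
 also have "... = ennreal (B + B')" using assms(5,6) by (rule ennreal_plus[symmetric])
 finally show ?thesis unfolding interp_def using f g
  by (intro exI[of _ "%z. f z + (-1) * g z"]) (auto intro!: holomorphic_intros)
qed

text \<open>Bounded sets of A^p are normal families, and Fatou's lemma keeps the bound. This is the
  closedness that \<open>cantor_Baire\<close> asks for.\<close>

lemma interp_limit:
 assumes p: "0 < p" "p <= 1" and c: "!!n::nat. interp p B (c n)" and B: "0 <= B"
  and lim: "!!b. b \<in> Z ==> (%n. c n b) \<longlonglongrightarrow> d b"
 shows "interp p B d"
proof -
 obtain C where C: "0 < C" "!!f z. f holomorphic_on disc ==> z \<in> disc ==>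
   ennreal (cmod (f z) powr p) <= ennreal (C / (bd z)^2) * Bint p f"
  using Bint_point[OF p] by blast
 have "\<forall>n. \<exists>f. f holomorphic_on disc \<and> Bint p f <= ennreal B \<and> (\<forall>b\<in>Z. f b = c n b)"
  using c unfolding interp_def by blast
 from choice[OF this] obtain f where
  "\<forall>n. f n holomorphic_on disc \<and> Bint p (f n) <= ennreal B \<and> (\<forall>b\<in>Z. f n b = c n b)" ..
 then have f: "!!n. f n holomorphic_on disc" "!!n. Bint p (f n) <= ennreal B" "!!n b. b \<in> Z ==> f n b = c n b"
  by auto
 have pt: "cmod (f n z) <= (C / (bd z)^2 * B) powr (1/p)" if z: "z \<in> disc" for n z
 proof -
  have "ennreal (cmod (f n z) powr p) <= ennreal (C / (bd z)^2) * ennreal B"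
   using C(2)[OF f(1) z, of n] f(2)[of n] by (meson mult_left_mono order_trans zero_le)
  also have "... = ennreal (C / (bd z)^2 * B)" using C(1) B by (intro ennreal_mult[symmetric]) auto
  finally have "cmod (f n z) powr p <= C / (bd z)^2 * B"
   using C(1) B by (subst (asm) ennreal_le_iff) auto
  then have "(cmod (f n z) powr p) powr (1/p) <= (C / (bd z)^2 * B) powr (1/p)"
   using p by (intro powr_mono2) auto
  moreover have "(cmod (f n z) powr p) powr (1/p) = cmod (f n z)" using p by (simp add: powr_powr)
  ultimately show ?thesis by (simp only:)
 qed
 have bdd: "\<exists>K. \<forall>h\<in>range f. \<forall>z\<in>X. cmod (h z) <= K" if X: "compact X" "X \<subseteq> disc" for X
 proof (cases "X = {}")
  case False
  have "continuous_on X bd" unfolding bd_def by (intro continuous_intros)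
  then obtain m where m: "m \<in> X" "!!z. z \<in> X ==> bd m <= bd z"
   using continuous_attains_inf[OF X(1) False] by blast
  have bm: "0 < bd m" using m X bd_pos by auto
  have "cmod (f n z) <= (C / (bd m)^2 * B) powr (1/p)" if z: "z \<in> X" for n z
  proof -
   have "(bd m)^2 <= (bd z)^2" using m(2)[OF z] bm by (intro power_mono) auto
   then have "C / (bd z)^2 * B <= C / (bd m)^2 * B"
    using C(1) bm B by (intro mult_right_mono frac_le) auto
   then have "(C / (bd z)^2 * B) powr (1/p) <= (C / (bd m)^2 * B) powr (1/p)"
    using p C(1) B by (intro powr_mono2) auto
   then show ?thesis using pt[of z n] z X by force
  qed
  then show ?thesis by auto
 qed auto
 obtain g r where g: "g holomorphic_on disc" "strict_mono (r :: nat => nat)"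
   "!!x. x \<in> disc ==> (%n. f (r n) x) \<longlonglongrightarrow> g x"
 proof (rule Montel[OF open_disc, of "range f" f])
  show "h holomorphic_on disc" if "h \<in> range f" for h using f that by auto
  show "\<exists>B. \<forall>h\<in>range f. \<forall>z\<in>K. cmod (h z) <= B" if "compact K" "K \<subseteq> disc" for K
   using bdd[OF that] .
  fix g :: "complex => complex" and r :: "nat => nat"
  assume "g holomorphic_on disc" "strict_mono r" "!!x. x \<in> disc ==> (%n. f (r n) x) \<longlonglongrightarrow> g x"
  then show thesis by (rule that)
 qed simp
 have "Bint p g <= ennreal B"
 proof (rule Bint_Fatou[OF _ g(3) _ p(1)])
  show "continuous_on disc (f (r n))" for n using f(1) holomorphic_on_imp_continuous_on by blast
  show "Bint p (f (r n)) <= ennreal B" for n by (rule f(2))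
 qed
 moreover have "g b = d b" if b: "b \<in> Z" for b
 proof -
  have "(%n. f (r n) b) \<longlonglongrightarrow> d b"
   using LIMSEQ_subseq_LIMSEQ[OF lim[OF b] g(2)] f(3)[OF b] by (simp add: o_def)
  with g(3)[OF in_disc[OF b]] show ?thesis by (rule LIMSEQ_unique)
 qed
 ultimately show ?thesis unfolding interp_def using g(1) by blast
qed

lemma interpolating_interp:
 assumes "interpolating p Z" "c \<in> lpZ p Z"
 shows "\<exists>N::nat. interp p (real N) c"
proof -
 obtain f where f: "f \<in> Bergman p" "!!a. a \<in> Z ==> f a = c a"
  using assms unfolding interpolating_def by blast
 then have h: "f holomorphic_on disc" "Bint p f < \<infinity>" by (auto simp: Bergman_iff)
 obtain N :: nat where "enn2real (Bint p f) <= real N" using real_arch_simple by blast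
 then have "ennreal (enn2real (Bint p f)) <= ennreal (real N)" by (rule ennreal_leI)
 moreover have "ennreal (enn2real (Bint p f)) = Bint p f" using h(2) by simp
 ultimately have "Bint p f <= ennreal (real N)" by (simp only:)
 then show ?thesis unfolding interp_def using h f by blast
qed

text \<open>If the cost of the unit datum at a, relative to \<open>(bd a)^2\<close>, were unbounded,
  choose points whose costs exceed \<open>4 ^ n\<close>, and weights \<open>t n\<close> so small
  that every 0-1 selection of them is an admissible datum. By \<open>cantor_Baire\<close> all
  selections with some fixed prefix have one cost bound N; two of them that differ in a single late
  place n subtract to a multiple of the unit datum, whose relative cost is then of order
  \<open>N * 2 ^ n\<close>, a contradiction.\<close>

lemma uniform_interp:
 assumes p: "0 < p" "p <= 1" and int: "interpolating p Z"
 shows "\<exists>M>0. \<forall>a\<in>Z. \<exists>g. g holomorphic_on disc \<and> g a = 1 \<and> (\<forall>b\<in>Z. b ~= a --> g b = 0) \<and>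
   Bint p g <= ennreal (M * (bd a)^2)"
proof (rule ccontr)
 assume no: "\<not> ?thesis"
 define e where "e a b = (if b = a then 1 else 0 :: complex)" for a b :: complex
 have ex_iff: "interp p B (e a) \<longleftrightarrow> (\<exists>g. g holomorphic_on disc \<and> g a = 1 \<and> (\<forall>b\<in>Z. b ~= a --> g b = 0) \<and>
   Bint p g <= ennreal B)" if "a \<in> Z" for a B
  unfolding interp_def e_def using that by (intro iff_exI) auto
 have bad: "\<exists>a\<in>Z. \<not> interp p (M * (bd a)^2) (e a)" if "0 < M" for M
  using no that ex_iff by blast
 define A where "A n = {a \<in> Z. \<not> interp p (4 ^ n * (bd a)^2) (e a)}" for n :: nat
 have Ane: "\<exists>a. a \<in> A n" for n unfolding A_def using bad[of "4 ^ n"] by auto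
 have Amono: "A n \<subseteq> A m" if "m <= n" for m n
 proof -
  have "interp p (4 ^ m * (bd a)^2) (e a) ==> interp p (4 ^ n * (bd a)^2) (e a)" for a
   by (erule interp_mono) (use that in \<open>auto intro!: mult_right_mono power_increasing\<close>)
  then show ?thesis unfolding A_def by auto
 qed
 have Aout: "\<exists>m'>m. a \<notin> A m'" if a: "a \<in> Z" for a m
 proof -
  have "e a \<in> lpZ p Z"
  proof -
   have "(%b. cmod (e a b) powr p * (1 - (cmod b)^2)^2) summable_on {a}" by simp
   then have "(%b. cmod (e a b) powr p * (1 - (cmod b)^2)^2) summable_on Z"
    by (rule summable_on_cong_neutral[THEN iffD1, rotated -1]) (use a p in \<open>auto simp: e_def\<close>)
   then show ?thesis by (simp add: lpZ_def)
  qed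
  then obtain N :: nat where N: "interp p (real N) (e a)" using interpolating_interp[OF int] by blast
  have b: "0 < (bd a)^2" using bd_pos[OF in_disc[OF a]] by simp
  obtain k where k: "real N / (bd a)^2 < 4 ^ k" using real_arch_pow[of 4] by auto
  have "4 ^ k <= (4::real) ^ (k + Suc m)" by (intro power_increasing) auto
  then have "real N / (bd a)^2 <= 4 ^ (k + Suc m)" using k by linarith
  then have "real N <= 4 ^ (k + Suc m) * (bd a)^2" using b by (simp only: pos_divide_le_eq)
  then have "a \<notin> A (k + Suc m)" unfolding A_def using interp_mono[OF N] by blast
  then show ?thesis by (intro exI[of _ "k + Suc m"]) simp
 qed
 \<comment> \<open>Each pair holds a point and a level at which it is bad. The next level is one at
   which the current point is no longer bad, so the chosen points are distinct.\<close>
 have "\<exists>f. \<forall>n. (fst (f n) \<in> A (snd (f n)) \<and> n <= snd (f n)) \<and>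
    (snd (f n) < snd (f (Suc n)) \<and> fst (f n) \<notin> A (snd (f (Suc n))))"
 proof (rule dependent_nat_choice[where P = "%n x. fst x \<in> A (snd x) \<and> n <= snd x"
    and Q = "%n x y. snd x < snd y \<and> fst x \<notin> A (snd y)"])
  show "\<exists>x. fst x \<in> A (snd x) \<and> (0::nat) <= snd x" using Ane[of 0] by auto
  fix x :: "complex \<times> nat" and n :: nat assume x: "fst x \<in> A (snd x) \<and> n <= snd x"
  then have "fst x \<in> Z" by (auto simp: A_def)
  from Aout[OF this] obtain m' where m': "snd x < m'" "fst x \<notin> A m'" by blast
  obtain a' where "a' \<in> A m'" using Ane by blast
  then show "\<exists>y. (fst y \<in> A (snd y) \<and> Suc n <= snd y) \<and> snd x < snd y \<and> fst x \<notin> A (snd y)"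
   using m' x by (intro exI[of _ "(a', m')"]) auto
 qed
 then obtain f where ff: "\<forall>n. (fst (f n) \<in> A (snd (f n)) \<and> n <= snd (f n)) \<and>
    (snd (f n) < snd (f (Suc n)) \<and> fst (f n) \<notin> A (snd (f (Suc n))))" ..
 have f: "fst (f n) \<in> A (snd (f n))" "n <= snd (f n)"
   "snd (f n) < snd (f (Suc n))" "fst (f n) \<notin> A (snd (f (Suc n)))" for n
  using spec[OF ff, of n] by simp_all
 define a where "a n = fst (f n)" for n
 have mono: "snd (f i) <= snd (f j)" if "i <= j" for i j
  by (rule lift_Suc_mono_le[of "%n. snd (f n)", OF less_imp_le[OF f(3)] that])
 have aA: "a n \<in> A n" for n using f(1)[of n] f(2)[of n] Amono unfolding a_def by blast
 have aZ: "a n \<in> Z" for n using aA[of n] by (simp add: A_def)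
 have neq: "a i ~= a j" if "i < j" for i j
 proof -
  have "a j \<in> A (snd (f (Suc i)))" using f(1)[of j] Amono[OF mono[of "Suc i" j]] that unfolding a_def by auto
  then show ?thesis using f(4)[of i] unfolding a_def by auto
 qed
 have inj: "inj a" by (rule injI) (metis linorder_neqE_nat neq)
 \<comment> \<open>Chosen so that \<open>t n powr p * (bd (a n))^2\<close> is
   \<open>(1/2) ^ n\<close>: every selection is summable, and dividing by \<open>t n\<close> again
   costs only the factor \<open>2 ^ n\<close>, which \<open>4 ^ n\<close> outgrows.\<close>
 define t where "t n = ((1/2) ^ n / (bd (a n))^2) powr (1/p)" for n
 have bda: "0 < bd (a n)" for n using bd_pos[OF in_disc[OF aZ]] .
 have tpos: "0 < t n" for n unfolding t_def using bda[of n] by simp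
 have tp: "t n powr p = (1/2) ^ n / (bd (a n))^2" for n
  unfolding t_def using p bda[of n] by (simp add: powr_powr)
 define cc where "cc x b = (if b \<in> range a \<and> x (inv a b) then complex_of_real (t (inv a b)) else 0)" for x b
 have cca: "cc x (a n) = (if x n then of_real (t n) else 0)" for x n
  by (simp add: cc_def inv_f_f[OF inj])
 have lp: "cc x \<in> lpZ p Z" for x
 proof -
  let ?h = "%b. cmod (cc x b) powr p * (1 - (cmod b)^2)^2"
  have "summable (%n. ?h (a n))"
  proof (rule summable_comparison_test[of _ "%n. 4 * (1/2) ^ n"])
   have "norm (?h (a n)) <= 4 * (1/2) ^ n" for n
   proof (cases "x n")
    case True
    have "(1 - (cmod (a n))^2)^2 <= (2 * bd (a n))^2"
     using square_le_bd[of "a n"] bd_square_le[OF in_disc[OF aZ[of n]]] bda[of n] by (intro power_mono) auto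
    then have "(1/2) ^ n / (bd (a n))^2 * (1 - (cmod (a n))^2)^2 <= (1/2) ^ n / (bd (a n))^2 * (2 * bd (a n))^2"
     by (intro mult_left_mono) auto
    moreover have "?h (a n) = (1/2) ^ n / (bd (a n))^2 * (1 - (cmod (a n))^2)^2"
     using True tpos[of n] by (simp add: cca tp)
    ultimately have "?h (a n) <= (1/2) ^ n / (bd (a n))^2 * (2 * bd (a n))^2" by (simp only:)
    also have "... = 4 * (1/2) ^ n" using bda[of n] by (simp add: power_mult_distrib)
    finally show ?thesis by simp
   qed (use p in \<open>simp add: cca\<close>)
   then show "\<exists>N. \<forall>n\<ge>N. norm (?h (a n)) <= 4 * (1/2) ^ n" by blast
   show "summable (%n. 4 * (1/2::real) ^ n)" by (intro summable_mult summable_geometric) simp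
  qed
  then have "(%n. ?h (a n)) summable_on UNIV"
   by (intro norm_summable_imp_summable_on) simp
  then have "?h summable_on (range a)"
   using summable_on_reindex[OF inj, of ?h] by (simp add: o_def)
  then have "?h summable_on Z"
   by (rule summable_on_cong_neutral[THEN iffD1, rotated -1]) (use aZ p in \<open>auto simp: cc_def\<close>)
  then show ?thesis by (simp add: lpZ_def)
 qed
 have "\<exists>N n x. \<forall>y. (\<forall>i<n. y i = x i) --> y \<in> {x. interp p (real N) (cc x)}"
 proof (rule cantor_Baire)
  show "\<exists>N. x \<in> {x. interp p (real N) (cc x)}" for x using interpolating_interp[OF int lp] by simp
  fix N x y assume x: "!!n::nat. x n \<in> {x. interp p (real N) (cc x)}" and xy: "!!n i. i < n ==> x n i = y i"
  have "interp p (real N) (cc y)"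
  proof (rule interp_limit[OF p, of _ "%n. cc (x n)"])
   show "interp p (real N) (cc (x n))" for n using x by simp
   show "(%n. cc (x n) b) \<longlonglongrightarrow> cc y b" for b
   proof (rule tendsto_eventually, rule eventually_sequentiallyI)
    fix n assume "Suc (inv a b) <= n"
    then show "cc (x n) b = cc y b" using xy[of "inv a b" n] by (simp add: cc_def)
   qed
  qed simp
  then show "y \<in> {x. interp p (real N) (cc x)}" by simp
 qed
 then obtain N n0 x where cyl: "!!y. (!!i. i < n0 ==> y i = x i) ==> interp p (real N) (cc y)" by auto
 have key: "interp p (2 * real N * 2 ^ n * (bd (a n))^2) (e (a n))" if n: "n0 <= n" for n
 proof -
  have i: "interp p (real N + real N) (%b. cc (x(n := True)) b - cc (x(n := False)) b)"
   using n by (intro interp_diff p cyl) auto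
  have N0: "0 <= real N + real N" by simp
  have nt: "cmod (of_real (1 / t n)) = 1 / t n" unfolding norm_of_real using tpos[of n] by simp
  have "interp p ((1 / t n) powr p * (real N + real N)) (%b. of_real (1 / t n) * (cc (x(n := True)) b - cc (x(n := False)) b))"
   using interp_scale[OF p(1) i N0, of "of_real (1 / t n)"] unfolding nt .
  moreover have "of_real (1 / t n) * (cc (x(n := True)) b - cc (x(n := False)) b) = e (a n) b" if "b \<in> Z" for b
  proof (cases "b \<in> range a")
   case True
   then obtain m where m: "b = a m" by auto
   show ?thesis unfolding m cca e_def using inj tpos[of n] by (auto simp: inj_eq)
  qed (auto simp: cc_def e_def)
  ultimately have "interp p ((1 / t n) powr p * (real N + real N)) (e (a n))" by (rule interp_cong)
  moreover have "(1 / t n) powr p = 2 ^ n * (bd (a n))^2"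
   using tpos[of n] bda[of n] by (simp add: powr_divide tp power_one_over)
  then have "(1 / t n) powr p * (real N + real N) = 2 * real N * 2 ^ n * (bd (a n))^2"
   by simp
  ultimately show ?thesis by (simp only:)
 qed
 obtain k where k: "2 * real N < 2 ^ k" using real_arch_pow[of 2] by auto
 define n where "n = n0 + k"
 have "2 * real N * 2 ^ n <= 2 ^ n * 2 ^ n"
 proof (intro mult_right_mono)
  have "(2::real) ^ k <= 2 ^ n" by (intro power_increasing) (auto simp: n_def)
  then show "2 * real N <= 2 ^ n" using k by linarith
 qed simp
 also have "... = (4::real) ^ n" by (simp flip: power_mult_distrib)
 finally have "2 * real N * 2 ^ n * (bd (a n))^2 <= 4 ^ n * (bd (a n))^2" by (intro mult_right_mono) auto
 from interp_mono[OF key this] have "interp p (4 ^ n * (bd (a n))^2) (e (a n))" by (simp add: n_def)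
 then show False using aA[of n] by (simp add: A_def)
qed

lemma kern_upper:
 assumes "a \<in> disc" shows "cmod (1 - cnj a * z) <= 2 * bd a + cmod (z - a)"
proof -
 have "1 - cnj a * z = (1 - cnj a * a) + cnj a * (a - z)" by (simp add: algebra_simps)
 then have "cmod (1 - cnj a * z) <= cmod (1 - cnj a * a) + cmod (cnj a * (a - z))"
  by (metis norm_triangle_ineq)
 also have "1 - cnj a * a = of_real (1 - (cmod a)^2)"
  unfolding of_real_diff of_real_1 complex_norm_square by (simp add: mult.commute)
 also have "cmod (of_real (1 - (cmod a)^2)) <= 2 * bd a"
  using square_le_bd[of a] bd_square_le[OF assms] bd_pos[OF assms] by (simp del: of_real_diff)
 also have "cmod (cnj a * (a - z)) <= cmod (z - a)"
  using assms by (simp add: norm_mult disc_iff norm_minus_commute mult_left_le_one_le)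
 finally show ?thesis by simp
qed

end

text \<open>A bound on the p-integral relative to \<open>(bd ze)^2\<close> bounds f by K on the ball
  of radius \<open>bd ze / 2\<close> about ze, hence its Lipschitz constant near ze by a multiple of
  \<open>K / bd ze\<close>.\<close>

lemma half_lower:
 assumes p: "0 < p" "p <= 1" and B: "0 < B"
 shows "\<exists>r>0. r <= 1/4 \<and> (\<forall>f ze. f holomorphic_on disc \<and> ze \<in> disc \<and> f ze = 1 \<and> Bint p f <= ennreal (B * (bd ze)^2)
   --> (\<forall>z\<in>ball ze (r * bd ze). 1/2 <= cmod (f z)))"
proof -
 obtain C where C: "0 < C" "!!f w r z. 0 < r ==> f holomorphic_on ball w r ==> z \<in> ball w (r/2) ==>
   ennreal (cmod (f z) powr p) <= ennreal (C / r^2) * (nn_set (ball w r) (%z. ennreal (cmod (f z) powr p)))"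
  using powr_mean_bound2[OF p] by blast
 define K where "K = (C * B) powr (1/p)"
 have K: "0 < K" using C B by (simp add: K_def)
 \<comment> \<open>\<open>holomorphic_lipschitz\<close> gives an oscillation of at most
   \<open>8 * K * r\<close>, which this choice makes at most 1/2.\<close>
 define r where "r = min (1/4) (1 / (16 * K))"
 have r: "0 < r" "r <= 1/4" "8 * K * r <= 1/2" using K by (auto simp: r_def min_def field_simps)
 show ?thesis
 proof (intro exI[of _ r] conjI r allI impI ballI; (elim conjE)?)
  fix f ze z assume f: "f holomorphic_on disc" "ze \<in> disc" "f ze = 1" "Bint p f <= ennreal (B * (bd ze)^2)"
   and z: "z \<in> ball ze (r * bd ze)"
  have b: "0 < bd ze" using f bd_pos by auto
  have sub: "ball ze (bd ze) \<subseteq> disc" using ball_bd_subset_disc[OF f(2), of 1] by simp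
  have Kb: "cmod (f x) <= K" if x: "x \<in> ball ze (bd ze / 2)" for x
  proof -
   have "ennreal (cmod (f x) powr p) <= ennreal (C / (bd ze)^2) * (nn_set (ball ze (bd ze)) (%z. ennreal (cmod (f z) powr p)))"
    using b x holomorphic_on_subset[OF f(1) sub] by (intro C) auto
   also have "... <= ennreal (C / (bd ze)^2) * Bint p f"
    unfolding Bint_def using sub by (intro mult_left_mono nn_integral_mono) (auto simp: indicator_def)
   also have "... <= ennreal (C / (bd ze)^2) * ennreal (B * (bd ze)^2)"
    using f(4) by (intro mult_left_mono) auto
   also have "... = ennreal (C / (bd ze)^2 * (B * (bd ze)^2))" using C B by (intro ennreal_mult[symmetric]) auto
   also have "C / (bd ze)^2 * (B * (bd ze)^2) = C * B" using b by simp
   finally have "cmod (f x) powr p <= C * B" using C(1) B by (subst (asm) ennreal_le_iff) auto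
   then have "(cmod (f x) powr p) powr (1/p) <= K" unfolding K_def using p by (intro powr_mono2) auto
   moreover have "(cmod (f x) powr p) powr (1/p) = cmod (f x)" using p by (simp add: powr_powr)
   ultimately show ?thesis by simp
  qed
  have sub2: "ball ze (bd ze / 2) \<subseteq> disc" using sub b by (auto simp: subset_iff)
  have zb: "cmod (z - ze) < r * bd ze" using z by (simp add: dist_norm norm_minus_commute)
  have "r * bd ze <= 1/4 * bd ze" using r b by (intro mult_right_mono) auto
  then have "z \<in> ball ze (bd ze / 2 / 2)" using z by auto
  then have "cmod (f z - f ze) <= 4 * K / (bd ze / 2) * cmod (z - ze)"
   using holomorphic_lipschitz[OF holomorphic_on_subset[OF f(1) sub2] _ Kb] b by auto
  also have "... <= 4 * K / (bd ze / 2) * (r * bd ze)" using zb K b by (intro mult_left_mono) auto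
  also have "... = 8 * K * r" using b by simp
  finally have "cmod (f z - 1) <= 1/2" using r f(3) by simp
  then show "1/2 <= cmod (f z)" using norm_triangle_ineq2[of 1 "1 - f z"] by (simp add: norm_minus_commute)
 qed
qed

text \<open>The function Psi vanishes exactly on Z and has modulus comparable to exp k away from Z.
It need not be a product of the factors gfac: a locally uniform limit of finite products is enough.\<close>
locale separated_Psi = separated_set +
 fixes \<Psi> :: "complex => complex" and c :: real
 assumes Psi_hol: "\<Psi> holomorphic_on disc" and c: "0 < c" "c <= 1"
  and Psi_le: "z \<in> disc ==> cmod (\<Psi> z) <= exp (kZ Z z)"
  and Psi_le_near: "z \<in> disc ==> a \<in> Z ==> cmod (\<Psi> z) <= exp (1/2) * pshyp z a * exp (kZ Z z)"
  and Psi_ge_far: "z \<in> disc ==> (!!a. a \<in> Z ==> dl / 2 * bd a <= cmod (z - a)) ==> c * exp (kZ Z z) <= cmod (\<Psi> z)"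
  and Psi_ge_near: "z \<in> disc ==> a \<in> Z ==> cmod (z - a) < dl / 2 * bd a ==> c * pshyp z a * exp (kZ Z z) <= cmod (\<Psi> z)"
begin

lemma Psi_zero_iff: "z \<in> disc ==> \<Psi> z = 0 \<longleftrightarrow> z \<in> Z"
proof
 assume z: "z \<in> disc" "z \<in> Z"
 then show "\<Psi> z = 0" using Psi_le_near[OF z] by (simp add: pshyp_eq)
next
 assume z: "z \<in> disc" "\<Psi> z = 0"
 show "z \<in> Z"
 proof (rule ccontr)
  assume nz: "z \<notin> Z"
  show False
  proof (cases "\<exists>a\<in>Z. cmod (z - a) < dl / 2 * bd a")
   case True
   then obtain a where a: "a \<in> Z" "cmod (z - a) < dl / 2 * bd a" by blast
   have "0 < pshyp z a" unfolding pshyp_eq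
    using nz a(1) kern_pos[OF in_disc[OF a(1)] z(1)] by (intro divide_pos_pos) auto
   then have "0 < c * pshyp z a * exp (kZ Z z)" using c by simp
   then show False using Psi_ge_near[OF z(1) a] z(2) by simp
  next
   case False
   then have "c * exp (kZ Z z) <= cmod (\<Psi> z)" using z by (intro Psi_ge_far) (auto simp: not_less)
   moreover have "0 < c * exp (kZ Z z)" using c by simp
   ultimately show False using z(2) by simp
  qed
 qed
qed

lemma near_ball_disc: "a \<in> Z ==> ball a (dl / 2 * bd a) \<subseteq> disc"
 using ball_bd_subset_disc[OF in_disc, of a "dl / 2"] delta by auto

lemma near_ball_Z: "a \<in> Z ==> z \<in> ball a (dl / 2 * bd a) ==> z \<in> Z ==> z = a"
proof (rule ccontr)
 assume a: "a \<in> Z" "z \<in> ball a (dl / 2 * bd a)" "z \<in> Z" "z ~= a"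
 have "z \<in> disc" using a in_disc by auto
 from near_far[OF this a(1,3)] a have "dl / 2 * bd z <= cmod (z - z)" by (auto simp: dist_norm norm_minus_commute)
 then show False using bd_pos[OF in_disc[OF a(3)]] delta by (simp add: mult_le_0_iff)
qed

text \<open>Divide \<open>Psi_ge_near\<close> by |z - a| and let z tend to a; near a the denominator
  of \<open>pshyp z a\<close> is at most \<open>3 * bd a\<close>. In particular the zeros of
  \<open>\<Psi>\<close> are simple, and the bound later normalises the functions that equal 1 at
  a.\<close>

lemma deriv_Psi_lower:
 assumes a: "a \<in> Z" shows "c * exp (kZ Z a) / (3 * bd a) <= cmod (deriv \<Psi> a)"
proof -
 have ad: "a \<in> disc" using in_disc[OF a] .
 have ba: "0 < bd a" using bd_pos[OF ad] .
 have Psi_a: "\<Psi> a = 0" using Psi_zero_iff[OF ad] a by simp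
 have D: "(\<Psi> has_field_derivative deriv \<Psi> a) (at a)"
  using Psi_hol open_disc ad holomorphic_derivI by blast
 have 1: "((%z. cmod ((\<Psi> z - \<Psi> a) / (z - a))) \<longlongrightarrow> cmod (deriv \<Psi> a)) (at a)"
  using D unfolding has_field_derivative_iff by (rule tendsto_norm)
 have "continuous (at a) (kZ Z)" using continuous_kZ ad open_disc continuous_on_eq_continuous_at by blast
 then have 2: "((%z. c * exp (kZ Z z) / (3 * bd a)) \<longlongrightarrow> c * exp (kZ Z a) / (3 * bd a)) (at a)"
  using ba by (intro tendsto_intros) (auto simp: continuous_at)
 have "\<forall>\<^sub>F z in at a. z \<in> ball a (dl / 2 * bd a) - {a}"
  using ba delta by (intro eventually_at_in_open) auto
 then have ev: "\<forall>\<^sub>F z in at a. c * exp (kZ Z z) / (3 * bd a) <= cmod ((\<Psi> z - \<Psi> a) / (z - a))"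
 proof eventually_elim
  case (elim z)
  then have z: "z \<in> disc" "cmod (z - a) < dl / 2 * bd a" "z ~= a"
   using near_ball_disc[OF a] by (auto simp: dist_norm norm_minus_commute)
  have "dl / 2 * bd a <= 1 * bd a" using delta ba by (intro mult_right_mono) auto
  then have k: "cmod (1 - cnj a * z) <= 3 * bd a" using kern_upper[OF ad, of z] z(2) by linarith
  have "c * exp (kZ Z z) / (3 * bd a) * cmod (z - a) <= c * exp (kZ Z z) / cmod (1 - cnj a * z) * cmod (z - a)"
   using k kern_pos[OF ad z(1)] c by (intro mult_right_mono frac_le) auto
  also have "... = c * pshyp z a * exp (kZ Z z)" by (simp add: pshyp_eq)
  also have "... <= cmod (\<Psi> z)" by (rule Psi_ge_near[OF z(1) a z(2)])
  finally show ?case using z(3) by (simp add: Psi_a norm_divide field_simps)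
 qed
 show ?thesis by (rule tendsto_le[OF _ 1 2 ev]) simp
qed

text \<open>The zeros of \<open>\<Psi>\<close> are simple, so near a point of Z the quotient of h by
  \<open>\<Psi>\<close> is the quotient of their difference quotients, both holomorphic there and
  the second without zeros.\<close>

lemma quotient_holomorphic:
 assumes h: "h holomorphic_on disc" "!!a. a \<in> Z ==> h a = 0"
 shows "\<exists>H. H holomorphic_on disc \<and> (\<forall>z\<in>disc. h z = H z * \<Psi> z)"
proof -
 define H where "H z = (if z \<in> Z then deriv h z / deriv \<Psi> z else h z / \<Psi> z)" for z
 have "\<exists>U. open U \<and> z \<in> U \<and> H holomorphic_on U" if z: "z \<in> disc" for z
 proof (cases "z \<in> Z")
  case False
  define U where "U = {w \<in> disc. \<Psi> w ~= 0}"
  have "U = disc \<inter> \<Psi> -` (- {0})" by (auto simp: U_def)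
  then have "open U"
   using continuous_open_preimage[OF holomorphic_on_imp_continuous_on[OF Psi_hol] open_disc, of "- {0}"]
   by (simp add: open_Compl)
  moreover have "z \<in> U" using z False Psi_zero_iff by (simp add: U_def)
  moreover have "(%w. h w / \<Psi> w) holomorphic_on U"
   using h(1) Psi_hol by (intro holomorphic_intros) (auto simp: U_def elim: holomorphic_on_subset)
  then have "H holomorphic_on U"
   by (rule holomorphic_transform) (use Psi_zero_iff in \<open>auto simp: H_def U_def\<close>)
  ultimately show ?thesis by blast
 next
  case a: True
  define U where "U = ball z (dl / 2 * bd z)"
  have U: "open U" "z \<in> U" "U \<subseteq> disc" using near_ball_disc[OF a] delta bd_pos[OF that] by (auto simp: U_def)
  define h1 where "h1 w = (if w = z then deriv h z else (h w - h z) / (w - z))" for w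
  define P1 where "P1 w = (if w = z then deriv \<Psi> z else (\<Psi> w - \<Psi> z) / (w - z))" for w
  have 1: "h1 holomorphic_on U" "P1 holomorphic_on U"
   unfolding h1_def P1_def using h(1) Psi_hol U by (auto intro!: pole_lemma elim: holomorphic_on_subset simp: interior_open)
  have z0: "h z = 0" "\<Psi> z = 0" using h(2)[OF a] Psi_zero_iff[OF that] a by auto
  have nz: "P1 w ~= 0" if w: "w \<in> U" for w
  proof (cases "w = z")
   case True
   have "0 < c * exp (kZ Z z) / (3 * bd z)" using c bd_pos[OF z] by simp
   then have "deriv \<Psi> z ~= 0" using deriv_Psi_lower[OF a] by auto
   then show ?thesis by (simp add: P1_def True)
  next
   case False
   then have "w \<notin> Z" using near_ball_Z[OF a] w by (auto simp: U_def)
   then show ?thesis using False w U Psi_zero_iff z0 by (auto simp: P1_def)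
  qed
  have "(%w. h1 w / P1 w) holomorphic_on U" using 1 nz by (intro holomorphic_intros) auto
  then have "H holomorphic_on U"
  proof (rule holomorphic_transform)
   fix w assume w: "w \<in> U"
   show "h1 w / P1 w = H w"
   proof (cases "w = z")
    case False
    then have "w \<notin> Z" using near_ball_Z[OF a] w by (auto simp: U_def)
    then show ?thesis using False z0 by (simp add: H_def h1_def P1_def)
   qed (simp add: H_def h1_def P1_def a)
  qed
  then show ?thesis using U by blast
 qed
 then have "H holomorphic_on disc"
  unfolding holomorphic_on_def using open_disc
  by (metis at_within_open field_differentiable_at_within holomorphic_on_imp_differentiable_at)
 moreover have "h z = H z * \<Psi> z" if "z \<in> disc" for z
  using that Psi_zero_iff[OF that] h(2) by (auto simp: H_def)
 ultimately show ?thesis by blast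
qed

end

context separated_set
begin

section \<open>Peak functions\<close>

definition wint :: "real => (complex => complex) => ennreal" where
 "wint p u = (nn_set disc (%z. ennreal ((cmod (u z) * exp (kZ Z z)) powr p)))"

lemma wmeas:
 assumes "continuous_on disc u" "0 < p"
 shows "(%z. ennreal ((cmod (u z) * exp (kZ Z z)) powr p) * indicator disc z) \<in> borel_measurable borel"
proof -
 have "continuous_on disc (%z. u z * of_real (exp (kZ Z z)))"
  using assms(1) continuous_kZ by (intro continuous_intros)
 from nn_meas[OF this sets_disc assms(2)] show ?thesis by (simp add: norm_mult)
qed

lemma wint_cmult:
 assumes "continuous_on disc u" "0 < p"
 shows "wint p (%z. s * u z) = ennreal (cmod s powr p) * wint p u"
proof -
 have "wint p (%z. s * u z) = (NN z. ennreal (cmod s powr p) * (ennreal ((cmod (u z) * exp (kZ Z z)) powr p) * indicator disc z))"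
  unfolding wint_def by (intro nn_integral_cong) (simp add: norm_mult powr_mult ennreal_mult mult.assoc)
 also have "... = ennreal (cmod s powr p) * wint p u"
  unfolding wint_def using wmeas[OF assms] by (intro nn_integral_cmult) simp
 finally show ?thesis .
qed

end

context separated_Psi
begin

text \<open>Away from Z, \<open>\<Psi>\<close> is comparable to \<open>exp (kZ Z z)\<close> and the
  estimate is pointwise. In a small ball about a both h and \<open>\<Psi>\<close> vanish at a:
  |h(z)| is at most |z - a| times a Lipschitz constant, \<open>\<Psi>\<close> relative to the weight
  is at least of order |z - a| / \<open>bd a\<close>, and the Lipschitz constant is controlled by
  the p-mean of h over a larger ball. These larger balls are disjoint.\<close>

lemma division_bound:
 assumes p: "0 < p" "p <= 1"
 shows "\<exists>C>0. \<forall>h H. h holomorphic_on disc \<and> H holomorphic_on disc \<and> (\<forall>a\<in>Z. h a = 0) \<and> (\<forall>z\<in>disc. h z = H z * \<Psi> z)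
   --> wint p H <= ennreal C * Bint p h"
proof -
 obtain Cm where Cm: "0 < Cm" "!!f w r z. 0 < r ==> f holomorphic_on ball w r ==> z \<in> ball w (r/2) ==>
   ennreal (cmod (f z) powr p) <= ennreal (Cm / r^2) * (nn_set (ball w r) (%z. ennreal (cmod (f z) powr p)))"
  using powr_mean_bound2[OF p] by blast
 \<comment> \<open>24 is 8 times 3: at distance \<open>dl / 8 * bd a\<close> from a,
   \<open>pshyp z a\<close> is at least \<open>dl / 24\<close>.\<close>
 define C1 where "C1 = (24 / (c * dl)) powr p"
 have C1: "0 < C1" "(1 / c) powr p <= C1"
 proof -
  have "1 / c <= 24 / (c * dl)" using c delta by (simp add: field_simps)
  then show "(1 / c) powr p <= C1" unfolding C1_def using c p by (intro powr_mono2) auto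
  show "0 < C1" using c delta by (simp add: C1_def)
 qed
 \<comment> \<open>48 is 3 times 16, with 16 from the Lipschitz bound on a ball of radius
   \<open>dl / 4 * bd a\<close>.\<close>
 define C2 where "C2 = (48 / (c * dl)) powr p * Cm * pi"
 have C2: "0 < C2" using c delta Cm by (simp add: C2_def)
 obtain F :: "nat => complex set" where F: "!!n. finite (F n)" "!!n. F n \<subseteq> Z"
  "filterlim F (finite_subsets_at_top Z) sequentially" by (rule exhaustion) (rule that)
 show ?thesis
 proof (intro exI[of _ "C1 + C2"] conjI allI impI; (elim conjE)?)
  show "0 < C1 + C2" using C1 C2 by simp
  fix h H assume h: "h holomorphic_on disc" and H: "H holomorphic_on disc" and h0: "\<forall>a\<in>Z. h a = 0"
   and hH: "\<forall>z\<in>disc. h z = H z * \<Psi> z"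
  let ?r = "%a. dl / 2 * bd a"
  let ?I = "%a. nn_set (ball a (?r a)) (%z. ennreal (cmod (h z) powr p))"
  let ?N = "%a. ball a (dl / 8 * bd a)"
  let ?X = "%a. ennreal ((48 / (c * dl)) powr p * Cm / (?r a)^2) * ?I a"
  have HP: "cmod (H z) = cmod (h z) / cmod (\<Psi> z)" if "z \<in> disc" "z \<notin> Z" for z
   using hH that Psi_zero_iff[OF that(1)] by (simp add: norm_mult)
  have HkPsi: "cmod (H z) * exp (kZ Z z) <= b"
   if z: "z \<in> disc" "z \<notin> Z" and low: "l * exp (kZ Z z) <= cmod (\<Psi> z)" "0 < l" and b: "cmod (h z) / l <= b" for z l b
  proof -
   have "cmod (H z) * exp (kZ Z z) = cmod (h z) * exp (kZ Z z) / cmod (\<Psi> z)" using HP[OF z] by simp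
   also have "... <= cmod (h z) * exp (kZ Z z) / (l * exp (kZ Z z))"
   proof -
    have p1: "0 < l * exp (kZ Z z)" using low(2) by simp
    then have p2: "0 < cmod (\<Psi> z)" using low(1) by linarith
    show ?thesis by (intro divide_left_mono low(1) mult_nonneg_nonneg mult_pos_pos[OF p2 p1]) auto
   qed
   also have "... = cmod (h z) / l" by simp
   finally show ?thesis using b by simp
  qed
  have ps: "cmod (z - a) / (3 * bd a) <= pshyp z a" if a: "a \<in> Z" and z: "z \<in> ball a (?r a)" for z a
  proof -
   have zd: "z \<in> disc" using near_ball_disc[OF a] z by auto
   have "dl / 2 * bd a <= 1 * bd a" using delta bd_pos[OF in_disc[OF a]] by (intro mult_right_mono) auto
   then have "cmod (1 - cnj a * z) <= 3 * bd a"
    using kern_upper[OF in_disc[OF a], of z] z by (auto simp: dist_norm norm_minus_commute)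
   then show ?thesis unfolding pshyp_eq using kern_pos[OF in_disc[OF a] zd] by (intro frac_le) auto
  qed
  have pow: "(b / l) powr p = b powr p * (1 / l) powr p" if "0 <= b" "0 < l" for b l
   by (simp flip: powr_mult)
  have pw1: "ennreal ((cmod (H z) * exp (kZ Z z)) powr p) <= ennreal (C1 * cmod (h z) powr p)"
   if z: "z \<in> disc" "z \<notin> Z" and far: "!!a. a \<in> Z ==> z \<notin> ?N a" for z
  proof -
   have "cmod (H z) * exp (kZ Z z) <= cmod (h z) * (24 / (c * dl))"
   proof (cases "\<exists>a\<in>Z. cmod (z - a) < ?r a")
    case True
    then obtain a where a: "a \<in> Z" "cmod (z - a) < ?r a" by blast
    have ba: "0 < bd a" using bd_pos[OF in_disc[OF a(1)]] .
    have "z \<in> ball a (?r a)" using a by (simp add: dist_norm norm_minus_commute)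
    then have "cmod (z - a) / (3 * bd a) <= pshyp z a" using ps a by blast
    moreover have "dl / 8 * bd a <= cmod (z - a)" using far[OF a(1)] by (simp add: dist_norm norm_minus_commute)
    then have "dl / 24 <= cmod (z - a) / (3 * bd a)" using ba by (simp add: field_simps)
    ultimately have "c * (dl / 24) * exp (kZ Z z) <= c * pshyp z a * exp (kZ Z z)"
     using c by (intro mult_right_mono mult_left_mono) auto
    also have "... <= cmod (\<Psi> z)" by (rule Psi_ge_near[OF z(1) a])
    finally show ?thesis using c delta by (intro HkPsi[OF z, of "c * (dl / 24)"]) (auto simp: field_simps)
   next
    case False
    then have "c * exp (kZ Z z) <= cmod (\<Psi> z)" using z by (intro Psi_ge_far) (auto simp: not_less)
    then show ?thesis
    proof (rule HkPsi[OF z])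
     have "cmod (h z) * (1 / c) <= cmod (h z) * (24 / (c * dl))"
      using c delta by (intro mult_left_mono) (auto simp: field_simps)
     then show "cmod (h z) / c <= cmod (h z) * (24 / (c * dl))" by simp
    qed (rule c)
   qed
   then have "(cmod (H z) * exp (kZ Z z)) powr p <= (cmod (h z) * (24 / (c * dl))) powr p"
    using p by (intro powr_mono2) auto
   also have "... = C1 * cmod (h z) powr p" unfolding C1_def powr_mult by simp
   finally show ?thesis by (rule ennreal_leI)
  qed
  have pw2: "ennreal ((cmod (H z) * exp (kZ Z z)) powr p) <= ?X a"
   if a: "a \<in> Z" and z: "z \<in> ?N a" and nz: "z \<notin> Z" for a z
  proof -
   have ad: "a \<in> disc" and ba: "0 < bd a" using in_disc[OF a] bd_pos by auto
   have r: "0 < ?r a" using delta ba by simp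
   have le: "dl / 8 * bd a <= ?r a" using delta ba by simp
   then have zr: "z \<in> ball a (?r a)" using z by (auto simp: less_le_trans)
   then have zd: "z \<in> disc" using near_ball_disc[OF a] by auto
   show ?thesis
   proof (cases "?I a = \<infinity>")
    case True
    have pos: "0 < (48 / (c * dl)) powr p * Cm / (?r a)^2"
     using c delta Cm(1) ba by (intro divide_pos_pos mult_pos_pos zero_less_power) auto
    have "ennreal K * \<infinity> = \<infinity>" if "0 < K" for K :: real
     using that by (simp add: ennreal_mult_top)
    from this[OF pos] show ?thesis unfolding True by (simp only: top_greatest infinity_ennreal_def)
   next
    case False
    then obtain I where I: "?I a = ennreal I" "0 <= I" by (cases "?I a") auto
    define M where "M = (Cm / (?r a)^2 * I) powr (1/p)"
    have M: "cmod (h x) <= M" if x: "x \<in> ball a (?r a / 2)" for x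
    proof -
     have "ennreal (cmod (h x) powr p) <= ennreal (Cm / (?r a)^2) * ?I a"
      using x r holomorphic_on_subset[OF h near_ball_disc[OF a]] by (intro Cm) auto
     also have "... = ennreal (Cm / (?r a)^2 * I)" unfolding I(1) using Cm I by (intro ennreal_mult[symmetric]) auto
     finally have "cmod (h x) powr p <= Cm / (?r a)^2 * I" using Cm(1) I by (subst (asm) ennreal_le_iff) auto
     then have "(cmod (h x) powr p) powr (1/p) <= M" unfolding M_def using p by (intro powr_mono2) auto
     moreover have "(cmod (h x) powr p) powr (1/p) = cmod (h x)" using p by (simp add: powr_powr)
     ultimately show ?thesis by simp
    qed
    have sub: "ball a (?r a / 2) \<subseteq> disc" using near_ball_disc[OF a] r by (auto simp: subset_iff)
    have "z \<in> ball a (?r a / 2 / 2)" using z by simp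
    then have "cmod (h z - h a) <= 4 * M / (?r a / 2) * cmod (z - a)"
     using holomorphic_lipschitz[OF holomorphic_on_subset[OF h sub] _ M] r by auto
    then have hz: "cmod (h z) <= 16 * M / (dl * bd a) * cmod (z - a)" using h0 a by (simp add: field_simps)
    have za: "0 < cmod (z - a)" using nz a by auto
    have "cmod (H z) * exp (kZ Z z) <= 48 / (c * dl) * M"
    proof (rule HkPsi[OF zd nz, of "c * (cmod (z - a) / (3 * bd a))"])
     show "0 < c * (cmod (z - a) / (3 * bd a))" using c za ba by simp
     have "c * (cmod (z - a) / (3 * bd a)) * exp (kZ Z z) <= c * pshyp z a * exp (kZ Z z)"
      using c ps[OF a zr] by (intro mult_right_mono mult_left_mono) auto
     also have "... <= cmod (\<Psi> z)"
      using zr by (intro Psi_ge_near[OF zd a]) (simp add: dist_norm norm_minus_commute)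
     finally show "c * (cmod (z - a) / (3 * bd a)) * exp (kZ Z z) <= cmod (\<Psi> z)" .
     have "cmod (h z) / (c * (cmod (z - a) / (3 * bd a))) <= (16 * M / (dl * bd a) * cmod (z - a)) / (c * (cmod (z - a) / (3 * bd a)))"
      using hz c za ba by (intro divide_right_mono) auto
     also have "... = 48 / (c * dl) * M" using c za ba delta by (simp add: field_simps)
     finally show "cmod (h z) / (c * (cmod (z - a) / (3 * bd a))) <= 48 / (c * dl) * M" .
    qed
    then have "(cmod (H z) * exp (kZ Z z)) powr p <= (48 / (c * dl) * M) powr p"
     using p by (intro powr_mono2) auto
    also have "... = (48 / (c * dl)) powr p * M powr p" by (rule powr_mult)
    also have "M powr p = Cm / (?r a)^2 * I" unfolding M_def using p Cm I by (simp add: powr_powr)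
    finally have "ennreal ((cmod (H z) * exp (kZ Z z)) powr p) <= ennreal ((48 / (c * dl)) powr p * Cm / (?r a)^2 * I)"
     by (intro ennreal_leI) simp
    also have "... = ?X a" unfolding I(1) using Cm I by (intro ennreal_mult) auto
    finally show ?thesis .
   qed
  qed
  define X where "X a = ?X a" for a
  define hh where "hh z = ennreal (cmod (h z) powr p) * indicator disc z" for z
  define gg where "gg n z = (\<Sum>a\<in>F n. X a * indicator (?N a) z)" for n z
  let ?G = "%n z. ennreal C1 * hh z + gg n z"
  have hm: "hh \<in> borel_measurable borel"
   using nn_meas[OF holomorphic_on_imp_continuous_on[OF h] sets_disc p(1)] by (simp only: hh_def[abs_def])
  have Gm: "gg n \<in> borel_measurable borel" for n
   unfolding gg_def[abs_def]
   by (intro borel_measurable_sum borel_measurable_times_ennreal borel_measurable_const borel_measurable_indicator) simp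
  have [measurable]: "hh \<in> borel_measurable borel" "gg n \<in> borel_measurable borel" for n
   by (rule hm, rule Gm)
  have GM: "?G n \<in> borel_measurable lborel" for n by measurable
  have Bh: "(NN z. hh z) = Bint p h" by (simp only: Bint_def hh_def)
  have ae: "AE z in lborel. z \<notin> Z"
   using countable_Z by (intro AE_not_in countable_imp_null_set_lborel)
  \<comment> \<open>The sum over Z is replaced by the finite sums over \<open>F n\<close>; a point
    of one of the small balls is covered for all large n, and Fatou's lemma brings the liminf
    outside.\<close>
  have "wint p H <= (NN z. liminf (%n. ?G n z))"
   unfolding wint_def
  proof (rule nn_integral_mono_AE, use ae in eventually_elim)
   fix z :: complex assume nz: "z \<notin> Z"
   show "ennreal ((cmod (H z) * exp (kZ Z z)) powr p) * indicator disc z <= liminf (%n. ?G n z)"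
   proof (cases "z \<in> disc")
    case True
    have ev: "eventually (%n. ennreal ((cmod (H z) * exp (kZ Z z)) powr p) * indicator disc z <= ?G n z) sequentially"
    proof (cases "\<exists>a\<in>Z. z \<in> ?N a")
     case False
     have "ennreal ((cmod (H z) * exp (kZ Z z)) powr p) * indicator disc z <= ennreal C1 * hh z"
      unfolding hh_def using pw1[OF True nz] False True C1 by (simp add: ennreal_mult)
     also have "... <= ?G n z" for n by simp
     finally show ?thesis by simp
    next
     case near: True
     then obtain a where a: "a \<in> Z" "z \<in> ?N a" by blast
     have "eventually (%n. finite (F n) \<and> {a} \<subseteq> F n \<and> F n \<subseteq> Z) sequentially"
      using F(3) a unfolding filterlim_finite_subsets_at_top by blast
     then show ?thesis
     proof eventually_elim
      case (elim n)
      have "ennreal ((cmod (H z) * exp (kZ Z z)) powr p) * indicator disc z <= X a * indicator (?N a) z"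
       unfolding X_def using pw2[OF a nz] a(2) True by simp
      also have "... <= gg n z"
       unfolding gg_def using elim by (intro member_le_sum) auto
      also have "... <= ?G n z" by simp
      finally show ?case .
     qed
    qed
    show ?thesis by (rule Liminf_bounded[OF ev])
   qed simp
  qed
  also have "... <= liminf (%n. NN z. ?G n z)"
   by (rule nn_integral_liminf) (rule GM)
  also have "... <= liminf (%n::nat. ennreal (C1 + C2) * Bint p h)"
  proof (intro Liminf_mono always_eventually allI)
   fix n
   have "(NN z. ?G n z) = ennreal C1 * Bint p h + (NN z. gg n z)"
    by (subst nn_integral_add) (simp_all add: nn_integral_cmult Bh)
   also have "(NN z. gg n z) = (\<Sum>a\<in>F n. NN z. X a * indicator (?N a) z)"
    unfolding gg_def
    by (intro nn_integral_sum borel_measurable_times_ennreal borel_measurable_const borel_measurable_indicator) simp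
   also have "... = (\<Sum>a\<in>F n. X a * emeasure lborel (?N a))"
    by (intro sum.cong nn_integral_cmult_indicator) auto
   also have "... <= (\<Sum>a\<in>F n. ennreal C2 * ?I a)"
   proof (rule sum_mono)
    fix a assume "a \<in> F n"
    then have ba: "0 < bd a" using F(2) in_disc bd_pos by blast
    have "emeasure lborel (?N a) = ennreal (pi * (dl / 8 * bd a)^2)"
     using ba delta by (intro emeasure_ball_complex) simp
    then have "X a * emeasure lborel (?N a) = ennreal ((48 / (c * dl)) powr p * Cm / (?r a)^2) * ennreal (pi * (dl / 8 * bd a)^2) * ?I a"
     by (simp only: X_def mult_ac)
    also have "ennreal ((48 / (c * dl)) powr p * Cm / (?r a)^2) * ennreal (pi * (dl / 8 * bd a)^2)
      = ennreal ((48 / (c * dl)) powr p * Cm / (?r a)^2 * (pi * (dl / 8 * bd a)^2))"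
     using Cm by (intro ennreal_mult[symmetric]) auto
    also have "(48 / (c * dl)) powr p * Cm / (?r a)^2 * (pi * (dl / 8 * bd a)^2) = C2 / 16"
     using ba delta by (simp add: C2_def field_simps power2_eq_square)
    also have "ennreal (C2 / 16) * ?I a <= ennreal C2 * ?I a"
     using C2 by (intro mult_right_mono ennreal_leI) auto
    finally show "X a * emeasure lborel (?N a) <= ennreal C2 * ?I a" .
   qed
   also have "... = ennreal C2 * (\<Sum>a\<in>F n. ?I a)" by (simp add: sum_distrib_left)
   also have "(\<Sum>a\<in>F n. ?I a) <= Bint p h"
   proof -
    have "(\<Sum>a\<in>F n. ?I a) = (\<Sum>a\<in>F n. nn_set (ball a (?r a)) (%z. (ennreal (cmod (h z) powr p) * indicator disc z)))"
    proof (intro sum.cong refl nn_integral_cong)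
     fix a z assume "a \<in> F n"
     then show "ennreal (cmod (h z) powr p) * indicator (ball a (?r a)) z = ennreal (cmod (h z) powr p) * indicator disc z * indicator (ball a (?r a)) z"
     proof (cases "z \<in> ball a (?r a)")
      case True
      then have "z \<in> disc" using near_ball_disc[of a] F(2) \<open>a \<in> F n\<close> by blast
      then show ?thesis by simp
     qed simp
    qed
    also have "... <= (nn_set disc (%z. (ennreal (cmod (h z) powr p) * indicator disc z)))"
     using esep_Z Z_disc delta(2) F hm by (intro esep_sum_integral_le) (auto simp: hh_def[abs_def])
    also have "... = Bint p h" unfolding Bint_def by (intro nn_integral_cong) (auto simp: indicator_def)
    finally show ?thesis .
   qed
   finally have "(NN z. ?G n z) <= ennreal C1 * Bint p h + ennreal C2 * Bint p h"
    by (simp add: mult_left_mono add_left_mono)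
   also have "... = ennreal (C1 + C2) * Bint p h"
    using C1 C2 by (simp add: distrib_right ennreal_plus)
   finally show "(NN z. ?G n z) <= ennreal (C1 + C2) * Bint p h" .
  qed
  also have "... = ennreal (C1 + C2) * Bint p h" by (rule Liminf_const) simp
  finally show "wint p H <= ennreal (C1 + C2) * Bint p h" .
 qed
qed

text \<open>H is the interpolating function g, times the Blaschke factor at a, divided by
  \<open>\<Psi>\<close>. That factor and \<open>\<Psi>\<close> vanish to the same order at a, so H
  does not degenerate there, and g stays above 1/2 near a by \<open>half_lower\<close>.\<close>

lemma peak_near:
 assumes p: "0 < p" "p <= 1" and int: "interpolating p Z"
 shows "\<exists>r C. 0 < r \<and> r <= 1/4 \<and> 0 < C \<and> (\<forall>a\<in>Z. \<exists>H. H holomorphic_on disc \<and>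
   (\<forall>z\<in>ball a (r * bd a). 1 <= cmod (H z) * exp (kZ Z z)) \<and> wint p H <= ennreal (C * (bd a)^2))"
proof -
 obtain M where M: "0 < M" "!!a. a \<in> Z ==> \<exists>g. g holomorphic_on disc \<and> g a = 1 \<and> (\<forall>b\<in>Z. b ~= a --> g b = 0) \<and>
   Bint p g <= ennreal (M * (bd a)^2)" using uniform_interp[OF p int] by blast
 obtain r where r: "0 < r" "r <= 1/4" "!!f ze z. f holomorphic_on disc ==> ze \<in> disc ==> f ze = 1 ==> Bint p f <= ennreal (M * (bd ze)^2)
   ==> z\<in>ball ze (r * bd ze) ==> 1/2 <= cmod (f z)" using half_lower[OF p M(1)] by blast
 obtain C where C: "0 < C" "!!h H. h holomorphic_on disc ==> H holomorphic_on disc ==> (\<forall>a\<in>Z. h a = 0) ==> (\<forall>z\<in>disc. h z = H z * \<Psi> z)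
   ==> wint p H <= ennreal C * Bint p h" using division_bound[OF p] by blast
 \<comment> \<open>2 undoes \<open>1/2 <= cmod (g z)\<close>, and \<open>exp (1/2)\<close> is the
   constant of \<open>Psi_le_near\<close>.\<close>
 define s where "s = 2 * exp (1/2 :: real)"
 have s: "0 < s" by (simp add: s_def)
 show ?thesis
 proof (rule exI[of _ r], rule exI[of _ "s powr p * (C * M)"], intro conjI r ballI)
  show "0 < s powr p * (C * M)" using s C M by simp
  fix a assume a: "a \<in> Z"
  have ad: "a \<in> disc" using in_disc[OF a] .
  have ba: "0 < bd a" using bd_pos[OF ad] .
  obtain g where g: "g holomorphic_on disc" "g a = 1" "!!b. b \<in> Z ==> b ~= a ==> g b = 0"
   "Bint p g <= ennreal (M * (bd a)^2)" using M(2)[OF a] by blast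
  define h where "h z = (z - a) / (1 - cnj a * z) * g z" for z
  have h: "h holomorphic_on disc" unfolding h_def using g(1) kern_nz[OF ad] by (intro holomorphic_intros) auto
  have h0: "\<forall>b\<in>Z. h b = 0" using g(3) by (auto simp: h_def)
  obtain H where H: "H holomorphic_on disc" "\<forall>z\<in>disc. h z = H z * \<Psi> z"
   using quotient_holomorphic[OF h] h0 by blast
  have nh: "cmod (h z) = pshyp z a * cmod (g z)" for z by (simp only: h_def norm_mult pshyp_def)
  have "Bint p h <= Bint p g"
   unfolding Bint_def
  proof (intro nn_integral_mono)
   fix z show "ennreal (cmod (h z) powr p) * indicator disc z <= ennreal (cmod (g z) powr p) * indicator disc z"
   proof (cases "z \<in> disc")
    case True
    have "cmod (h z) <= 1 * cmod (g z)" unfolding nh using pshyp_le_1[OF ad True] by (intro mult_right_mono) auto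
    then show ?thesis using p True by (auto intro!: ennreal_leI powr_mono2)
   qed simp
  qed
  then have "wint p H <= ennreal C * ennreal (M * (bd a)^2)"
   using C(2)[OF h H(1) h0 H(2)] g(4) by (meson mult_left_mono order_trans zero_le)
  also have "... = ennreal (C * (M * (bd a)^2))" using C M by (intro ennreal_mult[symmetric]) auto
  finally have wH: "wint p H <= ennreal (C * (M * (bd a)^2))" .
  have low1: "1 <= s * cmod (H z) * exp (kZ Z z)" if z: "z \<in> ball a (r * bd a)" "z ~= a" for z
  proof -
   have zd: "z \<in> disc" using ball_bd_subset_disc[OF ad, of r] r z by auto
   have g2: "1/2 <= cmod (g z)" by (rule r(3)[OF g(1) ad g(2,4) z(1)])
   have pp: "0 < pshyp z a" unfolding pshyp_eq using z kern_pos[OF ad zd] by (intro divide_pos_pos) auto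
   have "pshyp z a * (1/2) <= cmod (h z)" unfolding nh using g2 pp by (intro mult_left_mono) auto
   also have "cmod (h z) = cmod (H z) * cmod (\<Psi> z)" using H(2) zd by (simp add: norm_mult)
   also have "... <= cmod (H z) * (exp (1/2) * pshyp z a * exp (kZ Z z))"
    by (intro mult_left_mono Psi_le_near zd a) auto
   finally have "pshyp z a * 1 <= pshyp z a * (s * cmod (H z) * exp (kZ Z z))" by (simp add: s_def mult_ac)
   then show ?thesis using pp by simp
  qed
  \<comment> \<open>At a itself \<open>pshyp z a\<close> is 0 and cannot be cancelled, so the bound
    is obtained as a limit.\<close>
  have low2: "1 <= s * cmod (H a) * exp (kZ Z a)"
  proof -
   have "continuous (at a) H" "continuous (at a) (kZ Z)"
    using continuous_kZ holomorphic_on_imp_continuous_on[OF H(1)] ad open_disc continuous_on_eq_continuous_at by blast+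
   then have "((%z. s * cmod (H z) * exp (kZ Z z)) \<longlongrightarrow> s * cmod (H a) * exp (kZ Z a)) (at a)"
    by (intro tendsto_intros) (auto simp: continuous_at)
   moreover have "\<forall>\<^sub>F z in at a. z \<in> ball a (r * bd a) - {a}"
    using ba r by (intro eventually_at_in_open) auto
   then have "\<forall>\<^sub>F z in at a. 1 <= s * cmod (H z) * exp (kZ Z z)"
    by eventually_elim (use low1 in auto)
   ultimately show ?thesis by (rule tendsto_lowerbound) simp
  qed
  have cH: "continuous_on disc H" using H(1) by (rule holomorphic_on_imp_continuous_on)
  have "wint p (%z. of_real s * H z) <= ennreal (s powr p) * ennreal (C * (M * (bd a)^2))"
   unfolding wint_cmult[OF cH p(1)] using s wH by (simp add: mult_left_mono)
  also have "... = ennreal (s powr p * (C * (M * (bd a)^2)))" using C M by (intro ennreal_mult[symmetric]) auto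
  also have "s powr p * (C * (M * (bd a)^2)) = s powr p * (C * M) * (bd a)^2" by simp
  finally have "wint p (%z. of_real s * H z) <= ennreal (s powr p * (C * M) * (bd a)^2)" .
  moreover have "1 <= cmod (of_real s * H z) * exp (kZ Z z)" if "z \<in> ball a (r * bd a)" for z
   using low1[OF that] low2 s by (cases "z = a") (auto simp: norm_mult)
  moreover have "(%z. of_real s * H z) holomorphic_on disc" using H(1) by (intro holomorphic_intros)
  ultimately show "\<exists>H. H holomorphic_on disc \<and> (\<forall>z\<in>ball a (r * bd a). 1 <= cmod (H z) * exp (kZ Z z)) \<and>
    wint p H <= ennreal (s powr p * (C * M) * (bd a)^2)" by blast
 qed
qed

text \<open>Start from the kernel power G, equal to 1 at ze, and let \<phi> be the Blaschke factor
  at ze. The series h takes the values G / \<phi> on Z, so G - \<phi> h vanishes on Z and still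
  equals 1 at ze; division by \<open>\<Psi>\<close> gives H up to a constant. The distance of ze
  from Z keeps |\<phi>| away from 0 on Z.\<close>

lemma peak_far:
 assumes p: "0 < p" "p <= 1" and int: "interpolating p Z" and r1: "0 < r1" "r1 <= 1"
 shows "\<exists>r C. 0 < r \<and> r <= 1/4 \<and> 0 < C \<and> (\<forall>ze\<in>disc. (\<forall>a\<in>Z. r1 * bd a <= cmod (ze - a)) --> (\<exists>H. H holomorphic_on disc \<and>
   (\<forall>z\<in>ball ze (r * bd ze). 1 <= cmod (H z) * exp (kZ Z z)) \<and> wint p H <= ennreal (C * (bd ze)^2)))"
proof -
 obtain M where M: "0 < M" "\<forall>a\<in>Z. \<exists>g. g holomorphic_on disc \<and> g a = 1 \<and> (\<forall>b\<in>Z. b ~= a --> g b = 0) \<and>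
   Bint p g <= ennreal (M * (bd a)^2)" using uniform_interp[OF p int] by blast
 from bchoice[OF M(2)] obtain g where g: "!!a. a \<in> Z ==> g a holomorphic_on disc" "!!a. a \<in> Z ==> g a a = 1"
  "!!a b. a \<in> Z ==> b \<in> Z ==> b ~= a ==> g a b = 0" "!!a. a \<in> Z ==> Bint p (g a) <= ennreal (M * (bd a)^2)" by blast
 \<comment> \<open>n is large enough that |G|^p decays with an exponent N > 2, as
   \<open>kern_integral\<close> and \<open>esep_kern_sum\<close> require.\<close>
 obtain n :: nat where n: "3 / p < real n" using reals_Archimedean2 by blast
 define N where "N = real n * p"
 have N: "2 < N" using n p by (simp add: N_def field_simps)
 obtain CI where CI: "0 < CI" "!!z. z \<in> disc ==> (nn_set disc (%w. ennreal (cmod (1 - cnj w * z) powr (-N))))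
    <= ennreal (CI * bd z powr (2 - N))" by (rule kern_integral[OF N]) (rule that)
 obtain CS where CS: "0 < CS"
  "!!S F z. esep dl S ==> S \<subseteq> disc ==> finite F ==> F \<subseteq> S ==> z \<in> disc ==>
   (\<Sum>a\<in>F. (bd a)^2 * cmod (1 - cnj a * z) powr (-N)) <= CS * bd z powr (2 - N)"
  by (rule esep_kern_sum[OF N delta]) (rule that)
 define C1 where "C1 = 2 powr N * CI"
 define C2 where "C2 = (3 / r1) powr p * M * (2 powr N * CS)"
 have C12: "0 < C1" "0 < C2" using CI CS M r1 by (auto simp: C1_def C2_def)
 obtain r where r: "0 < r" "r <= 1/4" "!!f ze z. f holomorphic_on disc ==> ze \<in> disc ==> f ze = 1 ==> Bint p f <= ennreal ((C1 + C2) * (bd ze)^2)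
   ==> z\<in>ball ze (r * bd ze) ==> 1/2 <= cmod (f z)" using half_lower[OF p, of "C1 + C2"] C12 by auto
 obtain C where C: "0 < C" "!!h H. h holomorphic_on disc ==> H holomorphic_on disc ==> (\<forall>a\<in>Z. h a = 0) ==> (\<forall>z\<in>disc. h z = H z * \<Psi> z)
   ==> wint p H <= ennreal C * Bint p h" using division_bound[OF p] by blast
 show ?thesis
 proof (rule exI[of _ r], rule exI[of _ "2 powr p * (C * (C1 + C2))"], intro conjI r ballI impI)
  show "0 < 2 powr p * (C * (C1 + C2))" using C C12 by simp
  fix ze assume zd: "ze \<in> disc" and far: "\<forall>a\<in>Z. r1 * bd a <= cmod (ze - a)"
  have bz: "0 < bd ze" using bd_pos[OF zd] .
  define d where "d = 1 - (cmod ze)^2"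
  have d: "0 < d" "d <= 2 * bd ze" using bd_square_le[OF zd] bz square_le_bd[of ze] by (auto simp: d_def)
  define G where "G z = (of_real d / (1 - cnj ze * z)) ^ n" for z
  define \<phi> where "\<phi> z = (z - ze) / (1 - cnj ze * z)" for z
  have G: "G holomorphic_on disc" unfolding G_def using kern_nz[OF zd] by (intro holomorphic_intros) auto
  have phi: "\<phi> holomorphic_on disc" unfolding \<phi>_def using kern_nz[OF zd] by (intro holomorphic_intros) auto
  have nG: "cmod (G z) powr p = d powr N * cmod (1 - cnj z * ze) powr (-N)" if "z \<in> disc" for z
  proof -
   have k: "0 < cmod (1 - cnj ze * z)" using kern_pos[OF zd that] .
   have "cmod (G z) = (d / cmod (1 - cnj ze * z)) ^ n"
    using d by (simp add: G_def norm_power norm_divide)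
   also have "... = (d / cmod (1 - cnj ze * z)) powr real n" using d k by (simp add: powr_realpow)
   finally have "cmod (G z) powr p = (d / cmod (1 - cnj ze * z)) powr N" by (simp add: powr_powr N_def)
   also have "... = d powr N * cmod (1 - cnj ze * z) powr (-N)"
    using d k by (simp add: powr_divide powr_minus_divide)
   finally show ?thesis by (simp only: kern_sym)
  qed
  have dN: "d powr N * bd ze powr (2 - N) <= 2 powr N * (bd ze)^2"
  proof -
   have "d powr N <= (2 * bd ze) powr N" using d N by (intro powr_mono2) auto
   then have "d powr N * bd ze powr (2 - N) <= (2 * bd ze) powr N * bd ze powr (2 - N)" by (intro mult_right_mono) auto
   also have "... = 2 powr N * (bd ze powr N * bd ze powr (2 - N))" by (simp add: powr_mult)
   also have "bd ze powr N * bd ze powr (2 - N) = (bd ze)^2" using bz by (simp flip: powr_add)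
   finally show ?thesis .
  qed
  have BG: "Bint p G <= ennreal (C1 * (bd ze)^2)"
  proof -
   have km: "(%z. ennreal (cmod (1 - cnj z * ze) powr (-N)) * indicator disc z) \<in> borel_measurable lborel"
   proof -
    have [measurable]: "(%w. cmod (1 - cnj w * ze)) \<in> borel_measurable borel"
     by (intro borel_measurable_continuous_onI continuous_intros)
    show ?thesis by measurable
   qed
   have "Bint p G = (NN z. ennreal (d powr N) * (ennreal (cmod (1 - cnj z * ze) powr (-N)) * indicator disc z))"
    unfolding Bint_def
   proof (intro nn_integral_cong)
    fix z show "ennreal (cmod (G z) powr p) * indicator disc z = ennreal (d powr N) * (ennreal (cmod (1 - cnj z * ze) powr (-N)) * indicator disc z)"
    proof (cases "z \<in> disc")
     case True
     show ?thesis unfolding nG[OF True] using True by (simp add: ennreal_mult)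
    qed simp
   qed
   also have "... = ennreal (d powr N) * (nn_set disc (%z. ennreal (cmod (1 - cnj z * ze) powr (-N))))"
    by (rule nn_integral_cmult[OF km])
   also have "... <= ennreal (d powr N) * ennreal (CI * bd ze powr (2 - N))"
    by (intro mult_left_mono CI zd) auto
   also have "... = ennreal (CI * (d powr N * bd ze powr (2 - N)))"
    using CI by (simp add: ennreal_mult mult_ac)
   also have "... <= ennreal (C1 * (bd ze)^2)"
    using dN CI by (intro ennreal_leI) (simp add: C1_def mult_ac)
   finally show ?thesis .
  qed
  define cf where "cf a = G a / \<phi> a" for a
  have phi_low: "r1 / 3 <= cmod (\<phi> a)" if a: "a \<in> Z" for a
  proof -
   have ad: "a \<in> disc" using in_disc[OF a] .
   have f: "r1 * bd a <= cmod (ze - a)" using far a by blast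
   have "cmod (1 - cnj ze * a) = cmod (1 - cnj a * ze)" by (rule kern_sym)
   also have "... <= 2 * bd a + cmod (ze - a)" by (rule kern_upper[OF ad])
   finally have "r1 * cmod (1 - cnj ze * a) <= r1 * (2 * bd a + cmod (ze - a))" using r1 by (intro mult_left_mono) auto
   also have "... = 2 * (r1 * bd a) + r1 * cmod (ze - a)" by (simp add: algebra_simps)
   also have "... <= 2 * cmod (ze - a) + 1 * cmod (ze - a)" using f r1 by (intro add_mono mult_left_mono mult_right_mono) auto
   finally have "r1 * cmod (1 - cnj ze * a) <= 3 * cmod (a - ze)" by (simp add: norm_minus_commute)
   then show ?thesis using kern_pos[OF zd ad] by (simp add: \<phi>_def norm_divide field_simps)
  qed
  have bnd: "(\<Sum>a\<in>F. Bint p (%z. cf a * g a z)) <= ennreal (C2 * (bd ze)^2)" if F: "finite F" "F \<subseteq> Z" for F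
  proof -
   have "(\<Sum>a\<in>F. Bint p (%z. cf a * g a z)) <= (\<Sum>a\<in>F. ennreal ((3 / r1) powr p * M * d powr N * ((bd a)^2 * cmod (1 - cnj a * ze) powr (-N))))"
   proof (rule sum_mono)
    fix a assume "a \<in> F"
    then have a: "a \<in> Z" using F by auto
    have ad: "a \<in> disc" using in_disc[OF a] .
    have "cmod (cf a) <= cmod (G a) / (r1 / 3)"
     unfolding cf_def norm_divide using phi_low[OF a] r1 by (intro divide_left_mono) (auto intro!: mult_pos_pos order_less_le_trans[OF _ phi_low[OF a]])
    then have "cmod (cf a) powr p <= (cmod (G a) * (3 / r1)) powr p" using p by (intro powr_mono2) auto
    also have "... = (3 / r1) powr p * (d powr N * cmod (1 - cnj a * ze) powr (-N))"
     unfolding powr_mult nG[OF ad] by simp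
    finally have e: "cmod (cf a) powr p <= (3 / r1) powr p * (d powr N * cmod (1 - cnj a * ze) powr (-N))" .
    have "Bint p (%z. cf a * g a z) = ennreal (cmod (cf a) powr p) * Bint p (g a)"
     using g(1)[OF a] p holomorphic_on_imp_continuous_on by (intro Bint_cmult) auto
    also have "... <= ennreal ((3 / r1) powr p * (d powr N * cmod (1 - cnj a * ze) powr (-N))) * ennreal (M * (bd a)^2)"
     using g(4)[OF a] e by (intro mult_mono ennreal_leI) auto
    also have "... = ennreal ((3 / r1) powr p * (d powr N * cmod (1 - cnj a * ze) powr (-N)) * (M * (bd a)^2))"
     using M by (intro ennreal_mult[symmetric]) auto
    finally show "Bint p (%z. cf a * g a z) <= ennreal ((3 / r1) powr p * M * d powr N * ((bd a)^2 * cmod (1 - cnj a * ze) powr (-N)))"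
     by (simp add: mult_ac)
   qed
   also have "... = ennreal (\<Sum>a\<in>F. (3 / r1) powr p * M * d powr N * ((bd a)^2 * cmod (1 - cnj a * ze) powr (-N)))"
    using M by (intro sum_ennreal) auto
   also have "... <= ennreal (C2 * (bd ze)^2)"
   proof (rule ennreal_leI)
    have "(\<Sum>a\<in>F. (3 / r1) powr p * M * d powr N * ((bd a)^2 * cmod (1 - cnj a * ze) powr (-N)))
     = (3 / r1) powr p * M * d powr N * (\<Sum>a\<in>F. (bd a)^2 * cmod (1 - cnj a * ze) powr (-N))"
     by (simp add: sum_distrib_left)
    also have "... <= (3 / r1) powr p * M * d powr N * (CS * bd ze powr (2 - N))"
     using M CS(2)[OF esep_Z Z_disc F zd] by (intro mult_left_mono) auto
    also have "... = (3 / r1) powr p * M * CS * (d powr N * bd ze powr (2 - N))" by simp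
    also have "... <= (3 / r1) powr p * M * CS * (2 powr N * (bd ze)^2)"
     using M CS dN by (intro mult_left_mono) auto
    finally show "(\<Sum>a\<in>F. (3 / r1) powr p * M * d powr N * ((bd a)^2 * cmod (1 - cnj a * ze) powr (-N))) <= C2 * (bd ze)^2"
     by (simp add: C2_def mult_ac)
   qed
   finally show ?thesis .
  qed
  have "\<exists>h. h holomorphic_on disc \<and> Bint p h <= ennreal (C2 * (bd ze)^2) \<and> (\<forall>z\<in>disc. ((%a. cf a * g a z) has_sum h z) Z)"
   using C12 g(1) bnd by (intro Bergman_series p holomorphic_intros) auto
  then obtain h where h: "h holomorphic_on disc" "Bint p h <= ennreal (C2 * (bd ze)^2)"
   "!!z. z \<in> disc ==> ((%a. cf a * g a z) has_sum h z) Z" by blast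
  have hb: "h b = cf b" if b: "b \<in> Z" for b
  proof -
   have "((%a. cf a * g a b) has_sum cf b) {b}" using g(2)[OF b] has_sum_finite[of "{b}" "%a. cf a * g a b"] by simp
   then have "((%a. cf a * g a b) has_sum cf b) Z"
    by (rule has_sum_cong_neutral[THEN iffD1, rotated -1]) (use b g(3) in auto)
   with h(3)[OF in_disc[OF b]] show ?thesis by (rule has_sum_unique)
  qed
  define f where "f z = G z + \<phi> z * ((-1) * h z)" for z
  have f: "f holomorphic_on disc" unfolding f_def using G phi h(1) by (intro holomorphic_intros)
  have f1: "f ze = 1"
  proof -
   have "1 - cnj ze * ze = of_real d"
    unfolding d_def of_real_diff of_real_1 complex_norm_square by (simp add: mult.commute)
   then have "G ze = 1" using d by (simp add: G_def)
   then show ?thesis by (simp add: f_def \<phi>_def)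
  qed
  have f0: "\<forall>a\<in>Z. f a = 0"
  proof
   fix a assume a: "a \<in> Z"
   have "\<phi> a ~= 0" using phi_low[OF a] r1 by auto
   then show "f a = 0" by (simp add: f_def hb[OF a] cf_def)
  qed
  have Bf: "Bint p f <= ennreal ((C1 + C2) * (bd ze)^2)"
  proof -
   have ch: "continuous_on disc h" "continuous_on disc G" "continuous_on disc \<phi>"
    using h(1) G phi holomorphic_on_imp_continuous_on by auto
   have "Bint p f <= Bint p G + Bint p (%z. \<phi> z * ((-1) * h z))"
    unfolding f_def using ch p by (intro Bint_add continuous_intros)
   also have "Bint p (%z. \<phi> z * ((-1) * h z)) <= Bint p h"
    unfolding Bint_def
   proof (intro nn_integral_mono)
    fix z show "ennreal (cmod (\<phi> z * ((-1) * h z)) powr p) * indicator disc z <= ennreal (cmod (h z) powr p) * indicator disc z"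
    proof (cases "z \<in> disc")
     case True
     have "cmod (\<phi> z) <= 1" using pshyp_le_1[OF zd True] by (simp add: \<phi>_def pshyp_def)
     then have "cmod (\<phi> z * ((-1) * h z)) <= 1 * cmod (h z)"
      unfolding norm_mult by (intro mult_mono) auto
     then show ?thesis using p True by (auto intro!: ennreal_leI powr_mono2)
    qed simp
   qed
   also have "Bint p G + Bint p h <= ennreal (C1 * (bd ze)^2) + ennreal (C2 * (bd ze)^2)"
    by (intro add_mono BG h(2))
   also have "... = ennreal ((C1 + C2) * (bd ze)^2)"
    using C12 by (simp add: distrib_right ennreal_plus)
   finally show ?thesis by (simp add: add_left_mono)
  qed
  obtain H where H: "H holomorphic_on disc" "\<forall>z\<in>disc. f z = H z * \<Psi> z"
   using quotient_holomorphic[OF f] f0 by blast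
  have "wint p H <= ennreal C * ennreal ((C1 + C2) * (bd ze)^2)"
   using C(2)[OF f H(1) f0 H(2)] Bf by (meson mult_left_mono order_trans zero_le)
  also have "... = ennreal (C * ((C1 + C2) * (bd ze)^2))" using C C12 by (intro ennreal_mult[symmetric]) auto
  finally have wH: "wint p H <= ennreal (C * ((C1 + C2) * (bd ze)^2))" .
  have low: "1 <= 2 * cmod (H z) * exp (kZ Z z)" if z: "z \<in> ball ze (r * bd ze)" for z
  proof -
   have zz: "z \<in> disc" using ball_bd_subset_disc[OF zd, of r] r z by auto
   have "1/2 <= cmod (f z)" by (rule r(3)[OF f zd f1 Bf z])
   also have "cmod (f z) = cmod (H z) * cmod (\<Psi> z)" using H(2) zz by (simp add: norm_mult)
   also have "... <= cmod (H z) * exp (kZ Z z)" by (intro mult_left_mono Psi_le zz) auto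
   finally show ?thesis by simp
  qed
  have cH: "continuous_on disc H" using H(1) by (rule holomorphic_on_imp_continuous_on)
  have "wint p (%z. of_real 2 * H z) <= ennreal (2 powr p) * ennreal (C * ((C1 + C2) * (bd ze)^2))"
   unfolding wint_cmult[OF cH p(1)] using wH by (simp add: mult_left_mono)
  also have "... = ennreal (2 powr p * (C * ((C1 + C2) * (bd ze)^2)))" using C C12 by (intro ennreal_mult[symmetric]) auto
  also have "2 powr p * (C * ((C1 + C2) * (bd ze)^2)) = 2 powr p * (C * (C1 + C2)) * (bd ze)^2" by simp
  finally have "wint p (%z. of_real 2 * H z) <= ennreal (2 powr p * (C * (C1 + C2)) * (bd ze)^2)" .
  moreover have "1 <= cmod (of_real 2 * H z) * exp (kZ Z z)" if "z \<in> ball ze (r * bd ze)" for z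
   using low[OF that] by (simp add: norm_mult)
  moreover have "(%z. of_real 2 * H z) holomorphic_on disc" using H(1) by (intro holomorphic_intros)
  ultimately show "\<exists>H. H holomorphic_on disc \<and> (\<forall>z\<in>ball ze (r * bd ze). 1 <= cmod (H z) * exp (kZ Z z)) \<and>
    wint p H <= ennreal (2 powr p * (C * (C1 + C2)) * (bd ze)^2)" by blast
 qed
qed

text \<open>A point within \<open>r0 / 2 * bd a\<close> of some a in Z borrows the peak function of
  a; all others are covered by \<open>peak_far\<close>. In the first case \<open>bd ze\<close> and
  \<open>bd a\<close> agree up to a factor 2.\<close>

lemma peak_functions:
 assumes p: "0 < p" "p <= 1" and int: "interpolating p Z"
 shows "\<exists>r C. 0 < r \<and> r <= 1/4 \<and> 0 < C \<and> (\<forall>ze\<in>disc. \<exists>H. H holomorphic_on disc \<and>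
   (\<forall>z\<in>ball ze (r * bd ze). 1 <= cmod (H z) * exp (kZ Z z)) \<and> wint p H <= ennreal (C * (bd ze)^2))"
proof -
 obtain r0 C0 where 0: "0 < r0" "r0 <= 1/4" "0 < C0" "!!a. a \<in> Z ==> \<exists>H. H holomorphic_on disc \<and>
   (\<forall>z\<in>ball a (r0 * bd a). 1 <= cmod (H z) * exp (kZ Z z)) \<and> wint p H <= ennreal (C0 * (bd a)^2)"
  using peak_near[OF p int] by blast
 have "0 < r0 / 2" "r0 / 2 <= 1" using 0 by auto
 from peak_far[OF p int this] obtain r1 C1 where 1: "0 < r1" "r1 <= 1/4" "0 < C1"
  "!!ze. ze \<in> disc ==> \<forall>a\<in>Z. r0 / 2 * bd a <= cmod (ze - a) ==> \<exists>H. H holomorphic_on disc \<and>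
   (\<forall>z\<in>ball ze (r1 * bd ze). 1 <= cmod (H z) * exp (kZ Z z)) \<and> wint p H <= ennreal (C1 * (bd ze)^2)"
  by blast
 \<comment> \<open>With \<open>r <= r0 / 4\<close> and \<open>bd ze <= 2 * bd a\<close> the ball
   about ze has radius at most \<open>r0 / 2 * bd a\<close>, so it stays in the ball about
   a.\<close>
 define r where "r = min r1 (r0 / 4)"
 define C where "C = max C1 (4 * C0)"
 have r: "0 < r" "r <= 1/4" "r <= r1" "r <= r0 / 4" using 0 1 by (auto simp: r_def)
 show ?thesis
 proof (rule exI[of _ r], rule exI[of _ C], intro conjI r ballI)
  show "0 < C" using 1 by (simp add: C_def)
  fix ze assume zd: "ze \<in> disc"
  have bz: "0 < bd ze" using bd_pos[OF zd] .
  show "\<exists>H. H holomorphic_on disc \<and> (\<forall>z\<in>ball ze (r * bd ze). 1 <= cmod (H z) * exp (kZ Z z)) \<and> wint p H <= ennreal (C * (bd ze)^2)"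
  proof (cases "\<forall>a\<in>Z. r0 / 2 * bd a <= cmod (ze - a)")
   case True
   obtain H where H: "H holomorphic_on disc" "!!z. z\<in>ball ze (r1 * bd ze) ==> 1 <= cmod (H z) * exp (kZ Z z)" "wint p H <= ennreal (C1 * (bd ze)^2)"
    using 1(4)[OF zd True] by blast
   have "r * bd ze <= r1 * bd ze" using r bz by (intro mult_right_mono) auto
   then have "ball ze (r * bd ze) \<subseteq> ball ze (r1 * bd ze)" by (rule subset_ball)
   moreover have "ennreal (C1 * (bd ze)^2) <= ennreal (C * (bd ze)^2)"
    by (intro ennreal_leI mult_right_mono) (auto simp: C_def)
   ultimately show ?thesis using H order_trans by blast
  next
   case False
   then obtain a where a: "a \<in> Z" "cmod (ze - a) < r0 / 2 * bd a" by (auto simp: not_le)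
   have ba: "0 < bd a" using bd_pos[OF in_disc[OF a(1)]] .
   obtain H where H: "H holomorphic_on disc" "!!z. z\<in>ball a (r0 * bd a) ==> 1 <= cmod (H z) * exp (kZ Z z)" "wint p H <= ennreal (C0 * (bd a)^2)"
    using 0(4)[OF a(1)] by blast
   have "r0 / 2 * bd a <= 1/2 * bd a" using 0 ba by (intro mult_right_mono) auto
   then have "cmod (ze - a) < 1/2 * bd a" using a(2) by linarith
   then have bb: "bd ze <= 2 * bd a" "bd a <= 2 * bd ze" using bd_diff[of ze a] by (auto simp: abs_le_iff)
   have "ball ze (r * bd ze) \<subseteq> ball a (r0 * bd a)"
   proof
    fix z assume "z \<in> ball ze (r * bd ze)"
    then have "dist ze z < r * bd ze" by simp
    also have "... <= r0 / 4 * (2 * bd a)" using r bb bz 0 by (intro mult_mono) auto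
    finally have "dist ze z < r0 / 2 * bd a" by simp
    then show "z \<in> ball a (r0 * bd a)" using a(2) dist_triangle[of a z ze] by (auto simp: dist_norm norm_minus_commute)
   qed
   moreover have "C0 * (bd a)^2 <= C * (bd ze)^2"
   proof -
    have "(bd a)^2 <= (2 * bd ze)^2" using bb ba by (intro power_mono) auto
    then have "C0 * (bd a)^2 <= C0 * (2 * bd ze)^2" using 0 by (intro mult_left_mono) auto
    also have "... = 4 * C0 * (bd ze)^2" by (simp add: power_mult_distrib)
    also have "... <= C * (bd ze)^2" by (intro mult_right_mono) (auto simp: C_def)
    finally show ?thesis .
   qed
   then have "ennreal (C0 * (bd a)^2) <= ennreal (C * (bd ze)^2)" by (rule ennreal_leI)
   ultimately show ?thesis using H order_trans by blast
  qed
 qed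
qed

end

section \<open>Cauchy transforms, nets and mixed norms\<close>

lemma epowr_ennreal: "0 <= x ==> epowr (ennreal x) r = ennreal (x powr r)"
 by (simp add: epowr_def)

lemma epowr_top [simp]: "epowr \<infinity> r = \<infinity>" "epowr top r = \<infinity>"
 by (simp_all add: epowr_def infinity_ennreal_def)

lemma epowr_less_top: "epowr x r < \<infinity> \<longleftrightarrow> x < \<infinity>"
 by (auto simp: epowr_def less_top)

lemma epowr_mono:
 assumes "x <= y" "0 <= r" shows "epowr x r <= epowr y r"
proof (cases "y = \<infinity>")
 case False
 then have "x ~= \<infinity>" using assms(1) by (auto simp: top_unique)
 have "enn2real x <= enn2real y" using assms(1) False by (intro enn2real_mono) (auto simp: less_top)
 then show ?thesis using False \<open>x ~= \<infinity>\<close> assms(2) by (auto simp: epowr_def intro!: ennreal_leI powr_mono2)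
qed simp

lemma epowr_cmult_le:
 assumes "0 < r" "0 <= K" "x <= ennreal K * y" "y < \<infinity>"
 shows "epowr x r <= ennreal (K powr r) * epowr y r"
proof -
 obtain b where b: "y = ennreal b" "0 <= b" using assms(4) by (cases y) auto
 have e: "ennreal K * y = ennreal (K * b)" unfolding b(1) using assms(2) b(2) by (intro ennreal_mult[symmetric])
 have "epowr x r <= epowr (ennreal (K * b)) r" using assms(1,3) unfolding e by (intro epowr_mono) auto
 also have "... = ennreal (K powr r * b powr r)" using assms b by (simp add: epowr_ennreal powr_mult)
 also have "... = ennreal (K powr r) * epowr y r" unfolding b(1) using b(2) by (simp add: epowr_ennreal ennreal_mult)
 finally show ?thesis .
qed

text \<open>Bounds the integral of g^p over a set of finite measure by that of g; l is the scale at
  which both terms on the right have the same size.\<close>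

lemma powr_split_le:
 fixes g l p :: real
 assumes "0 <= g" "0 < l" "0 < p" "p <= 1"
 shows "g powr p <= l powr p + l powr (p - 1) * g"
proof (cases "g <= l")
 case True
 then have "g powr p <= l powr p" using assms by (intro powr_mono2) auto
 moreover have "0 <= l powr (p - 1) * g" using assms by simp
 ultimately show ?thesis by linarith
next
 case False
 then have g: "0 < g" "l <= g" using assms by auto
 have "g powr p = g powr (p - 1) * g" using powr_add[of g "p - 1" 1] g by simp
 also have "... <= l powr (p - 1) * g" using assms g by (intro mult_right_mono powr_mono2') auto
 finally show ?thesis by (simp add: add.commute add_increasing)
qed

lemma split_powr_le:
 fixes g l q :: real
 assumes "0 <= g" "0 < l" "1 <= q"
 shows "g <= l + l powr (1 - q) * g powr q"
proof (cases "g <= l")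
 case True
 then show ?thesis by (simp add: add_increasing2)
next
 case False
 then have g: "0 < g" "l <= g" using assms by auto
 have "g = g powr (1 - q) * g powr q" using g by (simp flip: powr_add)
 also have "... <= l powr (1 - q) * g powr q" using assms g by (intro mult_right_mono powr_mono2') auto
 finally show ?thesis using assms by linarith
qed

text \<open>A substitute for Jensen's inequality that loses only a factor 2: integrate
 \<open>g <= l + l powr (1 - q) * g powr q\<close> with \<open>l\<close> slightly larger than the \<open>q\<close>-mean.\<close>
lemma mean_le_powr_mean:
 fixes g :: "complex => real"
 assumes q: "1 <= q" and A: "A \<in> sets borel" and m: "emeasure lborel A = ennreal m" "0 < m"
  and g: "!!w. 0 <= g w" and gm: "g \<in> borel_measurable borel"
 shows "(nn_set A (%w. ennreal (g w)))
  <= ennreal (2 * m) * epowr (ennreal (1 / m) * (nn_set A (%w. ennreal (g w powr q)))) (1 / q)"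
proof -
 let ?I = "nn_set A (%w. ennreal (g w powr q))"
 show ?thesis
 proof (cases "?I = \<infinity>")
  case True
  then show ?thesis using m by (simp add: ennreal_mult_top)
 next
  case False
  then obtain I where I: "?I = ennreal I" "0 <= I" by (cases ?I) auto
  define X where "X = (I / m) powr (1 / q)"
  have X: "0 <= X" "X powr q = I / m" using q m I by (auto simp: X_def powr_powr)
  have rhs: "ennreal (2 * m) * epowr (ennreal (1 / m) * ?I) (1 / q) = ennreal (2 * m * X)"
  proof -
   have "ennreal (1 / m) * ?I = ennreal (I / m)" unfolding I(1) using m I by (simp flip: ennreal_mult)
   then show ?thesis using m I X by (simp add: epowr_ennreal X_def ennreal_mult)
  qed
  \<comment> \<open>l is taken above X rather than equal to it: X may be 0, and
    \<open>split_powr_le\<close> contains a negative power of l.\<close>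
  have bnd: "(nn_set A (%w. ennreal (g w))) <= ennreal (2 * m * l)" if l: "X < l" for l
  proof -
   have l0: "0 < l" using l X by linarith
   have "(nn_set A (%w. ennreal (g w)))
    <= (NN w. ennreal l * indicator A w + ennreal (l powr (1 - q)) * (ennreal (g w powr q) * indicator A w))"
   proof (rule nn_integral_mono)
    fix w
    have "ennreal (g w) <= ennreal (l + l powr (1 - q) * g w powr q)"
     using split_powr_le[OF g l0 q] by (rule ennreal_leI)
    also have "... = ennreal l + ennreal (l powr (1 - q)) * ennreal (g w powr q)"
     using l0 by (simp add: ennreal_plus ennreal_mult)
    finally show "ennreal (g w) * indicator A w <= ennreal l * indicator A w + ennreal (l powr (1 - q)) * (ennreal (g w powr q) * indicator A w)"
     by (auto simp: indicator_def)
   qed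
   also have "... = ennreal l * emeasure lborel A + ennreal (l powr (1 - q)) * ?I"
   proof -
    have gq: "(%w. ennreal (g w powr q) * indicator A w) \<in> borel_measurable lborel"
     using gm A by measurable
    have 1: "(%w. ennreal l * indicator A w) \<in> borel_measurable lborel" using A by measurable
    show ?thesis
     using A by (subst nn_integral_add[OF 1 borel_measurable_times_ennreal[OF borel_measurable_const gq]])
      (simp add: nn_integral_cmult[OF gq] nn_integral_cmult_indicator)
   qed
   also have "... = ennreal (l * m + l powr (1 - q) * I)"
    unfolding m(1) I(1) using l0 m I by (simp add: ennreal_plus ennreal_mult)
   also have "... <= ennreal (2 * m * l)"
   proof (rule ennreal_leI)
    have "I = m * X powr q" using X m by simp
    also have "... <= m * l powr q" using X l m q by (intro mult_left_mono powr_mono2) auto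
    finally have "l powr (1 - q) * I <= l powr (1 - q) * (m * l powr q)" by (intro mult_left_mono) auto
    also have "... = m * (l powr (1 - q) * l powr q)" by simp
    also have "l powr (1 - q) * l powr q = l" using l0 by (simp flip: powr_add)
    finally show "l * m + l powr (1 - q) * I <= 2 * m * l" by (simp add: algebra_simps)
   qed
   finally show ?thesis .
  qed
  have "(nn_set A (%w. ennreal (g w))) <= ennreal (2 * m * (X + 1))" by (rule bnd) simp
  then have "(nn_set A (%w. ennreal (g w))) < \<infinity>" using ennreal_less_top le_less_trans by (metis infinity_ennreal_def)
  then obtain Y where Y: "(nn_set A (%w. ennreal (g w))) = ennreal Y" "0 <= Y"
   by (cases "nn_set A (%w. ennreal (g w))") auto
  have "Y / (2 * m) <= X"
  proof (rule dense_ge)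
   fix l assume l: "X < l"
   then have "Y <= 2 * m * l" using bnd[OF l] Y X m by (simp add: Y(1))
   then show "Y / (2 * m) <= l" using m by (simp add: field_simps)
  qed
  then have "Y <= 2 * m * X" using m by (simp add: field_simps)
  then show ?thesis unfolding rhs Y(1) by (rule ennreal_leI)
 qed
qed

text \<open>Without the factor 1/pi: by \<open>CT_weak\<close> its distributional
  \<open>dbar\<close> is \<open>kap\<close> times nu.\<close>

definition CT :: "(complex => complex) => complex => complex" where
 "CT nu z = (LINT w|lborel. nu w / (z - w))"

definition CTn :: "(complex => complex) => complex => ennreal" where
 "CTn nu z = (NN w. ennreal (cmod (nu w) / cmod (z - w)))"

text \<open>Where the integrand is not integrable, the integral defining \<open>CT\<close> is 0 by
  convention, so the bound holds at every z.\<close>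

lemma norm_CT_le: "ennreal (cmod (CT nu z)) <= CTn nu z"
proof (cases "integrable lborel (%w. nu w / (z - w))")
 case True
 then show ?thesis unfolding CT_def CTn_def using integral_norm_bound_ennreal[OF True] by (simp add: norm_divide)
next
 case False
 then show ?thesis by (simp add: CT_def not_integrable_integral_eq)
qed

lemma measurable_CT [measurable]:
 assumes [measurable]: "nu \<in> borel_measurable borel"
 shows "CT nu \<in> borel_measurable borel" "CTn nu \<in> borel_measurable borel"
proof -
 have "(%z. LINT w|lborel. nu w / (z - w)) \<in> borel_measurable borel" by measurable
 then show "CT nu \<in> borel_measurable borel" by (simp add: CT_def[abs_def])
 have "(%z. NN w. ennreal (cmod (nu w) / cmod (z - w))) \<in> borel_measurable borel" by measurable
 then show "CTn nu \<in> borel_measurable borel" by (simp add: CTn_def[abs_def])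
qed

text \<open>The singularity may lie anywhere: points within r of w are handled by
  \<open>sing_integral\<close>, and on the rest the integrand is at most 1 / r, which adds pi
  r.\<close>

lemma sing_integral_ball:
 fixes w b :: complex
 assumes r: "0 < r"
 shows "(nn_set (ball b r) (%z. ennreal (1 / cmod (z - w)))) <= ennreal (17 * pi * r)"
proof -
 have "(nn_set (ball b r) (%z. ennreal (1 / cmod (z - w))))
   <= (NN z. ennreal (1 / cmod (z - w)) * indicator (ball w r) z + ennreal (1 / r) * indicator (ball b r) z)"
 proof (rule nn_integral_mono)
  fix z :: complex
  show "ennreal (1 / cmod (z - w)) * indicator (ball b r) z <= ennreal (1 / cmod (z - w)) * indicator (ball w r) z + ennreal (1 / r) * indicator (ball b r) z"
  proof (cases "z \<in> ball w r")
   case True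
   then show ?thesis by (simp add: indicator_def)
  next
   case False
   then have "r <= cmod (z - w)" by (simp add: dist_norm norm_minus_commute)
   then have "1 / cmod (z - w) <= 1 / r" using r by (intro frac_le) auto
   then show ?thesis using False by (simp add: indicator_def ennreal_leI)
  qed
 qed
 also have "... = (nn_set (ball w r) (%z. ennreal (1 / cmod (z - w)))) + ennreal (1 / r) * emeasure lborel (ball b r)"
  by (subst nn_integral_add)
    (auto simp: nn_integral_cmult_indicator intro!: borel_measurable_times_ennreal borel_measurable_indicator)
 also have "... <= ennreal (16 * pi * r) + ennreal (1 / r) * ennreal (pi * r^2)"
  using r by (intro add_mono sing_integral mult_left_mono) (auto simp: emeasure_ball_complex)
 also have "... = ennreal (17 * pi * r)"
  using r by (simp add: power2_eq_square flip: ennreal_mult ennreal_plus)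
 finally show ?thesis .
qed

lemma CTn_ball:
 assumes [measurable]: "nu \<in> borel_measurable borel" and r: "0 < r"
 shows "(nn_set (ball b r) (%z. CTn nu z)) <= ennreal (17 * pi * r) * (NN w. ennreal (cmod (nu w)))"
proof -
 have [measurable]: "ball b r \<in> sets borel" by simp
 have "(nn_set (ball b r) (%z. CTn nu z))
   = (NN z. (NN w. ennreal (cmod (nu w) / cmod (z - w)) * indicator (ball b r) z))"
  unfolding CTn_def by (intro nn_integral_cong nn_integral_multc[symmetric]) measurable
 also have "... = (NN w. (NN z. ennreal (cmod (nu w) / cmod (z - w)) * indicator (ball b r) z))"
  by (rule lborel_pair.Fubini'[symmetric]) measurable
 also have "... <= (NN w. ennreal (17 * pi * r) * ennreal (cmod (nu w)))"
 proof (rule nn_integral_mono)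
  fix w :: complex
  have "(NN z. ennreal (cmod (nu w) / cmod (z - w)) * indicator (ball b r) z)
   = (NN z. ennreal (cmod (nu w)) * (ennreal (1 / cmod (z - w)) * indicator (ball b r) z))"
   by (intro nn_integral_cong) (simp add: mult.assoc[symmetric] flip: ennreal_mult)
  also have "... = ennreal (cmod (nu w)) * (nn_set (ball b r) (%z. ennreal (1 / cmod (z - w))))"
   by (rule nn_integral_cmult) measurable
  also have "... <= ennreal (cmod (nu w)) * ennreal (17 * pi * r)"
   by (intro mult_left_mono sing_integral_ball r) auto
  finally show "(NN z. ennreal (cmod (nu w) / cmod (z - w)) * indicator (ball b r) z) <= ennreal (17 * pi * r) * ennreal (cmod (nu w))"
   by (simp add: mult.commute)
 qed
 also have "... = ennreal (17 * pi * r) * (NN w. ennreal (cmod (nu w)))"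
  by (rule nn_integral_cmult) measurable
 finally show ?thesis .
qed

text \<open>Fubini brings the integration over z inside, where \<open>Cauchy_Pompeiu\<close>
  evaluates it for each w; \<open>CTn_ball\<close> supplies the absolute integrability.\<close>

lemma CT_weak:
 assumes nu: "integrable lborel nu" and phi: "C1 \<phi>" and B: "!!z. B < cmod z ==> \<phi> z = 0"
 shows "integrable lborel (%z. CT nu z * dbar \<phi> z)"
  and "(LINT z|lborel. CT nu z * dbar \<phi> z) = - of_real kap * (LINT w|lborel. nu w * \<phi> w)"
proof -
 have [measurable]: "nu \<in> borel_measurable borel" using nu by auto
 have c: "continuous_on UNIV (dbar \<phi>)" by (rule C1_dbar_continuous[OF phi])
 then have [measurable]: "dbar \<phi> \<in> borel_measurable borel" by (rule borel_measurable_continuous_onI)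
 have B': "!!z. B < cmod z ==> dbar \<phi> z = 0" using dbar_support[OF phi B] by blast
 obtain M where M: "0 < M" "!!z. cmod (dbar \<phi> z) <= M" using compact_support_bounded[OF c B'] by blast
 define b where "b = \<bar>B\<bar> + 1"
 have b: "0 < b" by (simp add: b_def)
 have fin: "(NN w. ennreal (cmod (nu w))) < \<infinity>" using nu by (simp add: integrable_iff_bounded)
 have bound: "(NN z. ennreal (cmod (dbar \<phi> z)) * CTn nu z) < \<infinity>"
 proof -
  have "(NN z. ennreal (cmod (dbar \<phi> z)) * CTn nu z) <= (NN z. ennreal M * (CTn nu z * indicator (ball 0 b) z))"
  proof (rule nn_integral_mono)
   fix z show "ennreal (cmod (dbar \<phi> z)) * CTn nu z <= ennreal M * (CTn nu z * indicator (ball 0 b) z)"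
   proof (cases "z \<in> ball 0 b")
    case True
    then show ?thesis using M(2)[of z] by (auto intro!: mult_right_mono ennreal_leI)
   next
    case False
    then have "B < cmod z" by (simp add: b_def)
    then show ?thesis by (simp add: B')
   qed
  qed
  also have "... = ennreal M * (nn_set (ball 0 b) (%z. CTn nu z))"
   by (rule nn_integral_cmult) (auto intro!: borel_measurable_times_ennreal borel_measurable_indicator measurable_CT)
  also have "... <= ennreal M * (ennreal (17 * pi * b) * (NN w. ennreal (cmod (nu w))))"
   using b by (intro mult_left_mono CTn_ball) auto
  also have "... < \<infinity>" using fin by (simp add: ennreal_mult_less_top)
  finally show ?thesis .
 qed
 have pm: "(%(z, w). nu w * dbar \<phi> z / (z - w)) \<in> borel_measurable (lborel \<Otimes>\<^sub>M lborel)" by measurable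
 have pint: "integrable (lborel \<Otimes>\<^sub>M lborel) (%(z, w). nu w * dbar \<phi> z / (z - w))"
 proof (rule integrableI_bounded[OF pm])
  have "(\<integral>\<^sup>+ x. ennreal (cmod (case x of (z, w) => nu w * dbar \<phi> z / (z - w))) \<partial>(lborel \<Otimes>\<^sub>M lborel))
   = (NN z. (NN w. ennreal (cmod (nu w * dbar \<phi> z / (z - w)))))"
   using pm by (subst lborel.nn_integral_fst[symmetric]) auto
  also have "... = (NN z. ennreal (cmod (dbar \<phi> z)) * CTn nu z)"
  proof (rule nn_integral_cong)
   fix z
   have "(NN w. ennreal (cmod (nu w * dbar \<phi> z / (z - w)))) = (NN w. ennreal (cmod (dbar \<phi> z)) * ennreal (cmod (nu w) / cmod (z - w)))"
    by (intro nn_integral_cong) (simp add: norm_mult norm_divide mult_ac flip: ennreal_mult)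
   also have "... = ennreal (cmod (dbar \<phi> z)) * CTn nu z"
    unfolding CTn_def by (rule nn_integral_cmult) measurable
   finally show "(NN w. ennreal (cmod (nu w * dbar \<phi> z / (z - w)))) = ennreal (cmod (dbar \<phi> z)) * CTn nu z" .
  qed
  also note bound
  finally show "(\<integral>\<^sup>+ x. ennreal (cmod (case x of (z, w) => nu w * dbar \<phi> z / (z - w))) \<partial>(lborel \<Otimes>\<^sub>M lborel)) < \<infinity>" .
 qed
 have in1: "(LINT w|lborel. nu w * dbar \<phi> z / (z - w)) = CT nu z * dbar \<phi> z" for z
 proof -
  have "(LINT w|lborel. nu w * dbar \<phi> z / (z - w)) = (LINT w|lborel. nu w / (z - w) * dbar \<phi> z)"
   by (intro Bochner_Integration.integral_cong) auto
  then show ?thesis unfolding CT_def by (simp only: integral_mult_left_zero)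
 qed
 have in2: "(LINT z|lborel. nu w * dbar \<phi> z / (z - w)) = - of_real kap * (nu w * \<phi> w)" for w
 proof -
  have "(LINT z|lborel. nu w * dbar \<phi> z / (z - w)) = (LINT z|lborel. nu w * (dbar \<phi> z / (z - w)))"
   by (intro Bochner_Integration.integral_cong) auto
  also have "... = nu w * (LINT z|lborel. dbar \<phi> z / (z - w))" by (rule integral_mult_right_zero)
  also have "... = - of_real kap * (nu w * \<phi> w)" using Cauchy_Pompeiu(2)[OF phi B, where w = w] by simp
  finally show ?thesis .
 qed
 show "integrable lborel (%z. CT nu z * dbar \<phi> z)"
  using lborel_pair.integrable_fst'[OF pint] by (simp add: in1)
 have "(LINT z|lborel. CT nu z * dbar \<phi> z) = (LINT z|lborel. (LINT w|lborel. nu w * dbar \<phi> z / (z - w)))"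
  by (simp add: in1)
 also have "... = (LINT w|lborel. (LINT z|lborel. nu w * dbar \<phi> z / (z - w)))"
  using lborel_pair.Fubini_integral[OF pint] by simp
 also have "... = - of_real kap * (LINT w|lborel. nu w * \<phi> w)"
  unfolding in2 by (rule integral_mult_right_zero)
 finally show "(LINT z|lborel. CT nu z * dbar \<phi> z) = - of_real kap * (LINT w|lborel. nu w * \<phi> w)" .
qed

text \<open>A maximal separated set, from Zorn's lemma. If z violated the covering, z could be
  added: the factor 2 in the radius leaves room for \<open>sg * bd z <= cmod (z - s)\<close>, which
  \<open>esep\<close> also asks for, and \<open>sg <= 1/2\<close> absorbs the difference of
  \<open>bd z\<close> and \<open>bd s\<close>.\<close>

lemma net_exists:
 assumes s: "0 < sg" "sg <= 1/2"
 shows "\<exists>S. S \<subseteq> disc \<and> esep sg S \<and> (\<forall>z\<in>disc. \<exists>s\<in>S. cmod (z - s) < 2 * sg * bd s)"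
proof -
 let ?A = "{S. S \<subseteq> disc \<and> esep sg S}"
 have "\<exists>S\<in>?A. \<forall>X\<in>?A. S \<subseteq> X --> X = S"
 proof (rule subset_Zorn)
  fix \<C> assume ch: "subset.chain ?A \<C>"
  have "esep sg (\<Union>\<C>)"
   unfolding esep_def
  proof (intro ballI impI)
   fix a b assume ab: "a \<in> \<Union>\<C>" "b \<in> \<Union>\<C>" "a ~= b"
   then obtain X Y where XY: "X \<in> \<C>" "a \<in> X" "Y \<in> \<C>" "b \<in> Y" by blast
   then have "X \<subseteq> Y \<or> Y \<subseteq> X" using ch by (auto simp: subset_chain_def)
   then obtain W where W: "W \<in> \<C>" "a \<in> W" "b \<in> W" using XY by blast
   then have "esep sg W" using ch by (auto simp: subset_chain_def)
   then show "sg * bd a <= cmod (a - b)" using W ab(3) by (auto simp: esep_def)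
  qed
  moreover have "\<Union>\<C> \<subseteq> disc" using ch by (auto simp: subset_chain_def)
  ultimately show "\<exists>U\<in>?A. \<forall>X\<in>\<C>. X \<subseteq> U" by blast
 qed
 then obtain S where S0: "S \<in> ?A" "\<forall>X\<in>?A. S \<subseteq> X --> X = S" by (elim bexE)
 have S: "S \<subseteq> disc" "esep sg S" "X \<subseteq> disc ==> esep sg X ==> S \<subseteq> X ==> X = S" for X
  using S0 by simp_all
 have "\<exists>s\<in>S. cmod (z - s) < 2 * sg * bd s" if z: "z \<in> disc" for z
 proof (rule ccontr)
  assume no: "\<not> ?thesis"
  have far: "2 * sg * bd s <= cmod (z - s)" if "s \<in> S" for s using no that by (auto simp: not_less)
  have f1: "sg * bd s <= cmod (z - s)" if "s \<in> S" for s
  proof -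
   have "s \<in> disc" using that S(1) by blast
   then have "0 < sg * bd s" using s bd_pos by simp
   then show ?thesis using far[OF that] by linarith
  qed
  have f2: "sg * bd z <= cmod (z - s)" if "s \<in> S" for s
  proof -
   have "sg * bd z <= sg * (bd s + cmod (z - s))" using bd_diff[of z s] s by (intro mult_left_mono) auto
   also have "... = sg * bd s + sg * cmod (z - s)" by (simp add: algebra_simps)
   also have "... <= cmod (z - s) / 2 + 1/2 * cmod (z - s)"
    using far[OF that] s by (intro add_mono mult_right_mono) auto
   finally show ?thesis by simp
  qed
  have "esep sg (insert z S)"
   unfolding esep_def using S(2) f1 f2 by (auto simp: esep_def norm_minus_commute)
  then have "insert z S = S" using z S(1) by (intro S(3)) auto
  then have "z \<in> S" by auto
  then show False using far[of z] s bd_pos[OF z] by (simp add: mult_le_0_iff)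
 qed
 then show ?thesis using S(1,2) by blast
qed

text \<open>Makes the results on separated sets, countability in particular, available for a
  net.\<close>

lemma esep_separated_set:
 assumes "esep sg S" "S \<subseteq> disc" "0 < sg" "sg <= 1"
 shows "separated_set S (sg / 3)"
proof
 fix a b assume ab: "a \<in> S" "b \<in> S" "a ~= b"
 have b: "b \<in> disc" using ab assms by auto
 have "cmod (1 - cnj b * a) <= 2 * bd b + cmod (a - b)"
 proof -
  interpret separated_set "{}" 1 by unfold_locales auto
  show ?thesis by (rule kern_upper[OF b])
 qed
 then have "sg * cmod (1 - cnj b * a) <= sg * (2 * bd b + cmod (a - b))" using assms by (intro mult_left_mono) auto
 also have "... = 2 * (sg * bd b) + sg * cmod (a - b)" by (simp add: algebra_simps)
 also have "... <= 2 * cmod (a - b) + 1 * cmod (a - b)"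
  using assms(1,3,4) ab by (intro add_mono mult_left_mono mult_right_mono) (auto simp: esep_def norm_minus_commute)
 finally show "sg / 3 * cmod (1 - cnj b * a) <= cmod (a - b)" by simp
qed (use assms in auto)

text \<open>The constant of the outer ball comes from solving
  \<open>cmod (z - w) < R * (2 * bd z + cmod (z - w))\<close> for
  \<open>cmod (z - w)\<close>.\<close>

lemma pdisc_bounds:
 assumes z: "z \<in> disc" and R: "0 < R" "R < 1"
 shows "ball z (R * bd z) \<subseteq> pdisc z R" "pdisc z R \<subseteq> ball z (3 / (1 - R) * bd z)" "open (pdisc z R)"
proof -
 show "ball z (R * bd z) \<subseteq> pdisc z R"
 proof
  fix w assume w: "w \<in> ball z (R * bd z)"
  then have wd: "w \<in> disc" using ball_bd_subset_disc[OF z, of R] R by auto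
  have "cmod (z - w) < R * bd z" using w by (simp add: dist_norm)
  also have "... <= R * cmod (1 - cnj w * z)" using R kern_ge_right[OF wd, of z] by (intro mult_left_mono) auto
  finally show "w \<in> pdisc z R" using wd kern_pos[OF wd z] by (simp add: pdisc_def pshyp_eq field_simps)
 qed
 show "pdisc z R \<subseteq> ball z (3 / (1 - R) * bd z)"
 proof
  fix w assume "w \<in> pdisc z R"
  then have wd: "w \<in> disc" and p: "pshyp z w < R" by (auto simp: pdisc_def)
  have "cmod (z - w) < R * cmod (1 - cnj w * z)" using p kern_pos[OF wd z] by (simp add: pshyp_eq field_simps)
  also have "cmod (1 - cnj w * z) = cmod (1 - cnj z * w)" by (rule kern_sym)
  also have "... <= 2 * bd z + cmod (w - z)"
  proof -
   interpret separated_set "{}" 1 by unfold_locales auto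
   show ?thesis by (rule kern_upper[OF z])
  qed
  finally have "cmod (z - w) < R * (2 * bd z + cmod (z - w))" using R by (simp add: norm_minus_commute mult_left_mono)
  then have "(1 - R) * cmod (z - w) < 2 * R * bd z" by (simp add: algebra_simps)
  also have "... <= 3 * bd z" using R bd_pos[OF z] by (intro mult_right_mono) auto
  finally have "cmod (z - w) < 3 / (1 - R) * bd z" using R by (simp add: field_simps)
  then show "w \<in> ball z (3 / (1 - R) * bd z)" by (simp add: dist_norm)
 qed
 have "pdisc z R = disc \<inter> {w. cmod (z - w) < R * cmod (1 - cnj w * z)}"
  using kern_pos[OF _ z] by (auto simp: pdisc_def pshyp_eq field_simps)
 then show "open (pdisc z R)"
  by (simp only:) (intro open_Int open_disc open_Collect_less continuous_intros)
qed

text \<open>Fubini for the Cauchy transform is applied over \<open>lborel\<close>, so Lebesgue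
  measurable data are first replaced by Borel data almost everywhere.\<close>

lemma borel_representative:
 fixes f :: "complex => complex"
 assumes "f \<in> borel_measurable lebesgue"
 shows "\<exists>g\<in>borel_measurable borel. AE z in lborel. f z = g z"
proof -
 have "(%z. Re (f z)) \<in> borel_measurable (completion lborel)" "(%z. Im (f z)) \<in> borel_measurable (completion lborel)"
  using assms by measurable
 from this[THEN completion_ex_borel_measurable_real] obtain a b where
  ab: "a \<in> borel_measurable lborel" "AE z in lborel. Re (f z) = a z" "b \<in> borel_measurable lborel" "AE z in lborel. Im (f z) = b z"
  by blast
 have "(%z. Complex (a z) (b z)) \<in> borel_measurable borel"
  unfolding Complex_eq using ab by measurable
 moreover have "AE z in lborel. f z = Complex (a z) (b z)"
  using ab(2,4) by eventually_elim (simp add: complex_eq_iff)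
 ultimately show ?thesis by (intro bexI[of _ "%z. Complex (a z) (b z)"])
qed

text \<open>Only the constants \<open>a s\<close> are integrated, so no measurability of g enters;
  in \<open>mqint_lower\<close> g is a power of the local mean \<open>mq\<close> as a function of
  its centre.\<close>

lemma nn_disjoint_lower:
 fixes g :: "complex => ennreal"
 assumes "esep c S" "S \<subseteq> disc" "c <= 1" "finite F" "F \<subseteq> S"
  and g: "!!s z. s \<in> F ==> z \<in> ball s (c / 2 * bd s) ==> a s <= g z"
 shows "(\<Sum>s\<in>F. a s * emeasure lborel (ball s (c / 2 * bd s))) <= (nn_set disc (%z. g z))"
proof -
 have "(\<Sum>s\<in>F. a s * emeasure lborel (ball s (c / 2 * bd s))) = (\<Sum>s\<in>F. NN z. a s * indicator (ball s (c / 2 * bd s)) z)"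
  by (intro sum.cong nn_integral_cmult_indicator[symmetric]) auto
 also have "... = (NN z. (\<Sum>s\<in>F. a s * indicator (ball s (c / 2 * bd s)) z))"
  by (intro nn_integral_sum[symmetric] borel_measurable_times_ennreal borel_measurable_const borel_measurable_indicator) simp
 also have "... <= (nn_set disc (%z. g z))"
 proof (rule nn_integral_mono)
  fix z :: complex
  show "(\<Sum>s\<in>F. a s * indicator (ball s (c / 2 * bd s)) z) <= g z * indicator disc z"
  proof (cases "\<exists>s\<in>F. z \<in> ball s (c / 2 * bd s)")
   case True
   then obtain s where s: "s \<in> F" "z \<in> ball s (c / 2 * bd s)" by auto
   have "(\<Sum>b\<in>F. a b * indicator (ball b (c / 2 * bd b)) z) = (\<Sum>b\<in>F. if b = s then a s else 0)"
   proof (rule sum.cong[OF refl])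
    fix b assume b: "b \<in> F"
    show "a b * indicator (ball b (c / 2 * bd b)) z = (if b = s then a s else 0)"
    proof (cases "b = s")
     case False
     then have "z \<notin> ball b (c / 2 * bd b)"
      using esep_balls_disjoint[OF assms(1), of s b] s b assms(5) by blast
     then show ?thesis using False by simp
    qed (use s in simp)
   qed
   also have "... = a s" using s assms by simp
   also have "... <= g z" using g s by blast
   also have "z \<in> disc"
   proof -
    have "s \<in> disc" using s assms by auto
    from ball_bd_subset_disc[OF this, of "c/2"] s assms show ?thesis by auto
   qed
   then have "g z = g z * indicator disc z" by simp
   finally show ?thesis .
  next
   case False
   then have "(\<Sum>s\<in>F. a s * indicator (ball s (c / 2 * bd s)) z) = 0"
    by (intro sum.neutral) auto
   then show ?thesis by simp
  qed
 qed
 finally show ?thesis .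
qed

context separated_set
begin

lemma measurable_weight: "(%z. indicator disc z * exp (kZ Z z)) \<in> borel_measurable borel"
 using borel_measurable_continuous_on_indicator[OF sets_disc continuous_on_exp[OF continuous_kZ]] by simp

definition mqint :: "real => real => real => (complex => complex) => ennreal" where
 "mqint R p q f = (nn_set disc (%z. epowr (mq R q (%w. f w * complex_of_real (exp (kZ Z w))) z) p))"

lemma normZ_wint: "normZ p Z u = epowr (wint p u) (1/p)"
 by (simp add: normZ_def wint_def nn_integral_completion)

lemma normpqZ_mqint: "normpqZ R p q Z f = epowr (mqint R p q f) (1/p)"
 by (simp add: normpqZ_def mqint_def nn_integral_completion)

lemma mq_cong_AE:
 assumes "AE w in lborel. w \<in> disc --> f w = g w"
 shows "mq R q (%w. f w * e w) z = mq R q (%w. g w * e w) z"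
proof -
 have "(nn_set (pdisc z R) (%w. ennreal (cmod (f w * e w) powr q))) = (nn_set (pdisc z R) (%w. ennreal (cmod (g w * e w) powr q)))"
  by (intro nn_integral_cong_AE, use assms in eventually_elim) (auto simp: pdisc_def indicator_def)
 then show ?thesis by (simp add: mq_def nn_integral_completion)
qed

text \<open>This is \<open>mean_le_powr_mean\<close> on D(z, R), whose area is at most pi times the
  square of \<open>3 / (1 - R) * bd z\<close>; the factor 2 lost there turns 9 into 18.\<close>

lemma local_mean_le_mq:
 assumes f: "f \<in> borel_measurable borel" and q: "1 <= q" and z: "z \<in> disc" and R: "0 < R" "R < 1"
 shows "(nn_set (pdisc z R) (%w. ennreal (cmod (f w) * exp (kZ Z w))))
   <= ennreal (18 * pi / (1 - R)^2 * (bd z)^2) * mq R q (%w. f w * complex_of_real (exp (kZ Z w))) z"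
proof -
 have bz: "0 < bd z" using bd_pos[OF z] .
 note pd = pdisc_bounds[OF z R]
 have A: "pdisc z R \<in> sets borel" using pd(3) by simp
 have up: "emeasure lborel (pdisc z R) <= ennreal (pi * (3 / (1 - R) * bd z)^2)"
 proof -
  have "emeasure lborel (pdisc z R) <= emeasure lborel (ball z (3 / (1 - R) * bd z))" using pd by (intro emeasure_mono) auto
  also have "... = ennreal (pi * (3 / (1 - R) * bd z)^2)" using R bz by (intro emeasure_ball_complex) simp
  finally show ?thesis .
 qed
 have low: "ennreal (pi * (R * bd z)^2) <= emeasure lborel (pdisc z R)"
 proof -
  have "ennreal (pi * (R * bd z)^2) = emeasure lborel (ball z (R * bd z))" using R bz by (intro emeasure_ball_complex[symmetric]) simp
  also have "... <= emeasure lborel (pdisc z R)" using pd A by (intro emeasure_mono) auto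
  finally show ?thesis .
 qed
 obtain m where m: "emeasure lborel (pdisc z R) = ennreal m" "0 <= m"
  using up by (cases "emeasure lborel (pdisc z R)") (auto simp: top_unique)
 have m0: "0 < m"
 proof -
  have "pi * (R * bd z)^2 <= m" using low m by simp
  moreover have "0 < pi * (R * bd z)^2" using R bz by simp
  ultimately show ?thesis by linarith
 qed
 have m1: "m <= pi * (3 / (1 - R) * bd z)^2" using up m by simp
 have ml: "measure lebesgue (pdisc z R) = m" using A m by (simp add: measure_def emeasure_completion)
 define g where "g w = cmod (f w) * (indicator disc w * exp (kZ Z w))" for w
 have gm: "g \<in> borel_measurable borel" unfolding g_def[abs_def] using f measurable_weight by measurable
 have sub: "pdisc z R \<subseteq> disc" by (auto simp: pdisc_def)
 have geq: "g w = cmod (f w) * exp (kZ Z w)" if "w \<in> pdisc z R" for w using that sub by (auto simp: g_def)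
 have "(nn_set (pdisc z R) (%w. ennreal (cmod (f w) * exp (kZ Z w)))) = (nn_set (pdisc z R) (%w. ennreal (g w)))"
  by (intro nn_integral_cong) (auto simp: indicator_def geq)
 also have "... <= ennreal (2 * m) * epowr (ennreal (1 / m) * (nn_set (pdisc z R) (%w. ennreal (g w powr q)))) (1 / q)"
  by (rule mean_le_powr_mean[OF q A m(1) m0 _ gm]) (simp add: g_def)
 also have "(nn_set (pdisc z R) (%w. ennreal (g w powr q))) = (\<integral>\<^sup>+ w\<in>pdisc z R. ennreal (cmod (f w * complex_of_real (exp (kZ Z w))) powr q) \<partial>lebesgue)"
  unfolding nn_integral_completion by (intro nn_integral_cong) (auto simp: indicator_def geq norm_mult)
 also have "epowr (ennreal (1 / m) * ...) (1 / q) = mq R q (%w. f w * complex_of_real (exp (kZ Z w))) z"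
  by (simp only: mq_def ml)
 also have "ennreal (2 * m) * ... <= ennreal (18 * pi / (1 - R)^2 * (bd z)^2) * ..."
  using m1 by (intro mult_right_mono ennreal_leI) (auto simp: power_mult_distrib power_divide)
 finally show ?thesis .
qed

text \<open>For z close to s the disc D(z, R) contains the net ball of s, so the mass
  \<open>y s\<close> is at most a multiple of \<open>(bd s)^2\<close> times the local mean at z.
  Raising to the power p and integrating z over disjoint balls bounds the discrete norm of the
  masses by the mixed norm.\<close>

lemma mqint_lower:
 assumes q: "1 <= q" and R: "0 < R" "R < 1" and p: "0 < p" and sg: "0 < sg" "sg <= 1/16" "sg <= R / 16"
 shows "\<exists>K>0. \<forall>S f. esep sg S \<and> S \<subseteq> disc \<and> f \<in> borel_measurable borel \<and> mqint R p q f < \<infinity> -->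
   (\<exists>y. (\<forall>s\<in>S. 0 <= y s \<and> (nn_set (ball s (2 * sg * bd s)) (%w. ennreal (cmod (f w) * exp (kZ Z w)))) = ennreal (y s)) \<and>
    (\<forall>F. finite F \<and> F \<subseteq> S --> (\<Sum>s\<in>F. (y s / (bd s)^2) powr p * (bd s)^2) <= K * enn2real (mqint R p q f)))"
proof -
 \<comment> \<open>72 is 18 times 4, the 4 from \<open>bd z <= 2 * bd s\<close>.\<close>
 define L where "L = 72 * pi / (1 - R)^2"
 have L: "0 < L" using R by (simp add: L_def)
 define a where "a = pi * (sg / 2)^2"
 have a: "0 < a" using sg by (simp add: a_def)
 show ?thesis
 proof (intro exI[of _ "L powr p / a"] conjI allI impI; (elim conjE)?)
  show "0 < L powr p / a" using L a by simp
  fix S f assume S: "esep sg S" "S \<subseteq> disc" and f: "f \<in> borel_measurable borel" and J: "mqint R p q f < \<infinity>"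
  let ?Y = "%s. nn_set (ball s (2 * sg * bd s)) (%w. ennreal (cmod (f w) * exp (kZ Z w)))"
  let ?m = "%z. mq R q (%w. f w * complex_of_real (exp (kZ Z w))) z"
  have key: "?Y s <= ennreal (L * (bd s)^2) * ?m z" if s: "s \<in> S" and z: "z \<in> ball s (sg / 2 * bd s)" for s z
  proof -
   have sd: "s \<in> disc" using s S by auto
   have bs: "0 < bd s" using bd_pos[OF sd] .
   have zd: "z \<in> disc" using ball_bd_subset_disc[OF sd, of "sg / 2"] z sg by auto
   have zs: "cmod (z - s) < sg / 2 * bd s" using z by (simp add: dist_norm norm_minus_commute)
   have "sg / 2 * bd s <= 1/2 * bd s" using sg bs by (intro mult_right_mono) auto
   then have "cmod (z - s) < 1/2 * bd s" using zs by linarith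
   then have bz: "bd s <= 2 * bd z" "bd z <= 2 * bd s" using bd_diff[of z s] bs by (auto simp: abs_le_iff)
   have "ball s (2 * sg * bd s) \<subseteq> ball z (R * bd z)"
   proof
    fix w assume "w \<in> ball s (2 * sg * bd s)"
    then have "dist z w < sg / 2 * bd s + 2 * sg * bd s" using zs dist_triangle[of z w s] by (simp add: dist_norm)
    also have "... = 5/2 * (sg * bd s)" by simp
    also have "... <= 5/2 * (R / 16 * (2 * bd z))" using sg bz bs R by (intro mult_left_mono mult_mono) auto
    also have "... <= R * bd z" using R bd_pos[OF zd] by simp
    finally show "w \<in> ball z (R * bd z)" by simp
   qed
   then have sub: "ball s (2 * sg * bd s) \<subseteq> pdisc z R" using pdisc_bounds(1)[OF zd R] by blast
   have "?Y s <= (nn_set (pdisc z R) (%w. ennreal (cmod (f w) * exp (kZ Z w))))"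
    using sub by (intro nn_integral_mono) (auto simp: indicator_def)
   also have "... <= ennreal (18 * pi / (1 - R)^2 * (bd z)^2) * ?m z"
    by (rule local_mean_le_mq[OF f q zd R])
   also have "... <= ennreal (L * (bd s)^2) * ?m z"
   proof (intro mult_right_mono ennreal_leI)
    have "(bd z)^2 <= (2 * bd s)^2" using bz bd_pos[OF zd] by (intro power_mono) auto
    then have "18 * pi / (1 - R)^2 * (bd z)^2 <= 18 * pi / (1 - R)^2 * (2 * bd s)^2" by (intro mult_left_mono) auto
    also have "... = L * (bd s)^2" by (simp add: L_def power_mult_distrib)
    finally show "18 * pi / (1 - R)^2 * (bd z)^2 <= L * (bd s)^2" .
   qed simp
   finally show ?thesis .
  qed
  have em: "emeasure lborel (ball s (sg / 2 * bd s)) = ennreal (a * (bd s)^2)" if "s \<in> S" for s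
  proof -
   have "0 < bd s" using that S bd_pos by auto
   then have "emeasure lborel (ball s (sg / 2 * bd s)) = ennreal (pi * (sg / 2 * bd s)^2)"
    using sg by (intro emeasure_ball_complex) simp
   moreover have "pi * (sg / 2 * bd s)^2 = a * (bd s)^2" by (simp only: a_def power_mult_distrib mult_ac)
   ultimately show ?thesis by (simp only:)
  qed
  have s1: "sg <= 1" using sg by simp
  \<comment> \<open>An infinite mass at s would make the local mean infinite on a whole ball about
    s.\<close>
  have fin: "?Y s < \<infinity>" if s: "s \<in> S" for s
  proof (rule ccontr)
   assume "\<not> ?Y s < \<infinity>"
   then have top: "?Y s = \<infinity>" by (metis infinity_ennreal_def less_top)
   have bs: "0 < bd s" using s S bd_pos by auto
   have "(\<Sum>t\<in>{s}. \<infinity> * emeasure lborel (ball t (sg / 2 * bd t))) <= (nn_set disc (%z. epowr (?m z) p))"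
   proof (rule nn_disjoint_lower[OF S s1])
    fix t z assume t: "t \<in> {s}" and z: "z \<in> ball t (sg / 2 * bd t)"
    have "\<infinity> <= ennreal (L * (bd s)^2) * ?m z" using key[OF s, of z] t z top by simp
    then have "?m z = \<infinity>" by (simp add: top_unique ennreal_mult_eq_top_iff)
    then show "\<infinity> <= epowr (?m z) p" by simp
   qed (use s in auto)
   moreover have "(\<Sum>t\<in>{s}. \<infinity> * emeasure lborel (ball t (sg / 2 * bd t))) = \<infinity>"
    using em[OF s] a bs by (simp add: ennreal_top_mult)
   ultimately show False using J unfolding mqint_def by (simp add: top_unique)
  qed
  define y where "y s = enn2real (?Y s)" for s
  have y: "0 <= y s" "?Y s = ennreal (y s)" if "s \<in> S" for s using fin[OF that] by (simp_all add: y_def)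
  have "(\<Sum>s\<in>F. (y s / (bd s)^2) powr p * (bd s)^2) <= L powr p / a * enn2real (mqint R p q f)"
   if F: "finite F" "F \<subseteq> S" for F
  proof -
   have bs: "0 < bd s" if "s \<in> F" for s using that F S bd_pos by auto
   have "(\<Sum>s\<in>F. ennreal ((y s / (L * (bd s)^2)) powr p) * emeasure lborel (ball s (sg / 2 * bd s))) <= (nn_set disc (%z. epowr (?m z) p))"
   proof (rule nn_disjoint_lower[OF S s1 F])
    fix s z assume s: "s \<in> F" and z: "z \<in> ball s (sg / 2 * bd s)"
    have sS: "s \<in> S" using s F by auto
    show "ennreal ((y s / (L * (bd s)^2)) powr p) <= epowr (?m z) p"
    proof (cases "?m z = \<infinity>")
     case False
     then obtain b where b: "?m z = ennreal b" "0 <= b" by (cases "?m z") auto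
     have "ennreal (y s) <= ennreal (L * (bd s)^2) * ennreal b" using key[OF sS z] unfolding y(2)[OF sS] b(1) .
     also have "... = ennreal (L * (bd s)^2 * b)" using L b by (intro ennreal_mult[symmetric]) auto
     finally have "y s <= L * (bd s)^2 * b" using L b by (subst (asm) ennreal_le_iff) auto
     then have "y s / (L * (bd s)^2) <= b" using L bs[OF s] by (simp add: field_simps)
     then show ?thesis unfolding b(1) epowr_ennreal[OF b(2)] using y(1)[OF sS] L p
      by (intro ennreal_leI powr_mono2) auto
    qed simp
   qed
   then have "(\<Sum>s\<in>F. ennreal ((y s / (L * (bd s)^2)) powr p) * ennreal (a * (bd s)^2)) <= mqint R p q f"
    unfolding mqint_def using em F by (simp add: subset_iff cong: sum.cong)
   moreover have "(\<Sum>s\<in>F. ennreal ((y s / (L * (bd s)^2)) powr p) * ennreal (a * (bd s)^2))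
    = ennreal (\<Sum>s\<in>F. (y s / (L * (bd s)^2)) powr p * (a * (bd s)^2))"
    using a by (subst sum_ennreal[symmetric]) (auto simp: ennreal_mult)
   ultimately have "ennreal (\<Sum>s\<in>F. (y s / (L * (bd s)^2)) powr p * (a * (bd s)^2)) <= ennreal (enn2real (mqint R p q f))"
    using J by simp
   then have 1: "(\<Sum>s\<in>F. (y s / (L * (bd s)^2)) powr p * (a * (bd s)^2)) <= enn2real (mqint R p q f)"
    by (subst (asm) ennreal_le_iff) auto
   have "(\<Sum>s\<in>F. (y s / (bd s)^2) powr p * (bd s)^2) = (\<Sum>s\<in>F. L powr p / a * ((y s / (L * (bd s)^2)) powr p * (a * (bd s)^2)))"
   proof (rule sum.cong[OF refl])
    fix s assume s: "s \<in> F"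
    have "y s / (bd s)^2 = L * (y s / (L * (bd s)^2))" using L by simp
    then have "(y s / (bd s)^2) powr p = L powr p * (y s / (L * (bd s)^2)) powr p" by (simp only: powr_mult)
    then show "(y s / (bd s)^2) powr p * (bd s)^2 = L powr p / a * ((y s / (L * (bd s)^2)) powr p * (a * (bd s)^2))"
     using a by simp
   qed
   also have "... = L powr p / a * (\<Sum>s\<in>F. (y s / (L * (bd s)^2)) powr p * (a * (bd s)^2))"
    by (simp add: sum_distrib_left)
   also have "... <= L powr p / a * enn2real (mqint R p q f)" using 1 a by (intro mult_left_mono) auto
   finally show ?thesis .
  qed
  then show "\<exists>y. (\<forall>s\<in>S. 0 <= y s \<and> ?Y s = ennreal (y s)) \<and>
    (\<forall>F. finite F \<and> F \<subseteq> S --> (\<Sum>s\<in>F. (y s / (bd s)^2) powr p * (bd s)^2) <= L powr p / a * enn2real (mqint R p q f))"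
   using y by (intro exI[of _ y]) auto
 qed
qed

text \<open>Freeze the weight on the ball of radius \<open>bd s / 2\<close> by
  \<open>kZ_lipschitz\<close>, use the p-mean bound for H there, and put the weight back; the two
  changes cost \<open>exp (2 * CL)\<close>.\<close>

lemma weight_sup:
 assumes p: "0 < p" "p <= 1" and C0: "0 < C0"
 shows "\<exists>K>0. \<forall>H s. H holomorphic_on disc \<and> s \<in> disc \<and> wint p H <= ennreal (C0 * (bd s)^2) -->
   (\<forall>z\<in>ball s (bd s / 4). cmod (H z) * exp (kZ Z z) <= K)"
proof -
 obtain Cm where Cm: "0 < Cm" "!!f w r z. 0 < r ==> f holomorphic_on ball w r ==> z \<in> ball w (r/2) ==>
   ennreal (cmod (f z) powr p) <= ennreal (Cm / r^2) * (nn_set (ball w r) (%z. ennreal (cmod (f z) powr p)))"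
  using powr_mean_bound2[OF p] by blast
 obtain CL where CL: "0 < CL"
  "!!z w. z \<in> disc ==> cmod (z - w) <= bd z / 2 ==> \<bar>kZ Z z - kZ Z w\<bar> <= CL * cmod (z - w) / bd z"
  by (rule kZ_lipschitz) (rule that)
 define K where "K = exp (2 * CL) * (4 * Cm * C0) powr (1/p)"
 show ?thesis
 proof (intro exI[of _ K] conjI allI impI ballI; (elim conjE)?)
  show "0 < K" using Cm C0 by (simp add: K_def)
  fix H s z assume H: "H holomorphic_on disc" and s: "s \<in> disc" and w: "wint p H <= ennreal (C0 * (bd s)^2)" and z: "z \<in> ball s (bd s / 4)"
  have bs: "0 < bd s" using bd_pos[OF s] .
  have kl: "\<bar>kZ Z s - kZ Z w\<bar> <= CL" if "w \<in> ball s (bd s / 2)" for w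
  proof -
   have d: "cmod (s - w) <= bd s / 2" using that by (simp add: dist_norm)
   have "\<bar>kZ Z s - kZ Z w\<bar> <= CL * cmod (s - w) / bd s" by (rule CL(2)[OF s d])
   also have "... <= CL * bd s / bd s" using d CL(1) bs by (intro divide_right_mono mult_left_mono) auto
   finally show ?thesis using bs by simp
  qed
  have sub: "ball s (bd s / 2) \<subseteq> disc" using ball_bd_subset_disc[OF s, of "1/2"] by simp
  have "(nn_set (ball s (bd s / 2)) (%z. ennreal (cmod (H z) powr p)))
    <= (NN z. ennreal (exp (CL - kZ Z s) powr p) * (ennreal ((cmod (H z) * exp (kZ Z z)) powr p) * indicator disc z))"
  proof (rule nn_integral_mono)
   fix x
   show "ennreal (cmod (H x) powr p) * indicator (ball s (bd s / 2)) x <= ennreal (exp (CL - kZ Z s) powr p) * (ennreal ((cmod (H x) * exp (kZ Z x)) powr p) * indicator disc x)"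
   proof (cases "x \<in> ball s (bd s / 2)")
    case True
    have "1 <= exp (CL - kZ Z s) * exp (kZ Z x)" using kl[OF True] by (simp flip: exp_add)
    then have "cmod (H x) * 1 <= cmod (H x) * (exp (CL - kZ Z s) * exp (kZ Z x))" by (intro mult_left_mono) auto
    then have "cmod (H x) powr p <= (exp (CL - kZ Z s) * (cmod (H x) * exp (kZ Z x))) powr p"
     using p by (intro powr_mono2) (auto simp: mult_ac)
    then have "cmod (H x) powr p <= exp (CL - kZ Z s) powr p * (cmod (H x) * exp (kZ Z x)) powr p"
     by (simp only: powr_mult)
    then show ?thesis using True sub by (auto simp: ennreal_mult[symmetric] intro!: ennreal_leI)
   qed simp
  qed
  also have "... = ennreal (exp (CL - kZ Z s) powr p) * wint p H"
   unfolding wint_def using wmeas[OF holomorphic_on_imp_continuous_on[OF H] p(1)] by (intro nn_integral_cmult) simp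
  also have "... <= ennreal (exp (CL - kZ Z s) powr p) * ennreal (C0 * (bd s)^2)" using w by (intro mult_left_mono) auto
  also have "... = ennreal (exp (CL - kZ Z s) powr p * (C0 * (bd s)^2))" using C0 by (intro ennreal_mult[symmetric]) auto
  finally have I: "(nn_set (ball s (bd s / 2)) (%z. ennreal (cmod (H z) powr p))) <= ennreal (exp (CL - kZ Z s) powr p * (C0 * (bd s)^2))" .
  have "ennreal (cmod (H z) powr p) <= ennreal (Cm / (bd s / 2)^2) * (nn_set (ball s (bd s / 2)) (%z. ennreal (cmod (H z) powr p)))"
   using bs z holomorphic_on_subset[OF H sub] by (intro Cm) auto
  also have "... <= ennreal (Cm / (bd s / 2)^2) * ennreal (exp (CL - kZ Z s) powr p * (C0 * (bd s)^2))"
   using I by (intro mult_left_mono) auto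
  also have "... = ennreal (Cm / (bd s / 2)^2 * (exp (CL - kZ Z s) powr p * (C0 * (bd s)^2)))"
   using Cm C0 by (intro ennreal_mult[symmetric]) auto
  also have "Cm / (bd s / 2)^2 * (exp (CL - kZ Z s) powr p * (C0 * (bd s)^2)) = exp (CL - kZ Z s) powr p * (4 * Cm * C0)"
   using bs by (simp add: field_simps power2_eq_square)
  finally have "cmod (H z) powr p <= exp (CL - kZ Z s) powr p * (4 * Cm * C0)"
   using Cm(1) C0 by (subst (asm) ennreal_le_iff) auto
  then have "(cmod (H z) powr p) powr (1/p) <= (exp (CL - kZ Z s) powr p * (4 * Cm * C0)) powr (1/p)"
   using p by (intro powr_mono2) auto
  moreover have "(cmod (H z) powr p) powr (1/p) = cmod (H z)" using p by (simp add: powr_powr)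
  moreover have "(exp (CL - kZ Z s) powr p * (4 * Cm * C0)) powr (1/p) = exp (CL - kZ Z s) * (4 * Cm * C0) powr (1/p)"
   unfolding powr_mult[of "exp (CL - kZ Z s) powr p"] using p by (simp add: powr_powr)
  ultimately have "cmod (H z) <= exp (CL - kZ Z s) * (4 * Cm * C0) powr (1/p)" by (simp only:)
  then have "cmod (H z) * exp (kZ Z z) <= exp (CL - kZ Z s) * (4 * Cm * C0) powr (1/p) * exp (kZ Z z)" by (intro mult_right_mono) auto
  also have "... = exp (CL - kZ Z s + kZ Z z) * (4 * Cm * C0) powr (1/p)" by (simp add: exp_add mult_ac)
  also have "... <= K"
   unfolding K_def using kl[of z] z bs by (intro mult_right_mono) (auto simp: abs_le_iff)
  finally show "cmod (H z) * exp (kZ Z z) <= K" .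
 qed
qed

lemma kZ_exp_ge_1: "1 <= exp (kZ Z z)"
 using kZ_nonneg by simp

lemma Bint_le_wint: "0 < p ==> Bint p H <= wint p H"
 unfolding Bint_def wint_def
proof (intro nn_integral_mono)
 fix z assume p: "0 < p"
 have "cmod (H z) * 1 <= cmod (H z) * exp (kZ Z z)" using kZ_exp_ge_1 by (intro mult_left_mono) auto
 then show "ennreal (cmod (H z) powr p) * indicator disc z <= ennreal ((cmod (H z) * exp (kZ Z z)) powr p) * indicator disc z"
  using p by (intro mult_right_mono ennreal_leI powr_mono2) auto
qed

end

context separated_set
begin

section \<open>Solving the equation\<close>

lemma wmeas_borel:
 assumes [measurable]: "u \<in> borel_measurable borel"
 shows "(%z. ennreal ((cmod (u z) * exp (kZ Z z)) powr p) * indicator disc z) \<in> borel_measurable borel"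
proof -
 note measurable_weight[measurable]
 have "(%z. ennreal ((cmod (u z) * (indicator disc z * exp (kZ Z z))) powr p) * indicator disc z) \<in> borel_measurable borel"
  by measurable
 also have "(%z. ennreal ((cmod (u z) * (indicator disc z * exp (kZ Z z))) powr p) * indicator disc z)
   = (%z. ennreal ((cmod (u z) * exp (kZ Z z)) powr p) * indicator disc z)"
  by (auto simp: fun_eq_iff indicator_def)
 finally show ?thesis .
qed

text \<open>The piece is H(z) times the Cauchy transform of g / (kap (1 - |w|^2) H(w)). Away from s the transform is
bounded pointwise; near s, where it is only integrable, its p-th power is split by powr_split_le.\<close>
lemma solution_piece:
 assumes p: "0 < p" "p <= 1" and r: "16 * sg <= r" and sg: "0 < sg" "sg <= 1/64" and C0: "0 < C0"
 shows "\<exists>K>0. \<forall>s H g y. s \<in> disc \<and> H holomorphic_on disc \<and> (\<forall>z\<in>ball s (r * bd s). 1 <= cmod (H z) * exp (kZ Z z)) \<and>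
   wint p H <= ennreal (C0 * (bd s)^2) \<and> g \<in> borel_measurable borel \<and> (\<forall>w. w \<notin> ball s (2 * sg * bd s) --> g w = 0) \<and>
   0 <= y \<and> (nn_set (ball s (2 * sg * bd s)) (%w. ennreal (cmod (g w) * exp (kZ Z w)))) = ennreal y -->
   (\<exists>u. u \<in> borel_measurable borel \<and> (\<forall>z. z \<notin> disc --> u z = 0) \<and>
    wint p u <= ennreal (K * ((y / (bd s)^2) powr p * (bd s)^2)) \<and>
    (\<forall>m>0. (nn_set (cball 0 (1 - m)) (%z. ennreal (cmod (u z)))) <= ennreal (K * m powr (- 2 / p) * (bd s powr (2 / p) * (y / (bd s)^2)))) \<and>
    (\<forall>m \<phi>. 0 < m \<and> C1 \<phi> \<and> (\<forall>z. z \<notin> cball 0 (1 - m) --> \<phi> z = 0) -->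
      integrable lborel (%z. u z * dbar \<phi> z) \<and>
      (LINT z|lborel. u z * dbar \<phi> z) = - (LINT w|lborel. g w / of_real (1 - (cmod w)^2) * \<phi> w)))"
proof -
 obtain K1 where K1: "0 < K1" "!!H s z. H holomorphic_on disc ==> s \<in> disc ==> wint p H <= ennreal (C0 * (bd s)^2) ==>
   z\<in>ball s (bd s / 4) ==> cmod (H z) * exp (kZ Z z) <= K1" using weight_sup[OF p C0] by blast
 obtain Cb where Cb: "0 < Cb" "!!f z. f holomorphic_on disc ==> z \<in> disc ==>
   ennreal (cmod (f z) powr p) <= ennreal (Cb / (bd z)^2) * Bint p f"
  using Bint_point[OF p] by blast
 \<comment> \<open>The three terms bound the far part, the constant near part and the linear near
   part. \<open>16 * pi * sg^2\<close> is the area factor of the ball D1 below, and 136 is 17 times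
   4 times 2, from \<open>CTn_ball\<close> on D1 and the bound on nu.\<close>
 define Ka where "Ka = (1 / (kap * sg)) powr p * C0 + 16 * pi * sg^2 * K1 powr p + 136 * pi * sg * K1 powr p / kap"
 define Kb where "Kb = (Cb * C0) powr (1/p) * (34 * pi / kap)"
 have Kab: "0 < Ka" "0 < Kb"
 proof -
  have "0 < (1 / (kap * sg)) powr p * C0" "0 <= 16 * pi * sg^2 * K1 powr p" "0 <= 136 * pi * sg * K1 powr p / kap"
   using kap_pos sg C0 by auto
  then show "0 < Ka" unfolding Ka_def by linarith
  show "0 < Kb" using Cb C0 kap_pos by (simp add: Kb_def)
 qed
 show ?thesis
 proof (intro exI[of _ "Ka + Kb"] conjI allI impI; (elim conjE)?)
  show "0 < Ka + Kb" using Kab by simp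
  fix s H g y
  assume s: "s \<in> disc" and H: "H holomorphic_on disc" and Hlow: "\<forall>z\<in>ball s (r * bd s). 1 <= cmod (H z) * exp (kZ Z z)"
   and wH: "wint p H <= ennreal (C0 * (bd s)^2)" and gm [measurable]: "g \<in> borel_measurable borel"
   and g0: "\<forall>w. w \<notin> ball s (2 * sg * bd s) --> g w = 0" and y0: "0 <= y"
   and gy: "(nn_set (ball s (2 * sg * bd s)) (%w. ennreal (cmod (g w) * exp (kZ Z w)))) = ennreal y"
  define d where "d = bd s"
  have d: "0 < d" "d <= 1" using bd_pos[OF s] bd_le_1 by (auto simp: d_def)
  define A where "A = ball s (2 * sg * d)"
  have A_disc: "A \<subseteq> disc" unfolding A_def d_def using sg by (intro ball_bd_subset_disc s) simp
  have A_low: "d / 2 <= bd w" if "w \<in> A" for w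
  proof -
   have "cmod (w - s) < 2 * sg * d" using that by (simp add: A_def dist_norm norm_minus_commute)
   also have "... <= 1/2 * d" using sg d by (intro mult_right_mono) auto
   finally show ?thesis using bd_diff[of w s] by (auto simp: d_def abs_le_iff)
  qed
  have A_H: "1 <= cmod (H w) * exp (kZ Z w)" if "w \<in> A" for w
  proof -
   have "2 * sg * d <= r * d" using r sg d by (intro mult_right_mono) auto
   then have "w \<in> ball s (r * bd s)" using that by (auto simp: A_def d_def)
   then show ?thesis using Hlow by blast
  qed
  have H_nz: "H w ~= 0" if "w \<in> A" for w using A_H[OF that] by auto
  have cH: "continuous_on disc H" using H by (rule holomorphic_on_imp_continuous_on)
  have w1: "0 < 1 - (cmod w)^2" "d / 2 <= 1 - (cmod w)^2" if "w \<in> A" for w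
   using bd_square_le[of w] A_low[OF that] that A_disc d by auto
  \<comment> \<open>The factors \<open>kap\<close> and \<open>1 - (cmod w)^2\<close> are built in so
    that the weak equation for u comes out with right side
    \<open>g w / of_real (1 - (cmod w)^2)\<close>.\<close>
  define iH where "iH w = 1 / (of_real (kap * (1 - (cmod w)^2)) * H w)" for w
  have iHm: "(%w. indicator A w *\<^sub>R iH w) \<in> borel_measurable borel"
  proof (rule borel_measurable_continuous_on_indicator)
   show "continuous_on A iH" unfolding iH_def
   proof (intro continuous_intros continuous_on_subset[OF cH A_disc] ballI)
    fix w assume w: "w \<in> A"
    have "kap * (1 - (cmod w)^2) ~= 0" using kap_pos w1(1)[OF w] by simp
    then show "complex_of_real (kap * (1 - (cmod w)^2)) * H w ~= 0" using H_nz[OF w] by (simp only: mult_eq_0_iff of_real_eq_0_iff) simp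
   qed
  qed (simp add: A_def)
  define nu where "nu w = g w * (indicator A w *\<^sub>R iH w)" for w
  have num [measurable]: "nu \<in> borel_measurable borel"
   unfolding nu_def[abs_def] using gm iHm by (rule borel_measurable_times)
  have nu0: "nu w = 0" if "w \<notin> A" for w using that by (simp add: nu_def)
  have nub: "cmod (nu w) <= 2 / (kap * d) * (cmod (g w) * exp (kZ Z w))" for w
  proof (cases "w \<in> A")
   case True
   have "cmod (iH w) = 1 / (kap * (1 - (cmod w)^2) * cmod (H w))"
    unfolding iH_def norm_divide norm_mult norm_of_real using kap_pos w1(1)[OF True] by simp
   also have "... <= 1 / (kap * (d / 2) * cmod (H w))"
    using kap_pos w1[OF True] d H_nz[OF True] by (intro frac_le mult_right_mono mult_left_mono) auto
   also have "... = 2 / (kap * d) * (1 / cmod (H w))" by simp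
   also have "... <= 2 / (kap * d) * exp (kZ Z w)"
    using A_H[OF True] H_nz[OF True] kap_pos d by (intro mult_left_mono) (auto simp: pos_divide_le_eq mult.commute)
   finally have i: "cmod (iH w) <= 2 / (kap * d) * exp (kZ Z w)" .
   have "cmod (nu w) = cmod (g w) * cmod (iH w)" using True by (simp add: nu_def norm_mult)
   also have "... <= cmod (g w) * (2 / (kap * d) * exp (kZ Z w))" using i by (intro mult_left_mono) auto
   finally show ?thesis by (simp add: mult_ac)
  qed (use kap_pos d in \<open>simp add: nu0\<close>)
  note measurable_weight[measurable]
  have nuI: "(NN w. ennreal (cmod (nu w))) <= ennreal (2 / (kap * d) * y)"
  proof -
   have gA: "ennreal (cmod (g w) * (indicator disc w * exp (kZ Z w))) = ennreal (cmod (g w) * exp (kZ Z w)) * indicator A w" for w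
    using g0 A_disc by (auto simp: indicator_def A_def d_def)
   have "(NN w. ennreal (cmod (nu w))) <= (NN w. ennreal (2 / (kap * d)) * ennreal (cmod (g w) * (indicator disc w * exp (kZ Z w))))"
   proof (rule nn_integral_mono)
    fix w
    show "ennreal (cmod (nu w)) <= ennreal (2 / (kap * d)) * ennreal (cmod (g w) * (indicator disc w * exp (kZ Z w)))"
    proof (cases "w \<in> A")
     case True
     then show ?thesis unfolding gA using nub[of w] kap_pos d by (simp add: ennreal_leI flip: ennreal_mult)
    qed (simp add: nu0)
   qed
   also have "... = ennreal (2 / (kap * d)) * (NN w. ennreal (cmod (g w) * (indicator disc w * exp (kZ Z w))))"
    by (rule nn_integral_cmult) measurable
   also have "(NN w. ennreal (cmod (g w) * (indicator disc w * exp (kZ Z w)))) = ennreal y"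
    unfolding gA using gy by (simp add: A_def d_def)
   also have "ennreal (2 / (kap * d)) * ennreal y = ennreal (2 / (kap * d) * y)"
    using kap_pos d y0 by (intro ennreal_mult[symmetric]) auto
   finally show ?thesis .
  qed
  have nuInt: "integrable lborel nu"
  proof (rule integrableI_bounded)
   show "(NN w. ennreal (cmod (nu w))) < \<infinity>" using nuI ennreal_less_top le_less_trans by (metis infinity_ennreal_def)
  qed measurable
  define hd where "hd z = indicator disc z *\<^sub>R H z" for z
  have hdm [measurable]: "hd \<in> borel_measurable borel"
   unfolding hd_def[abs_def] by (rule borel_measurable_continuous_on_indicator[OF sets_disc cH])
  define u where "u z = hd z * CT nu z" for z
  have um [measurable]: "u \<in> borel_measurable borel"
   unfolding u_def[abs_def] by (intro borel_measurable_times hdm measurable_CT num)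
  have u0: "u z = 0" if "z \<notin> disc" for z using that by (simp add: u_def hd_def)
  have u1: "u z = H z * CT nu z" if "z \<in> disc" for z using that by (simp add: u_def hd_def)
  have CTnm [measurable]: "CTn nu \<in> borel_measurable borel" by (rule measurable_CT[OF num])
  \<comment> \<open>The natural size of the Cauchy transform at distance d from s: a mass of order y
    / d over a distance d.\<close>
  define x where "x = y / d^2"
  have x0: "0 <= x" using y0 by (simp add: x_def)
  have "wint p u <= ennreal (Ka * (x powr p * d^2))"
  \<comment> \<open>If y = 0 then nu vanishes almost everywhere; the case is separate because
    \<open>powr_split_le\<close> needs a positive level x.\<close>
  proof (cases "y = 0")
   case True
   then have "(NN w. ennreal (cmod (nu w))) = 0" using nuI by simp
   then have "AE w in lborel. ennreal (cmod (nu w)) = 0"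
    by (subst (asm) nn_integral_0_iff_AE) auto
   then have ae: "AE w in lborel. nu w = 0" by eventually_elim simp
   have "CT nu z = 0" for z
    unfolding CT_def by (rule integral_eq_zero_AE) (use ae in eventually_elim, simp)
   then have "wint p u = 0" unfolding wint_def u_def using p by simp
   then show ?thesis by simp
  next
   case False
   then have xp: "0 < x" using y0 d by (simp add: x_def)
   \<comment> \<open>Twice the radius of A, so that points outside D1 keep distance at least
     \<open>2 * sg * d\<close> from A, where nu lives.\<close>
   define D1 where "D1 = ball s (4 * sg * d)"
   have D1s: "D1 \<subseteq> ball s (bd s / 4)"
   proof -
    have "4 * sg * d <= 1/4 * d" using sg d by (intro mult_right_mono) auto
    then show ?thesis unfolding D1_def d_def by (intro subset_ball) simp
   qed
   have far: "cmod (CT nu z) <= x / (kap * sg)" if z: "z \<notin> D1" for z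
   proof -
    have "CTn nu z <= (NN w. ennreal (1 / (2 * sg * d)) * ennreal (cmod (nu w)))"
     unfolding CTn_def
    proof (rule nn_integral_mono)
     fix w
     show "ennreal (cmod (nu w) / cmod (z - w)) <= ennreal (1 / (2 * sg * d)) * ennreal (cmod (nu w))"
     proof (cases "w \<in> A")
      case True
      have "4 * sg * d <= dist s z" using z by (simp add: D1_def)
      then have "2 * sg * d <= cmod (z - w)" using True dist_triangle[of s z w] by (simp add: A_def dist_norm norm_minus_commute)
      then have "cmod (nu w) / cmod (z - w) <= cmod (nu w) / (2 * sg * d)" using sg d by (intro frac_le) auto
      then show ?thesis using sg d by (simp add: ennreal_leI flip: ennreal_mult)
     qed (simp add: nu0)
    qed
    also have "... = ennreal (1 / (2 * sg * d)) * (NN w. ennreal (cmod (nu w)))"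
     by (rule nn_integral_cmult) measurable
    also have "... <= ennreal (1 / (2 * sg * d)) * ennreal (2 / (kap * d) * y)" using nuI by (intro mult_left_mono) auto
    also have "... = ennreal (1 / (2 * sg * d) * (2 / (kap * d) * y))" using sg d kap_pos y0 by (intro ennreal_mult[symmetric]) auto
    also have "1 / (2 * sg * d) * (2 / (kap * d) * y) = x / (kap * sg)" using d by (simp add: x_def power2_eq_square)
    finally have "ennreal (cmod (CT nu z)) <= ennreal (x / (kap * sg))" using norm_CT_le order_trans by blast
    then show ?thesis using x0 kap_pos sg by (subst (asm) ennreal_le_iff) auto
   qed
   let ?W = "%z. ennreal ((cmod (H z) * exp (kZ Z z)) powr p) * indicator disc z"
   define a1 where "a1 = (x / (kap * sg)) powr p"
   define a2 where "a2 = K1 powr p * x powr p"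
   define a3 where "a3 = K1 powr p * x powr (p - 1)"
   have a0: "0 <= a1" "0 <= a2" "0 <= a3" by (simp_all add: a1_def a2_def a3_def)
   have pw: "ennreal ((cmod (u z) * exp (kZ Z z)) powr p) * indicator disc z
     <= ennreal a1 * ?W z + (ennreal a2 * indicator D1 z + ennreal a3 * (CTn nu z * indicator D1 z))" for z
   proof (cases "z \<in> disc")
    case zd: True
    show ?thesis
    proof (cases "z \<in> D1")
     case True
     have h: "cmod (H z) * exp (kZ Z z) <= K1" using K1(2)[OF H s wH] True D1s by blast
     have "cmod (u z) * exp (kZ Z z) = (cmod (H z) * exp (kZ Z z)) * cmod (CT nu z)" using u1[OF zd] by (simp add: norm_mult)
     also have "... <= K1 * cmod (CT nu z)" using h by (intro mult_right_mono) auto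
     finally have "(cmod (u z) * exp (kZ Z z)) powr p <= (K1 * cmod (CT nu z)) powr p" using p by (intro powr_mono2) auto
     also have "... = K1 powr p * cmod (CT nu z) powr p" by (rule powr_mult)
     also have "... <= K1 powr p * (x powr p + x powr (p - 1) * cmod (CT nu z))"
      using powr_split_le[OF norm_ge_zero xp p] by (intro mult_left_mono) auto
     also have "... = a2 + a3 * cmod (CT nu z)" by (simp add: a2_def a3_def algebra_simps)
     finally have "ennreal ((cmod (u z) * exp (kZ Z z)) powr p) <= ennreal (a2 + a3 * cmod (CT nu z))" by (rule ennreal_leI)
     also have "... = ennreal a2 + ennreal a3 * ennreal (cmod (CT nu z))" using a0 by (simp add: ennreal_plus ennreal_mult)
     also have "... <= ennreal a2 + ennreal a3 * CTn nu z" using norm_CT_le by (intro add_left_mono mult_left_mono) auto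
     finally show ?thesis using True zd by (simp add: add_increasing)
    next
     case False
     have "cmod (u z) * exp (kZ Z z) = cmod (CT nu z) * (cmod (H z) * exp (kZ Z z))" using u1[OF zd] by (simp add: norm_mult)
     also have "... <= x / (kap * sg) * (cmod (H z) * exp (kZ Z z))" using far[OF False] by (intro mult_right_mono) auto
     finally have "(cmod (u z) * exp (kZ Z z)) powr p <= (x / (kap * sg) * (cmod (H z) * exp (kZ Z z))) powr p" using p by (intro powr_mono2) auto
     also have "... = a1 * (cmod (H z) * exp (kZ Z z)) powr p" unfolding a1_def by (rule powr_mult)
     finally have "ennreal ((cmod (u z) * exp (kZ Z z)) powr p) <= ennreal (a1 * (cmod (H z) * exp (kZ Z z)) powr p)" by (rule ennreal_leI)
     also have "... = ennreal a1 * ennreal ((cmod (H z) * exp (kZ Z z)) powr p)" using a0 by (intro ennreal_mult) auto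
     finally show ?thesis using False zd by simp
    qed
   qed simp
   have D1b [measurable]: "D1 \<in> sets borel" by (simp add: D1_def)
   define WW where "WW z = ?W z" for z
   have [measurable]: "WW \<in> borel_measurable borel" unfolding WW_def[abs_def] using wmeas[OF cH p(1)] .
   have "wint p u <= (NN z. ennreal a1 * WW z + (ennreal a2 * indicator D1 z + ennreal a3 * (CTn nu z * indicator D1 z)))"
    unfolding wint_def WW_def by (intro nn_integral_mono pw)
   also have "... = ennreal a1 * (NN z. WW z) + (ennreal a2 * emeasure lborel D1 + ennreal a3 * (nn_set D1 (%z. CTn nu z)))"
    by (simp add: nn_integral_add nn_integral_cmult)
   also have "... <= ennreal a1 * ennreal (C0 * d^2) + (ennreal a2 * ennreal (pi * (4 * sg * d)^2) + ennreal a3 * (ennreal (17 * pi * (4 * sg * d)) * ennreal (2 / (kap * d) * y)))"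
   proof (intro add_mono mult_left_mono)
    show "(NN z. WW z) <= ennreal (C0 * d^2)" using wH by (simp add: wint_def WW_def d_def)
    show "emeasure lborel D1 <= ennreal (pi * (4 * sg * d)^2)" unfolding D1_def using sg d by (subst emeasure_ball_complex) auto
    have "(nn_set D1 (%z. CTn nu z)) <= ennreal (17 * pi * (4 * sg * d)) * (NN w. ennreal (cmod (nu w)))"
     unfolding D1_def using sg d by (intro CTn_ball num) auto
    also have "... <= ennreal (17 * pi * (4 * sg * d)) * ennreal (2 / (kap * d) * y)" using nuI by (intro mult_left_mono) auto
    finally show "(nn_set D1 (%z. CTn nu z)) <= ennreal (17 * pi * (4 * sg * d)) * ennreal (2 / (kap * d) * y)" .
   qed auto
   also have "... = ennreal (a1 * (C0 * d^2) + (a2 * (pi * (4 * sg * d)^2) + a3 * (17 * pi * (4 * sg * d) * (2 / (kap * d) * y))))"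
    using a0 C0 sg d kap_pos y0 by (simp only: ennreal_plus ennreal_mult mult_nonneg_nonneg add_nonneg_nonneg divide_nonneg_nonneg zero_le_power2 pi_ge_zero less_imp_le zero_le_numeral)
   also have "a1 * (C0 * d^2) + (a2 * (pi * (4 * sg * d)^2) + a3 * (17 * pi * (4 * sg * d) * (2 / (kap * d) * y))) = Ka * (x powr p * d^2)"
   proof -
    have "a1 = (1 / (kap * sg)) powr p * x powr p"
     unfolding a1_def by (subst powr_mult[symmetric]) simp
    moreover have "a3 * y = K1 powr p * x powr p * d^2"
    proof -
     have "y = x * d^2" using d by (simp add: x_def)
     then have "a3 * y = K1 powr p * (x powr (p - 1) * x) * d^2" by (simp add: a3_def)
     also have "x powr (p - 1) * x = x powr p" using powr_add[of x "p - 1" 1] xp by simp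
     finally show ?thesis .
    qed
    moreover have "a3 * (17 * pi * (4 * sg * d) * (2 / (kap * d) * y)) = (136 * pi * sg / kap) * (a3 * y)"
     using d by simp
    ultimately show ?thesis by (simp add: Ka_def a2_def power_mult_distrib algebra_simps)
   qed
   finally show ?thesis .
  qed
  moreover have "Ka * (x powr p * d^2) <= (Ka + Kb) * ((y / (bd s)^2) powr p * (bd s)^2)"
   unfolding x_def d_def using Kab by (intro mult_right_mono) auto
  ultimately have P1: "wint p u <= ennreal ((Ka + Kb) * ((y / (bd s)^2) powr p * (bd s)^2))"
   by (meson ennreal_leI order_trans)
  \<comment> \<open>The weighted p-integral gives no local integrability when p < 1; this L1 bound
    does. The negative power of m comes from point evaluation of H.\<close>
  have P2: "(nn_set (cball 0 (1 - m)) (%z. ennreal (cmod (u z)))) <= ennreal ((Ka + Kb) * m powr (- 2 / p) * (bd s powr (2 / p) * (y / (bd s)^2)))"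
   if m: "0 < m" for m
  proof -
   define M where "M = (Cb * C0) powr (1/p) * m powr (- 2 / p) * d powr (2 / p)"
   have M: "cmod (H z) <= M" if z: "z \<in> cball 0 (1 - m)" for z
   proof -
    have bz: "m <= bd z" using z by (simp add: bd_def)
    have zd: "z \<in> disc" using z m by (simp add: disc_iff)
    have "ennreal (cmod (H z) powr p) <= ennreal (Cb / (bd z)^2) * Bint p H" by (rule Cb(2)[OF H zd])
    also have "... <= ennreal (Cb / m^2) * ennreal (C0 * d^2)"
    proof (intro mult_mono ennreal_leI)
     have "m^2 <= (bd z)^2" using bz m by (intro power_mono) auto
     then show "Cb / (bd z)^2 <= Cb / m^2" using Cb(1) m by (intro frac_le) auto
     show "Bint p H <= ennreal (C0 * d^2)" using Bint_le_wint[OF p(1), of H] wH by (simp add: d_def)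
    qed auto
    also have "... = ennreal (Cb / m^2 * (C0 * d^2))" using Cb C0 by (intro ennreal_mult[symmetric]) auto
    finally have "cmod (H z) powr p <= Cb / m^2 * (C0 * d^2)" using Cb(1) C0 by (subst (asm) ennreal_le_iff) auto
    then have "(cmod (H z) powr p) powr (1/p) <= ((Cb * C0) * (m powr (-2) * d powr 2)) powr (1/p)"
     using p m d by (intro powr_mono2) (auto simp: powr_minus divide_inverse mult_ac)
    moreover have "(cmod (H z) powr p) powr (1/p) = cmod (H z)" using p by (simp add: powr_powr)
    moreover have "((Cb * C0) * (m powr (-2) * d powr 2)) powr (1/p) = M"
     unfolding M_def powr_mult[of "Cb * C0"] powr_mult[of "m powr (-2)"] by (simp add: powr_powr)
    ultimately show ?thesis by (simp only:)
   qed
   have M0: "0 <= M" using Cb C0 by (simp add: M_def)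
   have "(nn_set (cball 0 (1 - m)) (%z. ennreal (cmod (u z)))) <= (NN z. ennreal M * (CTn nu z * indicator (ball 0 1) z))"
   proof (rule nn_integral_mono)
    fix z show "ennreal (cmod (u z)) * indicator (cball 0 (1 - m)) z <= ennreal M * (CTn nu z * indicator (ball 0 1) z)"
    proof (cases "z \<in> cball 0 (1 - m)")
     case True
     then have zd: "z \<in> disc" "z \<in> ball 0 1" using m by (auto simp: disc_iff)
     have "ennreal (cmod (u z)) = ennreal (cmod (H z)) * ennreal (cmod (CT nu z))" using u1[OF zd(1)] by (simp add: norm_mult ennreal_mult)
     also have "... <= ennreal M * CTn nu z" using M[OF True] norm_CT_le by (intro mult_mono ennreal_leI) auto
     finally show ?thesis using True zd by simp
    qed simp
   qed
   also have "... = ennreal M * (nn_set (ball 0 1) (%z. CTn nu z))"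
    by (rule nn_integral_cmult) (auto intro!: borel_measurable_times_ennreal borel_measurable_indicator)
   also have "... <= ennreal M * (ennreal (17 * pi * 1) * ennreal (2 / (kap * d) * y))"
   proof (intro mult_left_mono)
    have "(nn_set (ball 0 1) (%z. CTn nu z)) <= ennreal (17 * pi * 1) * (NN w. ennreal (cmod (nu w)))"
     by (intro CTn_ball num) auto
    also have "... <= ennreal (17 * pi * 1) * ennreal (2 / (kap * d) * y)" using nuI by (intro mult_left_mono) auto
    finally show "(nn_set (ball 0 1) (%z. CTn nu z)) <= ennreal (17 * pi * 1) * ennreal (2 / (kap * d) * y)" .
   qed simp
   also have "... = ennreal (M * (17 * pi * 1 * (2 / (kap * d) * y)))"
   proof -
    have "0 <= 2 / (kap * d) * y" using kap_pos d y0 by simp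
    then show ?thesis using M0 by (subst ennreal_mult[symmetric] ennreal_mult'[symmetric]; (subst ennreal_mult'[symmetric])?; simp)
   qed
   also have "... <= ennreal ((Ka + Kb) * m powr (- 2 / p) * (bd s powr (2 / p) * (y / (bd s)^2)))"
   proof (rule ennreal_leI)
    have "M * (17 * pi * 1 * (2 / (kap * d) * y)) = Kb * m powr (- 2 / p) * (d powr (2 / p) * (x * d))"
     using d by (simp add: M_def Kb_def x_def power2_eq_square)
    also have "... <= (Ka + Kb) * m powr (- 2 / p) * (d powr (2 / p) * (x * 1))"
     using Kab x0 d by (intro mult_mono mult_left_mono mult_nonneg_nonneg) auto
    finally show "M * (17 * pi * 1 * (2 / (kap * d) * y)) <= (Ka + Kb) * m powr (- 2 / p) * (bd s powr (2 / p) * (y / (bd s)^2))"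
     by (simp add: x_def d_def)
   qed
   finally show ?thesis .
  qed
  \<comment> \<open>H is holomorphic, so it can be moved into the test function: \<open>dbar\<close>
    of \<phi> H is H times \<open>dbar \<phi>\<close>.\<close>
  have P3: "integrable lborel (%z. u z * dbar \<phi> z) \<and>
      (LINT z|lborel. u z * dbar \<phi> z) = - (LINT w|lborel. g w / of_real (1 - (cmod w)^2) * \<phi> w)"
   if m: "0 < m" and phi: "C1 \<phi>" and ph0: "\<forall>z. z \<notin> cball 0 (1 - m) --> \<phi> z = 0" for m \<phi>
  proof -
   have sub: "cball 0 (1 - m) \<subseteq> disc" using m by (auto simp: disc_iff)
   have psi: "C1 (%z. \<phi> z * H z)" "!!z. dbar (%z. \<phi> z * H z) z = dbar \<phi> z * H z"
    using C1_mult_holomorphic[OF phi open_disc H closed_cball sub] ph0 by auto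
   have supp: "\<phi> z * H z = 0" if "1 < cmod z" for z using ph0 that m by simp
   have d0: "dbar \<phi> z = 0" if "z \<notin> disc" for z
    using dbar_support[OF phi, of "1 - m" z] ph0 that m by (auto simp: disc_iff)
   have eq: "u z * dbar \<phi> z = CT nu z * dbar (%z. \<phi> z * H z) z" for z
   proof (cases "z \<in> disc")
    case True then show ?thesis by (simp add: u1 psi(2))
   next
    case False then show ?thesis by (simp add: d0 psi(2))
   qed
   have eq2: "of_real kap * (nu w * (\<phi> w * H w)) = g w / of_real (1 - (cmod w)^2) * \<phi> w" for w
   proof (cases "w \<in> A")
    case True
    have "of_real kap * (nu w * (\<phi> w * H w)) = (kk * (g w * (1 / (kk * ww * H w)))) * (\<phi> w * H w)" if "kk = of_real kap" "ww = of_real (1 - (cmod w)^2)" for kk ww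
     using True that by (simp add: nu_def iH_def mult.assoc)
    from this[OF refl refl] show ?thesis using H_nz[OF True] kap_pos w1(1)[OF True] by (simp del: of_real_diff)
   next
    case False
    then have "g w = 0" using g0 by (simp add: A_def d_def)
    then show ?thesis by (simp add: nu_def)
   qed
   note CW = CT_weak[OF nuInt psi(1) supp]
   have "(LINT z|lborel. u z * dbar \<phi> z) = - (of_real kap * (LINT w|lborel. nu w * (\<phi> w * H w)))"
    unfolding eq using CW(2) by simp
   also have "of_real kap * (LINT w|lborel. nu w * (\<phi> w * H w)) = (LINT w|lborel. of_real kap * (nu w * (\<phi> w * H w)))"
    by (rule integral_mult_right_zero[symmetric])
   finally show ?thesis unfolding eq2 using CW(1) unfolding eq by blast
  qed
  show "\<exists>u. u \<in> borel_measurable borel \<and> (\<forall>z. z \<notin> disc --> u z = 0) \<and>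
    wint p u <= ennreal ((Ka + Kb) * ((y / (bd s)^2) powr p * (bd s)^2)) \<and>
    (\<forall>m>0. (nn_set (cball 0 (1 - m)) (%z. ennreal (cmod (u z)))) <= ennreal ((Ka + Kb) * m powr (- 2 / p) * (bd s powr (2 / p) * (y / (bd s)^2)))) \<and>
    (\<forall>m \<phi>. 0 < m \<and> C1 \<phi> \<and> (\<forall>z. z \<notin> cball 0 (1 - m) --> \<phi> z = 0) -->
      integrable lborel (%z. u z * dbar \<phi> z) \<and>
      (LINT z|lborel. u z * dbar \<phi> z) = - (LINT w|lborel. g w / of_real (1 - (cmod w)^2) * \<phi> w))"
   using um u0 P1 P2 P3 by (intro exI[of _ u]) blast
 qed
qed

end

section \<open>Summation of the local solutions\<close>

lemma suminf_powr_le: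
 fixes x :: "nat => real"
 assumes "!!n. 0 <= x n" "summable x" "0 < p" "p <= 1"
 shows "ennreal ((\<Sum>n. x n) powr p) <= (\<Sum>n. ennreal (x n powr p))"
proof (rule LIMSEQ_le_const2)
 show "(%N. ennreal ((\<Sum>n<N. x n) powr p)) \<longlonglongrightarrow> ennreal ((\<Sum>n. x n) powr p)"
  using assms by (intro tendsto_ennrealI tendsto_powr2 summable_LIMSEQ tendsto_const always_eventually allI sum_nonneg) auto
 have "ennreal ((\<Sum>n<N. x n) powr p) <= (\<Sum>n. ennreal (x n powr p))" for N
 proof -
  have "ennreal ((\<Sum>n<N. x n) powr p) <= ennreal (\<Sum>n<N. x n powr p)"
   using assms by (intro ennreal_leI sum_powr_le) auto
  also have "... = (\<Sum>n<N. ennreal (x n powr p))" by (simp add: sum_ennreal)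
  also have "... <= (\<Sum>n. ennreal (x n powr p))" by (intro sum_le_suminf) auto
  finally show ?thesis .
 qed
 then show "\<exists>N. \<forall>n\<ge>N. ennreal ((\<Sum>n<n. x n) powr p) <= (\<Sum>n. ennreal (x n powr p))" by blast
qed

lemma suminf_ennreal_le:
 fixes X :: "nat => real"
 assumes "!!n. 0 <= X n" "!!N. (\<Sum>n<N. X n) <= B" "0 <= K"
 shows "(\<Sum>n. ennreal (K * X n)) <= ennreal (K * B)"
proof (rule suminf_le_const)
 show "summable (%n. ennreal (K * X n))" by simp
 fix N
 have "(\<Sum>n<N. ennreal (K * X n)) = ennreal (K * (\<Sum>n<N. X n))"
  using assms by (simp add: sum_ennreal sum_distrib_left)
 also have "... <= ennreal (K * B)" using assms by (intro ennreal_leI mult_left_mono) auto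
 finally show "(\<Sum>n<N. ennreal (K * X n)) <= ennreal (K * B)" .
qed

lemma AE_summable_cball:
 fixes u :: "nat => complex => complex"
 assumes [measurable]: "!!n. u n \<in> borel_measurable borel"
  and Y: "!!n. 0 <= Y n" "!!N. (\<Sum>n<N. Y n) <= PY" and L: "0 <= L"
  and l: "!!n. (nn_set (cball 0 r) (%z. ennreal (cmod (u n z)))) <= ennreal (L * Y n)"
 shows "(nn_set (cball 0 r) (%z. (\<Sum>n. ennreal (cmod (u n z))))) <= ennreal (L * PY)"
  and "AE z in lborel. z \<in> cball 0 r --> summable (%n. cmod (u n z))"
proof -
 have cb [measurable]: "cball 0 r \<in> sets (borel :: complex measure)" by simp
 have "(nn_set (cball 0 r) (%z. (\<Sum>n. ennreal (cmod (u n z)))))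
   = (NN z. (\<Sum>n. ennreal (cmod (u n z)) * indicator (cball 0 r) z))"
  by (simp add: ennreal_suminf_multc)
 also have "... = (\<Sum>n. nn_set (cball 0 r) (%z. ennreal (cmod (u n z))))"
  by (rule nn_integral_suminf) measurable
 also have "... <= (\<Sum>n. ennreal (L * Y n))" by (intro suminf_le l) auto
 also have "... <= ennreal (L * PY)" by (rule suminf_ennreal_le[OF Y L])
 finally show *: "(nn_set (cball 0 r) (%z. (\<Sum>n. ennreal (cmod (u n z))))) <= ennreal (L * PY)" .
 then have "(nn_set (cball 0 r) (%z. (\<Sum>n. ennreal (cmod (u n z))))) ~= \<infinity>"
  by (auto simp: top_unique)
 then have "AE z in lborel. (\<Sum>n. ennreal (cmod (u n z))) * indicator (cball 0 r) z ~= \<infinity>"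
  by (intro nn_integral_PInf_AE) measurable
 then show "AE z in lborel. z \<in> cball 0 r --> summable (%n. cmod (u n z))"
  by eventually_elim (auto intro!: summable_suminf_not_top)
qed

lemma disc_cball: "z \<in> disc \<longleftrightarrow> (\<exists>k::nat. z \<in> cball 0 (1 - 1 / real (Suc k)))"
proof
 assume "z \<in> disc"
 then have "0 < 1 - cmod z" by (simp add: disc_iff)
 then obtain k where "inverse (real (Suc k)) < 1 - cmod z" using reals_Archimedean by blast
 then show "\<exists>k. z \<in> cball 0 (1 - 1 / real (Suc k))" by (intro exI[of _ k]) (simp add: inverse_eq_divide)
next
 assume "\<exists>k::nat. z \<in> cball 0 (1 - 1 / real (Suc k))"
 then obtain k :: nat where "cmod z <= 1 - 1 / real (Suc k)" by auto
 then show "z \<in> disc" by (simp add: disc_iff) (smt (verit) divide_pos_pos of_nat_0_le_iff)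
qed

lemma integrable_norm_bound:
 fixes f :: "complex => complex"
 assumes [measurable]: "f \<in> borel_measurable borel" and b: "(NN z. ennreal (cmod (f z))) <= ennreal B" and B: "0 <= B"
 shows "integrable lborel f" "(LINT z|lborel. cmod (f z)) <= B"
proof -
 show i: "integrable lborel f"
 proof (rule integrableI_bounded)
  show "(NN z. ennreal (cmod (f z))) < \<infinity>" using b ennreal_less_top le_less_trans by (metis infinity_ennreal_def)
 qed measurable
 have "ennreal (LINT z|lborel. cmod (f z)) = (NN z. ennreal (cmod (f z)))"
  using i by (intro nn_integral_eq_integral[symmetric]) auto
 then show "(LINT z|lborel. cmod (f z)) <= B" using b B by (simp flip: ennreal_le_iff[OF B])
qed

lemma LINT_suminf_bound:
 fixes h :: "nat => complex => complex"
 assumes [measurable]: "!!n. h n \<in> borel_measurable borel"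
  and Y: "!!n. 0 <= Y n" "!!N. (\<Sum>n<N. Y n) <= PY" and L: "0 <= L"
  and l: "!!n. (NN z. ennreal (cmod (h n z))) <= ennreal (L * Y n)"
  and s: "AE z in lborel. summable (%n. cmod (h n z))"
 shows "integrable lborel (%z. \<Sum>n. h n z)" "(%n. LINT z|lborel. h n z) sums (LINT z|lborel. (\<Sum>n. h n z))"
proof -
 have b: "integrable lborel (h n)" "(LINT z|lborel. cmod (h n z)) <= L * Y n" for n
  using integrable_norm_bound[OF _ l[of n]] L Y(1) by auto
 have "summable Y"
 proof (rule summableI_nonneg_bounded[of _ PY])
  show "0 <= Y n" "(\<Sum>n<N. Y n) <= PY" for n N using Y by auto
 qed
 then have "summable (%n. L * Y n)" by (rule summable_mult)
 then have S: "summable (%n. LINT z|lborel. cmod (h n z))"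
  by (rule summable_comparison_test') (use b(2) in \<open>simp\<close>)
 show "integrable lborel (%z. \<Sum>n. h n z)" by (rule integrable_suminf[OF b(1) s S])
 show "(%n. LINT z|lborel. h n z) sums (LINT z|lborel. (\<Sum>n. h n z))" by (rule sums_integral[OF b(1) s S])
qed

context separated_set
begin

text \<open>Two sets of bounds run in parallel: \<open>K * X n\<close> for the weighted p-integrals,
  which add because p <= 1, and \<open>L m * Y n\<close> for the L1 norms on smaller discs, which
  make the series converge almost everywhere and allow sum and integral to be exchanged in the weak
  equation. The hypothesis \<open>gs\<close> says that the functions \<open>g n\<close> are f0 cut
  along a partition.\<close>

lemma sum_pieces:
 fixes u g :: "nat => complex => complex"
 assumes p: "0 < p" "p <= 1" and K: "0 <= K" and L: "!!m. 0 < m ==> 0 <= L m"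
  and um [measurable]: "!!n. u n \<in> borel_measurable borel" and gm [measurable]: "!!n. g n \<in> borel_measurable borel"
  and X: "!!n. 0 <= X n" "!!N. (\<Sum>n<N. X n) <= PX"
  and Y: "!!n. 0 <= Y n" "!!N. (\<Sum>n<N. Y n) <= PY"
  and w: "!!n. wint p (u n) <= ennreal (K * X n)"
  and lu: "!!n m. 0 < m ==> (nn_set (cball 0 (1 - m)) (%z. ennreal (cmod (u n z)))) <= ennreal (L m * Y n)"
  and lg: "!!n m. 0 < m ==> (nn_set (cball 0 (1 - m)) (%z. ennreal (cmod (g n z)))) <= ennreal (L m * Y n)"
  and gs: "!!z. \<exists>n. \<forall>k. g k z = (if k = n then f0 z else 0)"
  and weak: "!!n m \<phi>. 0 < m ==> C1 \<phi> ==> (\<forall>z. z \<notin> cball 0 (1 - m) --> \<phi> z = 0) ==>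
      integrable lborel (%z. u n z * dbar \<phi> z) \<and>
      (LINT z|lborel. u n z * dbar \<phi> z) = - (LINT w|lborel. g n w / of_real (1 - (cmod w)^2) * \<phi> w)"
 shows "\<exists>U. U \<in> borel_measurable borel \<and> wint p U <= ennreal (K * PX) \<and>
   (\<forall>m>0. (nn_set (cball 0 (1 - m)) (%z. ennreal (cmod (U z)))) < \<infinity>) \<and>
   (\<forall>m \<phi>. 0 < m \<and> C1 \<phi> \<and> (\<forall>z. z \<notin> cball 0 (1 - m) --> \<phi> z = 0) -->
      (LINT z|lborel. U z * dbar \<phi> z) = - (LINT w|lborel. f0 w / of_real (1 - (cmod w)^2) * \<phi> w))"
proof -
 define U where "U z = (\<Sum>n. u n z)" for z
 have Um [measurable]: "U \<in> borel_measurable borel" unfolding U_def[abs_def] by measurable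
 have ae: "AE z in lborel. z \<in> disc --> summable (%n. cmod (u n z))"
 proof -
  have "AE z in lborel. \<forall>k::nat. z \<in> cball 0 (1 - 1 / real (Suc k)) --> summable (%n. cmod (u n z))"
  proof (subst AE_all_countable, intro allI)
   fix k :: nat
   have "0 < 1 / real (Suc k)" by simp
   then show "AE z in lborel. z \<in> cball 0 (1 - 1 / real (Suc k)) --> summable (%n. cmod (u n z))"
    by (intro AE_summable_cball(2)[OF um Y L lu])
  qed
  then show ?thesis by eventually_elim (use disc_cball in blast)
 qed
 have P1: "wint p U <= ennreal (K * PX)"
 proof -
  define W where "W n z = ennreal ((cmod (u n z) * exp (kZ Z z)) powr p) * indicator disc z" for n z
  have Wm: "W n \<in> borel_measurable borel" for n unfolding W_def[abs_def] by (rule wmeas_borel[OF um])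
  have "wint p U <= (NN z. (\<Sum>n. W n z))"
   unfolding wint_def
  proof (rule nn_integral_mono_AE, use ae in eventually_elim)
   fix z assume s: "z \<in> disc --> summable (%n. cmod (u n z))"
   show "ennreal ((cmod (U z) * exp (kZ Z z)) powr p) * indicator disc z <= (\<Sum>n. W n z)"
   proof (cases "z \<in> disc")
    case True
    then have s: "summable (%n. cmod (u n z))" using s by simp
    have "cmod (U z) * exp (kZ Z z) <= (\<Sum>n. cmod (u n z)) * exp (kZ Z z)"
     unfolding U_def by (intro mult_right_mono summable_norm s) auto
    also have "... = (\<Sum>n. cmod (u n z) * exp (kZ Z z))" by (rule suminf_mult2[OF s])
    finally have "ennreal ((cmod (U z) * exp (kZ Z z)) powr p) <= ennreal ((\<Sum>n. cmod (u n z) * exp (kZ Z z)) powr p)"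
     using p by (intro ennreal_leI powr_mono2) auto
    also have "... <= (\<Sum>n. ennreal ((cmod (u n z) * exp (kZ Z z)) powr p))"
     using p by (intro suminf_powr_le summable_mult2 s) auto
    finally show ?thesis using True by (simp add: W_def)
   qed simp
  qed
  also have "... = (\<Sum>n. NN z. W n z)" using Wm by (intro nn_integral_suminf) simp
  also have "... <= (\<Sum>n. ennreal (K * X n))" using w unfolding wint_def W_def by (intro suminf_le) auto
  also have "... <= ennreal (K * PX)" by (rule suminf_ennreal_le[OF X K])
  finally show ?thesis .
 qed
 have P2: "(nn_set (cball 0 (1 - m)) (%z. ennreal (cmod (U z)))) < \<infinity>" if m: "0 < m" for m
 proof -
  have sub: "z \<in> disc" if "z \<in> cball 0 (1 - m)" for z using that m by (simp add: disc_iff)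
  have "(nn_set (cball 0 (1 - m)) (%z. ennreal (cmod (U z)))) <= (nn_set (cball 0 (1 - m)) (%z. (\<Sum>n. ennreal (cmod (u n z)))))"
  proof (rule nn_integral_mono_AE, use ae in eventually_elim)
   fix z assume s: "z \<in> disc --> summable (%n. cmod (u n z))"
   show "ennreal (cmod (U z)) * indicator (cball 0 (1 - m)) z <= (\<Sum>n. ennreal (cmod (u n z))) * indicator (cball 0 (1 - m)) z"
   proof (cases "z \<in> cball 0 (1 - m)")
    case True
    then have s: "summable (%n. cmod (u n z))" using s sub by simp
    have "ennreal (cmod (U z)) <= ennreal (\<Sum>n. cmod (u n z))" unfolding U_def by (intro ennreal_leI summable_norm s)
    also have "... = (\<Sum>n. ennreal (cmod (u n z)))" using s by (intro suminf_ennreal2[symmetric]) auto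
    finally show ?thesis using True by simp
   qed simp
  qed
  also have "... <= ennreal (L m * PY)" by (rule AE_summable_cball(1)[OF um Y L[OF m] lu[OF m]])
  finally show ?thesis using ennreal_less_top le_less_trans by (metis infinity_ennreal_def)
 qed
 have P3: "(LINT z|lborel. U z * dbar \<phi> z) = - (LINT w|lborel. f0 w / of_real (1 - (cmod w)^2) * \<phi> w)"
  if m: "0 < m" and phi: "C1 \<phi>" and ph0: "\<forall>z. z \<notin> cball 0 (1 - m) --> \<phi> z = 0" for m \<phi>
 proof -
  have sub: "z \<in> disc" "m <= 1 - (cmod z)^2" if "z \<in> cball 0 (1 - m)" for z
  proof -
   show zd: "z \<in> disc" using that m by (simp add: disc_iff)
   show "m <= 1 - (cmod z)^2" using bd_square_le[OF zd] that by (simp add: bd_def)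
  qed
  have ph1: "\<phi> z = 0" if "1 - m < cmod z" for z using ph0 that by simp
  have d0: "dbar \<phi> z = 0" if "1 - m < cmod z" for z by (rule dbar_support[OF phi ph1 that])
  obtain M1 where M1: "0 < M1" "!!z. cmod (dbar \<phi> z) <= M1"
   using compact_support_bounded[OF C1_dbar_continuous[OF phi] d0] by blast
  obtain M2 where M2: "0 < M2" "!!z. cmod (\<phi> z) <= M2"
   using compact_support_bounded[OF C1_continuous[OF phi] ph1] by blast
  have [measurable]: "dbar \<phi> \<in> borel_measurable borel" "\<phi> \<in> borel_measurable borel"
   by (intro borel_measurable_continuous_onI C1_dbar_continuous C1_continuous phi)+
  have mono: "(NN z. ennreal (cmod (h z * b z))) <= ennreal (M * L m * Yn)"
   if "(nn_set (cball 0 (1 - m)) (%z. ennreal (cmod (h z)))) <= ennreal (L m * Yn)" "0 <= M" "0 <= Yn"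
    and b: "!!z. cmod (b z) <= M * indicator (cball 0 (1 - m)) z" and [measurable]: "h \<in> borel_measurable borel"
   for h b :: "complex => complex" and M Yn :: real
  proof -
   have "(NN z. ennreal (cmod (h z * b z))) <= (NN z. ennreal M * (ennreal (cmod (h z)) * indicator (cball 0 (1 - m)) z))"
   proof (rule nn_integral_mono)
    fix z
    have "cmod (h z * b z) <= cmod (h z) * (M * indicator (cball 0 (1 - m)) z)"
     unfolding norm_mult by (intro mult_left_mono b) auto
    then show "ennreal (cmod (h z * b z)) <= ennreal M * (ennreal (cmod (h z)) * indicator (cball 0 (1 - m)) z)"
     using that(2) by (cases "z \<in> cball 0 (1 - m)") (auto simp: mult_ac ennreal_leI simp flip: ennreal_mult)
   qed
   also have "... = ennreal M * (nn_set (cball 0 (1 - m)) (%z. ennreal (cmod (h z))))"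
    by (rule nn_integral_cmult) (auto intro!: borel_measurable_times_ennreal borel_measurable_indicator)
   also have "... <= ennreal M * ennreal (L m * Yn)" using that(1) by (intro mult_left_mono) auto
   also have "... = ennreal (M * L m * Yn)" using that(2,3) L[OF m] by (simp add: mult.assoc flip: ennreal_mult)
   finally show ?thesis .
  qed
  define h1 where "h1 n z = u n z * dbar \<phi> z" for n z
  have h1s: "AE z in lborel. summable (%n. cmod (h1 n z)) \<and> (\<Sum>n. h1 n z) = U z * dbar \<phi> z"
   using ae
  proof eventually_elim
   fix z assume s: "z \<in> disc --> summable (%n. cmod (u n z))"
   show "summable (%n. cmod (h1 n z)) \<and> (\<Sum>n. h1 n z) = U z * dbar \<phi> z"
   proof (cases "z \<in> cball 0 (1 - m)")
    case True
    then have s: "summable (%n. cmod (u n z))" using s sub by simp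
    show ?thesis unfolding h1_def U_def norm_mult
     using s summable_norm_cancel[OF s] by (auto intro: summable_mult2 suminf_mult2[symmetric])
   next
    case False
    then show ?thesis using d0 by (simp add: h1_def)
   qed
  qed
  have [measurable]: "h1 n \<in> borel_measurable borel" for n unfolding h1_def[abs_def] by measurable
  have "(NN z. ennreal (cmod (h1 n z))) <= ennreal (M1 * L m * Y n)" for n
   unfolding h1_def using M1 d0 Y(1) by (intro mono lu m) (auto simp: indicator_def)
  then have S1: "(%n. LINT z|lborel. h1 n z) sums (LINT z|lborel. (\<Sum>n. h1 n z))"
   using M1 L[OF m] h1s by (intro LINT_suminf_bound(2)[OF _ Y, of h1 "M1 * L m"]) auto
  have e1: "(LINT z|lborel. (\<Sum>n. h1 n z)) = (LINT z|lborel. U z * dbar \<phi> z)"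
   by (rule integral_cong_AE, measurable) (use h1s in auto)
  define b where "b w = \<phi> w / of_real (1 - (cmod w)^2)" for w
  have bb: "cmod (b w) <= M2 / m * indicator (cball 0 (1 - m)) w" for w
  proof (cases "w \<in> cball 0 (1 - m)")
   case True
   have "cmod (b w) = cmod (\<phi> w) / (1 - (cmod w)^2)" unfolding b_def norm_divide norm_of_real using sub[OF True] m by simp
   also have "... <= M2 / m" using M2 m sub[OF True] by (intro frac_le) auto
   finally show ?thesis using True by simp
  qed (use ph1 in \<open>simp add: b_def\<close>)
  have [measurable]: "b \<in> borel_measurable borel" unfolding b_def[abs_def] by measurable
  define h2 where "h2 n w = g n w * b w" for n w
  have [measurable]: "h2 n \<in> borel_measurable borel" for n unfolding h2_def[abs_def] by measurable
  have "(NN z. ennreal (cmod (h2 n z))) <= ennreal (M2 / m * L m * Y n)" for n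
   unfolding h2_def using M2 m Y(1) by (intro mono lg m bb) auto
  moreover have h2s: "summable (%n. cmod (h2 n z)) \<and> (\<Sum>n. h2 n z) = f0 z * b z" for z
  proof -
   obtain n where n: "!!k. g k z = (if k = n then f0 z else 0)" using gs by blast
   have "(%k. h2 k z) = (%k. if k = n then f0 z * b z else 0)" by (auto simp: h2_def n)
   moreover have "(%k. if k = n then f0 z * b z else 0) sums (f0 z * b z)" by (rule sums_single)
   moreover have "(%k. cmod (h2 k z)) = (%k. if k = n then cmod (f0 z * b z) else 0)" by (auto simp: h2_def n)
   moreover have "(%k. if k = n then cmod (f0 z * b z) else 0) sums cmod (f0 z * b z)" by (rule sums_single)
   ultimately show ?thesis by (simp add: sums_iff)
  qed
  ultimately have S2: "(%n. LINT z|lborel. h2 n z) sums (LINT z|lborel. (\<Sum>n. h2 n z))"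
   using M2 m L[OF m] by (intro LINT_suminf_bound(2)[OF _ Y, of h2 "M2 / m * L m"]) auto
  have "(LINT z|lborel. h1 n z) = - (LINT z|lborel. h2 n z)" for n
   using weak[OF m phi ph0, of n] by (simp add: h1_def h2_def b_def)
  then have "(%n. LINT z|lborel. h1 n z) sums (- (LINT z|lborel. (\<Sum>n. h2 n z)))"
   using sums_minus[OF S2] by simp
  from sums_unique2[OF S1 this] show ?thesis unfolding e1 using h2s by (simp add: b_def)
 qed
 show ?thesis using Um P1 P2 P3 by blast
qed

end

lemma compact_subset_cball:
 assumes "compact K" "K \<subseteq> disc"
 shows "\<exists>m>0. K \<subseteq> cball 0 (1 - m)"
proof (cases "K = {}")
 case False
 obtain a where "a \<in> K" "!!z. z \<in> K ==> cmod z <= cmod a"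
  using continuous_attains_sup[OF assms(1) False, of cmod] by (auto intro: continuous_intros)
 then show ?thesis using assms(2) by (intro exI[of _ "bd a"]) (auto simp: bd_def disc_iff)
qed (auto intro: exI[of _ 1])

text \<open>Transfers the weak equation from Borel data and \<open>lborel\<close> to Lebesgue
  integrals over the disc. The support of a test function and every compact set lie in some
  \<open>cball 0 (1 - m)\<close>, where U is integrable.\<close>

lemma dbar_solutionI:
 assumes Um [measurable]: "U \<in> borel_measurable borel" and fm [measurable]: "f0 \<in> borel_measurable borel"
  and sf: "set_borel_measurable lebesgue disc f" and ae: "AE w in lborel. w \<in> disc --> f w = f0 w"
  and loc: "!!m. 0 < m ==> (nn_set (cball 0 (1 - m)) (%z. ennreal (cmod (U z)))) < \<infinity>"
  and weak: "!!m \<phi>. 0 < m ==> C1 \<phi> ==> (\<forall>z. z \<notin> cball 0 (1 - m) --> \<phi> z = 0) ==>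
      (LINT z|lborel. U z * dbar \<phi> z) = - (LINT w|lborel. f0 w / of_real (1 - (cmod w)^2) * \<phi> w)"
 shows "dbar_solution f U"
 unfolding dbar_solution_def
proof (intro conjI allI impI; (elim conjE)?)
 fix K assume K: "compact K" "K \<subseteq> disc"
 then obtain m where m: "0 < m" "K \<subseteq> cball 0 (1 - m)" using compact_subset_cball by blast
 have [measurable]: "K \<in> sets borel" using K(1) by (simp add: compact_imp_closed)
 have "integrable lborel (%z. indicator K z *\<^sub>R U z)"
 proof (rule integrableI_bounded)
  have "(NN z. ennreal (cmod (indicator K z *\<^sub>R U z))) <= (nn_set (cball 0 (1 - m)) (%z. ennreal (cmod (U z))))"
   using m(2) by (intro nn_integral_mono) (auto simp: indicator_def)
  then show "(NN z. ennreal (cmod (indicator K z *\<^sub>R U z))) < \<infinity>" using loc[OF m(1)] by (rule le_less_trans)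
 qed measurable
 then show "set_integrable lebesgue K U"
  unfolding set_integrable_def by (subst integrable_completion) auto
next
 fix \<phi> assume t: "test_fun \<phi>"
 then obtain m where m: "0 < m" "closure {z. \<phi> z ~= 0} \<subseteq> cball 0 (1 - m)"
  using compact_subset_cball unfolding test_fun_def by blast
 have phi: "C1 \<phi>" using t smooth_C1 by (simp add: test_fun_def)
 have ph0: "\<forall>z. z \<notin> cball 0 (1 - m) --> \<phi> z = 0"
  using m(2) closure_subset[of "{z. \<phi> z ~= 0}"] by blast
 have d0: "dbar \<phi> z = 0" if "z \<notin> disc" for z
  using dbar_support[OF phi, of "1 - m" z] ph0 that m by (auto simp: disc_iff)
 have p0: "\<phi> z = 0" if "z \<notin> disc" for z using ph0 that m by (auto simp: disc_iff)
 have [measurable]: "dbar \<phi> \<in> borel_measurable borel" "\<phi> \<in> borel_measurable borel"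
  by (intro borel_measurable_continuous_onI C1_dbar_continuous C1_continuous phi)+
 have "(LINT z:disc|lebesgue. U z * dbar \<phi> z) = (LINT z|lebesgue. U z * dbar \<phi> z)"
  unfolding set_lebesgue_integral_def by (rule Bochner_Integration.integral_cong) (auto simp: d0 indicator_def)
 also have "... = (LINT z|lborel. U z * dbar \<phi> z)" by (rule integral_completion) measurable
 also have "... = - (LINT w|lborel. f0 w / of_real (1 - (cmod w)^2) * \<phi> w)" by (rule weak[OF m(1) phi ph0])
 also have "(LINT w|lborel. f0 w / of_real (1 - (cmod w)^2) * \<phi> w) = (LINT w|lebesgue. f0 w / of_real (1 - (cmod w)^2) * \<phi> w)"
  by (rule integral_completion[symmetric]) measurable
 also have "... = (LINT z:disc|lebesgue. f z / of_real (1 - (cmod z)^2) * \<phi> z)"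
  unfolding set_lebesgue_integral_def
 proof (rule integral_cong_AE)
  have mm: "(%w. f0 w / of_real (1 - (cmod w)^2) * \<phi> w) \<in> borel_measurable lborel"
   "(%w. \<phi> w / of_real (1 - (cmod w)^2)) \<in> borel_measurable lborel" by measurable
  show "(%w. f0 w / of_real (1 - (cmod w)^2) * \<phi> w) \<in> borel_measurable lebesgue"
   by (rule measurable_completion[OF mm(1)])
  have "(%w. (indicator disc w *\<^sub>R f w) * (\<phi> w / of_real (1 - (cmod w)^2))) \<in> borel_measurable lebesgue"
   using sf unfolding set_borel_measurable_def by (rule borel_measurable_times) (rule measurable_completion[OF mm(2)])
  then show "(%z. indicator disc z *\<^sub>R (f z / of_real (1 - (cmod z)^2) * \<phi> z)) \<in> borel_measurable lebesgue"
   by (simp add: mult_ac scaleR_conv_of_real)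
  show "AE w in lebesgue. f0 w / of_real (1 - (cmod w)^2) * \<phi> w = indicator disc w *\<^sub>R (f w / of_real (1 - (cmod w)^2) * \<phi> w)"
   using AE_completion[OF ae]
  proof eventually_elim
   fix w assume "w \<in> disc --> f w = f0 w"
   then show "f0 w / of_real (1 - (cmod w)^2) * \<phi> w = indicator disc w *\<^sub>R (f w / of_real (1 - (cmod w)^2) * \<phi> w)"
    by (cases "w \<in> disc") (simp_all add: p0)
  qed
 qed
 finally show "- (LINT z:disc|lebesgue. U z * dbar \<phi> z) = (LINT z:disc|lebesgue. f z / of_real (1 - (cmod z)^2) * \<phi> z)"
  by simp
qed

context separated_Psi
begin

lemma solve_dbar:
 assumes p: "0 < p" "p <= 1" and int: "interpolating p Z" and q: "1 <= q" and R: "0 < R" "R < 1"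
 shows "\<exists>C::real. \<forall>f\<in>LpqZ R p q Z. \<exists>u. dbar_solution f u \<and> normZ p Z u <= ennreal C * normpqZ R p q Z f"
proof -
 obtain r C0 where r: "0 < r" "r <= 1/4" and C0: "0 < C0" and pk: "!!s. s \<in> disc ==> \<exists>H. H holomorphic_on disc \<and>
   (\<forall>z\<in>ball s (r * bd s). 1 <= cmod (H z) * exp (kZ Z z)) \<and> wint p H <= ennreal (C0 * (bd s)^2)"
  using peak_functions[OF p int] by blast
 \<comment> \<open>Below r / 16 the net balls lie where the peak function is large, below R / 16
   they lie in the discs D(z, R) of nearby z, and 1/64 serves \<open>solution_piece\<close>.\<close>
 define sg where "sg = min (min r R / 16) (1/64)"
 have sg: "0 < sg" "16 * sg <= r" "sg <= R / 16" "sg <= 1/64" using r R by (auto simp: sg_def min_def)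
 have sg2: "sg <= 1/16" "sg <= 1/2" "sg <= 1" using sg by auto
 obtain S where S: "S \<subseteq> disc" "esep sg S" and cov: "!!z. z \<in> disc ==> \<exists>s\<in>S. cmod (z - s) < 2 * sg * bd s"
  using net_exists[OF sg(1) sg2(2)] by blast
 interpret S: separated_set S "sg / 3" by (rule esep_separated_set[OF S(2,1) sg(1) sg2(3)])
 obtain Km where Km0: "0 < Km" and Kma: "\<forall>S f. esep sg S \<and> S \<subseteq> disc \<and> f \<in> borel_measurable borel \<and> mqint R p q f < \<infinity> -->
   (\<exists>y. (\<forall>s\<in>S. 0 <= y s \<and> (nn_set (ball s (2 * sg * bd s)) (%w. ennreal (cmod (f w) * exp (kZ Z w)))) = ennreal (y s)) \<and>
    (\<forall>F. finite F \<and> F \<subseteq> S --> (\<Sum>s\<in>F. (y s / (bd s)^2) powr p * (bd s)^2) <= Km * enn2real (mqint R p q f)))"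
  by (rule exE[OF mqint_lower[OF q R p(1) sg(1) sg2(1) sg(3)]], erule conjE, rule that)
 note Km = Km0 Kma[THEN spec, THEN spec, THEN mp]
 obtain K where K0: "0 < K" and Kall: "\<forall>s H g y. s \<in> disc \<and> H holomorphic_on disc \<and> (\<forall>z\<in>ball s (r * bd s). 1 <= cmod (H z) * exp (kZ Z z)) \<and>
   wint p H <= ennreal (C0 * (bd s)^2) \<and> g \<in> borel_measurable borel \<and> (\<forall>w. w \<notin> ball s (2 * sg * bd s) --> g w = 0) \<and>
   0 <= y \<and> (nn_set (ball s (2 * sg * bd s)) (%w. ennreal (cmod (g w) * exp (kZ Z w)))) = ennreal y -->
   (\<exists>u. u \<in> borel_measurable borel \<and> (\<forall>z. z \<notin> disc --> u z = 0) \<and>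
    wint p u <= ennreal (K * ((y / (bd s)^2) powr p * (bd s)^2)) \<and>
    (\<forall>m>0. (nn_set (cball 0 (1 - m)) (%z. ennreal (cmod (u z)))) <= ennreal (K * m powr (- 2 / p) * (bd s powr (2 / p) * (y / (bd s)^2)))) \<and>
    (\<forall>m \<phi>. 0 < m \<and> C1 \<phi> \<and> (\<forall>z. z \<notin> cball 0 (1 - m) --> \<phi> z = 0) -->
      integrable lborel (%z. u z * dbar \<phi> z) \<and>
      (LINT z|lborel. u z * dbar \<phi> z) = - (LINT w|lborel. g w / of_real (1 - (cmod w)^2) * \<phi> w)))"
  by (rule exE[OF solution_piece[OF p sg(2,1,4) C0]], erule conjE, rule that)
 note K = K0 Kall[THEN spec, THEN spec, THEN spec, THEN spec, THEN mp]
 define sq where "sq n = from_nat_into S n" for n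
 have Sne: "S ~= {}" using cov[of 0] by (auto simp: disc_iff)
 have sqS: "sq n \<in> S" for n unfolding sq_def by (rule from_nat_into[OF Sne])
 have sqd: "sq n \<in> disc" for n using sqS S by auto
 define d where "d n = bd (sq n)" for n
 have d: "0 < d n" for n using bd_pos[OF sqd] by (simp add: d_def)
 define B where "B n = ball (sq n) (2 * sg * d n)" for n
 define Q where "Q = disjointed B"
 have QB: "Q n \<subseteq> B n" for n unfolding Q_def by (rule disjointed_subset)
 have Qm [measurable]: "Q n \<in> sets borel" for n unfolding Q_def disjointed_def B_def by auto
 have Qdis: "Q m \<inter> Q n = {}" if "m ~= n" for m n
  using disjoint_family_disjointed[of B] that unfolding Q_def disjoint_family_on_def by blast
 have Qcov: "\<exists>n. z \<in> Q n" if zd: "z \<in> disc" for z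
 proof -
  obtain s where s: "s \<in> S" "cmod (z - s) < 2 * sg * bd s" using cov[OF zd] by blast
  obtain j where "sq j = s" unfolding sq_def using from_nat_into_surj[OF S.countable_Z s(1)] by blast
  then have "z \<in> B j" using s(2) by (simp add: B_def d_def dist_norm norm_minus_commute)
  then have "z \<in> (\<Union>i. Q i)" unfolding Q_def UN_disjointed_eq by blast
  then show ?thesis by blast
 qed
 \<comment> \<open>The enumeration could repeat net points. A repeated point has the same ball, so
   its disjointed piece is empty and no net point is counted twice.\<close>
 have Qinj: "sq m ~= sq n" if "m < n" "Q n ~= {}" for m n
 proof
  assume "sq m = sq n"
  then have "B m = B n" by (simp add: B_def d_def)
  then have "Q n = {}" using that(1) by (auto simp: Q_def disjointed_def)
  then show False using that by simp
 qed
 show ?thesis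
 proof (intro exI[of _ "(K * Km) powr (1/p)"] ballI)
  fix f assume f: "f \<in> LpqZ R p q Z"
  have sf: "set_borel_measurable lebesgue disc f" and "normpqZ R p q Z f < \<infinity>" using f by (auto simp: LpqZ_def)
  then have mf: "mqint R p q f < \<infinity>" unfolding normpqZ_mqint epowr_less_top by blast
  obtain g0 where g0 [measurable]: "g0 \<in> borel_measurable borel" and g0a: "AE z in lborel. indicator disc z *\<^sub>R f z = g0 z"
   using borel_representative[of "%z. indicator disc z *\<^sub>R f z"] sf unfolding set_borel_measurable_def by blast
  define f0 where "f0 w = indicator disc w *\<^sub>R g0 w" for w
  have f0m [measurable]: "f0 \<in> borel_measurable borel" unfolding f0_def[abs_def] by measurable
  have ae: "AE w in lborel. w \<in> disc --> f w = f0 w" using g0a by eventually_elim (auto simp: f0_def)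
  have f00: "f0 w = 0" if "w \<notin> disc" for w using that by (simp add: f0_def)
  have mfe: "mqint R p q f0 = mqint R p q f"
   unfolding mqint_def mq_cong_AE[OF ae] ..
  define J where "J = enn2real (mqint R p q f)"
  have J: "0 <= J" "ennreal J = mqint R p q f" using mf by (auto simp: J_def)
  have "esep sg S \<and> S \<subseteq> disc \<and> f0 \<in> borel_measurable borel \<and> mqint R p q f0 < \<infinity>"
   using S f0m mf unfolding mfe by blast
  from Km(2)[OF this] obtain y where yy: "\<forall>s\<in>S. 0 <= y s \<and> (nn_set (ball s (2 * sg * bd s)) (%w. ennreal (cmod (f0 w) * exp (kZ Z w)))) = ennreal (y s)"
   and yys: "\<forall>F. finite F \<and> F \<subseteq> S --> (\<Sum>s\<in>F. (y s / (bd s)^2) powr p * (bd s)^2) <= Km * enn2real (mqint R p q f0)"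
   by (elim exE conjE) (rule that)
  have y: "0 <= y s" "(nn_set (ball s (2 * sg * bd s)) (%w. ennreal (cmod (f0 w) * exp (kZ Z w)))) = ennreal (y s)" if "s \<in> S" for s
   using bspec[OF yy that] by simp_all
  have ys: "(\<Sum>s\<in>F. (y s / (bd s)^2) powr p * (bd s)^2) <= Km * J" if "finite F" "F \<subseteq> S" for F
   using yys[THEN spec, THEN mp, OF conjI[OF that]] unfolding mfe J_def .
  define g where "g n w = indicator (Q n) w *\<^sub>R f0 w" for n w
  have gm [measurable]: "g n \<in> borel_measurable borel" for n unfolding g_def[abs_def] by measurable
  have g_0: "g n w = 0" if "w \<notin> B n" for n w using that QB[of n] by (auto simp: g_def indicator_def)
  have gle: "cmod (g n w) <= cmod (f0 w)" for n w by (auto simp: g_def indicator_def)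
  define yn where "yn n = enn2real (nn_set (B n) (%w. ennreal (cmod (g n w) * exp (kZ Z w))))" for n
  have le: "(nn_set (B n) (%w. ennreal (cmod (g n w) * exp (kZ Z w)))) <= ennreal (y (sq n))" for n
   unfolding y(2)[OF sqS, symmetric] B_def d_def
   by (intro nn_integral_mono mult_right_mono ennreal_leI gle) auto
  have yn: "(nn_set (B n) (%w. ennreal (cmod (g n w) * exp (kZ Z w)))) = ennreal (yn n)" for n
   unfolding yn_def using le[of n] ennreal_less_top[of "y (sq n)"] le_less_trans by (intro ennreal_enn2real[symmetric]) blast
  have yn0: "0 <= yn n" for n by (simp add: yn_def)
  have yny: "yn n <= y (sq n)" for n using le[of n] y(1)[OF sqS] unfolding yn by (simp add: ennreal_le_iff)
  define X where "X n = (yn n / (d n)^2) powr p * (d n)^2" for n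
  have X0: "0 <= X n" for n by (simp add: X_def)
  define PX where "PX = Km * J"
  have XP: "(\<Sum>n<N. X n) <= PX" for N
  proof -
   define T where "T = {n. n < N \<and> Q n ~= {}}"
   have "(\<Sum>n<N. X n) = (\<Sum>n\<in>T. X n)"
   proof (rule sum.mono_neutral_right)
    show "\<forall>n\<in>{..<N} - T. X n = 0" using p by (auto simp: T_def X_def yn_def g_def)
   qed (auto simp: T_def)
   also have "... <= (\<Sum>n\<in>T. (y (sq n) / (d n)^2) powr p * (d n)^2)"
    unfolding X_def using yny yn0 p d by (intro sum_mono mult_right_mono powr_mono2 divide_right_mono divide_nonneg_nonneg) auto
   also have "... = (\<Sum>s\<in>sq ` T. (y s / (bd s)^2) powr p * (bd s)^2)"
   proof (subst sum.reindex)
    show "inj_on sq T" by (rule linorder_inj_onI') (use Qinj in \<open>auto simp: T_def\<close>)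
   qed (simp add: d_def)
   also have "... <= PX" unfolding PX_def using sqS by (intro ys) (auto simp: T_def)
   finally show ?thesis .
  qed
  define Y where "Y n = d n powr (2 / p) * (yn n / (d n)^2)" for n
  have Y0: "0 <= Y n" for n using yn0 by (simp add: Y_def)
  \<comment> \<open>\<open>Y n\<close> is \<open>X n powr (1/p)\<close>, and 1/p >= 1 with
    \<open>X n <= PX\<close> makes it at most a multiple of \<open>X n\<close>; so bounded sums of X
    give bounded sums of Y.\<close>
  have YX: "Y n <= PX powr (1/p - 1) * X n" for n
  proof -
   have "X n powr (1/p) = ((yn n / (d n)^2) powr p) powr (1/p) * ((d n)^2) powr (1/p)"
    unfolding X_def by (rule powr_mult)
   also have "((yn n / (d n)^2) powr p) powr (1/p) = yn n / (d n)^2" using p yn0[of n] by (simp add: powr_powr)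
   also have "((d n)^2) powr (1/p) = d n powr (2 / p)" using d[of n] by (simp add: powr_powr flip: powr_numeral)
   finally have e: "Y n = X n powr (1/p)" by (simp add: Y_def)
   show ?thesis
   proof (cases "X n = 0")
    case False
    then have xp: "0 < X n" using X0[of n] by simp
    have "X n <= (\<Sum>k<Suc n. X k)" using X0 by (intro member_le_sum) auto
    then have xP: "X n <= PX" using XP[of "Suc n"] by linarith
    have "X n powr (1/p) = X n powr (1/p - 1) * X n" using powr_add[of "X n" "1/p - 1" 1] xp by simp
    also have "... <= PX powr (1/p - 1) * X n" using p xp xP by (intro mult_right_mono powr_mono2) auto
    finally show ?thesis unfolding e .
   qed (simp add: e)
  qed
  have YP: "(\<Sum>n<N. Y n) <= PX powr (1/p - 1) * PX" for N
  proof -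
   have "(\<Sum>n<N. Y n) <= PX powr (1/p - 1) * (\<Sum>n<N. X n)" unfolding sum_distrib_left by (intro sum_mono YX)
   also have "... <= PX powr (1/p - 1) * PX" using XP by (intro mult_left_mono) auto
   finally show ?thesis .
  qed
  define Pr where "Pr n u \<longleftrightarrow> u \<in> borel_measurable borel \<and> (\<forall>z. z \<notin> disc --> u z = 0) \<and>
    wint p u <= ennreal (K * X n) \<and>
    (\<forall>m>0. (nn_set (cball 0 (1 - m)) (%z. ennreal (cmod (u z)))) <= ennreal (K * m powr (- 2 / p) * Y n)) \<and>
    (\<forall>m \<phi>. 0 < m \<and> C1 \<phi> \<and> (\<forall>z. z \<notin> cball 0 (1 - m) --> \<phi> z = 0) -->
      integrable lborel (%z. u z * dbar \<phi> z) \<and>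
      (LINT z|lborel. u z * dbar \<phi> z) = - (LINT w|lborel. g n w / of_real (1 - (cmod w)^2) * \<phi> w))" for n u
  have "\<exists>u. Pr n u" for n
  proof -
   obtain H where H: "H holomorphic_on disc" "\<forall>z\<in>ball (sq n) (r * bd (sq n)). 1 <= cmod (H z) * exp (kZ Z z)"
    "wint p H <= ennreal (C0 * (bd (sq n))^2)" using pk[OF sqd] by blast
   have gz: "\<forall>w. w \<notin> ball (sq n) (2 * sg * bd (sq n)) --> g n w = 0" using g_0[of _ n] by (auto simp: B_def d_def)
   show ?thesis unfolding Pr_def X_def Y_def d_def
    by (rule K(2)[of "sq n" H "g n" "yn n"]) (use sqd H gm gz yn0 yn[of n] in \<open>simp add: B_def d_def\<close>)
  qed
  then obtain u where Pu: "!!n. Pr n (u n)" by metis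
  have u: "!!n. u n \<in> borel_measurable borel" "!!n. wint p (u n) <= ennreal (K * X n)"
   and ul: "!!n m. 0 < m ==> (nn_set (cball 0 (1 - m)) (%z. ennreal (cmod (u n z)))) <= ennreal (K * m powr (- 2 / p) * Y n)"
   and uw: "!!n m \<phi>. 0 < m ==> C1 \<phi> ==> (\<forall>z. z \<notin> cball 0 (1 - m) --> \<phi> z = 0) ==>
      integrable lborel (%z. u n z * dbar \<phi> z) \<and>
      (LINT z|lborel. u n z * dbar \<phi> z) = - (LINT w|lborel. g n w / of_real (1 - (cmod w)^2) * \<phi> w)"
   using Pu unfolding Pr_def by blast+
  \<comment> \<open>The first term serves the solutions, the second the pieces of f0: a net ball
    meeting \<open>cball 0 (1 - m)\<close> has \<open>d n >= m / 2\<close>, and the exponent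
    \<open>2 - 2 / p\<close>, which is at most 0, converts the mass \<open>yn n\<close> into
    \<open>Y n\<close>.\<close>
  define L where "L m = K * m powr (- 2 / p) + (m / 2) powr (2 - 2 / p)" for m
  have lu: "(nn_set (cball 0 (1 - m)) (%z. ennreal (cmod (u n z)))) <= ennreal (L m * Y n)" if "0 < m" for n m
  proof -
   have "K * m powr (- 2 / p) * Y n <= L m * Y n" unfolding L_def using Y0 by (intro mult_right_mono) auto
   then show ?thesis using ul[OF that, of n] by (meson ennreal_leI order_trans)
  qed
  have lg: "(nn_set (cball 0 (1 - m)) (%z. ennreal (cmod (g n z)))) <= ennreal (L m * Y n)" if m: "0 < m" for n m
  proof (cases "B n \<inter> cball 0 (1 - m) = {}")
   case True
   then have "z \<notin> B n" if "z \<in> cball 0 (1 - m)" for z using that by blast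
   then have "ennreal (cmod (g n z)) * indicator (cball 0 (1 - m)) z = 0" for z using g_0[of z n] by (cases "z \<in> cball 0 (1 - m)") (auto simp: indicator_def)
   then have "(nn_set (cball 0 (1 - m)) (%z. ennreal (cmod (g n z)))) = 0" by (simp only: nn_integral_const) simp
   then show ?thesis by (simp only: zero_le)
  next
   case False
   then obtain w where w: "w \<in> B n" "w \<in> cball 0 (1 - m)" by blast
   have "cmod (w - sq n) < 2 * sg * d n" using w by (simp add: B_def dist_norm norm_minus_commute)
   also have "... <= 1/2 * d n" using sg d[of n] by (intro mult_right_mono) auto
   finally have "bd w <= 2 * d n" using bd_diff[of w "sq n"] d[of n] by (auto simp: d_def abs_le_iff)
   moreover have "m <= bd w" using w by (simp add: bd_def)
   ultimately have md: "m / 2 <= d n" by simp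
   have "(nn_set (cball 0 (1 - m)) (%z. ennreal (cmod (g n z)))) <= (nn_set (B n) (%w. ennreal (cmod (g n w) * exp (kZ Z w))))"
   proof (rule nn_integral_mono)
    fix z
    have "cmod (g n z) * 1 <= cmod (g n z) * exp (kZ Z z)" by (intro mult_left_mono kZ_exp_ge_1) auto
    then show "ennreal (cmod (g n z)) * indicator (cball 0 (1 - m)) z <= ennreal (cmod (g n z) * exp (kZ Z z)) * indicator (B n) z"
     using g_0[of z n] by (auto simp: indicator_def intro: ennreal_leI)
   qed
   also have "... = ennreal (yn n)" by (rule yn)
   also have "... <= ennreal (L m * Y n)"
   proof (rule ennreal_leI)
    have "d n powr (2 - 2 / p) * d n powr (2 / p) = (d n)^2" using d[of n] by (simp flip: powr_add powr_numeral)
    then have "yn n = d n powr (2 - 2 / p) * Y n" using d[of n] by (simp add: Y_def field_simps)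
    also have "... <= L m * Y n"
    proof (rule mult_right_mono[OF _ Y0])
     have "d n powr (2 - 2 / p) <= (m / 2) powr (2 - 2 / p)" using p m md by (intro powr_mono2') (auto simp: field_simps)
     then show "d n powr (2 - 2 / p) <= L m" using K by (simp add: L_def add_increasing)
    qed
    finally show "yn n <= L m * Y n" .
   qed
   finally show ?thesis .
  qed
  have gs: "\<exists>n. \<forall>k. g k z = (if k = n then f0 z else 0)" for z
  proof (cases "z \<in> disc")
   case True
   then obtain n where n: "z \<in> Q n" using Qcov by blast
   have "z \<notin> Q k" if "k ~= n" for k using n Qdis[OF that] by blast
   then show ?thesis using n by (intro exI[of _ n]) (auto simp: g_def)
  qed (auto simp: g_def f00)
  have L0: "0 <= L m" for m using K by (simp add: L_def)
  have "\<exists>U. U \<in> borel_measurable borel \<and> wint p U <= ennreal (K * PX) \<and>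
   (\<forall>m>0. (nn_set (cball 0 (1 - m)) (%z. ennreal (cmod (U z)))) < \<infinity>) \<and>
   (\<forall>m \<phi>. 0 < m \<and> C1 \<phi> \<and> (\<forall>z. z \<notin> cball 0 (1 - m) --> \<phi> z = 0) -->
      (LINT z|lborel. U z * dbar \<phi> z) = - (LINT w|lborel. f0 w / of_real (1 - (cmod w)^2) * \<phi> w))"
   by (rule sum_pieces[OF p less_imp_le[OF K(1)] L0 u(1) gm X0 XP Y0 YP u(2) lu lg gs uw])
  then obtain U where U: "U \<in> borel_measurable borel" "wint p U <= ennreal (K * PX)"
   "!!m. 0 < m ==> (nn_set (cball 0 (1 - m)) (%z. ennreal (cmod (U z)))) < \<infinity>"
   "!!m \<phi>. 0 < m ==> C1 \<phi> ==> (\<forall>z. z \<notin> cball 0 (1 - m) --> \<phi> z = 0) ==>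
      (LINT z|lborel. U z * dbar \<phi> z) = - (LINT w|lborel. f0 w / of_real (1 - (cmod w)^2) * \<phi> w)"
   by blast
  have "dbar_solution f U" by (rule dbar_solutionI[OF U(1) f0m sf ae U(3,4)])
  moreover have "normZ p Z U <= ennreal ((K * Km) powr (1/p)) * normpqZ R p q Z f"
   unfolding normZ_wint normpqZ_mqint
  proof (rule epowr_cmult_le)
   have "ennreal (K * PX) = ennreal (K * Km) * mqint R p q f"
    using K Km J by (simp add: PX_def mult.assoc ennreal_mult flip: J(2))
   then show "wint p U <= ennreal (K * Km) * mqint R p q f" using U(2) by simp
  qed (use p K Km mf in auto)
  ultimately show "\<exists>u. dbar_solution f u \<and> normZ p Z u <= ennreal ((K * Km) powr (1/p)) * normpqZ R p q Z f" by blast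
 qed
qed

end

section \<open>Weyl's lemma\<close>

text \<open>Boxes are stable under intersection and generate the Borel sets, so the integral
  vanishes over every Borel set. Passing to complements requires total integral 0, and this is where
  the bounded S is used: some box contains it.\<close>

lemma AE_zero_boxes:
 fixes F :: "complex => complex"
 assumes int: "integrable lborel F" and S: "bounded S" "!!x. x \<notin> S ==> F x = 0"
  and box: "!!a b. (LINT x:box a b|lborel. F x) = 0"
 shows "AE x in lborel. F x = 0"
proof (rule sigma_finite_measure.density_zero[OF sigma_finite_lborel int])
 have Fm [measurable]: "F \<in> borel_measurable borel" using int by auto
 have tot: "integral\<^sup>L lborel F = 0"
 proof -
  obtain a where a: "S \<subseteq> box (-a) a" using bounded_subset_box_symmetric[OF S(1)] by blast
  have "integral\<^sup>L lborel F = (LINT x:box (-a) a|lborel. F x)"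
   unfolding set_lebesgue_integral_def using a S(2) by (intro Bochner_Integration.integral_cong) (auto simp: indicator_def)
  then show ?thesis using box by simp
 qed
 fix A :: "complex set" assume "A \<in> sets lborel"
 then have "A \<in> sets borel" by simp
 then have A: "A \<in> sigma_sets UNIV (range (%(a, b). box a b))" unfolding borel_eq_box by simp
 have "Int_stable (range (%(a, b). box a b :: complex set))"
  by (auto simp: Int_stable_def box_Int_box)
 moreover have "range (%(a, b). box a b :: complex set) \<subseteq> Pow UNIV" by auto
 moreover note A
 ultimately show "(LINT x:A|lborel. F x) = 0"
 proof (induction rule: sigma_sets_induct_disjoint)
  case (basic A)
  then show ?case using box by auto
 next
  case empty
  show ?case by (simp add: set_lebesgue_integral_def)
 next
  case (compl A)
  then have [measurable]: "A \<in> sets borel" by (simp add: borel_eq_box)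
  have i: "set_integrable lborel A F" "set_integrable lborel (UNIV - A) F"
   unfolding set_integrable_def using int by (intro integrable_mult_indicator; simp)+
  have "(LINT x:A \<union> (UNIV - A)|lborel. F x) = (LINT x:A|lborel. F x) + (LINT x:UNIV - A|lborel. F x)"
   by (rule set_integral_Un[OF _ i]) auto
  moreover have "A \<union> (UNIV - A) = UNIV" by auto
  ultimately show ?case using compl.IH tot by (simp add: set_lebesgue_integral_def)
 next
  case (union A)
  then have [measurable]: "A i \<in> sets borel" for i by (simp add: borel_eq_box subset_eq)
  have "set_integrable lborel (\<Union>i. A i) F"
   unfolding set_integrable_def using int by (intro integrable_mult_indicator) auto
  then have "(LINT x:(\<Union>i. A i)|lborel. F x) = (\<Sum>i. LINT x:A i|lborel. F x)"
   using union.hyps by (intro lebesgue_integral_countable_add) (auto simp: disjoint_family_on_def)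
  then show ?case using union.IH by simp
 qed
qed

text \<open>By \<open>dbar_Kreg\<close> this is \<open>dbar\<close> of the regularised kernel, an
  approximate identity of total mass \<open>kap\<close>.\<close>

definition Pker :: "real => complex => complex => real" where
 "Pker e w z = e^2 / ((cmod (z - w))^2 + e^2)^2"

lemma Pker_nonneg: "0 <= Pker e w z" by (simp add: Pker_def)

lemma Pker_le: "0 < e ==> Pker e w z <= 1 / e^2"
proof -
 assume e: "0 < e"
 have "(e^2)^2 <= ((cmod (z - w))^2 + e^2)^2" by (intro power_mono) auto
 then have "Pker e w z <= e^2 / (e^2)^2" unfolding Pker_def using e by (intro frac_le) auto
 then show ?thesis using e by (simp add: power2_eq_square)
qed

lemma measurable_Pker: "(%(w, z). Pker e w z) \<in> borel_measurable (lborel \<Otimes>\<^sub>M lborel)"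
 "Pker e w \<in> borel_measurable borel" "(%w. Pker e w z) \<in> borel_measurable borel"
 unfolding Pker_def[abs_def] by measurable

text \<open>After w = z + e t the indicator at z + e t is eventually constant unless z lies on the
  frontier of E, so dominated convergence applies; the total mass of the bump gives the uniform
  bound.\<close>

lemma Pker_indicator_tendsto:
 fixes E :: "complex set"
 assumes Em [measurable]: "E \<in> sets borel" and z: "z \<notin> frontier E"
 shows "(%n. LINT w|lborel. of_real (indicator E w * Pker (1 / real (Suc n)) w z)) \<longlonglongrightarrow> complex_of_real (kap * indicator E z)"
  and "!!n. cmod (LINT w|lborel. of_real (indicator E w * Pker (1 / real (Suc n)) w z)) <= kap"
proof -
 define k where "k t = 1 / (1 + (cmod t)^2)^2" for t :: complex
 have ki: "integrable lborel k" using integrable_kap by (simp add: k_def[abs_def])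
 have km [measurable]: "k \<in> borel_measurable borel" unfolding k_def[abs_def] by measurable
 have k0: "0 <= k t" for t by (simp add: k_def)
 have kk: "integral\<^sup>L lborel k = kap" by (simp add: k_def[abs_def] kap_def)
 define s where "s n t = complex_of_real (indicator E (z + (1 / real (Suc n)) *\<^sub>R t) * k t)" for n t
 have sm [measurable]: "s n \<in> borel_measurable borel" for n
 proof -
  have "(%t. z + (1 / real (Suc n)) *\<^sub>R t) \<in> borel_measurable borel" by measurable
  then have "(%t. indicator E (z + (1 / real (Suc n)) *\<^sub>R t) :: real) \<in> borel_measurable borel"
   by (rule measurable_compose[OF _ borel_measurable_indicator[OF Em]])
  then show ?thesis unfolding s_def[abs_def] using km by measurable
 qed
 have eq: "(LINT w|lborel. of_real (indicator E w * Pker (1 / real (Suc n)) w z)) = (LINT t|lborel. s n t)" for n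
 proof -
  define e where "e = 1 / real (Suc n)"
  have e: "0 < e" by (simp add: e_def)
  note measurable_Pker(3)[measurable]
  have m: "(%w. complex_of_real (indicator E w * Pker e w z)) \<in> borel_measurable borel" by measurable
  have "(LINT w|lborel. complex_of_real (indicator E w * Pker e w z))
    = e^2 *\<^sub>R (LINT t|lborel. of_real (indicator E (z + e *\<^sub>R t) * Pker e (z + e *\<^sub>R t) z))"
   by (rule lborel_integral_complex_affine[OF e m])
  also have "... = (LINT t|lborel. e^2 *\<^sub>R of_real (indicator E (z + e *\<^sub>R t) * Pker e (z + e *\<^sub>R t) z))"
   by (rule integral_scaleR_right[symmetric])
  also have "(%t. e^2 *\<^sub>R of_real (indicator E (z + e *\<^sub>R t) * Pker e (z + e *\<^sub>R t) z)) = s n"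
  proof
   fix t
   have "e^2 * Pker e (z + e *\<^sub>R t) z = k t"
   proof -
    have "(cmod (z - (z + e *\<^sub>R t)))^2 + e^2 = e^2 * (1 + (cmod t)^2)" by (simp add: power_mult_distrib algebra_simps)
    then have "e^2 * Pker e (z + e *\<^sub>R t) z = (e^2 * e^2) / ((e^2)^2 * (1 + (cmod t)^2)^2)"
     unfolding Pker_def by (simp only: power_mult_distrib times_divide_eq_right)
    also have "... = k t" using e by (simp add: k_def power2_eq_square)
    finally show ?thesis .
   qed
   then show "e^2 *\<^sub>R of_real (indicator E (z + e *\<^sub>R t) * Pker e (z + e *\<^sub>R t) z) = s n t"
    unfolding s_def e_def[symmetric] by (simp add: scaleR_conv_of_real mult_ac flip: of_real_mult of_real_power)
  qed
  finally show ?thesis unfolding e_def .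
 qed
 have bnd: "cmod (s n t) <= k t" for n t using k0[of t] by (simp add: s_def norm_mult indicator_def)
 have "(%n. LINT t|lborel. s n t) \<longlonglongrightarrow> (LINT t|lborel. of_real (indicator E z) * of_real (k t))"
 proof (rule integral_dominated_convergence)
  show "AE t in lborel. (%n. s n t) \<longlonglongrightarrow> of_real (indicator E z) * of_real (k t)"
  proof (rule AE_I2)
   fix t
   have lim: "(%n. z + (1 / real (Suc n)) *\<^sub>R t) \<longlonglongrightarrow> z"
   proof -
    have "(%n. 1 / real (Suc n)) \<longlonglongrightarrow> 0" using LIMSEQ_inverse_real_of_nat by (simp add: inverse_eq_divide)
    then have "(%n. z + (1 / real (Suc n)) *\<^sub>R t) \<longlonglongrightarrow> z + 0 *\<^sub>R t" by (intro tendsto_intros)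
    then show ?thesis by simp
   qed
   have "eventually (%n. s n t = of_real (indicator E z) * of_real (k t)) sequentially"
   proof (cases "z \<in> interior E")
    case True
    have "eventually (%n. z + (1 / real (Suc n)) *\<^sub>R t \<in> interior E) sequentially"
     using lim True by (intro topological_tendstoD) auto
    then show ?thesis by eventually_elim (use True interior_subset[of E] in \<open>auto simp: s_def indicator_def\<close>)
   next
    case False
    then have zc: "z \<in> - closure E" using z by (simp add: frontier_def)
    have "eventually (%n. z + (1 / real (Suc n)) *\<^sub>R t \<in> - closure E) sequentially"
     using lim zc by (intro topological_tendstoD) auto
    then show ?thesis by eventually_elim (use zc closure_subset[of E] in \<open>auto simp: s_def indicator_def\<close>)
   qed
   then show "(%n. s n t) \<longlonglongrightarrow> of_real (indicator E z) * of_real (k t)" by (rule tendsto_eventually)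
  qed
  show "AE t in lborel. norm (s n t) <= k t" for n using bnd by simp
 qed (use ki in measurable)
 also have "(LINT t|lborel. of_real (indicator E z) * of_real (k t)) = complex_of_real (kap * indicator E z)"
  by (simp add: kk)
 finally show "(%n. LINT w|lborel. of_real (indicator E w * Pker (1 / real (Suc n)) w z)) \<longlonglongrightarrow> complex_of_real (kap * indicator E z)"
  by (simp only: eq)
 show "cmod (LINT w|lborel. of_real (indicator E w * Pker (1 / real (Suc n)) w z)) <= kap" for n
 proof -
  have "integrable lborel (s n)" by (rule Bochner_Integration.integrable_bound[OF ki]) (use bnd k0 in auto)
  then have "(LINT t|lborel. cmod (s n t)) <= (LINT t|lborel. k t)" using ki bnd by (intro integral_mono integrable_norm) auto
  then show ?thesis unfolding eq kk using integral_norm_bound[of lborel "s n"] by linarith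
 qed
qed

text \<open>Fubini moves the smoothing from mu, which is merely integrable, to the indicator of E,
  where the limit is known.\<close>

lemma mollify_limit:
 fixes E :: "complex set" and mu :: "complex => complex"
 assumes mu: "integrable lborel mu" and Em [measurable]: "E \<in> sets borel" and Eb: "bounded E"
  and fr: "AE z in lborel. z \<notin> frontier E"
 shows "(%n. LINT w:E|lborel. (LINT z|lborel. mu z * of_real (Pker (1 / real (Suc n)) w z))) \<longlonglongrightarrow> of_real kap * (LINT w:E|lborel. mu w)"
proof -
 have [measurable]: "mu \<in> borel_measurable borel" using mu by auto
 define J where "J n z = (LINT w|lborel. complex_of_real (indicator E w * Pker (1 / real (Suc n)) w z))" for n z
 note measurable_Pker(1)[measurable]
 have swap: "(LINT w:E|lborel. (LINT z|lborel. mu z * of_real (Pker (1 / real (Suc n)) w z))) = (LINT z|lborel. mu z * J n z)"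
  and Jm: "J n \<in> borel_measurable lborel" for n
 proof -
  define e where "e = 1 / real (Suc n)"
  have e: "0 < e" by (simp add: e_def)
  have Pm [measurable]: "(%(w, z). Pker e w z) \<in> borel_measurable (lborel \<Otimes>\<^sub>M lborel)" "(%(z, w). Pker e w z) \<in> borel_measurable (lborel \<Otimes>\<^sub>M lborel)"
   unfolding Pker_def[abs_def] by measurable
  show "J n \<in> borel_measurable lborel" unfolding J_def[abs_def] e_def[symmetric] by measurable
  have pm: "(%(w, z). mu z * of_real (indicator E w * Pker e w z)) \<in> borel_measurable (lborel \<Otimes>\<^sub>M lborel)" by measurable
  have "integrable (lborel \<Otimes>\<^sub>M lborel) (%(w, z). mu z * of_real (indicator E w * Pker e w z))"
  proof (rule integrableI_bounded[OF pm])
   have "(\<integral>\<^sup>+ x. ennreal (cmod (case x of (w, z) => mu z * of_real (indicator E w * Pker e w z))) \<partial>(lborel \<Otimes>\<^sub>M lborel))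
    = (NN w. (NN z. ennreal (cmod (mu z * of_real (indicator E w * Pker e w z)))))"
    using pm by (subst lborel.nn_integral_fst[symmetric]) auto
   also have "... <= (NN w. ((NN z. ennreal (1 / e^2) * ennreal (cmod (mu z))) * indicator E w))"
   proof (rule nn_integral_mono)
    fix w
    show "(NN z. ennreal (cmod (mu z * of_real (indicator E w * Pker e w z)))) <= (NN z. ennreal (1 / e^2) * ennreal (cmod (mu z))) * indicator E w"
    proof (cases "w \<in> E")
     case True
     have "cmod (mu z) * Pker e w z <= cmod (mu z) * (1 / e^2)" for z by (intro mult_left_mono Pker_le e) auto
     then show ?thesis using True Pker_nonneg[of e w] e
      by (auto intro!: nn_integral_mono ennreal_leI simp: norm_mult mult_ac simp flip: ennreal_mult)
    qed simp
   qed
   also have "... = (NN z. ennreal (1 / e^2) * ennreal (cmod (mu z))) * emeasure lborel E"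
    by (simp add: nn_integral_cmult_indicator)
   also have "(NN z. ennreal (1 / e^2) * ennreal (cmod (mu z))) = ennreal (1 / e^2) * (NN z. ennreal (cmod (mu z)))"
    by (rule nn_integral_cmult) measurable
   also have "... * emeasure lborel E < \<infinity>"
    using mu emeasure_bounded_finite[OF Eb] by (auto simp: integrable_iff_bounded ennreal_mult_less_top)
   finally show "(\<integral>\<^sup>+ x. ennreal (cmod (case x of (w, z) => mu z * of_real (indicator E w * Pker e w z))) \<partial>(lborel \<Otimes>\<^sub>M lborel)) < \<infinity>" .
  qed
  from lborel_pair.Fubini_integral[OF this]
  have "(LINT z|lborel. (LINT w|lborel. mu z * of_real (indicator E w * Pker e w z))) = (LINT w|lborel. (LINT z|lborel. mu z * of_real (indicator E w * Pker e w z)))"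
   by simp
  moreover have "(LINT w|lborel. mu z * of_real (indicator E w * Pker e w z)) = mu z * J n z" for z
   unfolding J_def e_def[symmetric] by (rule integral_mult_right_zero)
  moreover have "(LINT z|lborel. mu z * of_real (indicator E w * Pker e w z)) = indicator E w *\<^sub>R (LINT z|lborel. mu z * of_real (Pker e w z))" for w
   by (cases "w \<in> E") auto
  ultimately show "(LINT w:E|lborel. (LINT z|lborel. mu z * of_real (Pker (1 / real (Suc n)) w z))) = (LINT z|lborel. mu z * J n z)"
   unfolding e_def[symmetric] set_lebesgue_integral_def by (simp only:)
 qed
 have "(%n. LINT z|lborel. mu z * J n z) \<longlonglongrightarrow> (LINT z|lborel. mu z * complex_of_real (kap * indicator E z))"
 proof (rule integral_dominated_convergence)
  show "AE z in lborel. (%n. mu z * J n z) \<longlonglongrightarrow> mu z * complex_of_real (kap * indicator E z)"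
   using fr unfolding J_def by eventually_elim (intro tendsto_mult_left Pker_indicator_tendsto(1) Em)
  show "AE z in lborel. norm (mu z * J n z) <= cmod (mu z) * kap" for n
   using fr
  proof eventually_elim
   fix z assume "z \<notin> frontier E"
   then show "norm (mu z * J n z) <= cmod (mu z) * kap"
    unfolding norm_mult J_def by (intro mult_left_mono Pker_indicator_tendsto(2) Em) auto
  qed
  show "integrable lborel (%z. cmod (mu z) * kap)" using mu by auto
 qed (use Jm in measurable)
 also have "(LINT z|lborel. mu z * complex_of_real (kap * indicator E z)) = (LINT z|lborel. of_real kap * (indicator E z *\<^sub>R mu z))"
  by (intro Bochner_Integration.integral_cong) (auto simp: indicator_def)
 also have "... = of_real kap * (LINT w:E|lborel. mu w)" unfolding set_lebesgue_integral_def by (rule integral_mult_right_zero)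
 finally show ?thesis unfolding swap .
qed

text \<open>For z at positive distance from the support of nu the difference quotients of the kernel
  are bounded, so dominated convergence differentiates under the integral.\<close>

lemma CT_holomorphic:
 assumes nu: "integrable lborel nu" and r: "!!z. cmod z < r ==> nu z = 0"
 shows "CT nu holomorphic_on ball 0 r"
proof (rule holomorphic_onI)
 fix x assume x: "x \<in> ball (0::complex) r"
 define rh where "rh = r - cmod x"
 have rh: "0 < rh" using x by (simp add: rh_def)
 have [measurable]: "nu \<in> borel_measurable borel" using nu by auto
 define U where "U = ball x (rh / 2)"
 have far: "rh / 2 <= cmod (y - z)" if "y \<in> U" "nu z ~= 0" for y z
 proof -
  have "r <= cmod z" using r that(2) by force
  moreover have "cmod (y - x) < rh / 2" using that(1) by (simp add: U_def dist_norm norm_minus_commute)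
  moreover have "cmod z <= cmod x + cmod (y - x) + cmod (y - z)"
   using norm_triangle_ineq[of x "y - x"] norm_triangle_sub[of z y] by (simp add: norm_minus_commute)
  ultimately show ?thesis by (simp add: rh_def)
 qed
 have xU: "x \<in> U" using rh by (simp add: U_def)
 have inti: "integrable lborel (%z. nu z / (y - z))" if "y \<in> U" for y
 proof (rule Bochner_Integration.integrable_bound)
  show "integrable lborel (%z. 2 / rh * cmod (nu z))" using nu by auto
  show "AE z in lborel. norm (nu z / (y - z)) <= norm (2 / rh * cmod (nu z))"
  proof (rule AE_I2)
   fix z show "norm (nu z / (y - z)) <= norm (2 / rh * cmod (nu z))"
   proof (cases "nu z = 0")
    case False
    have "cmod (nu z) / cmod (y - z) <= cmod (nu z) / (rh / 2)" using far[OF that False] rh by (intro frac_le) auto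
    then show ?thesis using rh by (simp add: norm_divide norm_mult mult.commute)
   qed simp
  qed
 qed measurable
 have "(CT nu has_field_derivative (LINT z|lborel. - (nu z / ((x - z) * (x - z))))) (at x within U)"
  unfolding has_field_derivative_iff tendsto_at_iff_sequentially
 proof (intro allI impI)
  fix X :: "nat => complex" assume X: "\<forall>i. X i \<in> U - {x}" "X \<longlonglongrightarrow> x"
  have q: "(CT nu (X i) - CT nu x) / (X i - x) = (LINT z|lborel. - (nu z / ((X i - z) * (x - z))))" for i
  proof -
   have Xi: "X i \<in> U" "X i - x ~= 0" using X(1) by auto
   have "CT nu (X i) - CT nu x = (LINT z|lborel. nu z / (X i - z) - nu z / (x - z))"
    unfolding CT_def by (rule Bochner_Integration.integral_diff[symmetric]) (intro inti Xi xU)+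
   then have "(CT nu (X i) - CT nu x) / (X i - x) = (LINT z|lborel. (nu z / (X i - z) - nu z / (x - z)) / (X i - x))"
    by (simp only: integral_divide_zero)
   also have "... = (LINT z|lborel. - (nu z / ((X i - z) * (x - z))))"
   proof (rule Bochner_Integration.integral_cong[OF refl])
    fix z
    show "(nu z / (X i - z) - nu z / (x - z)) / (X i - x) = - (nu z / ((X i - z) * (x - z)))"
    proof (cases "nu z = 0")
     case False
     have "X i - z ~= 0" "x - z ~= 0" using far[OF Xi(1) False] far[OF xU False] rh by auto
     then show ?thesis using Xi(2) by (simp add: divide_simps) (simp add: algebra_simps)
    qed simp
   qed
   finally show ?thesis .
  qed
  have "(%i. LINT z|lborel. - (nu z / ((X i - z) * (x - z)))) \<longlonglongrightarrow> (LINT z|lborel. - (nu z / ((x - z) * (x - z))))"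
  proof (rule integral_dominated_convergence)
   show "integrable lborel (%z. 4 / rh^2 * cmod (nu z))" using nu by auto
   show "AE z in lborel. (%i. - (nu z / ((X i - z) * (x - z)))) \<longlonglongrightarrow> - (nu z / ((x - z) * (x - z)))"
   proof (rule AE_I2)
    fix z show "(%i. - (nu z / ((X i - z) * (x - z)))) \<longlonglongrightarrow> - (nu z / ((x - z) * (x - z)))"
    proof (cases "nu z = 0")
     case False
     have "x - z ~= 0" using far[OF xU False] rh by auto
     then show ?thesis using X(2) by (intro tendsto_intros) auto
    qed simp
   qed
   show "AE z in lborel. norm (- (nu z / ((X i - z) * (x - z)))) <= 4 / rh^2 * cmod (nu z)" for i
   proof (rule AE_I2)
    fix z show "norm (- (nu z / ((X i - z) * (x - z)))) <= 4 / rh^2 * cmod (nu z)"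
    proof (cases "nu z = 0")
     case False
     have "rh / 2 * (rh / 2) <= cmod (X i - z) * cmod (x - z)"
      using far[OF _ False, of "X i"] far[OF xU False] X(1) rh by (intro mult_mono) auto
     then have "cmod (nu z) / (cmod (X i - z) * cmod (x - z)) <= cmod (nu z) / (rh / 2 * (rh / 2))"
      using rh by (intro frac_le) auto
     then show ?thesis by (simp add: norm_divide norm_mult power2_eq_square mult.commute)
    qed simp
   qed
  qed measurable
  then show "((%y. (CT nu y - CT nu x) / (y - x)) \<circ> X) \<longlonglongrightarrow> (LINT z|lborel. - (nu z / ((x - z) * (x - z))))"
   by (simp add: o_def q)
 qed
 then have "CT nu field_differentiable (at x)"
  using at_within_open[of x U] xU unfolding field_differentiable_def by (auto simp: U_def)
 then show "CT nu field_differentiable at x within ball 0 r" by (rule field_differentiable_at_within)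
qed

lemma dbar_cutoff_inside:
 assumes "0 < r" "r < s" "cmod z < r" shows "dbar (cutoff r s) z = 0"
proof -
 have "hasAB (cutoff r s) 0 0 z"
 proof (rule hasAB_transform[OF hasAB_const[of 1], of "ball 0 r"])
  fix w :: complex assume "w \<in> ball 0 r"
  then show "1 = cutoff r s w" using cutoff_eq_1[OF assms(1,2), of w] by simp
 qed (use assms in auto)
 then show ?thesis by (simp add: hasAB_dbar)
qed

text \<open>Testing with a cutoff times the regularised Cauchy kernel and integrating over the pole w in a convex set
lets the regularisation tend to 0 without any differentiability of u.\<close>
lemma weyl_local:
 fixes u :: "complex => complex"
 assumes um [measurable]: "u \<in> borel_measurable borel"
  and loc: "!!m. 0 < m ==> (nn_set (cball 0 (1 - m)) (%z. ennreal (cmod (u z)))) < \<infinity>"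
  and weak: "!!\<phi>. test_fun \<phi> ==> (LINT z|lborel. u z * dbar \<phi> z) = 0"
  and r: "0 < r'" "r' < r" "r < 1"
 shows "\<exists>h. h holomorphic_on ball 0 r' \<and> (AE z in lborel. z \<in> ball 0 r' --> u z = h z)"
proof -
 define s where "s = (1 + r) / 2"
 have s: "r < s" "s < 1" "0 < r" using r by (auto simp: s_def)
 define ch where "ch = cutoff r s"
 have sg: "smooth_gen ch" unfolding ch_def by (rule smooth_gen_cutoff[OF s(3,1)])
 have C: "C1 ch" by (rule smooth_gen_C1[OF sg])
 have x1: "ch z = 1" if "cmod z <= r" for z unfolding ch_def by (rule cutoff_eq_1[OF s(3,1) that])
 have x0: "ch z = 0" if "s < cmod z" for z unfolding ch_def using cutoff_eq_0[OF s(3,1)] that by simp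
 have d0: "dbar ch z = 0" if "s < cmod z" for z by (rule dbar_support[OF C x0 that])
 have d1: "dbar ch z = 0" if "cmod z < r" for z unfolding ch_def by (rule dbar_cutoff_inside[OF s(3,1) that])
 obtain M where M: "0 < M" "!!z. cmod (dbar ch z) <= M"
  using compact_support_bounded[OF C1_dbar_continuous[OF C] d0] by blast
 have xb: "cmod (ch z) <= 1" for z unfolding ch_def by (rule cutoff_bounds(1)[OF s(3,1)])
 have [measurable]: "dbar ch \<in> borel_measurable borel" "ch \<in> borel_measurable borel"
  by (intro borel_measurable_continuous_onI C1_dbar_continuous C1_continuous C)+
 have [measurable]: "cball (0::complex) s \<in> sets borel" by simp
 have uint: "integrable lborel (%z. indicator (cball 0 s) z *\<^sub>R u z)"
 proof (rule integrableI_bounded)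
  have "(NN z. ennreal (norm (indicator (cball 0 s) z *\<^sub>R u z))) = (nn_set (cball 0 (1 - (1 - s))) (%z. ennreal (cmod (u z))))"
   by (intro nn_integral_cong) (auto simp: indicator_def)
  also have "... < \<infinity>" using s by (intro loc) simp
  finally show "(NN z. ennreal (norm (indicator (cball 0 s) z *\<^sub>R u z))) < \<infinity>" .
 qed measurable
 have bint: "integrable lborel (%z. u z * b z)" if "!!z. cmod (b z) <= B" "!!z. s < cmod z ==> b z = 0" and [measurable]: "b \<in> borel_measurable borel"
  for b :: "complex => complex" and B
 proof (rule Bochner_Integration.integrable_bound)
  show "integrable lborel (%z. B * norm (indicator (cball 0 s) z *\<^sub>R u z))" using uint by (intro integrable_mult_right integrable_norm)
  have B0: "0 <= B" using that(1)[of 0] norm_ge_zero order_trans by blast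
  show "AE z in lborel. norm (u z * b z) <= norm (B * norm (indicator (cball 0 s) z *\<^sub>R u z))"
  proof (rule AE_I2)
   fix z show "norm (u z * b z) <= norm (B * norm (indicator (cball 0 s) z *\<^sub>R u z))"
   proof (cases "z \<in> cball 0 s")
    case True
    have "cmod (u z) * cmod (b z) <= cmod (u z) * B" by (intro mult_left_mono that) auto
    then show ?thesis using True B0 by (simp add: norm_mult mult.commute)
   next
    case False
    then show ?thesis using that(2)[of z] by simp
   qed
  qed
 qed measurable
 define mu where "mu z = u z * ch z" for z
 define nu where "nu z = u z * dbar ch z" for z
 have mui: "integrable lborel mu" unfolding mu_def[abs_def] using xb x0 by (intro bint) auto
 have nui: "integrable lborel nu" unfolding nu_def[abs_def] using M d0 by (intro bint) auto
 have [measurable]: "mu \<in> borel_measurable borel" "nu \<in> borel_measurable borel" using mui nui by auto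
 have nu0: "nu z = 0" if "cmod z < r" for z using d1[OF that] by (simp add: nu_def)
 \<comment> \<open>nu lives on |z| >= r while |w| < r', so the kernel is bounded by 1 / (r - r'),
   uniformly in e.\<close>
 have nuK: "cmod (nu z * Kreg e w z) <= cmod (nu z) / (r - r')" if w: "w \<in> ball 0 r'" for e w z
 proof (cases "cmod z < r")
  case False
  have "r - r' <= cmod (z - w)" using w False norm_triangle_ineq2[of z w] by simp
  then have "1 / cmod (z - w) <= 1 / (r - r')" using r by (intro frac_le) auto
  then have "cmod (Kreg e w z) <= 1 / (r - r')" using norm_Kreg_le[of e w z] by linarith
  then have "cmod (nu z) * cmod (Kreg e w z) <= cmod (nu z) * (1 / (r - r'))" by (intro mult_left_mono) auto
  then show ?thesis by (simp add: norm_mult)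
 qed (simp add: nu0)
 define c where "c = (LINT z|lborel. cmod (nu z) / (r - r'))"
 have ci: "integrable lborel (%z. cmod (nu z) / (r - r'))" using nui by auto
 have Km [measurable]: "Kreg e w \<in> borel_measurable borel" if "0 < e" for e w
  by (rule borel_measurable_continuous_onI[OF continuous_Kreg[OF that]])
 have Ki: "integrable lborel (%z. nu z * Kreg e w z)" if w: "w \<in> ball 0 r'" and e: "0 < e" for e w
 proof (rule Bochner_Integration.integrable_bound[OF ci])
  show "(%z. nu z * Kreg e w z) \<in> borel_measurable lborel" using Km[OF e] by measurable
 qed (use nuK[OF w] r in auto)
 \<comment> \<open>The product of \<open>ch\<close> and \<open>Kreg\<close> is an admissible test
   function; its \<open>dbar\<close> splits into a term where the cutoff varies and the approximate
   identity at w.\<close>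
 have key: "(LINT z|lborel. mu z * of_real (Pker e w z)) = - (LINT z|lborel. nu z * Kreg e w z)" if w: "w \<in> ball 0 r'" and e: "0 < e" for e w
 proof -
  have sgk: "smooth_gen (%z. ch z * Kreg e w z)" by (rule smooth_gen.mult[OF sg smooth_gen_Kreg[OF e]])
  have sub: "closure {z. ch z * Kreg e w z ~= 0} \<subseteq> cball 0 s"
   using x0 by (intro closure_minimal) (auto simp: not_less[symmetric])
  have "test_fun (%z. ch z * Kreg e w z)"
   unfolding test_fun_def
  proof (intro conjI smooth_gen_smooth[OF sgk])
   show "compact (closure {z. ch z * Kreg e w z ~= 0})"
    using sub bounded_subset[OF bounded_cball] by (auto simp: compact_eq_bounded_closed)
   show "closure {z. ch z * Kreg e w z ~= 0} \<subseteq> disc" using sub s by (auto simp: disc_iff subset_iff)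
  qed
  from weak[OF this] have "(LINT z|lborel. u z * dbar (%z. ch z * Kreg e w z) z) = 0" .
  moreover have "u z * dbar (%z. ch z * Kreg e w z) z = nu z * Kreg e w z + mu z * of_real (Pker e w z)" for z
  proof -
   have "dbar (%z. ch z * Kreg e w z) z = dbar ch z * Kreg e w z + ch z * dbar (Kreg e w) z"
    by (rule dbar_mult) (use C smooth_gen_C1[OF smooth_gen_Kreg[OF e]] in \<open>auto simp: C1_def\<close>)
   then show ?thesis unfolding dbar_Kreg[OF e] by (simp add: nu_def mu_def Pker_def algebra_simps)
  qed
  moreover have "integrable lborel (%z. mu z * of_real (Pker e w z))"
  proof (rule Bochner_Integration.integrable_bound)
   show "integrable lborel (%z. cmod (mu z) * (1 / e^2))" using mui by auto
   note measurable_Pker(2)[measurable]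
   show "(%z. mu z * of_real (Pker e w z)) \<in> borel_measurable lborel" by measurable
   show "AE z in lborel. norm (mu z * of_real (Pker e w z)) <= norm (cmod (mu z) * (1 / e^2))"
   proof (rule AE_I2)
    fix z
    have "cmod (mu z) * Pker e w z <= cmod (mu z) * (1 / e^2)" by (intro mult_left_mono Pker_le e) auto
    then show "norm (mu z * of_real (Pker e w z)) <= norm (cmod (mu z) * (1 / e^2))"
     using Pker_nonneg[of e w z] e by (simp add: norm_mult)
   qed
  qed
  ultimately show ?thesis using Ki[OF w e] by (simp add: eq_neg_iff_add_eq_0 add.commute)
 qed
 have CTe: "CT nu w = (LINT z|lborel. - (nu z * (1 / (z - w))))" for w
  unfolding CT_def by (intro Bochner_Integration.integral_cong) (auto simp: minus_divide_right)
 have lim: "(%n. - (LINT z|lborel. nu z * Kreg (1 / real (Suc n)) w z)) \<longlonglongrightarrow> CT nu w" if w: "w \<in> ball 0 r'" for w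
 proof -
  have "(%n. LINT z|lborel. - (nu z * Kreg (1 / real (Suc n)) w z)) \<longlonglongrightarrow> CT nu w"
   unfolding CTe
  proof (rule integral_dominated_convergence[where w = "%z. cmod (nu z) / (r - r')"])
   show "AE z in lborel. (%n. - (nu z * Kreg (1 / real (Suc n)) w z)) \<longlonglongrightarrow> - (nu z * (1 / (z - w)))"
    by (intro AE_I2 tendsto_minus tendsto_mult_left Kreg_tendsto)
   have "0 < 1 / real (Suc n)" for n by simp
   from Km[OF this] show "(%z. - (nu z * Kreg (1 / real (Suc n)) w z)) \<in> borel_measurable lborel" for n by measurable
  qed (use ci nuK[OF w] in auto)
  then show ?thesis by simp
 qed
 have bnd: "cmod (- (LINT z|lborel. nu z * Kreg (1 / real (Suc n)) w z)) <= c" if w: "w \<in> ball 0 r'" for w n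
 proof -
  have "0 < 1 / real (Suc n)" by simp
  note i = Ki[OF w this]
  have "(LINT z|lborel. cmod (nu z * Kreg (1 / real (Suc n)) w z)) <= c"
   unfolding c_def by (intro integral_mono integrable_norm i ci nuK w)
  then show ?thesis using integral_norm_bound[of lborel "%z. nu z * Kreg (1 / real (Suc n)) w z"] unfolding norm_minus_cancel by linarith
 qed
 have bndC: "cmod (CT nu w) <= c" if w: "w \<in> ball 0 r'" for w
  by (rule LIMSEQ_le_const2[OF tendsto_norm[OF lim[OF w]]]) (use bnd[OF w] in blast)
 have CTm [measurable]: "CT nu \<in> borel_measurable borel" by (rule measurable_CT) simp
 have bm [measurable]: "ball (0::complex) r' \<in> sets borel" by simp
 have cind: "integrable lborel (%w::complex. c * indicator (ball 0 r') w)"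
  using emeasure_bounded_finite[of "ball (0::complex) r'"] by (auto simp: integrable_real_indicator)
 \<comment> \<open>Convexity gives E a null frontier, as \<open>mollify_limit\<close>
   requires.\<close>
 have main: "of_real kap * (LINT w:E|lborel. mu w) = (LINT w:E|lborel. CT nu w)"
  if Es: "E \<subseteq> ball 0 r'" and Em [measurable]: "E \<in> sets borel" and conv: "convex E" for E
 proof (rule LIMSEQ_unique)
  have Eb: "bounded E" using bounded_subset[OF bounded_ball Es] .
  have "frontier E \<in> null_sets lebesgue" using negligible_convex_frontier[OF conv] by (simp add: negligible_iff_null_sets)
  then have "frontier E \<in> null_sets lborel" by (subst (asm) null_sets_completion_iff) auto
  then have fr: "AE z in lborel. z \<notin> frontier E" by (rule AE_not_in)
  show "(%n. LINT w:E|lborel. (LINT z|lborel. mu z * of_real (Pker (1 / real (Suc n)) w z))) \<longlonglongrightarrow> of_real kap * (LINT w:E|lborel. mu w)"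
   by (rule mollify_limit[OF mui Em Eb fr])
  show "(%n. LINT w:E|lborel. (LINT z|lborel. mu z * of_real (Pker (1 / real (Suc n)) w z))) \<longlonglongrightarrow> (LINT w:E|lborel. CT nu w)"
   unfolding set_lebesgue_integral_def
  proof (rule integral_dominated_convergence[OF _ _ cind])
   have ke: "(LINT z|lborel. mu z * of_real (Pker (1 / real (Suc n)) w z)) = - (LINT z|lborel. nu z * Kreg (1 / real (Suc n)) w z)" if "w \<in> E" for w n
    using that Es by (intro key) auto
   show "AE w in lborel. (%n. indicator E w *\<^sub>R (LINT z|lborel. mu z * of_real (Pker (1 / real (Suc n)) w z))) \<longlonglongrightarrow> indicator E w *\<^sub>R CT nu w"
   proof (rule AE_I2)
    fix w show "(%n. indicator E w *\<^sub>R (LINT z|lborel. mu z * of_real (Pker (1 / real (Suc n)) w z))) \<longlonglongrightarrow> indicator E w *\<^sub>R CT nu w"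
    proof (cases "w \<in> E")
     case True
     then have "w \<in> ball 0 r'" using Es by auto
     from lim[OF this] show ?thesis unfolding ke[OF True] using True by simp
    qed simp
   qed
   show "AE w in lborel. norm (indicator E w *\<^sub>R (LINT z|lborel. mu z * of_real (Pker (1 / real (Suc n)) w z))) <= c * indicator (ball 0 r') w" for n
   proof (rule AE_I2)
    fix w show "norm (indicator E w *\<^sub>R (LINT z|lborel. mu z * of_real (Pker (1 / real (Suc n)) w z))) <= c * indicator (ball 0 r') w"
    proof (cases "w \<in> E")
     case True
     then have wr: "w \<in> ball 0 r'" using Es by auto
     show ?thesis unfolding ke[OF True] using True wr bnd[OF wr, of n] by simp
    next
     case False
     have "0 <= c" unfolding c_def using r by (intro integral_nonneg_AE AE_I2) auto
     then show ?thesis using False by simp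
    qed
   qed
   show "(%w. indicator E w *\<^sub>R (LINT z|lborel. mu z * of_real (Pker (1 / real (Suc n)) w z))) \<in> borel_measurable lborel" for n
   proof -
    note measurable_Pker(1)[measurable]
    have "(%(w, z). mu z * of_real (Pker (1 / real (Suc n)) w z)) \<in> borel_measurable (lborel \<Otimes>\<^sub>M lborel)" by measurable
    then have "(%w. LINT z|lborel. mu z * of_real (Pker (1 / real (Suc n)) w z)) \<in> borel_measurable lborel"
     by (rule lborel.borel_measurable_lebesgue_integral)
    then show ?thesis by measurable
   qed
  qed measurable
 qed
 define F where "F z = indicator (ball 0 r') z *\<^sub>R (of_real kap * mu z - CT nu z)" for z
 have CTi: "integrable lborel (%z. indicator (ball 0 r') z *\<^sub>R CT nu z)"
  by (rule Bochner_Integration.integrable_bound[OF cind]) (use bndC in \<open>auto simp: indicator_def intro: order_trans[OF _ abs_ge_self]\<close>)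
 have mi: "integrable lborel (%z. indicator (ball 0 r') z *\<^sub>R (of_real kap * mu z))"
  using mui by (intro integrable_mult_indicator integrable_mult_right) auto
 have "AE z in lborel. F z = 0"
 proof (rule AE_zero_boxes[of _ "ball 0 r'"])
  show "integrable lborel F" unfolding F_def[abs_def] scaleR_diff_right by (rule Bochner_Integration.integrable_diff[OF mi CTi])
  fix a b :: complex
  \<comment> \<open>The intersection of a box with the ball is convex, so the identity
    \<open>main\<close> applies to it.\<close>
  define E where "E = box a b \<inter> ball 0 r'"
  have E: "E \<subseteq> ball 0 r'" "E \<in> sets borel" "convex E" by (auto simp: E_def intro: convex_Int)
  have iE: "integrable lborel (%z. indicator E z *\<^sub>R (of_real kap * mu z))" "integrable lborel (%z. indicator E z *\<^sub>R CT nu z)"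
  proof -
   show "integrable lborel (%z. indicator E z *\<^sub>R (of_real kap * mu z))"
    using mui E by (intro integrable_mult_indicator integrable_mult_right) auto
   have "integrable lborel (%z. indicator E z *\<^sub>R (indicator (ball 0 r') z *\<^sub>R CT nu z))"
    by (rule integrable_mult_indicator[OF _ CTi]) (use E in simp)
   then show "integrable lborel (%z. indicator E z *\<^sub>R CT nu z)"
    by (rule Bochner_Integration.integrable_cong[THEN iffD1, rotated -1]) (auto simp: E_def indicator_def)
  qed
  have "(LINT x:box a b|lborel. F x) = (LINT z|lborel. indicator E z *\<^sub>R (of_real kap * mu z) - indicator E z *\<^sub>R CT nu z)"
   unfolding set_lebesgue_integral_def F_def by (intro Bochner_Integration.integral_cong) (auto simp: E_def indicator_def)
  also have "... = (LINT z|lborel. indicator E z *\<^sub>R (of_real kap * mu z)) - (LINT z|lborel. indicator E z *\<^sub>R CT nu z)"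
   by (rule Bochner_Integration.integral_diff[OF iE])
  also have "(LINT z|lborel. indicator E z *\<^sub>R (of_real kap * mu z)) = of_real kap * (LINT w:E|lborel. mu w)"
   unfolding set_lebesgue_integral_def integral_mult_right_zero[symmetric] by (intro Bochner_Integration.integral_cong) auto
  also have "... = (LINT z|lborel. indicator E z *\<^sub>R CT nu z)" using main[OF E] by (simp add: set_lebesgue_integral_def)
  finally show "(LINT x:box a b|lborel. F x) = 0" by simp
 qed (auto simp: F_def)
 then have "AE z in lborel. z \<in> ball 0 r' --> u z = CT nu z / of_real kap"
 proof eventually_elim
  fix z assume F: "F z = 0"
  show "z \<in> ball 0 r' --> u z = CT nu z / of_real kap"
  proof
   assume z: "z \<in> ball 0 r'"
   then have "mu z = u z" using x1[of z] r by (simp add: mu_def)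
   then show "u z = CT nu z / of_real kap" using F z kap_pos by (simp add: F_def field_simps)
  qed
 qed
 moreover have "(%z. CT nu z / of_real kap) holomorphic_on ball 0 r'"
 proof -
  have "CT nu holomorphic_on ball 0 r'"
   by (rule holomorphic_on_subset[OF CT_holomorphic[OF nui nu0]]) (use r in auto)
  then show ?thesis using kap_pos by (intro holomorphic_intros) auto
 qed
 ultimately show ?thesis by blast
qed

lemma AE_eq_continuous:
 fixes f g :: "complex => complex"
 assumes "open S" "continuous_on S f" "continuous_on S g" "AE z in lborel. z \<in> S --> f z = g z" "z \<in> S"
 shows "f z = g z"
proof (rule ccontr)
 assume ne: "f z ~= g z"
 define T where "T = {z \<in> S. f z - g z ~= 0}"
 have "open (S \<inter> (%z. f z - g z) -` (- {0}))"
  using assms(1-3) by (intro continuous_open_preimage continuous_on_diff) auto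
 moreover have "S \<inter> (%z. f z - g z) -` (- {0}) = T" by (auto simp: T_def)
 ultimately have o: "open T" by simp
 moreover have "T ~= {}" using ne assms(5) by (auto simp: T_def)
 moreover have "AE z in lborel. z \<notin> T" using assms(4) by eventually_elim (auto simp: T_def)
 then have "emeasure lborel T = 0" using o by (subst (asm) AE_iff_measurable[OF _ refl]) auto
 ultimately show False using open_not_negligible[of T] by (simp add: negligible_iff_emeasure0)
qed

theorem weyl:
 fixes u :: "complex => complex"
 assumes um: "u \<in> borel_measurable borel"
  and loc: "!!m. 0 < m ==> (nn_set (cball 0 (1 - m)) (%z. ennreal (cmod (u z)))) < \<infinity>"
  and weak: "!!\<phi>. test_fun \<phi> ==> (LINT z|lborel. u z * dbar \<phi> z) = 0"
 shows "\<exists>h. h holomorphic_on disc \<and> (AE z in lborel. z \<in> disc --> u z = h z)"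
proof -
 \<comment> \<open>\<open>n + 2\<close> makes every radius positive.\<close>
 define rh where "rh n = 1 - 1 / real (n + 2)" for n :: nat
 have rh: "0 < rh n" "rh n < 1" for n by (auto simp: rh_def)
 have rhm: "rh m <= rh n" if "m <= n" for m n using that by (simp add: rh_def frac_le)
 have "\<exists>h. h holomorphic_on ball 0 (rh n) \<and> (AE z in lborel. z \<in> ball 0 (rh n) --> u z = h z)" for n
  using rh[of n] by (intro weyl_local[OF um loc weak, of _ "(1 + rh n) / 2"]) auto
 then obtain h where h: "!!n. h n holomorphic_on ball 0 (rh n)" "!!n. AE z in lborel. z \<in> ball 0 (rh n) --> u z = h n z"
  by metis
 have agree: "h m z = h n z" if "m <= n" "z \<in> ball 0 (rh m)" for m n z
 proof (rule AE_eq_continuous[of "ball 0 (rh m)" "h m" "h n" z])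
  show "continuous_on (ball 0 (rh m)) (h m)" by (rule holomorphic_on_imp_continuous_on[OF h(1)])
  have "h n holomorphic_on ball 0 (rh m)" using rhm[OF that(1)] by (intro holomorphic_on_subset[OF h(1)]) auto
  then show "continuous_on (ball 0 (rh m)) (h n)" by (rule holomorphic_on_imp_continuous_on)
  show "AE z in lborel. z \<in> ball 0 (rh m) --> h m z = h n z"
   using h(2)[of m] h(2)[of n] by eventually_elim (use rhm[OF that(1)] in auto)
 qed (use that in auto)
 define N where "N z = (LEAST n. z \<in> ball 0 (rh n))" for z :: complex
 define H where "H z = h (N z) z" for z
 have H: "H z = h n z" if "z \<in> ball 0 (rh n)" for n z
  unfolding H_def N_def by (rule agree) (use that in \<open>auto intro: Least_le LeastI\<close>)
 have U: "disc = (\<Union>n. ball 0 (rh n))"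
 proof (rule set_eqI)
  fix z show "z \<in> disc \<longleftrightarrow> z \<in> (\<Union>n. ball 0 (rh n))"
  proof
   assume "z \<in> disc"
   then have "0 < 1 - cmod z" by (simp add: disc_iff)
   then obtain k where k: "inverse (real (Suc k)) < 1 - cmod z" using reals_Archimedean by blast
   have "1 / real (k + 2) <= inverse (real (Suc k))" by (simp add: inverse_eq_divide frac_le)
   then have "z \<in> ball 0 (rh k)" using k by (simp add: rh_def)
   then show "z \<in> (\<Union>n. ball 0 (rh n))" by blast
  next
   assume "z \<in> (\<Union>n. ball 0 (rh n))"
   then obtain n where "cmod z < rh n" by auto
   then show "z \<in> disc" using rh(2)[of n] by (simp add: disc_iff)
  qed
 qed
 have "H holomorphic_on disc" unfolding U
 proof (rule holomorphic_on_UN_open)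
  show "H holomorphic_on ball 0 (rh n)" for n
   using h(1)[of n] by (rule holomorphic_transform) (simp only: H)
 qed auto
 moreover have "AE z in lborel. \<forall>n. z \<in> ball 0 (rh n) --> u z = h n z"
  using h(2) by (subst AE_all_countable) blast
 then have "AE z in lborel. z \<in> disc --> u z = H z"
 proof eventually_elim
  fix z assume a: "\<forall>n. z \<in> ball 0 (rh n) --> u z = h n z"
  show "z \<in> disc --> u z = H z"
  proof
   assume "z \<in> disc"
   then obtain n where "z \<in> ball 0 (rh n)" unfolding U by blast
   then show "u z = H z" using a H by auto
  qed
 qed
 ultimately show ?thesis by blast
qed

section \<open>Interpolation from solvability\<close>

text \<open>A solution u is only known to be integrable on compact subsets of the disc; its
  measurability on the disc follows along an exhaustion by closed discs, and a Borel version can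
  then enter Weyl's lemma.\<close>

lemma dbar_solution_borel:
 assumes u: "dbar_solution f u"
 shows "\<exists>v. v \<in> borel_measurable borel \<and> (AE z in lborel. z \<in> disc --> u z = v z) \<and>
   (\<forall>m>0. (nn_set (cball 0 (1 - m)) (%z. ennreal (cmod (v z)))) < \<infinity>) \<and>
   (\<forall>\<phi>. test_fun \<phi> --> (LINT z|lborel. v z * dbar \<phi> z) = - (LINT z:disc|lebesgue. f z / of_real (1 - (cmod z)^2) * \<phi> z))"
proof -
 have si: "set_integrable lebesgue K u" if "compact K" "K \<subseteq> disc" for K using u that by (auto simp: dbar_solution_def)
 define r where "r i = 1 - 1 / real (Suc i)" for i :: nat
 have cb: "cball 0 (r i) \<subseteq> disc" for i using disc_cball unfolding r_def by blast
 have rm: "r i <= r j" if "i <= j" for i j using that by (simp add: r_def frac_le)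
 have um: "(%z. indicator disc z *\<^sub>R u z) \<in> borel_measurable lebesgue"
 proof (rule borel_measurable_LIMSEQ_metric)
  show "(%z. indicator (cball 0 (r i)) z *\<^sub>R u z) \<in> borel_measurable lebesgue" for i
   using si[OF compact_cball cb] unfolding set_integrable_def by (rule borel_measurable_integrable)
  fix z :: complex
  have "eventually (%i. indicator (cball 0 (r i)) z *\<^sub>R u z = indicator disc z *\<^sub>R u z) sequentially"
  proof (cases "z \<in> disc")
   case True
   then obtain k where k: "z \<in> cball 0 (r k)" using disc_cball unfolding r_def by blast
   have "z \<in> cball 0 (r i)" if "k <= i" for i using k rm[OF that] by simp
   then show ?thesis using True by (intro eventually_sequentiallyI[of k]) simp
  next
   case False
   then have "z \<notin> cball 0 (r i)" for i using cb by blast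
   then show ?thesis using False by simp
  qed
  then show "(%i. indicator (cball 0 (r i)) z *\<^sub>R u z) \<longlonglongrightarrow> indicator disc z *\<^sub>R u z" by (rule tendsto_eventually)
 qed
 then obtain v where vm [measurable]: "v \<in> borel_measurable borel" and va: "AE z in lborel. indicator disc z *\<^sub>R u z = v z"
  using borel_representative by blast
 have ae: "AE z in lborel. z \<in> disc --> u z = v z" using va by eventually_elim auto
 have loc: "(nn_set (cball 0 (1 - m)) (%z. ennreal (cmod (v z)))) < \<infinity>" if m: "0 < m" for m
 proof -
  have sub: "cball 0 (1 - m) \<subseteq> disc" using m by (auto simp: disc_iff)
  have "(nn_set (cball 0 (1 - m)) (%z. ennreal (cmod (v z)))) = (NN z. ennreal (norm (indicator (cball 0 (1 - m)) z *\<^sub>R u z)))"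
  proof (rule nn_integral_cong_AE, use ae in eventually_elim)
   fix z assume "z \<in> disc --> u z = v z"
   then show "ennreal (cmod (v z)) * indicator (cball 0 (1 - m)) z = ennreal (norm (indicator (cball 0 (1 - m)) z *\<^sub>R u z))"
    using sub by (auto simp: indicator_def)
  qed
  also have "... = (\<integral>\<^sup>+ z. ennreal (norm (indicator (cball 0 (1 - m)) z *\<^sub>R u z)) \<partial>lebesgue)"
   by (rule nn_integral_completion[symmetric])
  also have "... < \<infinity>" using si[OF compact_cball sub] by (simp add: set_integrable_def integrable_iff_bounded)
  finally show ?thesis .
 qed
 have weak: "(LINT z|lborel. v z * dbar \<phi> z) = - (LINT z:disc|lebesgue. f z / of_real (1 - (cmod z)^2) * \<phi> z)" if t: "test_fun \<phi>" for \<phi>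
 proof -
  have phi: "C1 \<phi>" using t smooth_C1 by (simp add: test_fun_def)
  have dm [measurable]: "dbar \<phi> \<in> borel_measurable borel" by (intro borel_measurable_continuous_onI C1_dbar_continuous phi)
  have "(LINT z|lborel. v z * dbar \<phi> z) = (LINT z|lebesgue. v z * dbar \<phi> z)"
   by (rule integral_completion[symmetric]) measurable
  also have "... = (LINT z|lebesgue. (indicator disc z *\<^sub>R u z) * dbar \<phi> z)"
  proof (rule integral_cong_AE)
   have m: "(%z. v z * dbar \<phi> z) \<in> borel_measurable lborel" "dbar \<phi> \<in> borel_measurable lborel" by measurable
   show "(%z. v z * dbar \<phi> z) \<in> borel_measurable lebesgue" by (rule measurable_completion[OF m(1)])
   show "(%z. indicator disc z *\<^sub>R u z * dbar \<phi> z) \<in> borel_measurable lebesgue"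
    by (intro borel_measurable_times um measurable_completion[OF m(2)])
   show "AE z in lebesgue. v z * dbar \<phi> z = indicator disc z *\<^sub>R u z * dbar \<phi> z"
    using AE_completion[OF va] by eventually_elim simp
  qed
  also have "... = (LINT z:disc|lebesgue. u z * dbar \<phi> z)"
   unfolding set_lebesgue_integral_def by (intro Bochner_Integration.integral_cong) auto
  finally have 1: "(LINT z|lborel. v z * dbar \<phi> z) = (LINT z:disc|lebesgue. u z * dbar \<phi> z)" .
  have "- (LINT z:disc|lebesgue. u z * dbar \<phi> z) = (LINT z:disc|lebesgue. f z / of_real (1 - (cmod z)^2) * \<phi> z)"
   using u t unfolding dbar_solution_def by blast
  then show ?thesis unfolding 1 by (metis minus_minus)
 qed
 show ?thesis using vm ae loc weak by blast
qed

text \<open>v is 1 / (z - a) with the pole cut out. Its \<open>dbar\<close> lives where the cutoff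
  varies, at distance between \<open>rh / 3\<close> and \<open>2 / 3 * rh\<close> from a; at a
  itself both sides of the formula are 0.\<close>

lemma bump_quotient:
 fixes a :: complex
 assumes "0 < rh"
 defines "v \<equiv> %z. (1 - chi ((z - a) / of_real rh)) * inverse (z - a)"
 shows "C1 v" "dbar v z = - (dbar chi ((z - a) / of_real rh) / of_real rh) * inverse (z - a)"
proof -
 let ?X = "%z. chi ((z - a) / of_real rh)"
 note X = C1_scale[OF C1_chi assms(1), of a]
 have C: "C1 (%z. 1 + (-1) * ?X z)" by (intro C1_add C1_mult C1_const X(1))
 define K where "K = {z. rh / 3 <= cmod (z - a)}"
 have cK: "closed K" unfolding K_def by (intro closed_Collect_le continuous_intros)
 have K: "K \<subseteq> - {a}" using assms(1) by (auto simp: K_def)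
 have z0: "1 + (-1) * ?X z = 0" if "z \<notin> K" for z
 proof -
  have "cmod ((z - a) / of_real rh) <= 1/3" using that assms(1) by (simp add: K_def norm_divide field_simps)
  then show ?thesis using chi_1 by simp
 qed
 have hol: "(%z. inverse (z - a)) holomorphic_on - {a}" by (intro holomorphic_intros) auto
 have o: "open (- {a})" by auto
 note M = C1_mult_holomorphic[OF C o hol cK K z0]
 have e: "v = (%z. (1 + (-1) * ?X z) * inverse (z - a))" by (simp add: v_def fun_eq_iff)
 show "C1 v" unfolding e by (rule M(1))
 have H: "hasAB (%z. 1 + (-1) * ?X z) (0 + (0 * ?X z + (-1) * pd 1 ?X z)) (0 + (0 * ?X z + (-1) * pd \<i> ?X z)) z"
  by (intro hasAB_add hasAB_mult hasAB_const C1_hasAB X(1))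
 have Y: "dbar (%z. 1 + (-1) * ?X z) z = - dbar ?X z"
  using hasAB_dbar[OF H] unfolding dbar_def by (simp add: field_simps)
 show "dbar v z = - (dbar chi ((z - a) / of_real rh) / of_real rh) * inverse (z - a)"
  unfolding e by (rule trans[OF C1_mult_holomorphic(2)[OF C o hol cK K]]) (rule z0, assumption, simp only: Y X(2))
qed

lemma integral_by_parts_dbar:
 assumes v: "C1 v" and phi: "C1 \<phi>" and B: "!!z. B < cmod z ==> \<phi> z = 0"
 shows "integrable lborel (%z. v z * dbar \<phi> z)" "integrable lborel (%z. dbar v z * \<phi> z)"
  "(LINT z|lborel. v z * dbar \<phi> z) = - (LINT z|lborel. dbar v z * \<phi> z)"
proof -
 have d0: "dbar \<phi> z = 0" if "B < cmod z" for z by (rule dbar_support[OF phi B that])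
 show i: "integrable lborel (%z. v z * dbar \<phi> z)" "integrable lborel (%z. dbar v z * \<phi> z)"
  using B d0 by (intro integrable_compact_support[of _ B] continuous_intros C1_continuous C1_dbar_continuous v phi; simp)+
 have "dbar (%z. v z * \<phi> z) = (%z. dbar v z * \<phi> z + v z * dbar \<phi> z)"
  by (rule ext, rule dbar_mult) (use v phi in \<open>auto simp: C1_def\<close>)
 then have "(LINT z|lborel. dbar v z * \<phi> z + v z * dbar \<phi> z) = 0"
  using integral_dbar_zero[OF C1_mult[OF v phi], of B] B by simp
 then have "(LINT z|lborel. dbar v z * \<phi> z) + (LINT z|lborel. v z * dbar \<phi> z) = 0"
  by (simp only: Bochner_Integration.integral_add[OF i(2,1)])
 then show "(LINT z|lborel. v z * dbar \<phi> z) = - (LINT z|lborel. dbar v z * \<phi> z)" by (metis add.commute eq_neg_iff_add_eq_0)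
qed

lemma epowr_le_imp:
 assumes "epowr x (1 / p) <= ennreal y" "0 < p" "0 <= y"
 shows "x <= ennreal (y powr p)"
proof (cases x)
 case (real t)
 then have "t powr (1 / p) <= y" using assms by (simp add: epowr_ennreal)
 then have "(t powr (1 / p)) powr p <= y powr p" using assms by (intro powr_mono2) auto
 then show ?thesis using real assms by (simp add: powr_powr ennreal_leI)
qed (use assms in \<open>simp add: top_unique\<close>)

context separated_set
begin

text \<open>The sub-mean value bound for |f|^p is summed over the disjoint balls about Z. Separation
  alone thus gives the first half of interpolation.\<close>

lemma Bergman_lpZ:
 assumes p: "0 < p" "p <= 1" and f: "f \<in> Bergman p"
 shows "f \<in> lpZ p Z"
proof -
 have hol: "f holomorphic_on disc" and fin: "Bint p f < \<infinity>" using f by (auto simp: Bergman_iff)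
 obtain C where C: "0 < C" "!!f w r. 0 < r ==> f holomorphic_on ball w r ==>
   ennreal (cmod (f w) powr p) <= ennreal (C / r^2) * (nn_set (ball w r) (%z. ennreal (cmod (f z) powr p)))"
  using powr_mean_bound[OF p] by blast
 define D where "D = 16 * C / dl^2"
 have D: "0 < D" using C delta by (simp add: D_def)
 define g where "g z = ennreal (cmod (f z) powr p) * indicator disc z" for z
 have gm: "g \<in> borel_measurable borel" unfolding g_def[abs_def]
  by (rule nn_meas[OF holomorphic_on_imp_continuous_on[OF hol] sets_disc p(1)])
 have tm: "ennreal (cmod (f a) powr p * (1 - (cmod a)^2)^2) <= ennreal D * (nn_set (ball a (dl / 2 * bd a)) (%w. g w))" if a: "a \<in> Z" for a
 proof -
  have ad: "a \<in> disc" using in_disc[OF a] .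
  have ba: "0 < bd a" using bd_pos[OF ad] .
  have sub: "ball a (dl / 2 * bd a) \<subseteq> disc" using delta by (intro ball_bd_subset_disc ad) simp
  have sq: "(1 - (cmod a)^2)^2 <= (2 * bd a)^2" using square_le_bd[of a] bd_square_le[OF ad] ba by (intro power_mono) auto
  have "ennreal (cmod (f a) powr p) <= ennreal (C / (dl / 2 * bd a)^2) * (nn_set (ball a (dl / 2 * bd a)) (%z. ennreal (cmod (f z) powr p)))"
   using delta ba by (intro C(2) holomorphic_on_subset[OF hol sub]) simp
  also have "(nn_set (ball a (dl / 2 * bd a)) (%z. ennreal (cmod (f z) powr p))) = (nn_set (ball a (dl / 2 * bd a)) (%w. g w))"
   using sub by (intro nn_integral_cong) (auto simp: g_def indicator_def)
  finally have 1: "ennreal (cmod (f a) powr p) <= ennreal (C / (dl / 2 * bd a)^2) * (nn_set (ball a (dl / 2 * bd a)) (%w. g w))" .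
  have "ennreal (cmod (f a) powr p * (1 - (cmod a)^2)^2) <= ennreal (cmod (f a) powr p * (2 * bd a)^2)"
   using sq by (intro ennreal_leI mult_left_mono) auto
  also have "... = ennreal ((2 * bd a)^2) * ennreal (cmod (f a) powr p)" by (simp only: mult.commute ennreal_mult zero_le_power2 powr_ge_zero)
  also have "... <= ennreal ((2 * bd a)^2) * (ennreal (C / (dl / 2 * bd a)^2) * (nn_set (ball a (dl / 2 * bd a)) (%w. g w)))"
   using 1 by (intro mult_left_mono) auto
  also have "... = ennreal ((2 * bd a)^2 * (C / (dl / 2 * bd a)^2)) * (nn_set (ball a (dl / 2 * bd a)) (%w. g w))"
   using C by (subst ennreal_mult) (auto simp only: mult.assoc zero_le_power2 divide_nonneg_nonneg less_imp_le)
  also have "(2 * bd a)^2 * (C / (dl / 2 * bd a)^2) = D" using ba delta by (simp add: D_def field_simps power2_eq_square)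
  finally show ?thesis .
 qed
 have "(\<Sum>a\<in>F. cmod (f a) powr p * (1 - (cmod a)^2)^2) <= D * enn2real (Bint p f)" if F: "finite F" "F \<subseteq> Z" for F
 proof -
  have "ennreal (\<Sum>a\<in>F. cmod (f a) powr p * (1 - (cmod a)^2)^2) = (\<Sum>a\<in>F. ennreal (cmod (f a) powr p * (1 - (cmod a)^2)^2))"
   by (intro sum_ennreal[symmetric]) auto
  also have "... <= (\<Sum>a\<in>F. ennreal D * (nn_set (ball a (dl / 2 * bd a)) (%w. g w)))"
   using F by (intro sum_mono tm) auto
  also have "... <= ennreal D * (nn_set disc (%w. g w))"
   unfolding sum_distrib_left[symmetric] by (intro mult_left_mono esep_sum_integral_le[OF esep_Z Z_disc delta(2) F gm]) auto
  also have "(nn_set disc (%w. g w)) = Bint p f"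
   unfolding Bint_def by (intro nn_integral_cong) (auto simp: g_def indicator_def)
  also have "ennreal D * Bint p f = ennreal (D * enn2real (Bint p f))" using D fin by (simp add: ennreal_mult)
  finally show ?thesis using D by (subst (asm) ennreal_le_iff) auto
 qed
 then show ?thesis unfolding lpZ_def mem_Collect_eq
  by (intro nonneg_bdd_above_summable_on) (auto intro!: bdd_aboveI[of _ "D * enn2real (Bint p f)"])
qed

text \<open>Multiply the function belonging to a by the prescribed value at a. Since p <= 1, the
  p-integrals of the terms add up to at most a multiple of the \<open>lpZ\<close> sum, so
  \<open>Bergman_series\<close> applies.\<close>

lemma interpolating_of_deltas:
 assumes p: "0 < p" "p <= 1" and B: "0 < B"
  and ex: "!!a. a \<in> Z ==> \<exists>F. F holomorphic_on disc \<and> F a = 1 \<and> (\<forall>b\<in>Z. b ~= a --> F b = 0) \<and> Bint p F <= ennreal (B * (bd a)^2)"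
 shows "interpolating p Z"
 unfolding interpolating_def
proof (intro conjI ballI)
 show "f \<in> lpZ p Z" if "f \<in> Bergman p" for f by (rule Bergman_lpZ[OF p that])
 fix cf assume cf: "cf \<in> lpZ p Z"
 obtain g where g: "!!a. a \<in> Z ==> g a holomorphic_on disc" "!!a. a \<in> Z ==> g a a = 1"
  "!!a b. a \<in> Z ==> b \<in> Z ==> b ~= a ==> g a b = 0" "!!a. a \<in> Z ==> Bint p (g a) <= ennreal (B * (bd a)^2)"
  using ex by metis
 let ?t = "%a. cmod (cf a) powr p * (1 - (cmod a)^2)^2"
 have sm: "?t summable_on Z" using cf by (simp add: lpZ_def)
 define T where "T = B * infsum ?t Z"
 have T: "0 <= T" unfolding T_def using B by (intro mult_nonneg_nonneg infsum_nonneg) auto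
 have bnd: "(\<Sum>a\<in>F. Bint p (%z. cf a * g a z)) <= ennreal T" if F: "finite F" "F \<subseteq> Z" for F
 proof -
  have "Bint p (%z. cf a * g a z) <= ennreal (B * ?t a)" if a: "a \<in> F" for a
  proof -
   have aZ: "a \<in> Z" using a F by auto
   have ad: "a \<in> disc" using in_disc[OF aZ] .
   have "Bint p (%z. cf a * g a z) = ennreal (cmod (cf a) powr p) * Bint p (g a)"
    using g(1)[OF aZ] p by (intro Bint_cmult holomorphic_on_imp_continuous_on)
   also have "... <= ennreal (cmod (cf a) powr p) * ennreal (B * (bd a)^2)" using g(4)[OF aZ] by (intro mult_left_mono) auto
   also have "... = ennreal (cmod (cf a) powr p * (B * (bd a)^2))" using B by (intro ennreal_mult[symmetric]) auto
   also have "... <= ennreal (B * ?t a)"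
   proof (rule ennreal_leI)
    have "(bd a)^2 <= (1 - (cmod a)^2)^2" using bd_square_le[OF ad] bd_pos[OF ad] by (intro power_mono) auto
    then have "cmod (cf a) powr p * (B * (bd a)^2) <= cmod (cf a) powr p * (B * (1 - (cmod a)^2)^2)"
     using B by (intro mult_left_mono) auto
    then show "cmod (cf a) powr p * (B * (bd a)^2) <= B * ?t a" by (simp add: mult_ac)
   qed
   finally show ?thesis .
  qed
  then have "(\<Sum>a\<in>F. Bint p (%z. cf a * g a z)) <= (\<Sum>a\<in>F. ennreal (B * ?t a))" by (rule sum_mono)
  also have "... = ennreal (B * (\<Sum>a\<in>F. ?t a))" using B by (simp add: sum_ennreal sum_distrib_left)
  also have "... <= ennreal T" unfolding T_def
   using B F sm by (intro ennreal_leI mult_left_mono finite_sum_le_infsum) auto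
  finally show ?thesis .
 qed
 have "\<exists>h. h holomorphic_on disc \<and> Bint p h <= ennreal T \<and> (\<forall>z\<in>disc. ((%a. cf a * g a z) has_sum h z) Z)"
  using g(1) bnd by (intro Bergman_series p T holomorphic_intros) auto
 then obtain h where h: "h holomorphic_on disc" "Bint p h <= ennreal T"
  "!!z. z \<in> disc ==> ((%a. cf a * g a z) has_sum h z) Z" by blast
 have hb: "h b = cf b" if b: "b \<in> Z" for b
 proof -
  have "((%a. cf a * g a b) has_sum cf b) {b}" using g(2)[OF b] has_sum_finite[of "{b}" "%a. cf a * g a b"] by simp
  then have "((%a. cf a * g a b) has_sum cf b) Z"
   by (rule has_sum_cong_neutral[THEN iffD1, rotated -1]) (use b g(3) in auto)
  with h(3)[OF in_disc[OF b]] show ?thesis by (rule has_sum_unique)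
 qed
 have "h \<in> Bergman p" using h(1,2) ennreal_less_top le_less_trans unfolding Bergman_iff by (metis infinity_ennreal_def)
 then show "\<exists>f\<in>Bergman p. \<forall>a\<in>Z. f a = cf a" using hb by blast
qed

text \<open>The local mean at z is at most M, and it is 0 unless D(z, R) meets the ball carrying f,
  which confines z to a ball of radius proportional to \<open>bd a\<close>.\<close>

lemma mqint_upper:
 assumes p: "0 < p" and q: "1 <= q" and R: "0 < R" "R < 1" and a: "a \<in> disc" and M: "0 <= M"
  and f0: "!!w. w \<notin> ball a (bd a / 2) ==> f w = 0" and fM: "!!w. w \<in> disc ==> cmod (f w) * exp (kZ Z w) <= M"
 shows "mqint R p q f <= ennreal (M powr p * (49 * pi / (1 - R)^2 * (bd a)^2))"
proof -
 have ba: "0 < bd a" using bd_pos[OF a] .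
 let ?g = "%w. f w * complex_of_real (exp (kZ Z w))"
 \<comment> \<open>7 is 1 plus 3 times 2: at most \<open>bd a / 2\<close> from a to a point w of the
   ball carrying f, then \<open>3 / (1 - R) * bd w\<close> by \<open>pdisc_bounds\<close>, with
   \<open>bd w <= 2 * bd a\<close>.\<close>
 define A where "A = ball a (7 / (1 - R) * bd a)"
 have pw: "epowr (mq R q ?g z) p * indicator disc z <= ennreal (M powr p) * indicator A z" for z
 proof (cases "z \<in> disc \<and> pdisc z R \<inter> ball a (bd a / 2) ~= {}")
  case True
  then have z: "z \<in> disc" by simp
  obtain w where w: "w \<in> pdisc z R" "w \<in> ball a (bd a / 2)" using True by blast
  have wd: "w \<in> disc" using w by (simp add: pdisc_def)
  have "pshyp w z = pshyp z w" unfolding pshyp_eq using kern_sym[of z w] by (simp add: norm_minus_commute)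
  then have "z \<in> pdisc w R" using w(1) z by (simp add: pdisc_def)
  then have zw: "cmod (w - z) < 3 / (1 - R) * bd w" using pdisc_bounds(2)[OF wd R] by (auto simp: dist_norm)
  have aw: "cmod (a - w) < bd a / 2" using w(2) by (simp add: dist_norm)
  then have bw: "bd w <= 2 * bd a" using bd_diff[of w a] ba by (auto simp: abs_le_iff norm_minus_commute)
  have "cmod (a - z) <= cmod (a - w) + cmod (w - z)" using norm_triangle_ineq[of "a - w" "w - z"] by simp
  also have "... < bd a / 2 + 3 / (1 - R) * bd w" using zw aw by simp
  also have "... <= 1 / (1 - R) * bd a + 3 / (1 - R) * (2 * bd a)"
  proof (intro add_mono mult_left_mono bw)
   have "1 <= 1 / (1 - R)" using R by (simp add: field_simps)
   then have "1 * bd a <= 1 / (1 - R) * bd a" using ba by (intro mult_right_mono) auto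
   then show "bd a / 2 <= 1 / (1 - R) * bd a" using ba by linarith
  qed (use R in auto)
  also have "... = 7 / (1 - R) * bd a" by (simp add: field_simps)
  finally have zA: "z \<in> A" by (simp add: A_def dist_norm)
  define D where "D = pdisc z R"
  have Do: "open D" "D \<subseteq> disc" using pdisc_bounds(3)[OF z R] by (auto simp: D_def pdisc_def)
  have D: "D \<in> sets borel" using Do(1) by simp
  have Df: "emeasure lebesgue D < \<infinity>"
  proof -
   have "emeasure lborel D < \<infinity>" using bounded_subset[of disc D] Do(2) by (intro emeasure_bounded_finite) (auto simp: disc_def)
   then show ?thesis using D by simp
  qed
  have eD: "emeasure lebesgue D = ennreal (measure lebesgue D)" using Df by (intro emeasure_eq_ennreal_measure) auto
  have "(\<integral>\<^sup>+ w\<in>D. ennreal (cmod (?g w) powr q) \<partial>lebesgue) <= (\<integral>\<^sup>+ w. ennreal (M powr q) * indicator D w \<partial>lebesgue)"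
  proof (rule nn_integral_mono)
   fix w
   show "ennreal (cmod (?g w) powr q) * indicator D w <= ennreal (M powr q) * indicator D w"
   proof (cases "w \<in> D")
    case True
    then have "cmod (?g w) <= M" using fM[of w] Do(2) by (auto simp: norm_mult)
    then show ?thesis using q True by (auto intro!: ennreal_leI powr_mono2)
   qed simp
  qed
  also have "... = ennreal (M powr q) * ennreal (measure lebesgue D)" using D by (simp add: nn_integral_cmult_indicator eD)
  finally have I: "(\<integral>\<^sup>+ w\<in>D. ennreal (cmod (?g w) powr q) \<partial>lebesgue) <= ennreal (M powr q) * ennreal (measure lebesgue D)" .
  have "ennreal (1 / measure lebesgue D) * (\<integral>\<^sup>+ w\<in>D. ennreal (cmod (?g w) powr q) \<partial>lebesgue) <= ennreal (1 / measure lebesgue D) * (ennreal (M powr q) * ennreal (measure lebesgue D))"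
   using I by (intro mult_left_mono) auto
  also have "... = ennreal (1 / measure lebesgue D * (M powr q * measure lebesgue D))"
   by (simp only: ennreal_mult mult_nonneg_nonneg divide_nonneg_nonneg zero_le_one measure_nonneg powr_ge_zero)
  also have "... <= ennreal (M powr q)" by (intro ennreal_leI) simp
  finally have "mq R q ?g z <= epowr (ennreal (M powr q)) (1 / q)" unfolding mq_def D_def[symmetric] using q by (intro epowr_mono) auto
  also have "... = ennreal M" using q M by (simp add: epowr_ennreal powr_powr)
  finally have "epowr (mq R q ?g z) p <= epowr (ennreal M) p" using p by (intro epowr_mono) auto
  then show ?thesis using zA z M by (simp add: epowr_ennreal)
 next
  case False
  show ?thesis
  proof (cases "z \<in> disc")
   case True
   have "f w = 0" if "w \<in> pdisc z R" for w using that True False by (intro f0) blast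
   then have e: "ennreal (cmod (?g w) powr q) * indicator (pdisc z R) w = 0" for w by (auto simp: indicator_def)
   have "mq R q ?g z = epowr 0 (1 / q)" unfolding mq_def e by simp
   then have "mq R q ?g z = 0" by (simp add: epowr_def)
   then have "epowr (mq R q ?g z) p = 0" by (simp add: epowr_def)
   then show ?thesis by simp
  qed simp
 qed
 have "mqint R p q f <= (NN z. ennreal (M powr p) * indicator A z)"
  unfolding mqint_def by (rule nn_integral_mono[OF pw])
 also have "... = ennreal (M powr p) * emeasure lborel A" by (rule nn_integral_cmult_indicator) (simp add: A_def)
 also have "emeasure lborel A = ennreal (pi * (7 / (1 - R) * bd a)^2)"
  unfolding A_def using R ba by (intro emeasure_ball_complex) auto
 also have "ennreal (M powr p) * ... = ennreal (M powr p * (pi * (7 / (1 - R) * bd a)^2))" by (intro ennreal_mult[symmetric]) auto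
 also have "pi * (7 / (1 - R) * bd a)^2 = 49 * pi / (1 - R)^2 * (bd a)^2" by (simp add: power_mult_distrib power_divide)
 finally show ?thesis .
qed

end

context separated_Psi
begin

lemma delta_functions:
 assumes p: "0 < p" "p <= 1" and q: "1 <= q" and R: "0 < R" "R < 1"
  and solve: "!!f. f \<in> LpqZ R p q Z ==> \<exists>u. dbar_solution f u \<and> normZ p Z u <= ennreal C * normpqZ R p q Z f"
 shows "\<exists>B>0. \<forall>a\<in>Z. \<exists>F. F holomorphic_on disc \<and> F a = 1 \<and> (\<forall>b\<in>Z. b ~= a --> F b = 0) \<and> Bint p F <= ennreal (B * (bd a)^2)"
proof -
 obtain Ck where Ck: "0 < Ck" "!!z w. z \<in> disc ==> cmod (z - w) <= bd z / 2 ==> \<bar>kZ Z z - kZ Z w\<bar> <= Ck * cmod (z - w) / bd z"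
  by (rule kZ_lipschitz) (rule that)
 obtain M1 where M1: "0 < M1" "!!z. cmod (dbar chi z) <= M1" using dbar_chi_bound by blast
 define L where "L = 49 * pi / (1 - R)^2"
 \<comment> \<open>108 is 3 times 36: 36 comes from the bound Ma for f, and 3 from
   \<open>deriv_Psi_lower\<close>. The factor \<open>exp (Ck / 2)\<close> compares the weight near a
   with its value E at a.\<close>
 define k1 where "k1 = (108 * M1 * exp (Ck / 2) / c) powr p"
 define k2 where "k2 = (3 * exp (1/2 + Ck / 2) / c) powr p"
 define B where "B = \<bar>C\<bar> powr p * (k1 * L) + k2 * pi / 4"
 have L: "0 < L" using R by (simp add: L_def)
 have k: "0 <= k1" "0 < k2" using c by (auto simp: k1_def k2_def)
 have B: "0 < B" unfolding B_def using k L by (intro add_nonneg_pos) auto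
 have "\<exists>F. F holomorphic_on disc \<and> F a = 1 \<and> (\<forall>b\<in>Z. b ~= a --> F b = 0) \<and> Bint p F <= ennreal (B * (bd a)^2)" if a: "a \<in> Z" for a
 proof -
  have ad: "a \<in> disc" using in_disc[OF a] .
  define d where "d = bd a"
  have d: "0 < d" using bd_pos[OF ad] by (simp add: d_def)
  define rh where "rh = d / 2"
  have rh: "0 < rh" using d by (simp add: rh_def)
  define E where "E = exp (kZ Z a)"
  have E: "0 < E" by (simp add: E_def)
  have ek: "exp (kZ Z w) <= exp (Ck / 2) * E" if "cmod (w - a) <= rh" for w
  proof -
   have aw: "cmod (a - w) <= bd a / 2" using that by (simp add: rh_def d_def norm_minus_commute)
   have "Ck * cmod (a - w) / bd a <= Ck * (bd a / 2) / bd a"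
    using aw Ck d by (intro divide_right_mono mult_left_mono) (auto simp: d_def)
   moreover have "Ck * (bd a / 2) / bd a = Ck / 2" using d by (simp add: d_def)
   ultimately have "kZ Z w <= Ck / 2 + kZ Z a" using Ck(2)[OF ad aw] by linarith
   then have "exp (kZ Z w) <= exp (Ck / 2 + kZ Z a)" by simp
   then show ?thesis by (simp add: exp_add E_def)
  qed
  define X where "X z = chi ((z - a) / of_real rh)" for z
  define v where "v = (%z. (1 - chi ((z - a) / of_real rh)) * inverse (z - a))"
  have v: "C1 v" "!!z. dbar v z = - (dbar chi ((z - a) / of_real rh) / of_real rh) * inverse (z - a)"
   unfolding v_def using bump_quotient[OF rh, of a] by blast+
  have vX: "v z = (1 - X z) * inverse (z - a)" for z by (simp add: v_def X_def)
  have nr: "cmod ((z - a) / of_real rh) = cmod (z - a) / rh" for z using rh by (simp add: norm_divide)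
  \<comment> \<open>The right side is chosen so that every solution u has the same
    \<open>dbar\<close> as v.\<close>
  define f where "f z = of_real (1 - (cmod z)^2) * dbar v z" for z
  define Ma where "Ma = 36 * M1 * exp (Ck / 2) * E / d"
  have Ma: "0 <= Ma" using M1 E d by (simp add: Ma_def)
  have f0: "f w = 0" if "w \<notin> ball a (bd a / 2)" for w
  proof -
   have "rh <= cmod (w - a)" using that by (simp add: rh_def d_def dist_norm norm_minus_commute)
   then have "2/3 < cmod ((w - a) / of_real rh)" unfolding nr using rh by (simp add: field_simps)
   then show ?thesis using dbar_chi_zero by (simp add: f_def v(2))
  qed
  have fM: "cmod (f w) * exp (kZ Z w) <= Ma" if w: "w \<in> disc" for w
  proof (cases "w \<in> ball a (bd a / 2) \<and> rh / 3 <= cmod (w - a)")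
   case True
   then have wa: "cmod (w - a) < rh" "d / 6 <= cmod (w - a)" by (auto simp: rh_def d_def dist_norm norm_minus_commute)
   have "bd w <= 3 / 2 * d" using bd_diff[of w a] wa by (auto simp: d_def rh_def abs_le_iff)
   then have s: "1 - (cmod w)^2 <= 3 * d" using square_le_bd[of w] by linarith
   have s0: "0 <= 1 - (cmod w)^2" using bd_square_le[OF w] bd_pos[OF w] by linarith
   have "inverse (cmod (w - a)) <= inverse (d / 6)" using wa d by (intro le_imp_inverse_le) auto
   then have i: "cmod (inverse (w - a)) <= 6 / d" by (simp add: norm_inverse)
   have "cmod (dbar v w) = cmod (dbar chi ((w - a) / of_real rh)) / rh * cmod (inverse (w - a))"
    unfolding v(2) using rh by (simp add: norm_mult norm_divide)
   also have "... <= M1 / rh * (6 / d)" using i M1 rh d by (intro mult_mono divide_right_mono) auto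
   also have "... = 12 * M1 / d^2" using d by (simp add: rh_def power2_eq_square)
   finally have dv: "cmod (dbar v w) <= 12 * M1 / d^2" .
   have "cmod (f w) = (1 - (cmod w)^2) * cmod (dbar v w)" unfolding f_def norm_mult norm_of_real using s0 by simp
   also have "... <= 3 * d * (12 * M1 / d^2)" using s s0 dv d by (intro mult_mono) auto
   also have "... = 36 * M1 / d" using d by (simp add: power2_eq_square)
   finally have "cmod (f w) * exp (kZ Z w) <= 36 * M1 / d * (exp (Ck / 2) * E)"
    using ek[of w] wa M1 d by (intro mult_mono) auto
   then show ?thesis by (simp add: Ma_def)
  next
   case False
   have "f w = 0"
   proof (cases "w \<in> ball a (bd a / 2)")
    case True
    then have "cmod ((w - a) / of_real rh) < 1/3" unfolding nr using False rh by (simp add: field_simps)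
    then show ?thesis using dbar_chi_zero by (simp add: f_def v(2))
   qed (rule f0)
   then show ?thesis using Ma by simp
  qed
  define m where "m = Ma powr p * (L * d^2)"
  have m0: "0 <= m" using L by (simp add: m_def)
  have mq: "mqint R p q f <= ennreal m"
   unfolding m_def L_def d_def by (rule mqint_upper[OF p(1) q R ad Ma f0 fM])
  have vm [measurable]: "v \<in> borel_measurable borel" "dbar v \<in> borel_measurable borel"
   by (intro borel_measurable_continuous_onI C1_dbar_continuous C1_continuous v(1))+
  have fm: "f \<in> borel_measurable borel" unfolding f_def[abs_def] by measurable
  have "f \<in> LpqZ R p q Z"
   unfolding LpqZ_def mem_Collect_eq
  proof
   have "(%x. indicator disc x *\<^sub>R f x) \<in> borel_measurable lborel" using fm by measurable
   then show "set_borel_measurable lebesgue disc f" unfolding set_borel_measurable_def by (rule measurable_completion)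
   show "normpqZ R p q Z f < \<infinity>" unfolding normpqZ_mqint epowr_less_top using mq ennreal_less_top[of m] by (simp add: le_less_trans)
  qed
  then obtain u where u: "dbar_solution f u" "normZ p Z u <= ennreal C * normpqZ R p q Z f" using solve by blast
  have wu: "wint p u <= ennreal (\<bar>C\<bar> powr p * m)"
  proof -
   have "epowr (wint p u) (1/p) <= ennreal C * epowr (mqint R p q f) (1/p)" using u(2) by (simp add: normZ_wint normpqZ_mqint)
   also have "... <= ennreal \<bar>C\<bar> * epowr (ennreal m) (1/p)"
    using mq p by (intro mult_mono ennreal_leI epowr_mono) auto
   also have "... = ennreal (\<bar>C\<bar> * m powr (1/p))" using m0 by (simp add: epowr_ennreal ennreal_mult)
   finally have "wint p u <= ennreal ((\<bar>C\<bar> * m powr (1/p)) powr p)" using p by (intro epowr_le_imp) auto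
   also have "(\<bar>C\<bar> * m powr (1/p)) powr p = \<bar>C\<bar> powr p * m" unfolding powr_mult using p m0 by (simp add: powr_powr)
   finally show ?thesis .
  qed
  obtain u' where um [measurable]: "u' \<in> borel_measurable borel" and ua: "AE z in lborel. z \<in> disc --> u z = u' z"
   and ul: "!!m. 0 < m ==> (nn_set (cball 0 (1 - m)) (%z. ennreal (cmod (u' z)))) < \<infinity>"
   and uw: "!!\<phi>. test_fun \<phi> ==> (LINT z|lborel. u' z * dbar \<phi> z) = - (LINT z:disc|lebesgue. f z / of_real (1 - (cmod z)^2) * \<phi> z)"
   using dbar_solution_borel[OF u(1)] by blast
  have wu': "wint p u' <= ennreal (\<bar>C\<bar> powr p * m)"
  proof -
   have "wint p u' = wint p u" unfolding wint_def
   proof (rule nn_integral_cong_AE, use ua in eventually_elim)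
    fix z assume "z \<in> disc --> u z = u' z"
    then show "ennreal ((cmod (u' z) * exp (kZ Z z)) powr p) * indicator disc z = ennreal ((cmod (u z) * exp (kZ Z z)) powr p) * indicator disc z"
     by (cases "z \<in> disc") auto
   qed
   then show ?thesis using wu by simp
  qed
  have "\<exists>h. h holomorphic_on disc \<and> (AE z in lborel. z \<in> disc --> u' z - v z = h z)"
  proof (rule weyl)
   show "(%z. u' z - v z) \<in> borel_measurable borel" by measurable
   show "(nn_set (cball 0 (1 - m)) (%z. ennreal (cmod (u' z - v z)))) < \<infinity>" if m: "0 < m" for m
   proof -
    have [measurable]: "cball (0::complex) (1 - m) \<in> sets borel" by simp
    have "integrable lborel (%z. indicator (cball 0 (1 - m)) z *\<^sub>R v z)"
     by (rule borel_integrable_compact[OF compact_cball C1_continuous[OF v(1)]])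
    then have J: "(NN z. ennreal (norm (indicator (cball 0 (1 - m)) z *\<^sub>R v z))) < \<infinity>" by (simp add: integrable_iff_bounded)
    have "(nn_set (cball 0 (1 - m)) (%z. ennreal (cmod (u' z - v z))))
     <= (NN z. ennreal (cmod (u' z)) * indicator (cball 0 (1 - m)) z + ennreal (norm (indicator (cball 0 (1 - m)) z *\<^sub>R v z)))"
     by (intro nn_integral_mono) (auto simp: indicator_def norm_triangle_ineq4 intro!: ennreal_leI simp flip: ennreal_plus)
    also have "... = (nn_set (cball 0 (1 - m)) (%z. ennreal (cmod (u' z)))) + (NN z. ennreal (norm (indicator (cball 0 (1 - m)) z *\<^sub>R v z)))"
     by (rule nn_integral_add) measurable
    also have "... < \<infinity>" unfolding infinity_ennreal_def ennreal_add_less_top using ul[OF m] J unfolding infinity_ennreal_def by (rule conjI)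
    finally show ?thesis .
   qed
   fix \<phi> assume t: "test_fun \<phi>"
   then obtain m where m: "0 < m" "closure {z. \<phi> z ~= 0} \<subseteq> cball 0 (1 - m)"
    using compact_subset_cball unfolding test_fun_def by blast
   have phi: "C1 \<phi>" using t smooth_C1 by (simp add: test_fun_def)
   have ph: "\<phi> z = 0" if "1 - m < cmod z" for z
    using m(2) closure_subset[of "{z. \<phi> z ~= 0}"] that by (auto simp: subset_iff)
   have d0: "dbar \<phi> z = 0" if "1 - m < cmod z" for z by (rule dbar_support[OF phi ph that])
   have [measurable]: "dbar \<phi> \<in> borel_measurable borel" "\<phi> \<in> borel_measurable borel"
    by (intro borel_measurable_continuous_onI C1_dbar_continuous C1_continuous phi)+
   obtain M where M: "0 < M" "!!z. cmod (dbar \<phi> z) <= M"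
    using compact_support_bounded[OF C1_dbar_continuous[OF phi] d0] by blast
   have iu: "integrable lborel (%z. u' z * dbar \<phi> z)"
   proof (rule integrableI_bounded)
    have "(NN z. ennreal (norm (u' z * dbar \<phi> z))) <= (NN z. ennreal M * (ennreal (cmod (u' z)) * indicator (cball 0 (1 - m)) z))"
    proof (rule nn_integral_mono)
     fix z show "ennreal (norm (u' z * dbar \<phi> z)) <= ennreal M * (ennreal (cmod (u' z)) * indicator (cball 0 (1 - m)) z)"
     proof (cases "z \<in> cball 0 (1 - m)")
      case True
      have "cmod (u' z) * cmod (dbar \<phi> z) <= cmod (u' z) * M" by (intro mult_left_mono M) auto
      then show ?thesis using True M by (simp add: norm_mult mult.commute ennreal_leI flip: ennreal_mult)
     qed (use d0 in simp)
    qed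
    also have "... = ennreal M * (nn_set (cball 0 (1 - m)) (%z. ennreal (cmod (u' z))))"
     by (rule nn_integral_cmult) (auto intro!: borel_measurable_times_ennreal borel_measurable_indicator)
    also have "... < \<infinity>" using ul[OF m(1)] by (simp add: ennreal_mult_less_top)
    finally show "(NN z. ennreal (norm (u' z * dbar \<phi> z))) < \<infinity>" .
   qed measurable
   note P = integral_by_parts_dbar[OF v(1) phi ph]
   have "(LINT z:disc|lebesgue. f z / of_real (1 - (cmod z)^2) * \<phi> z) = (LINT z|lebesgue. dbar v z * \<phi> z)"
    unfolding set_lebesgue_integral_def
   proof (rule Bochner_Integration.integral_cong[OF refl])
    fix z show "indicator disc z *\<^sub>R (f z / of_real (1 - (cmod z)^2) * \<phi> z) = dbar v z * \<phi> z"
    proof (cases "z \<in> disc")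
     case True
     then have "1 - (cmod z)^2 ~= 0" using bd_square_le[OF True] bd_pos[OF True] by linarith
     then show ?thesis using True unfolding f_def by (simp del: of_real_diff)
    next
     case False
     then show ?thesis using ph[of z] m by (simp add: disc_iff)
    qed
   qed
   also have "... = (LINT z|lborel. dbar v z * \<phi> z)" by (rule integral_completion) measurable
   finally have "(LINT z|lborel. u' z * dbar \<phi> z) = (LINT z|lborel. v z * dbar \<phi> z)" using uw[OF t] P(3) by simp
   then show "(LINT z|lborel. (u' z - v z) * dbar \<phi> z) = 0"
    unfolding left_diff_distrib using Bochner_Integration.integral_diff[OF iu P(1)] by simp
  qed
  then obtain h where h: "h holomorphic_on disc" and ha: "AE z in lborel. z \<in> disc --> u' z - v z = h z" by blast
  define D where "D = deriv \<Psi> a"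
  have Dlow: "c * E / (3 * d) <= cmod D" using deriv_Psi_lower[OF a] by (simp add: D_def E_def d_def)
  have Dpos: "0 < c * E / (3 * d)" using c E d by simp
  then have D0: "D ~= 0" using Dlow by auto
  have Psia: "\<Psi> a = 0" using Psi_zero_iff[OF ad] a by simp
  \<comment> \<open>\<open>\<Psi>\<close> divided by z - a with the removable singularity filled in;
    F0 is then \<open>\<Psi>\<close> times the sum of 1 / (z - a) and h.\<close>
  define G where "G z = (if z = a then D else \<Psi> z / (z - a))" for z
  have G: "G holomorphic_on disc"
   using pole_lemma_open[OF Psi_hol open_disc, of a] unfolding G_def[abs_def] D_def Psia diff_0_right .
  define F0 where "F0 z = G z + \<Psi> z * h z" for z
  have F0: "F0 holomorphic_on disc" unfolding F0_def using G Psi_hol h by (intro holomorphic_intros)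
  define N where "N = exp (1/2 + Ck / 2) * E / d"
  have N: "0 <= N" using E d by (simp add: N_def)
  define W where "W z = ennreal ((cmod (u' z) * exp (kZ Z z)) powr p) * indicator disc z" for z
  have Wm [measurable]: "W \<in> borel_measurable borel" unfolding W_def[abs_def] by (rule wmeas_borel[OF um])
  have "Bint p F0 <= (NN z. W z + ennreal (N powr p) * indicator (ball a rh) z)"
   unfolding Bint_def
  proof (rule nn_integral_mono_AE, use ha AE_lborel_singleton[of a] in eventually_elim)
   fix z assume e: "z \<in> disc --> u' z - v z = h z" and za: "z ~= a"
   show "ennreal (cmod (F0 z) powr p) * indicator disc z <= W z + ennreal (N powr p) * indicator (ball a rh) z"
   proof (cases "z \<in> disc")
    case True
    \<comment> \<open>Almost everywhere h is u' - v. This leaves \<open>\<Psi>\<close> u', bounded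
      by the weighted modulus of u', and a term supported near a in which the zero of
      \<open>\<Psi>\<close> cancels the pole.\<close>
    have "F0 z = \<Psi> z * u' z + \<Psi> z * X z * inverse (z - a)"
    proof -
     have "h z = u' z - (1 - X z) * inverse (z - a)" using e True by (simp add: vX)
     then have "F0 z = \<Psi> z * inverse (z - a) + \<Psi> z * (u' z - (1 - X z) * inverse (z - a))"
      using za by (simp add: F0_def G_def divide_inverse)
     then show ?thesis by (simp add: algebra_simps)
    qed
    then have "cmod (F0 z) <= cmod (\<Psi> z * u' z) + cmod (\<Psi> z * X z * inverse (z - a))" by (simp only: norm_triangle_ineq)
    also have "... <= cmod (u' z) * exp (kZ Z z) + N * indicator (ball a rh) z"
    proof (rule add_mono)
     have "cmod (\<Psi> z) * cmod (u' z) <= exp (kZ Z z) * cmod (u' z)" by (intro mult_right_mono Psi_le True) auto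
     then show "cmod (\<Psi> z * u' z) <= cmod (u' z) * exp (kZ Z z)" by (simp add: norm_mult mult.commute)
     show "cmod (\<Psi> z * X z * inverse (z - a)) <= N * indicator (ball a rh) z"
     proof (cases "z \<in> ball a rh")
      case zb: True
      have "cmod (X z) <= 1" unfolding X_def chi_def by (rule cutoff_bounds(1)) auto
      then have "cmod (\<Psi> z * X z * inverse (z - a)) <= cmod (\<Psi> z) * 1 * cmod (inverse (z - a))"
       unfolding norm_mult by (intro mult_right_mono mult_left_mono) auto
      also have "... <= exp (1/2) * pshyp z a * exp (kZ Z z) * 1 * cmod (inverse (z - a))"
       by (intro mult_right_mono Psi_le_near True a) auto
      also have "... = exp (1/2) * exp (kZ Z z) * (1 / cmod (1 - cnj a * z))"
       using za by (simp add: pshyp_eq norm_inverse)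
      also have "... <= exp (1/2) * (exp (Ck / 2) * E) * (1 / d)"
      proof (intro mult_mono frac_le)
       show "exp (kZ Z z) <= exp (Ck / 2) * E" using zb by (intro ek) (simp add: dist_norm norm_minus_commute)
       show "d <= cmod (1 - cnj a * z)" unfolding d_def by (rule kern_ge_left[OF True])
      qed (use d E in auto)
      also have "... = N" by (simp add: N_def exp_add)
      finally show ?thesis using zb by simp
     next
      case False
      then have "2/3 <= cmod ((z - a) / of_real rh)" unfolding nr using rh by (simp add: field_simps dist_norm norm_minus_commute)
      then have "X z = 0" unfolding X_def by (rule chi_0)
      then show ?thesis using N by simp
     qed
    qed
    finally have "cmod (F0 z) powr p <= (cmod (u' z) * exp (kZ Z z) + N * indicator (ball a rh) z) powr p"
     using p by (intro powr_mono2) auto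
    also have "... <= (cmod (u' z) * exp (kZ Z z)) powr p + (N * indicator (ball a rh) z) powr p"
     using p N by (intro add_powr_le) auto
    also have "(N * indicator (ball a rh) z) powr p = N powr p * indicator (ball a rh) z"
     using p by (simp add: indicator_def)
    finally have "ennreal (cmod (F0 z) powr p) <= ennreal ((cmod (u' z) * exp (kZ Z z)) powr p + N powr p * indicator (ball a rh) z)"
     by (rule ennreal_leI)
    also have "... = ennreal ((cmod (u' z) * exp (kZ Z z)) powr p) + ennreal (N powr p) * indicator (ball a rh) z"
     by (subst ennreal_plus) (auto simp: indicator_def)
    finally show ?thesis using True by (simp add: W_def)
   qed simp
  qed
  also have "... = (NN z. W z) + ennreal (N powr p) * emeasure lborel (ball a rh)"
  proof -
   have [measurable]: "ball a rh \<in> sets borel" by simp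
   have "(NN z. W z + ennreal (N powr p) * indicator (ball a rh) z)
    = (NN z. W z) + (NN z. ennreal (N powr p) * indicator (ball a rh) z)"
    by (rule nn_integral_add) measurable
   also have "(NN z. ennreal (N powr p) * indicator (ball a rh) z) = ennreal (N powr p) * emeasure lborel (ball a rh)"
    by (rule nn_integral_cmult_indicator) simp
   finally show ?thesis .
  qed
  also have "(NN z. W z) = wint p u'" by (simp add: W_def wint_def)
  also have "emeasure lborel (ball a rh) = ennreal (pi * rh^2)" using rh by (intro emeasure_ball_complex) simp
  also have "wint p u' + ennreal (N powr p) * ennreal (pi * rh^2) <= ennreal (\<bar>C\<bar> powr p * m) + ennreal (N powr p) * ennreal (pi * rh^2)"
   by (intro add_right_mono wu')
  also have "... = ennreal (\<bar>C\<bar> powr p * m + N powr p * (pi * rh^2))"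
   using m0 by (simp only: ennreal_plus ennreal_mult mult_nonneg_nonneg powr_ge_zero pi_ge_zero zero_le_power2)
  finally have BF0: "Bint p F0 <= ennreal (\<bar>C\<bar> powr p * m + N powr p * (pi * rh^2))" .
  define F where "F z = inverse D * F0 z" for z
  have "Bint p F = ennreal (cmod (inverse D) powr p) * Bint p F0"
   unfolding F_def by (rule Bint_cmult[OF holomorphic_on_imp_continuous_on[OF F0] p(1)])
  also have "... <= ennreal ((3 * d / (c * E)) powr p) * ennreal (\<bar>C\<bar> powr p * m + N powr p * (pi * rh^2))"
  proof (intro mult_mono BF0 ennreal_leI powr_mono2)
   have "1 / cmod D <= 1 / (c * E / (3 * d))" using Dlow Dpos by (intro frac_le) auto
   then show "cmod (inverse D) <= 3 * d / (c * E)" by (simp add: norm_divide inverse_eq_divide)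
  qed (use p in auto)
  also have "... = ennreal ((3 * d / (c * E)) powr p * (\<bar>C\<bar> powr p * m + N powr p * (pi * rh^2)))"
   using m0 by (intro ennreal_mult[symmetric]) auto
  also have "(3 * d / (c * E)) powr p * (\<bar>C\<bar> powr p * m + N powr p * (pi * rh^2)) = B * (bd a)^2"
  proof -
   \<comment> \<open>The weight E at a and the distance d cancel here, which makes B independent of
     a.\<close>
   have e1: "(3 * d / (c * E)) powr p * Ma powr p = k1"
   proof -
    have "3 * d / (c * E) * Ma = 108 * M1 * exp (Ck / 2) / c" using d E c by (simp add: Ma_def field_simps)
    then show ?thesis by (simp only: k1_def powr_mult[symmetric])
   qed
   have e2: "(3 * d / (c * E)) powr p * N powr p = k2"
   proof -
    have "3 * d / (c * E) * N = 3 * exp (1/2 + Ck / 2) / c" using d E c by (simp add: N_def field_simps)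
    then show ?thesis by (simp only: k2_def powr_mult[symmetric])
   qed
   have "(3 * d / (c * E)) powr p * (\<bar>C\<bar> powr p * m + N powr p * (pi * rh^2))
    = \<bar>C\<bar> powr p * (((3 * d / (c * E)) powr p * Ma powr p) * (L * d^2)) + ((3 * d / (c * E)) powr p * N powr p) * (pi * (d^2 / 4))"
    unfolding m_def rh_def by (simp only: power_divide) (simp add: algebra_simps)
   also have "... = B * (bd a)^2" unfolding e1 e2 by (simp add: B_def d_def algebra_simps)
   finally show ?thesis .
  qed
  finally have "Bint p F <= ennreal (B * (bd a)^2)" .
  moreover have "F holomorphic_on disc" unfolding F_def using F0 by (intro holomorphic_intros)
  moreover have "F a = 1" using D0 by (simp add: F_def F0_def G_def Psia)
  moreover have "F b = 0" if b: "b \<in> Z" "b ~= a" for b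
  proof -
   have "\<Psi> b = 0" using Psi_zero_iff[OF in_disc[OF b(1)]] b by simp
   then show ?thesis using b by (simp add: F_def F0_def G_def)
  qed
  ultimately show ?thesis by blast
 qed
 then show ?thesis using B by blast
qed

end

theorem mainTheorem10:
 fixes p R :: real and Z :: "complex set"
 assumes "0 < p" "p < 1"
  and "0 < R" "R < 1"
  and "Z \<subseteq> disc"
  and "separated Z"
 shows "(interpolating p Z \<longleftrightarrow>
      (\<forall>q\<ge>1. \<exists>C::real. \<forall>f\<in>LpqZ R p q Z.
        \<exists>u. dbar_solution f u \<and> normZ p Z u <= ennreal C * normpqZ R p q Z f))
    \<and> (interpolating p Z \<longleftrightarrow>
      (\<exists>q\<ge>1. \<exists>C::real. \<forall>f\<in>LpqZ R p q Z.
        \<exists>u. dbar_solution f u \<and> normZ p Z u <= ennreal C * normpqZ R p q Z f))"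
proof -
 obtain dl where dl: "0 < dl" "!!a b. a \<in> Z ==> b \<in> Z ==> a ~= b ==> dl <= pshyp a b"
  using assms(6) unfolding separated_def by blast
 interpret separated_set Z "min dl 1"
 proof
  fix a b assume ab: "a \<in> Z" "b \<in> Z" "a ~= b"
  have k: "0 < cmod (1 - cnj b * a)" using ab assms(5) by (intro kern_pos) auto
  have "min dl 1 <= cmod (a - b) / cmod (1 - cnj b * a)" using dl(2)[OF ab] by (simp add: pshyp_eq)
  then show "min dl 1 * cmod (1 - cnj b * a) <= cmod (a - b)" using k by (simp add: pos_le_divide_eq)
 qed (use assms dl in auto)
 obtain \<Psi> c where "separated_Psi Z (min dl 1) \<Psi> c"
 proof (rule Psi_exists)
  fix \<Psi> c
  assume A: "\<Psi> holomorphic_on disc" "0 < c" "c <= 1"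
   "!!z. z \<in> disc ==> cmod (\<Psi> z) <= exp (kZ Z z)"
   "!!z a. z \<in> disc ==> a \<in> Z ==> cmod (\<Psi> z) <= exp (1/2) * pshyp z a * exp (kZ Z z)"
   "!!z. z \<in> disc ==> (!!a. a \<in> Z ==> min dl 1 / 2 * bd a <= cmod (z - a)) ==> c * exp (kZ Z z) <= cmod (\<Psi> z)"
   "!!z a. z \<in> disc ==> a \<in> Z ==> cmod (z - a) < min dl 1 / 2 * bd a ==> c * pshyp z a * exp (kZ Z z) <= cmod (\<Psi> z)"
  show thesis
  proof (rule that[of \<Psi> c], unfold_locales)
   show "c * exp (kZ Z z) <= cmod (\<Psi> z)" if "z \<in> disc" "!!a. a \<in> Z ==> min dl 1 / 2 * bd a <= cmod (z - a)" for z
    by (rule A(6)[OF that])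
  qed (rule A; assumption)+
 qed
 then interpret separated_Psi Z "min dl 1" \<Psi> c .
 let ?S = "%q. \<exists>C::real. \<forall>f\<in>LpqZ R p q Z. \<exists>u. dbar_solution f u \<and> normZ p Z u <= ennreal C * normpqZ R p q Z f"
 have p: "0 < p" "p <= 1" using assms by auto
 have ab: "?S q" if "interpolating p Z" "1 <= q" for q
  using solve_dbar[OF p that assms(3,4)] .
 have ca: "interpolating p Z" if q: "1 <= q" and S: "?S q" for q
 proof -
  obtain C where C: "!!f. f \<in> LpqZ R p q Z ==> \<exists>u. dbar_solution f u \<and> normZ p Z u <= ennreal C * normpqZ R p q Z f"
   using S by blast
  obtain B where "0 < B" "!!a. a \<in> Z ==> \<exists>F. F holomorphic_on disc \<and> F a = 1 \<and> (\<forall>b\<in>Z. b ~= a --> F b = 0) \<and> Bint p F <= ennreal (B * (bd a)^2)"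
   using delta_functions[OF p q assms(3,4) C] by blast
  then show ?thesis by (rule interpolating_of_deltas[OF p])
 qed
 \<comment> \<open>The step from all q to some q takes q = 1, supplied by
   \<open>order_refl\<close>.\<close>
 show ?thesis using ab ca by (meson order_refl)
qed

end
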